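(* Let $n\ge 3$ be an odd integer and $\ell=\frac{n-3}{2}$. Let $Q=\mathsf{k}[x_1,\dots,x_n]$ (standard graded), where $\mathsf{k}$ is a field with $\operatorname{char}\mathsf{k}>n$ or $\operatorname{char}\mathsf{k}=0$, and let $R=Q/(x_1^2,\dots,x_n^2,(x_1+\dots+x_n)^2)$. Then $$\beta_{i,j}^Q(R)=\begin{cases} \binom{n+1}{i}, & \text{if } j=2i \text{ and } 0\le i\le \ell,\\ \rho_{\ell+1}(n-1)+\binom{n}{\ell}, & \text{if } j=2i=i+(\ell+1),\\ \rho_i(n-1), & \text{if } j=i+(\ell+1)\ne 2i \text{ and } 0\le i\le n-1,\\ \rho_{i-1}(n-1), & \text{if } j=i+(\ell+2) \text{ and } 1\le i\le n,\\ 0, & \text{otherwise.} \end{cases}$$ In particular, if $n\ge 7$ and $\rho_k=\rho_k(n-1)$ for $0\le k\le n-1$, then the nonzero entries on the two strands $j=i+\ell+1$ and $j=i+\ell+2$ are contained in: $\beta^Q_{\ell+1,2\ell+2}(R)=\rho_{\ell+1}+\binom{n}{\ell}$; $\beta^Q_{i,i+\ell+1}(R)=\rho_i$ for $2\le i\le \ell+3$, $i\neq \ell+1$; $\beta^Q_{i,i+\ell+1}(R)=\rho_{n+1-i}$ for $\ell+4\le i\le n-1$; $\beta^Q_{i,i+\ell+2}(R)=\rho_{i-1}$ for $3\le i\le \ell+4$; $\beta^Q_{i,i+\ell+2}(R)=\rho_{n+2-i}$ for $\ell+5\le i\le n$. Moreover, $\rho_{\ell+1}+\binom{n}{\ell}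=\rho_{\ell+3}+\binom{n+1}{\ell+1}$.
   Context: For a graded $Q$-module $M$, $\beta_{i,j}^Q(M)=\dim_{\mathsf{k}}\operatorname{Tor}_i^Q(M,\mathsf{k})_j$. For an integer $m\ge 1$ put $\ell_m=\lfloor\frac{m-2}{2}\rfloor$. The sequence $\{\rho_k(m)\}_{k\ge 0}$ is defined by $\rho_0(m)=0$ and, for $k\ge 1$, $$\rho_k(m)=\sum_{i=0}^{k-1}(-1)^{i+k+1}\binom{m+k-i-1}{m-1}\rho_i(m)+\sum_{i=0}^{\ell_m}(-1)^{i+k+1}\binom{m+k+\ell_m-2i}{m-1}\binom{m+1}{i}.$$ (For $n$ odd and $m=n-1$ one has $\ell_m=\frac{n-3}{2}$.) *)

theory Defs
  imports "HOL-Library.Poly_Mapping" "HOL-Library.Cardinality" "HOL-Computational_Algebra.Computational_Algebra"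
begin

section \<open>The graded polynomial ring\<close>

text \<open>
  Polynomials over \<open>'k\<close> whose variables are indexed by the finite type \<open>'v\<close>: finitely supported
  maps from exponent vectors to coefficients. With \<open>CARD('v) = n\<close> this is the polynomial ring
  in \<open>n\<close> variables, the multiplication being the convolution product of
  \<^theory>\<open>HOL-Library.Poly_Mapping\<close>.
\<close>

type_synonym ('v, 'k) mpol = "('v \<Rightarrow>\<^sub>0 nat) \<Rightarrow>\<^sub>0 'k"

definition Var :: "'v \<Rightarrow> ('v, 'k::field) mpol" where
  "Var v = Poly_Mapping.single (Poly_Mapping.single v 1) 1"

definition Const :: "'k \<Rightarrow> ('v, 'k::field) mpol" where
  "Const c = Poly_Mapping.single 0 c"

definition homogeneous :: "int \<Rightarrow> ('v::finite, 'k::field) mpol set" where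
  "homogeneous d =
     {p. \<forall>m \<in> Poly_Mapping.keys p. int (\<Sum>v\<in>UNIV. Poly_Mapping.lookup m v) = d}"


section \<open>Graded free resolutions\<close>

text \<open>
  A graded module is given by its scalar multiplication \<open>scale\<close> (on the whole type) and by its
  homogeneous components \<open>gr :: int \<Rightarrow> 'm set\<close>.

  The free module \<open>F\<^sub>i\<close> of a resolution has basis \<open>e\<^sub>b\<close> for \<open>b \<in> basis F i\<close>, where \<open>e\<^sub>b\<close> has
  degree \<open>bdeg F i b\<close>; its elements are the finitely supported maps \<open>nat \<Rightarrow>\<^sub>0 Q\<close> with support in
  \<open>basis F i\<close>. The bases need not be finite. Countable bases suffice for resolving finitely
  generated modules, because the kernel of a homogeneous map out of such an \<open>F\<^sub>i\<close> is spanned over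
  \<open>k\<close> by countably many homogeneous elements.

  Pitfall: \<open>diff F i\<close> is the differential \<open>F\<^bsub>i+1\<^esub> \<rightarrow> F\<^sub>i\<close>, given by the images of the basis
  elements of \<open>F\<^bsub>i+1\<^esub>\<close>; \<open>aug F\<close> gives the images under \<open>F\<^sub>0 \<rightarrow> M\<close> of the basis elements of \<open>F\<^sub>0\<close>.
\<close>

record (overloaded) ('v, 'k, 'm) free_resolution =
  basis :: "nat \<Rightarrow> nat set"
  bdeg :: "nat \<Rightarrow> nat \<Rightarrow> int"
  diff :: "nat \<Rightarrow> nat \<Rightarrow> (nat \<Rightarrow>\<^sub>0 ('v, 'k) mpol)"
  aug :: "nat \<Rightarrow> 'm"

definition supported :: "nat set \<Rightarrow> (nat \<Rightarrow>\<^sub>0 'a::zero) set" where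
  "supported B = {w. Poly_Mapping.keys w \<subseteq> B}"

text \<open>
  Let \<open>D\<close> be a \<open>Q\<close>-linear map between free modules, given on basis elements by
  \<open>D b = \<Sum>\<^sub>c q\<^bsub>b,c\<^esub> e\<^sub>c\<close>. After tensoring with a \<open>Q\<close>-module \<open>N\<close> with scalar multiplication \<open>scale\<close>, it
  sends \<open>\<Sum>\<^sub>b e\<^sub>b \<otimes> y\<^sub>b\<close> to \<open>\<Sum>\<^sub>b \<Sum>\<^sub>c e\<^sub>c \<otimes> q\<^bsub>b,c\<^esub> y\<^sub>b\<close>. For \<open>N = Q\<close>, i.e. \<open>scale = (*)\<close>, this is the linear
  map itself.
\<close>

definition tensor_map ::
  "('q::zero \<Rightarrow> 'n \<Rightarrow> 'n) \<Rightarrow> (nat \<Rightarrow> (nat \<Rightarrow>\<^sub>0 'q)) \<Rightarrow> (nat \<Rightarrow>\<^sub>0 'n) \<Rightarrow> (nat \<Rightarrow>\<^sub>0 'n::comm_monoid_add)" where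
  "tensor_map scale D w =
     (\<Sum>b\<in>Poly_Mapping.keys w.
        Poly_Mapping.map (\<lambda>q. scale q (Poly_Mapping.lookup w b)) (D b))"

definition aug_map ::
  "('q::zero \<Rightarrow> 'm \<Rightarrow> 'm) \<Rightarrow> (nat \<Rightarrow> 'm) \<Rightarrow> (nat \<Rightarrow>\<^sub>0 'q) \<Rightarrow> 'm::comm_monoid_add" where
  "aug_map scale a w = (\<Sum>b\<in>Poly_Mapping.keys w. scale (Poly_Mapping.lookup w b) (a b))"

definition graded_free_resolution ::
  "(('v::finite, 'k::field) mpol \<Rightarrow> 'm \<Rightarrow> 'm::ab_group_add) \<Rightarrow> (int \<Rightarrow> 'm set)
     \<Rightarrow> ('v, 'k, 'm) free_resolution \<Rightarrow> bool" where
  "graded_free_resolution scale gr F \<longleftrightarrow>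
     (\<forall>b\<in>basis F 0. aug F b \<in> gr (bdeg F 0 b)) \<and>
     (\<forall>i. \<forall>b\<in>basis F (Suc i). diff F i b \<in> supported (basis F i)) \<and>
     (\<forall>i. \<forall>b\<in>basis F (Suc i). \<forall>c\<in>basis F i.
        Poly_Mapping.lookup (diff F i b) c \<in> homogeneous (bdeg F (Suc i) b - bdeg F i c)) \<and>
     aug_map scale (aug F) ` supported (basis F 0) = UNIV \<and>
     tensor_map (*) (diff F 0) ` supported (basis F 1)
       = {w \<in> supported (basis F 0). aug_map scale (aug F) w = 0} \<and>
     (\<forall>i. tensor_map (*) (diff F (Suc i)) ` supported (basis F (Suc (Suc i)))
       = {w \<in> supported (basis F (Suc i)). tensor_map (*) (diff F i) w = 0})"


section \<open>Dimension of a quotient of subspaces\<close>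

text \<open>
  \<open>S\<close> represents a basis of \<open>V / W\<close> for subspaces \<open>W \<subseteq> V\<close>. As for the library's \<open>dim\<close>, the
  dimension is \<open>0\<close> by convention if there is no finite basis.
\<close>

definition quotient_basis ::
  "('k::field \<Rightarrow> 'b \<Rightarrow> 'b) \<Rightarrow> 'b set \<Rightarrow> 'b set \<Rightarrow> 'b::ab_group_add set \<Rightarrow> bool" where
  "quotient_basis scale V W S \<longleftrightarrow>
     S \<subseteq> V \<and>
     (\<forall>T c. finite T \<and> T \<subseteq> S \<and> (\<Sum>s\<in>T. scale (c s) s) \<in> W \<longrightarrow> (\<forall>s\<in>T. c s = 0)) \<and>
     (\<forall>v\<in>V. \<exists>T c. finite T \<and> T \<subseteq> S \<and> v - (\<Sum>s\<in>T. scale (c s) s) \<in> W)"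

definition quotient_dim ::
  "('k::field \<Rightarrow> 'b \<Rightarrow> 'b) \<Rightarrow> 'b set \<Rightarrow> 'b::ab_group_add set \<Rightarrow> nat" where
  "quotient_dim scale V W = card (SOME S. quotient_basis scale V W S)"


section \<open>Tor and graded Betti numbers\<close>

text \<open>
  \<open>Tor\<^sub>i(M, N)\<^sub>j\<close> is the homology in homological degree \<open>i\<close> and internal degree \<open>j\<close> of
  \<open>F \<otimes> N\<close> for a graded free resolution \<open>F\<close> of \<open>M\<close>. Here \<open>F\<^sub>i \<otimes> N\<close> is the direct sum of copies
  of \<open>N\<close> indexed by \<open>basis F i\<close>, and \<open>e\<^sub>b \<otimes> y\<close> has degree \<open>bdeg F i b + deg y\<close>.
\<close>

definition tensor_part ::
  "('v, 'k, 'm) free_resolution \<Rightarrow> (int \<Rightarrow> 'n set) \<Rightarrow> nat \<Rightarrow> int \<Rightarrow> (nat \<Rightarrow>\<^sub>0 'n::zero) set" where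
  "tensor_part F grN i j =
     {w \<in> supported (basis F i).
        \<forall>b\<in>basis F i. Poly_Mapping.lookup w b \<in> grN (j - bdeg F i b)}"

definition tensor_cycles ::
  "('v, 'k::field, 'm) free_resolution \<Rightarrow> (('v, 'k) mpol \<Rightarrow> 'n \<Rightarrow> 'n) \<Rightarrow> (int \<Rightarrow> 'n set)
     \<Rightarrow> nat \<Rightarrow> int \<Rightarrow> (nat \<Rightarrow>\<^sub>0 'n::ab_group_add) set" where
  "tensor_cycles F scaleN grN i j =
     {w \<in> tensor_part F grN i j.
        case i of 0 \<Rightarrow> True | Suc i' \<Rightarrow> tensor_map scaleN (diff F i') w = 0}"

definition tensor_boundaries ::
  "('v, 'k::field, 'm) free_resolution \<Rightarrow> (('v, 'k) mpol \<Rightarrow> 'n \<Rightarrow> 'n) \<Rightarrow> (int \<Rightarrow> 'n set)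
     \<Rightarrow> nat \<Rightarrow> int \<Rightarrow> (nat \<Rightarrow>\<^sub>0 'n::ab_group_add) set" where
  "tensor_boundaries F scaleN grN i j =
     tensor_map scaleN (diff F i) ` tensor_part F grN (Suc i) j"

definition dim_Tor ::
  "(('v::finite, 'k::field) mpol \<Rightarrow> 'm \<Rightarrow> 'm::ab_group_add) \<Rightarrow> (int \<Rightarrow> 'm set)
     \<Rightarrow> (('v, 'k) mpol \<Rightarrow> 'n \<Rightarrow> 'n::ab_group_add) \<Rightarrow> (int \<Rightarrow> 'n set) \<Rightarrow> nat \<Rightarrow> int \<Rightarrow> nat" where
  "dim_Tor scaleM grM scaleN grN i j =
     (let F = (SOME F. graded_free_resolution scaleM grM F)
      in quotient_dim (\<lambda>c. Poly_Mapping.map (scaleN (Const c)))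
           (tensor_cycles F scaleN grN i j) (tensor_boundaries F scaleN grN i j))"

text \<open>The residue field \<open>k = Q / (x\<^sub>1, \<dots>, x\<^sub>n)\<close>, concentrated in degree \<open>0\<close>.\<close>

definition residue_scale :: "('v, 'k::field) mpol \<Rightarrow> 'k \<Rightarrow> 'k" where
  "residue_scale q c = Poly_Mapping.lookup q 0 * c"

definition residue_gr :: "int \<Rightarrow> 'k::field set" where
  "residue_gr d = (if d = 0 then UNIV else {0})"

lemma module_residue: "module (residue_scale :: ('v, 'k::field) mpol \<Rightarrow> 'k \<Rightarrow> 'k)"
proof -
  have *: "Poly_Mapping.lookup (p * q) 0 = Poly_Mapping.lookup p 0 * Poly_Mapping.lookup q 0"
    for p q :: "('v, 'k) mpol"
  proof -
    have "a + b = 0 \<longleftrightarrow> a = 0 \<and> b = 0" for a b :: "'v \<Rightarrow>\<^sub>0 nat"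
      by (auto simp: poly_mapping_eq_iff fun_eq_iff lookup_add)
    hence "Poly_Mapping.lookup (p * q) 0 =
             (\<Sum>a. Poly_Mapping.lookup p a * (Poly_Mapping.lookup q 0 when a = 0))"
      unfolding lookup_mult by (intro Sum_any.cong) (auto simp: when_def)
    thus ?thesis
      by (simp add: mult_when)
  qed
  show ?thesis
    by standard (auto simp: residue_scale_def lookup_add algebra_simps * lookup_one)
qed

definition graded_betti ::
  "(('v::finite, 'k::field) mpol \<Rightarrow> 'm \<Rightarrow> 'm::ab_group_add) \<Rightarrow> (int \<Rightarrow> 'm set)
     \<Rightarrow> nat \<Rightarrow> int \<Rightarrow> nat" where
  "graded_betti scale gr i j =
     dim_Tor scale gr (residue_scale :: ('v, 'k) mpol \<Rightarrow> 'k \<Rightarrow> 'k) residue_gr i j"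


section \<open>The ring \<open>R\<close>\<close>

text \<open>The submodule of \<open>Q\<close> spanned by a set is the ideal generated by it.\<close>

definition squares_ideal :: "('v::finite, 'k::field) mpol set" where
  "squares_ideal = module.span (*) (insert ((\<Sum>v\<in>UNIV. Var v)\<^sup>2) (range (\<lambda>v. (Var v)\<^sup>2)))"

lemma module_mult: "module ((*) :: 'a::comm_ring_1 \<Rightarrow> 'a \<Rightarrow> 'a)"
  by standard (auto simp: algebra_simps)

lemma squares_ideal_closed:
  "0 \<in> squares_ideal"
  "p \<in> squares_ideal \<Longrightarrow> q \<in> squares_ideal \<Longrightarrow> p + q \<in> squares_ideal"
  "p \<in> squares_ideal \<Longrightarrow> q \<in> squares_ideal \<Longrightarrow> p - q \<in> squares_ideal"
  "p \<in> squares_ideal \<Longrightarrow> - p \<in> squares_ideal"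
  "q \<in> squares_ideal \<Longrightarrow> p * q \<in> squares_ideal"
  unfolding squares_ideal_def
  by (rule module.span_zero module.span_add module.span_diff module.span_neg module.span_scale;
      (rule module_mult | assumption))+

quotient_type (overloaded) ('v, 'k) squares_ring =
  "('v::finite, 'k::field) mpol" / "\<lambda>p q. p - q \<in> (squares_ideal :: ('v, 'k) mpol set)"
  morphisms rep_squares_ring squares_class
proof (rule equivpI)
  show "reflp (\<lambda>p q. p - q \<in> (squares_ideal :: ('v, 'k) mpol set))"
    by (auto simp: reflp_def squares_ideal_closed)
  show "symp (\<lambda>p q. p - q \<in> (squares_ideal :: ('v, 'k) mpol set))"
    using squares_ideal_closed(4) by (fastforce simp: symp_def)
  show "transp (\<lambda>p q. p - q \<in> (squares_ideal :: ('v, 'k) mpol set))"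
    using squares_ideal_closed(2) by (fastforce simp: transp_def)
qed

instantiation squares_ring :: (finite, field) comm_ring
begin

lift_definition zero_squares_ring :: "('a, 'b) squares_ring" is 0 .

lift_definition plus_squares_ring ::
  "('a, 'b) squares_ring \<Rightarrow> ('a, 'b) squares_ring \<Rightarrow> ('a, 'b) squares_ring" is "(+)"
  using squares_ideal_closed(2) by (fastforce simp: algebra_simps)

lift_definition minus_squares_ring ::
  "('a, 'b) squares_ring \<Rightarrow> ('a, 'b) squares_ring \<Rightarrow> ('a, 'b) squares_ring" is "(-)"
  using squares_ideal_closed(3) by (fastforce simp: algebra_simps)

lift_definition uminus_squares_ring ::
  "('a, 'b) squares_ring \<Rightarrow> ('a, 'b) squares_ring" is "uminus"
  using squares_ideal_closed(4) by (fastforce simp: algebra_simps)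

lift_definition times_squares_ring ::
  "('a, 'b) squares_ring \<Rightarrow> ('a, 'b) squares_ring \<Rightarrow> ('a, 'b) squares_ring" is "(*)"
proof -
  fix p p' q q' :: "('a, 'b) mpol"
  assume "p - p' \<in> squares_ideal" "q - q' \<in> squares_ideal"
  hence "q * (p - p') + p' * (q - q') \<in> squares_ideal"
    by (intro squares_ideal_closed(2,5))
  thus "p * q - p' * q' \<in> squares_ideal"
    by (simp add: algebra_simps)
qed

instance
  by standard (transfer; simp add: algebra_simps squares_ideal_closed)+

end

definition squares_scale ::
  "('v::finite, 'k::field) mpol \<Rightarrow> ('v, 'k) squares_ring \<Rightarrow> ('v, 'k) squares_ring" where
  "squares_scale q x = squares_class q * x"

definition squares_gr :: "int \<Rightarrow> ('v::finite, 'k::field) squares_ring set" where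
  "squares_gr d = squares_class ` homogeneous d"

lemma module_squares:
  "module (squares_scale :: ('v::finite, 'k::field) mpol \<Rightarrow> _)"
proof
  fix p q :: "('v, 'k) mpol" and x y :: "('v, 'k) squares_ring"
  show "squares_scale p (x + y) = squares_scale p x + squares_scale p y"
    by (simp add: squares_scale_def distrib_left)
  show "squares_scale (p + q) x = squares_scale p x + squares_scale q x"
    by (simp add: squares_scale_def plus_squares_ring.abs_eq [symmetric] distrib_right)
  show "squares_scale p (squares_scale q x) = squares_scale (p * q) x"
    by (simp add: squares_scale_def times_squares_ring.abs_eq [symmetric] mult.assoc)
  show "squares_scale 1 x = x"
    by (induct x rule: squares_ring.abs_induct)
       (simp add: squares_scale_def times_squares_ring.abs_eq)
qed


section \<open>The sequence \<open>\<rho>\<close>\<close>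

definition ell :: "nat \<Rightarrow> int" where
  "ell m = \<lfloor>(of_nat m - 2) / (2 :: rat)\<rfloor>"

text \<open>
  For \<open>m \<ge> 1\<close> all binomial coefficients below have nonnegative upper entries, so the truncation in
  \<open>nat\<close> and in the subtractions never takes effect. The second sum is empty if \<open>m = 1\<close>, as
  \<open>ell 1 = - 1\<close>.
\<close>

declare sum.cong [fundef_cong]

fun rho :: "nat \<Rightarrow> nat \<Rightarrow> int" where
  "rho m k =
     (if k = 0 then 0
      else (\<Sum>i<k. (- 1) ^ (i + k + 1) * int ((m + k - i - 1) choose (m - 1)) * rho m i)
         + (\<Sum>i | int i \<le> ell m.
              (- 1) ^ (i + k + 1)
                * int (nat (int m + int k + ell m - 2 * int i) choose (m - 1))
                * int ((m + 1) choose i)))"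

declare rho.simps [simp del]

end

theory Submission
  imports Defs "HOL-Library.Function_Algebras" "HOL-Library.Countable_Set"
begin

text \<open>
  Put \<open>n = 2r + 3\<close>, \<open>\<sigma> = \<Sum>\<^sub>v x\<^sub>v\<close> and \<open>I = (x\<^sub>v\<^sup>2, \<sigma>\<^sup>2)\<close>. Tor is balanced, so the Betti numbers of
  \<open>R = Q / I\<close> are the dimensions of its Koszul homology. This homology is computed by writing \<open>R\<close> in two
  ways as the quotient of a simpler ring by a quadric. The quadric is a sum of products of two elements of
  the maximal ideal and so acts null-homotopically on the Koszul complex; wherever it is a nonzerodivisor,
  the long exact sequence splits.

  First, \<open>R = A / \<sigma>\<^sup>2\<close> with \<open>A = Q / (x\<^sub>v\<^sup>2)\<close>. Every polynomial of degree \<open>\<ge> r + 3\<close> lies in \<open>I\<close>, and since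
  \<open>A\<close> has a perfect pairing, \<open>\<sigma>\<^sup>2\<close> is injective on \<open>A\<^sub>d\<close> for \<open>d \<le> r\<close>. This gives the part \<open>j \<le> i + r\<close> of the
  Betti table.

  Second, \<open>R = T / w\<^sup>2\<close> for a variable \<open>w\<close> and \<open>T = Q / (x\<^sub>v\<^sup>2 - w\<^sup>2, \<sigma>\<^sup>2 - w\<^sup>2)\<close>. The sign vectors with \<open>r + 2\<close>
  entries \<open>1\<close> are zeros of the defining equations, and a dimension count shows that evaluation at them is an
  isomorphism on \<open>T\<^sub>d\<close> for \<open>d \<ge> r + 1\<close>. Hence \<open>w\<close> is a nonzerodivisor on \<open>T\<close>, multiplication by \<open>w\<close> is onto in
  degrees \<open>\<ge> r + 2\<close>, \<open>dim T\<^sub>d\<close> is the binomial coefficient of \<open>n\<close> over \<open>min(d, r + 1)\<close>, and the Koszul homology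
  of \<open>T\<close> vanishes for \<open>j \<ge> i + r + 2\<close>. So on \<open>j = i + r + 1\<close> it is determined by the Euler characteristic,
  i.e. by the coefficients of \<open>P(t) = (1 - t)\<^sup>n \<Sum>\<^sub>d dim T\<^sub>d t\<^sup>d\<close>.

  Dividing \<open>P\<close> by \<open>(1 - t)\<^bsup>n-1\<^esup>\<close> gives the recursion defining \<open>\<rho>\<close>, and its symmetry is
  \<open>P(t) - t\<^bsup>2n\<^esup> P(1/t) = (1 - t\<^sup>2)\<^sup>n\<close>.
\<close>

section \<open>Dimensions of quotients\<close>

text \<open>Multiplication by \<open>sigma^2\<close> on \<open>A\<close> need not be injective above
  degree \<open>r\<close>, so the first presentation controls only the lower part of the table. On
  \<open>T\<close>, which has dimension one, the square of \<open>w\<close> is a nonzerodivisor in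
  every degree. The sequence then splits everywhere, each entry of \<open>R\<close> is a sum of two
  entries of \<open>T\<close>, and the low part known from \<open>A\<close> determines the low part
  of \<open>T\<close>.

  A sign vector with \<open>r + 2\<close> entries 1 and \<open>r + 1\<close> entries -1 has
  coordinate sum 1, so \<open>sigma^2 - w^2\<close> vanishes there. Its negative is the same
  projective point, so each point is counted once.

  The vanishing of \<open>R\<close> in degree \<open>r + 3\<close> stands in for a Lefschetz
  property: the sum over a set \<open>S\<close> of at least \<open>r + 3\<close> variables is
  \<open>sigma\<close> minus the sum over the complement, and high powers of the latter are 0 modulo
  squares. The characteristic enters through the factorials up to \<open>n\<close>.

  The Betti numbers refer to a chosen resolution of which only the existence is known. Balancing
  therefore works with an arbitrary one, by dimension shifting along its syzygies.\<close>

definition has_qdim ::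
  "('k::field \<Rightarrow> 'b \<Rightarrow> 'b) \<Rightarrow> 'b set \<Rightarrow> 'b::ab_group_add set \<Rightarrow> nat \<Rightarrow> bool" where
  "has_qdim sc V W n \<longleftrightarrow> (\<exists>S. finite S \<and> card S = n \<and> quotient_basis sc V W S)"

text \<open>
  A copy of \<open>vector_space\<close>: extending that locale itself would propagate every definition to the
  unqualified interpretation of real vector spaces in the library and so shadow it.
\<close>

locale kspace = vector_space
begin

definition indep_mod :: "'b set \<Rightarrow> 'b set \<Rightarrow> bool" where
  "indep_mod W S \<longleftrightarrow>
     (\<forall>T c. finite T \<and> T \<subseteq> S \<and> (\<Sum>s\<in>T. scale (c s) s) \<in> W \<longrightarrow> (\<forall>s\<in>T. c s = 0))"

lemma indep_modD:
  assumes "indep_mod W S" "finite T" "T \<subseteq> S" "(\<Sum>s\<in>T. scale (c s) s) \<in> W" "s \<in> T"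
  shows "c s = 0"
  using assms unfolding indep_mod_def by blast

lemma quotient_basis_iff:
  "quotient_basis scale V W S \<longleftrightarrow>
     S \<subseteq> V \<and> indep_mod W S \<and> (\<forall>v\<in>V. \<exists>u\<in>span S. v - u \<in> W)"
proof -
  have "(\<exists>T c. finite T \<and> T \<subseteq> S \<and> v - (\<Sum>s\<in>T. scale (c s) s) \<in> W) \<longleftrightarrow> (\<exists>u\<in>span S. v - u \<in> W)" for v
    unfolding span_explicit by auto
  thus ?thesis unfolding quotient_basis_def indep_mod_def by simp
qed

lemma indep_mod_mono: "indep_mod V S \<Longrightarrow> W \<subseteq> V \<Longrightarrow> indep_mod W S"
  unfolding indep_mod_def by blast

lemma indep_mod_not_mem:
  assumes "indep_mod W S" "s \<in> S"
  shows "s \<notin> W"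
proof
  assume "s \<in> W"
  hence "(\<Sum>t\<in>{s}. scale ((\<lambda>_. 1) t) t) \<in> W" by simp
  from indep_modD[OF assms(1) _ _ this, of s] assms(2) show False by simp
qed

text \<open>An exchange argument modulo \<open>W\<close>: replacing each element of \<open>T\<close>
  by a representative in \<open>span S\<close> is injective and keeps independence, and independent
  sets in the span of \<open>S\<close> have at most \<open>card S\<close> elements.\<close>

lemma indep_mod_card_le:
  assumes W: "subspace W" and S: "finite S" and T: "indep_mod W T"
    and TS: "\<And>t. t \<in> T \<Longrightarrow> \<exists>u\<in>span S. t - u \<in> W"
  shows "finite T \<and> card T \<le> card S"
proof -
  obtain P where P: "\<And>t. t \<in> T \<Longrightarrow> P t \<in> span S" "\<And>t. t \<in> T \<Longrightarrow> t - P t \<in> W"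
    using TS by metis
  have inj: "inj_on P T"
  proof (rule inj_onI, rule ccontr)
    fix t t' assume t: "t \<in> T" "t' \<in> T" "P t = P t'" "t \<noteq> t'"
    have "(t - P t) - (t' - P t') \<in> W"
      using P t W subspace_diff by blast
    hence "(\<Sum>s\<in>{t,t'}. scale (if s = t then 1 else - 1) s) \<in> W"
      using t by simp
    from indep_modD[OF T _ _ this, of t] t show False by simp
  qed
  have "independent (P ` T)"
    unfolding independent_explicit_finite_subsets
  proof (intro allI impI ballI)
    fix U u v assume U: "U \<subseteq> P ` T" "finite U" "(\<Sum>v\<in>U. scale (u v) v) = 0" "v \<in> U"
    obtain T0 where T0: "T0 \<subseteq> T" "U = P ` T0" using U(1) by (meson subset_image_iff)
    have fin: "finite T0" using U(2) T0 inj by (meson finite_imageD inj_on_subset)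
    have z: "(\<Sum>t\<in>T0. scale (u (P t)) (P t)) = 0"
      using U(3) unfolding T0(2) sum.reindex[OF inj_on_subset[OF inj T0(1)]] by simp
    have "(\<Sum>t\<in>T0. scale (u (P t)) (t - P t)) \<in> W"
      using T0 P W by (intro subspace_sum subspace_scale) auto
    hence "(\<Sum>t\<in>T0. scale (u (P t)) t) \<in> W"
      using z by (simp add: scale_right_diff_distrib sum_subtractf)
    from indep_modD[OF T fin T0(1) this] U(4) T0(2)
    show "u v = 0" by auto
  qed
  moreover have "P ` T \<subseteq> span S" using P by auto
  ultimately have "finite (P ` T) \<and> card (P ` T) \<le> card S"
    using independent_span_bound[OF S] by blast
  thus ?thesis using inj by (metis card_image finite_imageD)
qed

lemma has_qdim_unique:
  assumes W: "subspace W" and h: "has_qdim scale V W n" and S: "quotient_basis scale V W S"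
  shows "card S = n"
proof -
  obtain S' where S': "finite S'" "card S' = n" "quotient_basis scale V W S'"
    using h unfolding has_qdim_def by blast
  have "finite S \<and> card S \<le> card S'"
    using S S'(3) unfolding quotient_basis_iff by (intro indep_mod_card_le[OF W S'(1)]) blast+
  moreover from this have "finite S' \<and> card S' \<le> card S"
    using S S'(3) unfolding quotient_basis_iff by (intro indep_mod_card_le[OF W]) blast+
  ultimately show ?thesis using S'(2) by linarith
qed

lemma has_qdim_unique': "subspace W \<Longrightarrow> has_qdim scale V W m \<Longrightarrow> has_qdim scale V W n \<Longrightarrow> m = n"
  using has_qdim_unique[of W V m] unfolding has_qdim_def[of _ _ _ n] by blast

text \<open>The choice in \<open>quotient_dim\<close> yields 0 for an infinite basis. The relation
  \<open>has_qdim\<close> asserts finiteness together with the value, so all computations use it,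
  and this lemma converts the final result.\<close>

lemma quotient_dim_eq:
  assumes "subspace W" "has_qdim scale V W n"
  shows "quotient_dim scale V W = n"
proof -
  have "\<exists>S. quotient_basis scale V W S" using assms(2) unfolding has_qdim_def by blast
  hence "quotient_basis scale V W (SOME S. quotient_basis scale V W S)" by (rule someI_ex)
  from has_qdim_unique[OF assms this] show ?thesis unfolding quotient_dim_def .
qed

lemma has_qdim_self: "subspace W \<Longrightarrow> V \<subseteq> W \<Longrightarrow> has_qdim scale V W 0"
  unfolding has_qdim_def quotient_basis_iff by (rule exI[of _ "{}"]) (auto simp: indep_mod_def)

lemma has_qdim_0D: "has_qdim scale V W 0 \<Longrightarrow> V \<subseteq> W"
  unfolding has_qdim_def quotient_basis_iff by auto

lemma has_qdim_trans:
  assumes W: "subspace W" and V: "subspace V" and WV: "W \<subseteq> V" and VU: "V \<subseteq> U"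
    and a: "has_qdim scale V W a" and b: "has_qdim scale U V b"
  shows "has_qdim scale U W (a + b)"
proof -
  obtain A where A: "finite A" "card A = a" "A \<subseteq> V" "indep_mod W A"
      "\<And>v. v \<in> V \<Longrightarrow> \<exists>u\<in>span A. v - u \<in> W"
    using a unfolding has_qdim_def quotient_basis_iff by blast
  obtain B where B: "finite B" "card B = b" "B \<subseteq> U" "indep_mod V B"
      "\<And>v. v \<in> U \<Longrightarrow> \<exists>u\<in>span B. v - u \<in> V"
    using b unfolding has_qdim_def quotient_basis_iff by blast
  have disj: "A \<inter> B = {}" using A(3) indep_mod_not_mem[OF B(4)] by blast
  have indep: "indep_mod W (A \<union> B)"
    unfolding indep_mod_def
  proof (intro allI impI, elim conjE)
    fix T c assume T: "finite T" "T \<subseteq> A \<union> B" "(\<Sum>s\<in>T. scale (c s) s) \<in> W"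
    let ?f = "\<lambda>s. scale (c s) s"
    have "T = (T \<inter> A) \<union> (T \<inter> B)" using T by auto
    hence sp: "sum ?f T = sum ?f (T \<inter> A) + sum ?f (T \<inter> B)"
      using T(1) disj sum.union_disjoint[of "T \<inter> A" "T \<inter> B" ?f] by fastforce
    have TA: "sum ?f (T \<inter> A) \<in> V" using A(3) V by (intro subspace_sum subspace_scale) auto
    have "sum ?f T - sum ?f (T \<inter> A) \<in> V" using T(3) WV TA V subspace_diff by blast
    hence "sum ?f (T \<inter> B) \<in> V" using sp by simp
    hence cB: "\<forall>s\<in>T \<inter> B. c s = 0" using indep_modD[OF B(4), of "T \<inter> B" c] T(1) by auto
    hence "sum ?f (T \<inter> B) = 0" by (intro sum.neutral) auto
    hence "sum ?f (T \<inter> A) \<in> W" using sp T(3) by simp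
    hence "\<forall>s\<in>T \<inter> A. c s = 0" using indep_modD[OF A(4), of "T \<inter> A" c] T(1) by auto
    thus "\<forall>s\<in>T. c s = 0" using cB T(2) by blast
  qed
  have "\<exists>w\<in>span (A \<union> B). u - w \<in> W" if u: "u \<in> U" for u
  proof -
    obtain x where x: "x \<in> span B" "u - x \<in> V" using B(5)[OF u] by blast
    obtain y where y: "y \<in> span A" "u - x - y \<in> W" using A(5)[OF x(2)] by blast
    have "x + y \<in> span (A \<union> B)"
      using x y span_mono[of A "A \<union> B"] span_mono[of B "A \<union> B"] by (intro span_add) auto
    thus ?thesis using y(2) by (intro bexI[of _ "x + y"]) (auto simp: algebra_simps)
  qed
  thus ?thesis
    using A B disj indep VU unfolding has_qdim_def quotient_basis_iff
    by (intro exI[of _ "A \<union> B"]) (auto simp: card_Un_disjoint)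
qed

text \<open>A set of largest size among those independent modulo \<open>W\<close> is a basis,
  because a vector outside its span modulo \<open>W\<close> could be added. The bound
  \<open>N\<close> guarantees a largest size.\<close>

lemma has_qdim_bounded_exists:
  assumes V: "subspace V" and W: "subspace W"
    and bd: "\<And>T. T \<subseteq> V \<Longrightarrow> indep_mod W T \<Longrightarrow> finite T \<and> card T \<le> N"
  shows "\<exists>a. has_qdim scale V W a"
proof -
  let ?P = "\<lambda>m. \<exists>T. T \<subseteq> V \<and> indep_mod W T \<and> card T = m"
  have P0: "?P 0" using exI[of "\<lambda>T. T \<subseteq> V \<and> indep_mod W T \<and> card T = 0" "{}"]
    unfolding indep_mod_def by simp
  have "{m. ?P m} \<subseteq> {..N}" using bd by auto
  hence fin: "finite {m. ?P m}" using finite_subset by blast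
  define m where "m = Max {m. ?P m}"
  have "m \<in> {m. ?P m}" unfolding m_def using fin P0 by (intro Max_in) auto
  hence m1: "?P m" by simp
  have m2: "m' \<le> m" if "?P m'" for m' unfolding m_def using fin that by (intro Max_ge) auto
  obtain T where T: "T \<subseteq> V" "indep_mod W T" "card T = m" using m1 by blast
  have finT: "finite T" using bd T by blast
  have "\<exists>u\<in>span T. v - u \<in> W" if v: "v \<in> V" for v
  proof (rule ccontr)
    assume no: "\<not> ?thesis"
    hence vT: "v \<notin> T" using span_base[of v T] subspace_0[OF W] by force
    have "indep_mod W (insert v T)"
      unfolding indep_mod_def
    proof (intro allI impI, elim conjE)
      fix A c assume A: "finite A" "A \<subseteq> insert v T" "(\<Sum>s\<in>A. scale (c s) s) \<in> W"
      let ?f = "\<lambda>s. scale (c s) s"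
      have cv: "c v = 0" if "v \<in> A"
      proof (rule ccontr)
        assume c0: "c v \<noteq> 0"
        have "sum ?f A = ?f v + sum ?f (A - {v})" using that A(1) by (simp add: sum.remove)
        hence "scale (inverse (c v)) (sum ?f A) = v + scale (inverse (c v)) (sum ?f (A - {v}))"
          using c0 by (simp add: scale_right_distrib)
        moreover have "scale (inverse (c v)) (sum ?f A) \<in> W" using A(3) W subspace_scale by blast
        moreover have "sum ?f (A - {v}) \<in> span T"
          using A(2) by (intro span_sum span_scale span_base) auto
        hence "- scale (inverse (c v)) (sum ?f (A - {v})) \<in> span T"
          by (intro span_neg span_scale)
        ultimately show False using no by (metis diff_minus_eq_add)
      qed
      have "(\<Sum>s\<in>A - {v}. ?f s) = (\<Sum>s\<in>A. ?f s)"
        using A(1) cv by (intro sum.mono_neutral_left) auto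
      hence "\<forall>s\<in>A - {v}. c s = 0"
        using indep_modD[OF T(2), of "A - {v}" c] A by auto
      thus "\<forall>s\<in>A. c s = 0" using cv by blast
    qed
    hence "?P (Suc m)" using T finT v vT by (intro exI[of _ "insert v T"]) auto
    thus False using m2[of "Suc m"] by simp
  qed
  thus ?thesis using T finT unfolding has_qdim_def quotient_basis_iff by blast
qed

lemma has_qdim_split:
  assumes W: "subspace W" and V: "subspace V" and U: "subspace U" and WV: "W \<subseteq> V" and VU: "V \<subseteq> U"
    and n: "has_qdim scale U W n"
  obtains a b where "has_qdim scale V W a" "has_qdim scale U V b" "a + b = n"
proof -
  obtain S where S: "finite S" "card S = n" "\<And>u. u \<in> U \<Longrightarrow> \<exists>x\<in>span S. u - x \<in> W"
    using n unfolding has_qdim_def quotient_basis_iff by blast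
  have bd: "finite T \<and> card T \<le> n" if "T \<subseteq> U" "indep_mod W T" for T
    using indep_mod_card_le[OF W S(1) that(2)] S that by blast
  obtain a where a: "has_qdim scale V W a"
    using has_qdim_bounded_exists[OF V W, of n] bd VU by blast
  obtain b where b: "has_qdim scale U V b"
    using has_qdim_bounded_exists[OF U V, of n] bd indep_mod_mono[OF _ WV] by blast
  from has_qdim_unique'[OF W has_qdim_trans[OF W V WV VU a b] n] a b that show thesis by blast
qed

end

text \<open>The hypotheses make \<open>f\<close> induce an isomorphism of \<open>V / W\<close> onto
  \<open>V' / W'\<close>. An equivalence, because the known dimension is sometimes that of the
  source and sometimes that of the target.\<close>

lemma has_qdim_image:
  assumes f: "Vector_Spaces.linear s1 s2 f" and W': "module.subspace s2 W'"
    and fV: "\<And>v. v \<in> V \<Longrightarrow> f v \<in> V'" and V: "module.subspace s1 V"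
    and ker: "\<And>v. v \<in> V \<Longrightarrow> f v \<in> W' \<longleftrightarrow> v \<in> W"
    and sur: "\<And>v'. v' \<in> V' \<Longrightarrow> \<exists>v\<in>V. v' - f v \<in> W'"
  shows "has_qdim s2 V' W' n \<longleftrightarrow> has_qdim s1 V W n"
proof -
  interpret Vector_Spaces.linear s1 s2 f by fact
  interpret q1: kspace s1 ..
  interpret q2: kspace s2 ..
  have fsum: "f (\<Sum>s\<in>T. s1 (c s) s) = (\<Sum>s\<in>T. s2 (c s) (f s))" for T c
    by (simp add: sum scale)
  show ?thesis
  proof
    assume "has_qdim s1 V W n"
    then obtain S where S: "finite S" "card S = n" "S \<subseteq> V" "q1.indep_mod W S"
      "\<And>v. v \<in> V \<Longrightarrow> \<exists>u\<in>vs1.span S. v - u \<in> W"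
      unfolding has_qdim_def q1.quotient_basis_iff by blast
    have SV: "vs1.span S \<subseteq> V" using S V vs1.span_minimal by blast
    have inj: "inj_on f S"
    proof (rule inj_onI, rule ccontr)
      fix t t' assume t: "t \<in> S" "t' \<in> S" "f t = f t'" "t \<noteq> t'"
      have "t - t' \<in> V" using S t V vs1.subspace_diff by blast
      moreover have "f (t - t') \<in> W'" using t vs2.subspace_0[OF W'] by (simp add: diff)
      ultimately have "(\<Sum>s\<in>{t,t'}. s1 (if s = t then 1 else - 1) s) \<in> W"
        using t ker by simp
      from q1.indep_modD[OF S(4) _ _ this, of t] t show False by simp
    qed
    have "q2.indep_mod W' (f ` S)"
      unfolding q2.indep_mod_def
    proof (intro allI impI, elim conjE)
      fix T c assume T: "finite T" "T \<subseteq> f ` S" "(\<Sum>s\<in>T. s2 (c s) s) \<in> W'"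
      obtain T0 where T0: "T0 \<subseteq> S" "T = f ` T0" using T(2) by (meson subset_image_iff)
      have fin: "finite T0" using T0 S(1) finite_subset by blast
      have "(\<Sum>s\<in>T. s2 (c s) s) = f (\<Sum>s\<in>T0. s1 (c (f s)) s)"
        unfolding fsum T0(2) sum.reindex[OF inj_on_subset[OF inj T0(1)]] by simp
      moreover have "(\<Sum>s\<in>T0. s1 (c (f s)) s) \<in> V"
        using T0 S(3) V by (intro vs1.subspace_sum vs1.subspace_scale) auto
      ultimately have "(\<Sum>s\<in>T0. s1 (c (f s)) s) \<in> W" using T(3) ker by simp
      from q1.indep_modD[OF S(4) fin T0(1) this] T0(2) show "\<forall>s\<in>T. c s = 0" by auto
    qed
    moreover have "\<exists>u\<in>vs2.span (f ` S). v' - u \<in> W'" if v': "v' \<in> V'" for v'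
    proof -
      obtain v where v: "v \<in> V" "v' - f v \<in> W'" using sur v' by blast
      obtain u where u: "u \<in> vs1.span S" "v - u \<in> W" using S(5) v by blast
      have "v - u \<in> V" using v u SV V vs1.subspace_diff by blast
      hence "f (v - u) \<in> W'" using ker u by blast
      hence "(v' - f v) + f (v - u) \<in> W'" using v W' vs2.subspace_add by blast
      moreover have "f u \<in> vs2.span (f ` S)" using u span_image by blast
      ultimately show ?thesis by (intro bexI[of _ "f u"]) (auto simp: diff)
    qed
    ultimately show "has_qdim s2 V' W' n"
      using S inj fV unfolding has_qdim_def q2.quotient_basis_iff
      by (intro exI[of _ "f ` S"]) (auto simp: card_image)
  next
    assume "has_qdim s2 V' W' n"
    then obtain S where S: "finite S" "card S = n" "S \<subseteq> V'" "q2.indep_mod W' S"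
      "\<And>v. v \<in> V' \<Longrightarrow> \<exists>u\<in>vs2.span S. v - u \<in> W'"
      unfolding has_qdim_def q2.quotient_basis_iff by blast
    obtain g where g: "\<And>s. s \<in> S \<Longrightarrow> g s \<in> V" "\<And>s. s \<in> S \<Longrightarrow> s - f (g s) \<in> W'"
      using sur S(3) by (metis subsetD)
    have inj: "inj_on g S"
    proof (rule inj_onI, rule ccontr)
      fix t t' assume t: "t \<in> S" "t' \<in> S" "g t = g t'" "t \<noteq> t'"
      have "(t - f (g t)) - (t' - f (g t')) \<in> W'" using g t W' vs2.subspace_diff by blast
      hence "(\<Sum>s\<in>{t,t'}. s2 (if s = t then 1 else - 1) s) \<in> W'" using t by simp
      from q2.indep_modD[OF S(4) _ _ this, of t] t show False by simp
    qed
    have "q1.indep_mod W (g ` S)"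
      unfolding q1.indep_mod_def
    proof (intro allI impI, elim conjE)
      fix T c assume T: "finite T" "T \<subseteq> g ` S" "(\<Sum>s\<in>T. s1 (c s) s) \<in> W"
      obtain T0 where T0: "T0 \<subseteq> S" "T = g ` T0" using T(2) by (meson subset_image_iff)
      have fin: "finite T0" using T0 S(1) finite_subset by blast
      have "(\<Sum>s\<in>T. s1 (c s) s) \<in> V"
        using T0 g(1) V by (intro vs1.subspace_sum vs1.subspace_scale) auto
      hence h1: "f (\<Sum>s\<in>T. s1 (c s) s) \<in> W'" using T(3) ker by blast
      have "(\<Sum>s\<in>T. s2 (c s) (f s)) = (\<Sum>s\<in>T0. s2 (c (g s)) (f (g s)))"
        unfolding T0(2) sum.reindex[OF inj_on_subset[OF inj T0(1)]] o_def ..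
      with fsum have h2: "f (\<Sum>s\<in>T. s1 (c s) s) = (\<Sum>s\<in>T0. s2 (c (g s)) (f (g s)))"
        by (rule trans)
      have h3: "(\<Sum>s\<in>T0. s2 (c (g s)) (s - f (g s))) \<in> W'"
        using T0(1) g(2) by (intro vs2.subspace_sum[OF W'] vs2.subspace_scale[OF W']) auto
      have "(\<Sum>s\<in>T0. s2 (c (g s)) (s - f (g s))) + (\<Sum>s\<in>T0. s2 (c (g s)) (f (g s))) \<in> W'"
        using vs2.subspace_add[OF W' h3 h1] unfolding h2 .
      hence "(\<Sum>s\<in>T0. s2 (c (g s)) s) \<in> W'"
        by (simp add: vs2.scale_right_diff_distrib sum_subtractf)
      from q2.indep_modD[OF S(4) fin T0(1) this] T0(2) show "\<forall>s\<in>T. c s = 0" by auto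
    qed
    moreover have "\<exists>u\<in>vs1.span (g ` S). v - u \<in> W" if v: "v \<in> V" for v
    proof -
      obtain u where u: "u \<in> vs2.span S" "f v - u \<in> W'" using S(5) fV v by blast
      obtain c where c: "u = (\<Sum>s\<in>S. s2 (c s) s)"
        using u(1) unfolding vs2.span_finite[OF S(1)] by blast
      define x where "x = (\<Sum>s\<in>S. s1 (c s) (g s))"
      have x1: "x \<in> vs1.span (g ` S)"
        unfolding x_def by (intro vs1.span_sum vs1.span_scale vs1.span_base) simp
      have x2: "x \<in> V"
        unfolding x_def using g(1) by (intro vs1.subspace_sum[OF V] vs1.subspace_scale[OF V])
      have "u - f x = (\<Sum>s\<in>S. s2 (c s) (s - f (g s)))"
        unfolding c x_def by (simp add: sum scale vs2.scale_right_diff_distrib sum_subtractf)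
      also have "\<dots> \<in> W'"
        using g(2) by (intro vs2.subspace_sum[OF W'] vs2.subspace_scale[OF W'])
      finally have "(f v - u) + (u - f x) \<in> W'" by (rule vs2.subspace_add[OF W' u(2)])
      hence "f (v - x) \<in> W'" by (simp add: diff)
      hence "v - x \<in> W" using ker[OF vs1.subspace_diff[OF V v x2]] by blast
      thus ?thesis using x1 by blast
    qed
    ultimately show "has_qdim s1 V W n"
      using S inj g unfolding has_qdim_def q1.quotient_basis_iff
      by (intro exI[of _ "g ` S"]) (auto simp: card_image)
  qed
qed

section \<open>Koszul complexes\<close>

text \<open>
  The Koszul complex on a list of commuting operators is built as an iterated mapping cone, which
  avoids the signs of the exterior algebra. A chain is a function on bit lists: the list
  \<open>s\<close> stands for the wedge product of the basis vectors at the positions where \<open>s\<close> is \<open>True\<close>.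
\<close>

fun koszul :: "('v \<Rightarrow> 'm \<Rightarrow> 'm) \<Rightarrow> 'v list \<Rightarrow> (bool list \<Rightarrow> 'm) \<Rightarrow> bool list \<Rightarrow> 'm::ab_group_add" where
  "koszul X [] c s = 0"
| "koszul X (v # vs) c [] = 0"
| "koszul X (v # vs) c (True # s) = - koszul X vs (\<lambda>t. c (True # t)) s"
| "koszul X (v # vs) c (False # s) = koszul X vs (\<lambda>t. c (False # t)) s + X v (c (True # s))"

text \<open>Exterior multiplication by the basis vector at the first occurrence of \<open>v\<close>,
  acting on coefficient functions: the value at \<open>s\<close> comes from the list with that
  position switched to \<open>False\<close>, with a sign for every \<open>True\<close> before
  it.\<close>

fun wedge :: "'v \<Rightarrow> 'v list \<Rightarrow> (bool list \<Rightarrow> 'm) \<Rightarrow> bool list \<Rightarrow> 'm::ab_group_add" where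
  "wedge v [] c s = 0"
| "wedge v (u # us) c [] = 0"
| "wedge v (u # us) c (True # s) =
     (if u = v then c (False # s) else - wedge v us (\<lambda>t. c (True # t)) s)"
| "wedge v (u # us) c (False # s) = (if u = v then 0 else wedge v us (\<lambda>t. c (False # t)) s)"

text \<open>A wedge of \<open>i\<close> basis vectors has internal degree \<open>i\<close>, hence
  the shift \<open>j - int i\<close>. Forcing 0 on all other lists makes equality of chains equality
  of functions.\<close>

definition kchains :: "(int \<Rightarrow> 'm set) \<Rightarrow> nat \<Rightarrow> nat \<Rightarrow> int \<Rightarrow> (bool list \<Rightarrow> 'm::zero) set" where
  "kchains G n i j =
     {c. \<forall>s. c s \<in> (if length s = n \<and> count_list s True = i then G (j - int i) else {0})}"

definition pw :: "('k \<Rightarrow> 'm \<Rightarrow> 'm) \<Rightarrow> 'k \<Rightarrow> ('a \<Rightarrow> 'm) \<Rightarrow> 'a \<Rightarrow> 'm" where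
  "pw sc c f = (\<lambda>s. sc c (f s))"

lemma pw_apply [simp]: "pw sc c f s = sc c (f s)"
  by (simp add: pw_def)

lemma (in kspace) kspace_pw: "kspace (pw scale)"
  by standard (auto simp: fun_eq_iff algebra_simps)

lemma all_bool_list: "(\<forall>s. P s) \<longleftrightarrow> P [] \<and> (\<forall>t. P (False # t)) \<and> (\<forall>t. P (True # t))"
  by (metis (full_types) list.exhaust)

text \<open>The Koszul complex sees only the action of the variables, so a module is given by
  commuting linear operators. The same lemmas then serve the polynomial ring, free modules, syzygies
  and \<open>R\<close>.\<close>

locale var_ops = kspace sc for sc :: "'k::field \<Rightarrow> 'm::ab_group_add \<Rightarrow> 'm" +
  fixes X :: "'v \<Rightarrow> 'm \<Rightarrow> 'm"
  assumes X_add: "X v (a + b) = X v a + X v b"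
    and X_scale: "X v (sc c a) = sc c (X v a)"
    and X_comm: "X u (X v a) = X v (X u a)"
begin

sublocale ch: kspace "pw sc" by (rule kspace_pw)

lemma X_0 [simp]: "X v 0 = 0"
  using X_scale[of v 0 0] by simp

lemma X_minus: "X v (- a) = - X v a"
  using X_add[of v a "- a"] by (simp add: eq_neg_iff_add_eq_0 add.commute)

lemma koszul_plus: "koszul X vs (\<lambda>s. a s + b s) s = koszul X vs a s + koszul X vs b s"
proof (induction vs arbitrary: a b s)
  case (Cons v vs)
  show ?case
  proof (cases s)
    case (Cons d t)
    show ?thesis
      using Cons.IH[of "\<lambda>t. a (d # t)" "\<lambda>t. b (d # t)" t] unfolding Cons
      by (cases d) (simp_all add: X_add)
  qed simp
qed simp

lemma koszul_uminus: "koszul X vs (\<lambda>s. - a s) s = - koszul X vs a s"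
proof (induction vs arbitrary: a s)
  case (Cons u us)
  show ?case
  proof (cases s)
    case (Cons d t)
    show ?thesis
      using Cons.IH[of "\<lambda>t. a (d # t)" t] unfolding Cons
      by (cases d) (simp_all add: X_minus)
  qed simp
qed simp

lemma koszul_scale: "koszul X vs (\<lambda>s. sc c (a s)) s = sc c (koszul X vs a s)"
proof (induction vs arbitrary: a s)
  case (Cons u us)
  show ?case
  proof (cases s)
    case (Cons d t)
    show ?thesis
      using Cons.IH[of "\<lambda>t. a (d # t)" t] unfolding Cons
      by (cases d) (simp_all add: X_scale scale_right_distrib)
  qed simp
qed simp

lemma koszul_zero [simp]: "koszul X vs (\<lambda>s. 0) s = 0"
  using koszul_scale[of vs 0 "\<lambda>_. 0" s] by simp

lemma wedge_plus: "wedge v vs (\<lambda>s. a s + b s) s = wedge v vs a s + (wedge v vs b s :: 'm)"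
proof (induction vs arbitrary: a b s)
  case (Cons u vs)
  show ?case
  proof (cases s)
    case (Cons d t)
    show ?thesis
      using Cons.IH[of "\<lambda>t. a (d # t)" "\<lambda>t. b (d # t)" t] unfolding Cons
      by (cases d) simp_all
  qed simp
qed simp

lemma wedge_scale: "wedge v vs (\<lambda>s. sc c (a s)) s = sc c (wedge v vs a s)"
proof (induction vs arbitrary: a s)
  case (Cons u us)
  show ?case
  proof (cases s)
    case (Cons d t)
    show ?thesis
      using Cons.IH[of "\<lambda>t. a (d # t)" t] unfolding Cons
      by (cases d) (simp_all)
  qed simp
qed simp

lemma wedge_uminus: "wedge v vs (\<lambda>s. - a s) s = - (wedge v vs a s :: 'm)"
proof (induction vs arbitrary: a s)
  case (Cons u us)
  show ?case
  proof (cases s)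
    case (Cons d t)
    show ?thesis
      using Cons.IH[of "\<lambda>t. a (d # t)" t] unfolding Cons
      by (cases d) (simp_all)
  qed simp
qed simp

lemma X_koszul: "X v (koszul X vs c s) = koszul X vs (\<lambda>t. X v (c t)) s"
proof (induction vs arbitrary: c s)
  case (Cons u us)
  show ?case
  proof (cases s)
    case (Cons d t)
    show ?thesis
      using Cons.IH[of "\<lambda>t. c (d # t)" t] unfolding Cons
      by (cases d) (simp_all add: X_add X_minus X_comm[of v])
  qed simp
qed simp

lemma X_wedge: "X v (wedge u vs c s) = wedge u vs (\<lambda>t. X v (c t)) s"
proof (induction vs arbitrary: c s)
  case (Cons u us)
  show ?case
  proof (cases s)
    case (Cons d t)
    show ?thesis
      using Cons.IH[of "\<lambda>t. c (d # t)" t] unfolding Cons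
      by (cases d) (simp_all add: X_add X_minus)
  qed simp
qed simp

lemma koszul_koszul: "koszul X vs (koszul X vs c) s = 0"
proof (induction vs arbitrary: c s)
  case (Cons v vs)
  show ?case
  proof (cases s)
    case (Cons b t)
    show ?thesis
      using Cons.IH[of "\<lambda>t. c (b # t)" t] unfolding Cons
      by (cases b) (simp_all add: koszul_uminus koszul_plus X_koszul X_minus)
  qed simp
qed simp

text \<open>Each variable acts null-homotopically. At the position of \<open>v\<close> the wedge
  identifies the two copies in the mapping cone; at other positions the signs make the mixed terms
  cancel.\<close>

lemma wedge_homotopy:
  assumes "v \<in> set vs" "length s = length vs"
  shows "koszul X vs (wedge v vs c) s + wedge v vs (koszul X vs c) s = X v (c s)"
  using assms
proof (induction vs arbitrary: c s)
  case (Cons u us)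
  obtain b t where s: "s = b # t" using Cons.prems by (cases s) auto
  show ?case
  proof (cases "u = v")
    case True
    thus ?thesis by (cases b) (simp_all add: s)
  next
    case False
    hence "koszul X us (wedge v us (\<lambda>t. c (b # t))) t + wedge v us (koszul X us (\<lambda>t. c (b # t))) t
        = X v (c (b # t))"
      using Cons.prems s by (intro Cons.IH) auto
    thus ?thesis using False
      by (cases b) (simp_all add: s koszul_uminus wedge_uminus wedge_plus X_minus X_wedge algebra_simps)
  qed
qed simp

end

lemma koszul_map:
  assumes "\<And>a b. f (a + b) = f a + f b" "\<And>v a. f (X v a) = X' v (f a)"
  shows "koszul X' vs (\<lambda>s. f (c s)) s = f (koszul X vs c s)"
proof -
  have 0: "f 0 = 0" using assms(1)[of 0 0] by simp
  have m: "f (- a) = - f a" for a using assms(1)[of a "- a"] 0 by (simp add: eq_neg_iff_add_eq_0 add.commute)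
  show ?thesis
  proof (induction vs arbitrary: c s)
    case (Cons u us)
    show ?case
    proof (cases s)
      case (Cons d t)
      show ?thesis
        using Cons.IH[of "\<lambda>t. c (d # t)" t] unfolding Cons
        by (cases d) (simp_all add: assms 0 m)
    qed (simp add: 0)
  qed (simp add: 0)
qed

lemma chains_D1: "c \<in> kchains G n i j \<Longrightarrow> length s = n \<Longrightarrow> count_list s True = i \<Longrightarrow> c s \<in> G (j - int i)"
  and chains_D2: "c \<in> kchains G n i j \<Longrightarrow> length s \<noteq> n \<or> count_list s True \<noteq> i \<Longrightarrow> c s = 0"
  unfolding kchains_def by (auto dest!: spec[of _ s])

lemma chains_I:
  assumes "\<And>s. length s = n \<Longrightarrow> count_list s True = i \<Longrightarrow> c s \<in> G (j - int i)"
    and "\<And>s. length s \<noteq> n \<or> count_list s True \<noteq> i \<Longrightarrow> c s = 0"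
  shows "c \<in> kchains G n i j"
  using assms unfolding kchains_def by auto

locale graded_ops = var_ops sc X for sc :: "'k::field \<Rightarrow> 'm::ab_group_add \<Rightarrow> 'm" and X :: "'v \<Rightarrow> 'm \<Rightarrow> 'm" +
  fixes G :: "int \<Rightarrow> 'm set"
  assumes G_subspace: "subspace (G d)"
    and X_G: "a \<in> G d \<Longrightarrow> X v a \<in> G (d + 1)"
begin

lemma zero_G [simp]: "0 \<in> G d"
  using subspace_0[OF G_subspace] .

lemma chains_range: "c \<in> kchains G n i j \<Longrightarrow> c s \<in> G (j - int i)"
  unfolding kchains_def by (auto dest!: spec[of _ s] split: if_splits)

lemma subspace_chains: "ch.subspace (kchains G n i j)"
proof (rule ch.subspaceI)
  show "0 \<in> kchains G n i j" by (auto simp: kchains_def)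
  show "x + y \<in> kchains G n i j" if "x \<in> kchains G n i j" "y \<in> kchains G n i j" for x y
    using that G_subspace by (auto simp: kchains_def subspace_add)
  show "pw sc c x \<in> kchains G n i j" if "x \<in> kchains G n i j" for x c
    using that G_subspace by (auto simp: kchains_def subspace_scale)
qed

lemma X_chains:
  assumes "c \<in> kchains G n i j"
  shows "(\<lambda>t. X v (c t)) \<in> kchains G n i (j + 1)"
proof (rule chains_I)
  fix s assume "length s = n" "count_list s True = i"
  from X_G[OF chains_D1[OF assms this], of v] show "X v (c s) \<in> G (j + 1 - int i)"
    by (simp add: algebra_simps)
qed (use chains_D2[OF assms] in auto)

lemma chains_Suc_iff:
  "c \<in> kchains G (Suc n) i j \<longleftrightarrow> c [] = 0 \<and> (\<lambda>t. c (False # t)) \<in> kchains G n i j \<and>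
     (case i of 0 \<Rightarrow> \<forall>t. c (True # t) = 0 | Suc i' \<Rightarrow> (\<lambda>t. c (True # t)) \<in> kchains G n i' (j - 1))"
  unfolding kchains_def mem_Collect_eq all_bool_list[of "\<lambda>s. c s \<in> _ s"]
  by (cases i) (simp_all add: algebra_simps)

lemma koszul_chains_0:
  assumes "c \<in> kchains G (length vs) 0 j"
  shows "koszul X vs c s = 0"
  using assms
proof (induction vs arbitrary: c s)
  case (Cons v vs)
  have c: "(\<lambda>t. c (False # t)) \<in> kchains G (length vs) 0 j" "\<And>t. c (True # t) = 0"
    using Cons.prems unfolding length_Cons chains_Suc_iff by auto
  show ?case
  proof (cases s)
    case (Cons d t)
    show ?thesis using Cons.IH[OF c(1)] c(2) unfolding Cons by (cases d) simp_all
  qed simp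
qed simp

lemma koszul_chains:
  assumes "c \<in> kchains G (length vs) (Suc i) j"
  shows "koszul X vs c \<in> kchains G (length vs) i j"
  using assms
proof (induction vs arbitrary: c i j)
  case Nil
  show ?case by (auto simp: kchains_def)
next
  case (Cons v vs)
  let ?c0 = "\<lambda>t. c (False # t)" and ?c1 = "\<lambda>t. c (True # t)"
  have c: "?c0 \<in> kchains G (length vs) (Suc i) j" "?c1 \<in> kchains G (length vs) i (j - 1)"
    using Cons.prems unfolding length_Cons chains_Suc_iff by auto
  have k0: "koszul X vs ?c0 \<in> kchains G (length vs) i j" using Cons.IH c by blast
  have k1: "(\<lambda>t. X v (?c1 t)) \<in> kchains G (length vs) i j"
    using X_chains[OF c(2)] by simp
  have h0: "(\<lambda>t. koszul X vs ?c0 t + X v (?c1 t)) \<in> kchains G (length vs) i j"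
    using ch.subspace_add[OF subspace_chains k0 k1] by (simp add: plus_fun_def)
  have h1: "case i of 0 \<Rightarrow> \<forall>t. - koszul X vs ?c1 t = 0
      | Suc i' \<Rightarrow> (\<lambda>t. - koszul X vs ?c1 t) \<in> kchains G (length vs) i' (j - 1)"
  proof (cases i)
    case 0
    thus ?thesis using koszul_chains_0 c(2) by simp
  next
    case (Suc i')
    hence "koszul X vs ?c1 \<in> kchains G (length vs) i' (j - 1)" using Cons.IH c by blast
    from ch.subspace_neg[OF subspace_chains this] show ?thesis
      using Suc by (simp add: fun_Compl_def)
  qed
  show ?case unfolding length_Cons chains_Suc_iff koszul.simps by (intro conjI refl h0 h1)
qed

text \<open>A statement uniform in \<open>i\<close>: for \<open>i = 0\<close> there is no chain
  group below, but the degree of the values still makes sense.\<close>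

lemma koszul_range:
  assumes "c \<in> kchains G (length vs) i j"
  shows "koszul X vs c s \<in> G (j + 1 - int i)"
proof (cases i)
  case 0
  have "koszul X vs c s = 0" using assms unfolding 0 by (rule koszul_chains_0)
  thus ?thesis by simp
next
  case (Suc i')
  have "koszul X vs c s \<in> G (j - int i')"
    using assms unfolding Suc by (intro chains_range[OF koszul_chains])
  moreover have "j - int i' = j + 1 - int i" using Suc by simp
  ultimately show ?thesis by simp
qed

lemma wedge_0: "wedge v vs (\<lambda>t. 0) s = (0::'m)"
  using wedge_scale[of v vs 0 "\<lambda>_. 0"] by simp

lemma wedge_chains:
  assumes "c \<in> kchains G (length vs) i j"
  shows "wedge v vs c \<in> kchains G (length vs) (Suc i) (j + 1)"
  using assms
proof (induction vs arbitrary: c i j)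
  case Nil
  show ?case by (auto simp: kchains_def)
next
  case (Cons u us)
  let ?c0 = "\<lambda>t. c (False # t)" and ?c1 = "\<lambda>t. c (True # t)"
  have c0: "?c0 \<in> kchains G (length us) i j"
    using Cons.prems unfolding length_Cons chains_Suc_iff by auto
  show ?case
  proof (cases "u = v")
    case True
    have "(\<lambda>t. 0) \<in> kchains G (length us) (Suc i) (j + 1)" by (rule chains_I) auto
    thus ?thesis using True c0 unfolding length_Cons chains_Suc_iff by simp
  next
    case False
    have "(\<lambda>t. - wedge v us ?c1 t) \<in> kchains G (length us) i j"
    proof (cases i)
      case 0
      hence "\<And>t. ?c1 t = 0" using Cons.prems unfolding length_Cons chains_Suc_iff by simp
      hence "(\<lambda>t. - wedge v us ?c1 t) = (\<lambda>t. 0)" using wedge_0[of v us] by simp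
      thus ?thesis by (auto intro: chains_I)
    next
      case (Suc i')
      hence "?c1 \<in> kchains G (length us) i' (j - 1)"
        using Cons.prems unfolding length_Cons chains_Suc_iff by simp
      from Cons.IH[OF this] have "wedge v us ?c1 \<in> kchains G (length us) i j" using Suc by simp
      from ch.subspace_neg[OF subspace_chains this] show ?thesis by (simp add: fun_Compl_def)
    qed
    thus ?thesis using False Cons.IH[OF c0] unfolding length_Cons chains_Suc_iff by simp
  qed
qed

end

text \<open>Cycles and boundaries of the Koszul complex of the quotient by \<open>J\<close>,
  represented by chains upstairs. Homology of a quotient module is thus computed without forming the
  quotient as a type.\<close>

definition koszul_cycles ::
  "('v \<Rightarrow> 'm \<Rightarrow> 'm) \<Rightarrow> (int \<Rightarrow> 'm set) \<Rightarrow> 'm set \<Rightarrow> 'v list \<Rightarrow> nat \<Rightarrow> int \<Rightarrow> (bool list \<Rightarrow> 'm::ab_group_add) set"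
  where "koszul_cycles X G J vs i j =
           {c \<in> kchains G (length vs) i j. \<forall>s. koszul X vs c s \<in> J}"

definition koszul_bounds ::
  "('v \<Rightarrow> 'm \<Rightarrow> 'm) \<Rightarrow> (int \<Rightarrow> 'm set) \<Rightarrow> 'm set \<Rightarrow> 'v list \<Rightarrow> nat \<Rightarrow> int \<Rightarrow> (bool list \<Rightarrow> 'm::ab_group_add) set"
  where "koszul_bounds X G J vs i j =
           {koszul X vs e + g | e g. e \<in> kchains G (length vs) (Suc i) j \<and> g \<in> kchains G (length vs) i j \<and> (\<forall>s. g s \<in> J)}"

definition (in var_ops) stable :: "'m set \<Rightarrow> bool" where
  "stable J \<longleftrightarrow> subspace J \<and> (\<forall>v. \<forall>a\<in>J. X v a \<in> J)"

context graded_ops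
begin

lemma koszul_stable:
  assumes "stable J" "\<And>s. c s \<in> J"
  shows "koszul X vs c s \<in> J"
  using assms(2)
proof (induction vs arbitrary: c s)
  case Nil
  show ?case using assms(1) subspace_0 unfolding stable_def by simp
next
  case (Cons u us)
  have J: "subspace J" "\<And>v a. a \<in> J \<Longrightarrow> X v a \<in> J" using assms(1) unfolding stable_def by auto
  show ?case
  proof (cases s)
    case Nil
    thus ?thesis using subspace_0 J by simp
  next
    case (Cons d t)
    have "koszul X us (\<lambda>t. c (d # t)) t \<in> J" using Cons.IH Cons.prems by simp
    thus ?thesis
      using Cons J Cons.prems by (cases d) (simp_all add: subspace_add subspace_neg)
  qed
qed

lemma koszul_fun_plus: "koszul X vs (a + b) = koszul X vs a + koszul X vs b"
  by (rule ext) (use koszul_plus in \<open>simp add: plus_fun_def\<close>)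

lemma koszul_fun_pw: "koszul X vs (pw sc c a) = pw sc c (koszul X vs a)"
  by (rule ext) (simp add: pw_def koszul_scale)

lemma linear_koszul: "Vector_Spaces.linear (pw sc) (pw sc) (koszul X vs)"
  by (simp add: Vector_Spaces.linear_iff ch.vector_space_axioms koszul_fun_plus koszul_fun_pw)

sublocale kz: Vector_Spaces.linear "pw sc" "pw sc" "koszul X vs" for vs
  by (rule linear_koszul)

lemma koszul_koszul_fun [simp]: "koszul X vs (koszul X vs c) = 0"
  by (rule ext) (simp add: koszul_koszul)

lemma stable_0: "stable {0}"
  unfolding stable_def by simp

lemma subspace_cycles:
  assumes "stable J"
  shows "ch.subspace (koszul_cycles X G J vs i j)"
proof -
  have J: "subspace J" using assms unfolding stable_def by auto
  show ?thesis
  proof (rule ch.subspaceI)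
    show "0 \<in> koszul_cycles X G J vs i j"
      using ch.subspace_0[OF subspace_chains] subspace_0[OF J] by (simp add: koszul_cycles_def)
    show "x + y \<in> koszul_cycles X G J vs i j"
      if "x \<in> koszul_cycles X G J vs i j" "y \<in> koszul_cycles X G J vs i j" for x y
      using that ch.subspace_add[OF subspace_chains] subspace_add[OF J]
      by (simp add: koszul_cycles_def koszul_fun_plus)
    show "pw sc c x \<in> koszul_cycles X G J vs i j" if "x \<in> koszul_cycles X G J vs i j" for x c
      using that ch.subspace_scale[OF subspace_chains] subspace_scale[OF J]
      by (simp add: koszul_cycles_def koszul_fun_pw)
  qed
qed

lemma koszul_boundsI:
  "e \<in> kchains G (length vs) (Suc i) j \<Longrightarrow> g \<in> kchains G (length vs) i j \<Longrightarrow> (\<And>s. g s \<in> J) \<Longrightarrow>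
    koszul X vs e + g \<in> koszul_bounds X G J vs i j"
  unfolding koszul_bounds_def by blast

lemma koszul_boundsD:
  "b \<in> koszul_bounds X G J vs i j \<Longrightarrow>
    \<exists>e g. e \<in> kchains G (length vs) (Suc i) j \<and> g \<in> kchains G (length vs) i j \<and> (\<forall>s. g s \<in> J) \<and> b = koszul X vs e + g"
  unfolding koszul_bounds_def by blast

lemma subspace_bounds:
  assumes "stable J"
  shows "ch.subspace (koszul_bounds X G J vs i j)"
proof -
  have J: "subspace J" using assms unfolding stable_def by auto
  show ?thesis
  proof (rule ch.subspaceI)
    show "0 \<in> koszul_bounds X G J vs i j"
      using koszul_boundsI[OF ch.subspace_0[OF subspace_chains] ch.subspace_0[OF subspace_chains], where J = J]
        subspace_0[OF J] by simp
    show "x + y \<in> koszul_bounds X G J vs i j"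
      if xy: "x \<in> koszul_bounds X G J vs i j" "y \<in> koszul_bounds X G J vs i j" for x y
    proof -
      obtain e g where x: "e \<in> kchains G (length vs) (Suc i) j" "g \<in> kchains G (length vs) i j" "\<And>s. g s \<in> J"
        "x = koszul X vs e + g" using koszul_boundsD[OF xy(1)] by auto
      obtain e' g' where y: "e' \<in> kchains G (length vs) (Suc i) j" "g' \<in> kchains G (length vs) i j" "\<And>s. g' s \<in> J"
        "y = koszul X vs e' + g'" using koszul_boundsD[OF xy(2)] by auto
      have "koszul X vs (e + e') + (g + g') \<in> koszul_bounds X G J vs i j"
        using x y subspace_add[OF J] by (intro koszul_boundsI ch.subspace_add[OF subspace_chains]) auto
      thus ?thesis using x y by (simp add: koszul_fun_plus algebra_simps)
    qed
    show "pw sc c x \<in> koszul_bounds X G J vs i j" if x0: "x \<in> koszul_bounds X G J vs i j" for x c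
    proof -
      obtain e g where x: "e \<in> kchains G (length vs) (Suc i) j" "g \<in> kchains G (length vs) i j" "\<And>s. g s \<in> J"
        "x = koszul X vs e + g" using koszul_boundsD[OF x0] by auto
      have "koszul X vs (pw sc c e) + (pw sc c g) \<in> koszul_bounds X G J vs i j"
        using x subspace_scale[OF J] by (intro koszul_boundsI ch.subspace_scale[OF subspace_chains]) auto
      thus ?thesis using x by (simp add: koszul_fun_pw ch.scale_right_distrib)
    qed
  qed
qed

lemma bounds_subset_cycles:
  assumes "stable J"
  shows "koszul_bounds X G J vs i j \<subseteq> koszul_cycles X G J vs i j"
proof
  fix b assume "b \<in> koszul_bounds X G J vs i j"
  from koszul_boundsD[OF this] obtain e g where x: "e \<in> kchains G (length vs) (Suc i) j" "g \<in> kchains G (length vs) i j" "\<And>s. g s \<in> J"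
    "b = koszul X vs e + g" by (elim exE conjE) (rule that; blast)
  show "b \<in> koszul_cycles X G J vs i j"
    unfolding koszul_cycles_def x(4)
    using koszul_stable[OF assms x(3)] koszul_chains[OF x(1)] x(2) ch.subspace_add[OF subspace_chains]
    by (auto simp: koszul_fun_plus)
qed

text \<open>A stable subspace is a graded module in its own right. The syzygies of a resolution
  enter in this form.\<close>

lemma graded_ops_Int:
  assumes "stable J"
  shows "graded_ops sc X (\<lambda>d. G d \<inter> J)"
  using assms G_subspace X_G by unfold_locales (auto simp: stable_def subspace_inter)

lemma chains_Int_iff:
  assumes "stable J"
  shows "c \<in> kchains (\<lambda>d. G d \<inter> J) n i j \<longleftrightarrow> c \<in> kchains G n i j \<and> (\<forall>s. c s \<in> J)"
proof -
  have J: "0 \<in> J" using assms subspace_0 unfolding stable_def by auto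
  have "(c s \<in> (if P then G d \<inter> J else {0})) \<longleftrightarrow> c s \<in> (if P then G d else {0}) \<and> c s \<in> J" for s P d
    using J by (cases P) auto
  thus ?thesis unfolding kchains_def by (simp add: all_conj_distrib)
qed

lemma koszul_bounds_0: "koszul_bounds X G {0} vs i j = koszul X vs ` kchains G (length vs) (Suc i) j"
proof -
  have "(\<forall>s. g s \<in> {0}) \<longleftrightarrow> g = 0" for g :: "bool list \<Rightarrow> 'm"
    by (simp add: fun_eq_iff)
  moreover have "0 \<in> kchains G (length vs) i j" by (rule ch.subspace_0[OF subspace_chains])
  ultimately show ?thesis unfolding koszul_bounds_def by auto
qed

text \<open>
  The connecting isomorphism for \<open>0 \<rightarrow> J \<rightarrow> G \<rightarrow> G / J \<rightarrow> 0\<close>, where the Koszul complex of \<open>G\<close>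
  has no homology in positive degrees.
\<close>

lemma koszul_shift:
  assumes J: "stable J"
    and acyclic: "\<And>i c. c \<in> kchains G (length vs) (Suc i) j \<Longrightarrow> koszul X vs c = 0 \<Longrightarrow>
      \<exists>e\<in>kchains G (length vs) (Suc (Suc i)) j. koszul X vs e = c"
  defines "G' \<equiv> \<lambda>d. G d \<inter> J"
  shows "has_qdim (pw sc) (koszul_cycles X G' {0} vs i j \<inter> koszul X vs ` kchains G (length vs) (Suc i) j)
           (koszul_bounds X G' {0} vs i j) h \<longleftrightarrow>
         has_qdim (pw sc) (koszul_cycles X G J vs (Suc i) j) (koszul_bounds X G J vs (Suc i) j) h"
proof (rule has_qdim_image[OF linear_koszul])
  interpret G': graded_ops sc X G' unfolding G'_def by (rule graded_ops_Int[OF J])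
  note G'_iff = chains_Int_iff[OF J, folded G'_def]
  show "ch.subspace (koszul_bounds X G' {0} vs i j)" by (rule G'.subspace_bounds[OF stable_0])
  show "ch.subspace (koszul_cycles X G J vs (Suc i) j)" by (rule subspace_cycles[OF J])
  show "koszul X vs c \<in> koszul_cycles X G' {0} vs i j \<inter> koszul X vs ` kchains G (length vs) (Suc i) j"
    if "c \<in> koszul_cycles X G J vs (Suc i) j" for c
    using that koszul_chains by (auto simp: koszul_cycles_def G'_iff)
  show "\<exists>v\<in>koszul_cycles X G J vs (Suc i) j. v' - koszul X vs v \<in> koszul_bounds X G' {0} vs i j"
    if v': "v' \<in> koszul_cycles X G' {0} vs i j \<inter> koszul X vs ` kchains G (length vs) (Suc i) j" for v'
  proof -
    obtain e where e: "e \<in> kchains G (length vs) (Suc i) j" "v' = koszul X vs e" using v' by blast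
    have "e \<in> koszul_cycles X G J vs (Suc i) j"
      using v' e by (auto simp: koszul_cycles_def G'_iff)
    moreover have "v' - koszul X vs e \<in> koszul_bounds X G' {0} vs i j"
      using e G'.subspace_bounds[OF stable_0, THEN ch.subspace_0] by simp
    ultimately show ?thesis by blast
  qed
  show "koszul X vs c \<in> koszul_bounds X G' {0} vs i j \<longleftrightarrow> c \<in> koszul_bounds X G J vs (Suc i) j"
    if c: "c \<in> koszul_cycles X G J vs (Suc i) j" for c
  proof
    assume "koszul X vs c \<in> koszul_bounds X G' {0} vs i j"
    then obtain e where e: "e \<in> kchains G' (length vs) (Suc i) j" "koszul X vs c = koszul X vs e"
      unfolding G'.koszul_bounds_0 by blast
    have e': "e \<in> kchains G (length vs) (Suc i) j" "\<And>s. e s \<in> J" using e(1) by (auto simp: G'_iff)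
    have "c - e \<in> kchains G (length vs) (Suc i) j"
      using c e'(1) ch.subspace_diff[OF subspace_chains] by (simp add: koszul_cycles_def)
    moreover have "koszul X vs (c - e) = 0" using e(2) by (simp add: kz.diff)
    ultimately obtain d where d: "d \<in> kchains G (length vs) (Suc (Suc i)) j" "koszul X vs d = c - e"
      using acyclic by blast
    have "koszul X vs d + e \<in> koszul_bounds X G J vs (Suc i) j"
      by (rule koszul_boundsI[OF d(1) e'])
    thus "c \<in> koszul_bounds X G J vs (Suc i) j" using d by simp
  next
    assume "c \<in> koszul_bounds X G J vs (Suc i) j"
    from koszul_boundsD[OF this] obtain e g where x: "e \<in> kchains G (length vs) (Suc (Suc i)) j" "g \<in> kchains G (length vs) (Suc i) j"
      "\<And>s. g s \<in> J" "c = koszul X vs e + g" by (elim exE conjE) (rule that; blast)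
    have "koszul X vs c = koszul X vs g" using x by (simp add: koszul_fun_plus)
    moreover have "g \<in> kchains G' (length vs) (Suc i) j" using x by (simp add: G'_iff)
    ultimately show "koszul X vs c \<in> koszul_bounds X G' {0} vs i j"
      unfolding G'.koszul_bounds_0 by blast
  qed
qed

text \<open>In positive degree every cycle with values in \<open>J\<close> bounds in
  \<open>G\<close>, so the intersection in \<open>koszul_shift\<close> is the whole space of cycles.
  In degree 0 it is a genuine condition, used in \<open>Hk_V_Suc\<close>.\<close>

lemma koszul_shift_Suc:
  assumes J: "stable J"
    and acyclic: "\<And>i c. c \<in> kchains G (length vs) (Suc i) j \<Longrightarrow> koszul X vs c = 0 \<Longrightarrow>
      \<exists>e\<in>kchains G (length vs) (Suc (Suc i)) j. koszul X vs e = c"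
  defines "G' \<equiv> \<lambda>d. G d \<inter> J"
  shows "has_qdim (pw sc) (koszul_cycles X G' {0} vs (Suc i) j) (koszul_bounds X G' {0} vs (Suc i) j) h \<longleftrightarrow>
         has_qdim (pw sc) (koszul_cycles X G J vs (Suc (Suc i)) j) (koszul_bounds X G J vs (Suc (Suc i)) j) h"
proof -
  have "koszul_cycles X G' {0} vs (Suc i) j \<subseteq> koszul X vs ` kchains G (length vs) (Suc (Suc i)) j"
  proof
    fix c assume c: "c \<in> koszul_cycles X G' {0} vs (Suc i) j"
    hence "c \<in> kchains G (length vs) (Suc i) j" "koszul X vs c = 0"
      by (auto simp: koszul_cycles_def G'_def chains_Int_iff[OF J] fun_eq_iff)
    thus "c \<in> koszul X vs ` kchains G (length vs) (Suc (Suc i)) j" using acyclic by blast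
  qed
  hence "koszul_cycles X G' {0} vs (Suc i) j \<inter> koszul X vs ` kchains G (length vs) (Suc (Suc i)) j
    = koszul_cycles X G' {0} vs (Suc i) j" by blast
  with koszul_shift[OF J acyclic, of "Suc i" h] show ?thesis unfolding G'_def by simp
qed

text \<open>A graded surjection with kernel \<open>J\<close> identifies the complex of
  \<open>G'\<close> with that of \<open>G / J\<close>. Surjectivity in each degree lets chains be
  lifted value by value, and the kernel condition turns vanishing downstairs into membership in
  \<open>J\<close>.\<close>

lemma koszul_quotient_map:
  assumes G': "graded_ops sc' X' G'" and J: "stable J"
    and f: "Vector_Spaces.linear sc sc' f" and fX: "\<And>v a. f (X v a) = X' v (f a)"
    and fG: "\<And>d a. a \<in> G d \<Longrightarrow> f a \<in> G' d" and sur: "\<And>d b. b \<in> G' d \<Longrightarrow> \<exists>a\<in>G d. f a = b"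
    and ker: "\<And>d a. a \<in> G d \<Longrightarrow> f a = 0 \<longleftrightarrow> a \<in> J"
  shows "has_qdim (pw sc') (koszul_cycles X' G' {0} vs i j) (koszul_bounds X' G' {0} vs i j) h \<longleftrightarrow>
         has_qdim (pw sc) (koszul_cycles X G J vs i j) (koszul_bounds X G J vs i j) h"
proof -
  interpret G': graded_ops sc' X' G' by fact
  interpret f: Vector_Spaces.linear sc sc' f by fact
  let ?F = "\<lambda>c s. f (c s)"
  have lin: "Vector_Spaces.linear (pw sc) (pw sc') ?F"
    by (simp add: Vector_Spaces.linear_iff ch.vector_space_axioms G'.ch.vector_space_axioms f.add f.scale fun_eq_iff)
  have kF: "koszul X' vs (?F c) = ?F (koszul X vs c)" for c
    by (rule ext) (rule koszul_map, simp_all add: f.add fX)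
  have F_chains: "?F c \<in> kchains G' n i j" if "c \<in> kchains G n i j" for c n i
    using chains_D1[OF that] chains_D2[OF that] fG by (intro chains_I) auto
  have lift: "\<exists>c\<in>kchains G n i j. ?F c = c'" if c': "c' \<in> kchains G' n i j" for c' n i
  proof -
    have "\<forall>s. \<exists>a. f a = c' s \<and> (if length s = n \<and> count_list s True = i then a \<in> G (j - int i) else a = 0)"
    proof
      fix s
      show "\<exists>a. f a = c' s \<and> (if length s = n \<and> count_list s True = i then a \<in> G (j - int i) else a = 0)"
      proof (cases "length s = n \<and> count_list s True = i")
        case True
        thus ?thesis using sur[OF chains_D1[OF c', of s]] by auto
      next
        case False
        thus ?thesis using chains_D2[OF c', of s] f.zero by auto
      qed
    qed
    then obtain c where c: "\<And>s. f (c s) = c' s"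
      "\<And>s. if length s = n \<and> count_list s True = i then c s \<in> G (j - int i) else c s = 0" by metis
    have "c \<in> kchains G n i j"
    proof (rule chains_I)
      show "c s \<in> G (j - int i)" if "length s = n" "count_list s True = i" for s using c(2)[of s] that by simp
      show "c s = 0" if "length s \<noteq> n \<or> count_list s True \<noteq> i" for s using c(2)[of s] that by auto
    qed
    thus ?thesis using c(1) by auto
  qed
  show ?thesis
  proof (rule has_qdim_image[OF lin])
    show "G'.ch.subspace (koszul_bounds X' G' {0} vs i j)" by (rule G'.subspace_bounds[OF G'.stable_0])
    show "ch.subspace (koszul_cycles X G J vs i j)" by (rule subspace_cycles[OF J])
    show "?F c \<in> koszul_cycles X' G' {0} vs i j" if c: "c \<in> koszul_cycles X G J vs i j" for c
    proof -
      have "f (koszul X vs c s) = 0" for s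
        using c koszul_range[of c vs i j s] ker by (auto simp: koszul_cycles_def)
      thus ?thesis using c F_chains by (auto simp: koszul_cycles_def kF)
    qed
    show "\<exists>v\<in>koszul_cycles X G J vs i j. v' - ?F v \<in> koszul_bounds X' G' {0} vs i j"
      if v': "v' \<in> koszul_cycles X' G' {0} vs i j" for v'
    proof -
      obtain c where c: "c \<in> kchains G (length vs) i j" "?F c = v'"
        using v' lift unfolding koszul_cycles_def by blast
      have "koszul X vs c s \<in> J" for s
      proof -
        have "f (koszul X vs c s) = koszul X' vs v' s" using kF[of c] c(2) by (simp add: fun_eq_iff)
        also have "\<dots> = 0" using v' by (auto simp: koszul_cycles_def)
        finally show ?thesis using ker koszul_range[OF c(1)] by blast
      qed
      hence "c \<in> koszul_cycles X G J vs i j" using c by (simp add: koszul_cycles_def)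
      moreover have "v' - ?F c \<in> koszul_bounds X' G' {0} vs i j"
        using c G'.subspace_bounds[OF G'.stable_0, THEN G'.ch.subspace_0] by simp
      ultimately show ?thesis by blast
    qed
    show "?F c \<in> koszul_bounds X' G' {0} vs i j \<longleftrightarrow> c \<in> koszul_bounds X G J vs i j"
      if c: "c \<in> koszul_cycles X G J vs i j" for c
    proof
      assume "?F c \<in> koszul_bounds X' G' {0} vs i j"
      then obtain e' where e': "e' \<in> kchains G' (length vs) (Suc i) j" "?F c = koszul X' vs e'"
        unfolding G'.koszul_bounds_0 by blast
      obtain e where e: "e \<in> kchains G (length vs) (Suc i) j" "?F e = e'" using lift[OF e'(1)] by blast
      have g: "c - koszul X vs e \<in> kchains G (length vs) i j"
        using c koszul_chains[OF e(1)] ch.subspace_diff[OF subspace_chains] by (simp add: koszul_cycles_def)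
      have "f ((c - koszul X vs e) s) = 0" for s
        using e'(2) e(2) kF[of e] by (simp add: f.diff fun_eq_iff)
      hence "(c - koszul X vs e) s \<in> J" for s using ker chains_range[OF g] by blast
      from koszul_boundsI[OF e(1) g this] show "c \<in> koszul_bounds X G J vs i j"
        unfolding add.commute[of "koszul X vs e"] diff_add_cancel .
    next
      assume "c \<in> koszul_bounds X G J vs i j"
      from koszul_boundsD[OF this] obtain e g where x: "e \<in> kchains G (length vs) (Suc i) j" "g \<in> kchains G (length vs) i j"
        "\<And>s. g s \<in> J" "c = koszul X vs e + g" by (elim exE conjE) (rule that; blast)
      have fg: "f (g s) = 0" for s using ker[OF chains_range[OF x(2)]] x(3) by simp
      have "?F c = koszul X' vs (?F e)" unfolding kF x(4) by (simp add: f.add fg)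
      thus "?F c \<in> koszul_bounds X' G' {0} vs i j"
        using F_chains[OF x(1)] unfolding G'.koszul_bounds_0 by blast
    qed
  qed
qed

end

section \<open>The polynomial ring\<close>

definition mdeg :: "('v::finite \<Rightarrow>\<^sub>0 nat) \<Rightarrow> int" where
  "mdeg m = int (\<Sum>v\<in>UNIV. Poly_Mapping.lookup m v)"

lemma mdeg_add: "mdeg (a + b) = mdeg a + mdeg b"
  by (simp add: mdeg_def lookup_add sum.distrib)

lemma mdeg_nonneg: "mdeg a \<ge> 0"
  unfolding mdeg_def by (rule of_nat_0_le_iff)

lemma mdeg_0 [simp]: "mdeg 0 = 0"
  by (simp add: mdeg_def)

lemma mdeg_single [simp]: "mdeg (Poly_Mapping.single v n) = int n"
  by (simp add: mdeg_def lookup_single when_def)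

lemma homogeneous_iff: "p \<in> homogeneous d \<longleftrightarrow> (\<forall>m\<in>Poly_Mapping.keys p. mdeg m = d)"
  by (simp add: homogeneous_def mdeg_def)

lemma homogeneous_iff_lookup:
  "p \<in> homogeneous d \<longleftrightarrow> (\<forall>m. mdeg m \<noteq> d \<longrightarrow> Poly_Mapping.lookup p m = 0)"
  unfolding homogeneous_iff Ball_def in_keys_iff by auto

lemma homogeneous_negative: "d < 0 \<Longrightarrow> p \<in> homogeneous d \<Longrightarrow> p = 0"
proof (rule poly_mapping_eqI)
  fix m assume "d < 0" "p \<in> homogeneous d"
  thus "Poly_Mapping.lookup p m = Poly_Mapping.lookup 0 m"
    using mdeg_nonneg[of m] unfolding homogeneous_iff_lookup by auto
qed

definition psc :: "'k \<Rightarrow> ('v, 'k::field) mpol \<Rightarrow> ('v, 'k) mpol" where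
  "psc c p = Const c * p"

lemma lookup_single_mult:
  fixes p :: "('a::cancel_comm_monoid_add) \<Rightarrow>\<^sub>0 ('b::semiring_0)"
  shows "Poly_Mapping.lookup (Poly_Mapping.single a c * p) (a + b) = c * Poly_Mapping.lookup p b"
proof -
  have "Poly_Mapping.lookup (Poly_Mapping.single a c * p) (a + b)
      = (\<Sum>l. (c * (\<Sum>q. Poly_Mapping.lookup p q when a + b = l + q)) when a = l)"
    unfolding lookup_mult by (intro Sum_any.cong) (simp add: lookup_single when_mult)
  also have "\<dots> = c * (\<Sum>q. Poly_Mapping.lookup p q when a + b = a + q)"
    by simp
  also have "(\<Sum>q. Poly_Mapping.lookup p q when a + b = a + q) = Poly_Mapping.lookup p b"
    by simp
  finally show ?thesis .
qed

lemma lookup_single_mult_0: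
  fixes p :: "('a::cancel_comm_monoid_add) \<Rightarrow>\<^sub>0 ('b::semiring_0)"
  assumes "\<And>b. m \<noteq> a + b"
  shows "Poly_Mapping.lookup (Poly_Mapping.single a c * p) m = 0"
proof -
  have "Poly_Mapping.lookup (Poly_Mapping.single a c * p) m = (\<Sum>l::'a. 0)"
    unfolding lookup_mult using assms by (intro Sum_any.cong) (auto simp: lookup_single when_def)
  thus ?thesis by simp
qed

lemma lookup_psc [simp]: "Poly_Mapping.lookup (psc c p) m = c * Poly_Mapping.lookup p m"
  using lookup_single_mult[of 0 c p m] by (simp add: psc_def Const_def)

lemma lookup_Var_mult:
  "Poly_Mapping.lookup (Var v * p) (Poly_Mapping.single v 1 + b) = Poly_Mapping.lookup p b"
  using lookup_single_mult[of "Poly_Mapping.single v 1" 1 p b] by (simp add: Var_def)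

lemma single_add_iff: "(\<exists>b. m = Poly_Mapping.single v (n::nat) + b) \<longleftrightarrow> n \<le> Poly_Mapping.lookup m v"
proof
  assume le: "n \<le> Poly_Mapping.lookup m v"
  show "\<exists>b. m = Poly_Mapping.single v n + b"
  proof (intro exI poly_mapping_eqI)
    fix k show "Poly_Mapping.lookup m k
      = Poly_Mapping.lookup (Poly_Mapping.single v n + (m - Poly_Mapping.single v n)) k"
      using le by (cases "k = v") (auto simp: lookup_add lookup_minus lookup_single when_def)
  qed
qed (auto simp: lookup_add)

lemma lookup_Var_mult_0: "Poly_Mapping.lookup m v = 0 \<Longrightarrow> Poly_Mapping.lookup (Var v * p) m = 0"
  using lookup_single_mult_0[of m "Poly_Mapping.single v 1" 1 p] single_add_iff[of m v 1]
  by (auto simp: Var_def)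

lemma kspace_psc: "kspace (psc :: 'k::field \<Rightarrow> ('v, 'k) mpol \<Rightarrow> _)"
  by standard (auto intro!: poly_mapping_eqI simp: lookup_add algebra_simps)

interpretation psc: kspace "psc :: 'k::field \<Rightarrow> ('v, 'k) mpol \<Rightarrow> _"
  by (rule kspace_psc)

lemma psc_mult: "psc c (p * q) = psc c p * q" "psc c (p * q) = p * psc c q"
  by (simp_all add: psc_def mult_ac)

lemma sum_single: "p = (\<Sum>m\<in>Poly_Mapping.keys p. Poly_Mapping.single m (Poly_Mapping.lookup p m))"
  by (intro poly_mapping_eqI)
     (simp add: lookup_sum lookup_single when_def in_keys_iff)

definition hcomp :: "int \<Rightarrow> ('v::finite, 'k::field) mpol \<Rightarrow> ('v, 'k) mpol" where
  "hcomp d p = (\<Sum>m\<in>{m \<in> Poly_Mapping.keys p. mdeg m = d}. Poly_Mapping.single m (Poly_Mapping.lookup p m))"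

lemma lookup_hcomp: "Poly_Mapping.lookup (hcomp d p) m = (Poly_Mapping.lookup p m when mdeg m = d)"
  by (simp add: hcomp_def lookup_sum lookup_single when_def in_keys_iff)

lemma hcomp_plus: "hcomp d (p + q) = hcomp d p + hcomp d q"
  by (rule poly_mapping_eqI) (simp add: lookup_hcomp lookup_add when_add_distrib)

lemma hcomp_minus: "hcomp d (p - q) = hcomp d p - hcomp d q"
  by (rule poly_mapping_eqI) (simp add: lookup_hcomp lookup_minus when_diff_distrib)

lemma hcomp_0 [simp]: "hcomp d 0 = 0"
  by (simp add: hcomp_def)

lemma hcomp_sum: "hcomp d (\<Sum>a\<in>A. f a) = (\<Sum>a\<in>A. hcomp d (f a))"
  by (induction A rule: infinite_finite_induct) (auto simp: hcomp_plus)

lemma hcomp_homogeneous: "hcomp d p \<in> homogeneous d"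
  unfolding homogeneous_iff_lookup by (simp add: lookup_hcomp)

lemma hcomp_same: "p \<in> homogeneous d \<Longrightarrow> hcomp d p = p"
  by (rule poly_mapping_eqI) (simp add: lookup_hcomp homogeneous_iff_lookup when_def)

lemma sum_hcomp:
  assumes "finite D" "mdeg ` Poly_Mapping.keys p \<subseteq> D"
  shows "(\<Sum>d\<in>D. hcomp d p) = p"
proof (rule poly_mapping_eqI)
  fix k
  have "Poly_Mapping.lookup p k = 0" if "mdeg k \<notin> D"
    using assms(2) that by (metis image_subset_iff in_keys_iff)
  thus "Poly_Mapping.lookup (\<Sum>d\<in>D. hcomp d p) k = Poly_Mapping.lookup p k"
    using assms(1) by (auto simp: lookup_sum lookup_hcomp when_def)
qed

text \<open>Only exponents \<open>l\<close> of degree \<open>e\<close> contribute to the product, so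
  the component of degree \<open>d\<close> sees exactly the part of \<open>p\<close> in degree
  \<open>d - e\<close>.\<close>

lemma hcomp_mult:
  assumes q: "q \<in> homogeneous e"
  shows "hcomp d (q * p) = q * hcomp (d - e) p"
proof (rule poly_mapping_eqI)
  fix m
  have "Poly_Mapping.lookup (q * hcomp (d - e) p) m
      = (\<Sum>l. Poly_Mapping.lookup q l * (\<Sum>r. Poly_Mapping.lookup (hcomp (d - e) p) r when m = l + r))"
    by (rule lookup_mult)
  also have "\<dots> = (\<Sum>l. (Poly_Mapping.lookup q l * (\<Sum>r. Poly_Mapping.lookup p r when m = l + r)) when mdeg m = d)"
  proof (rule Sum_any.cong)
    fix l
    show "Poly_Mapping.lookup q l * (\<Sum>r. Poly_Mapping.lookup (hcomp (d - e) p) r when m = l + r)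
      = (Poly_Mapping.lookup q l * (\<Sum>r. Poly_Mapping.lookup p r when m = l + r) when mdeg m = d)"
    proof (cases "Poly_Mapping.lookup q l = 0")
      case False
      hence l: "mdeg l = e" using q unfolding homogeneous_iff_lookup by blast
      have "(\<Sum>r. Poly_Mapping.lookup (hcomp (d - e) p) r when m = l + r)
          = (\<Sum>r. (Poly_Mapping.lookup p r when m = l + r) when mdeg m = d)"
      proof (rule Sum_any.cong)
        fix r
        show "(Poly_Mapping.lookup (hcomp (d - e) p) r when m = l + r) =
          ((Poly_Mapping.lookup p r when m = l + r) when mdeg m = d)"
          using l by (auto simp: when_def lookup_hcomp mdeg_add)
      qed
      also have "\<dots> = ((\<Sum>r. Poly_Mapping.lookup p r when m = l + r) when mdeg m = d)"
        by (auto simp: when_def)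
      finally show ?thesis by (simp add: mult_when)
    qed simp
  qed
  also have "\<dots> = Poly_Mapping.lookup (hcomp d (q * p)) m"
    unfolding lookup_hcomp lookup_mult by (auto simp: when_def)
  finally show "Poly_Mapping.lookup (hcomp d (q * p)) m = Poly_Mapping.lookup (q * hcomp (d - e) p) m" by simp
qed

lemma subspace_homogeneous: "psc.subspace (homogeneous d :: ('v::finite, 'k::field) mpol set)"
  by (rule psc.subspaceI) (auto simp: homogeneous_iff_lookup lookup_add)

lemma homogeneous_mult:
  assumes "p \<in> homogeneous d" "q \<in> homogeneous e"
  shows "p * q \<in> homogeneous (d + e)"
  using hcomp_mult[OF assms(1), of "d + e" q] hcomp_same[OF assms(2)] hcomp_homogeneous[of "d + e" "p * q"]
  by simp

lemma homogeneous_single: "Poly_Mapping.single m c \<in> homogeneous (mdeg m)"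
  unfolding homogeneous_iff_lookup by (auto simp: lookup_single when_def)

lemma homogeneous_Var: "Var v \<in> homogeneous 1"
  using homogeneous_single[of "Poly_Mapping.single v 1" 1] by (simp add: Var_def)

lemma homogeneous_Const: "Const c \<in> homogeneous 0"
  using homogeneous_single[of 0 c] by (simp add: Const_def)

section \<open>Exactness of the Koszul complex of the polynomial ring\<close>

abbreviation vmul :: "'v \<Rightarrow> ('v, 'k::field) mpol \<Rightarrow> ('v, 'k) mpol" where
  "vmul v p \<equiv> Var v * p"

lemma graded_ops_poly:
  "graded_ops (psc :: 'k::field \<Rightarrow> ('v::finite, 'k) mpol \<Rightarrow> _) vmul homogeneous"
proof
  show "Var v * a \<in> homogeneous (d + 1)" if "a \<in> homogeneous d" for v :: 'v and a :: "('v, 'k) mpol" and d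
    using homogeneous_mult[OF homogeneous_Var that, of v] by (simp add: add.commute)
qed (auto simp: distrib_left psc_def mult.left_commute subspace_homogeneous)

interpretation poly: graded_ops "psc :: 'k::field \<Rightarrow> ('v::finite, 'k) mpol \<Rightarrow> _" vmul homogeneous
  by (rule graded_ops_poly)

text \<open>The ideal generated by the variables in \<open>U\<close>, described by its monomials, so
  that cancelling a variable outside \<open>U\<close> is a comparison of coefficients.\<close>

definition vars_ideal :: "'v set \<Rightarrow> ('v, 'k::field) mpol set" where
  "vars_ideal U = {p. \<forall>a\<in>Poly_Mapping.keys p. \<exists>v\<in>U. Poly_Mapping.lookup a v \<noteq> 0}"

lemma vars_ideal_iff:
  "p \<in> vars_ideal U \<longleftrightarrow> (\<forall>a. (\<forall>v\<in>U. Poly_Mapping.lookup a v = 0) \<longrightarrow> Poly_Mapping.lookup p a = 0)"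
  unfolding vars_ideal_def Ball_def in_keys_iff by auto

lemma vars_ideal_0 [simp]: "0 \<in> vars_ideal U"
  by (simp add: vars_ideal_iff)

lemma vars_ideal_add: "p \<in> vars_ideal U \<Longrightarrow> q \<in> vars_ideal U \<Longrightarrow> p + q \<in> vars_ideal U"
  by (simp add: vars_ideal_iff lookup_add)

lemma vars_ideal_uminus: "p \<in> vars_ideal U \<Longrightarrow> - p \<in> vars_ideal U"
  by (simp add: vars_ideal_iff)

lemma Var_mult_vars_ideal: "v \<in> U \<Longrightarrow> Var v * p \<in> vars_ideal U"
  unfolding vars_ideal_iff by (metis lookup_Var_mult_0)

lemma vars_ideal_mono: "U \<subseteq> U' \<Longrightarrow> vars_ideal U \<subseteq> vars_ideal U'"
  unfolding vars_ideal_iff subset_iff by blast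

lemma vars_ideal_cancel:
  assumes "Var v * p \<in> vars_ideal U" "v \<notin> U"
  shows "p \<in> vars_ideal U"
  unfolding vars_ideal_iff
proof (intro allI impI)
  fix a :: "'a \<Rightarrow>\<^sub>0 nat" assume a: "\<forall>u\<in>U. Poly_Mapping.lookup a u = 0"
  hence "\<forall>u\<in>U. Poly_Mapping.lookup (Poly_Mapping.single v 1 + a) u = 0"
    using assms(2) by (auto simp: lookup_add lookup_single when_def)
  hence "Poly_Mapping.lookup (Var v * p) (Poly_Mapping.single v 1 + a) = 0"
    using assms(1) unfolding vars_ideal_iff by blast
  thus "Poly_Mapping.lookup p a = 0" unfolding lookup_Var_mult .
qed

lemma koszul_vars_ideal: "koszul vmul vs c s \<in> vars_ideal (set vs)"
proof (induction vs arbitrary: c s)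
  case (Cons v vs)
  have *: "vars_ideal (set vs) \<subseteq> vars_ideal (set (v # vs))" by (rule vars_ideal_mono) auto
  show ?case
  proof (cases s)
    case (Cons d t)
    have "koszul vmul vs (\<lambda>t. c (d # t)) t \<in> vars_ideal (set (v # vs))" using Cons.IH * by blast
    thus ?thesis unfolding Cons
      by (cases d) (auto intro: vars_ideal_uminus vars_ideal_add Var_mult_vars_ideal)
  qed simp
qed simp

text \<open>The witness collects the monomials of \<open>p\<close> that contain \<open>v\<close>,
  each divided by \<open>v\<close>. The remaining monomials avoid \<open>v\<close> and therefore
  contain a variable of \<open>U\<close>.\<close>

lemma vars_ideal_split:
  assumes "p \<in> vars_ideal (insert v U)" "p \<in> homogeneous d"
  shows "\<exists>q\<in>homogeneous (d - 1). p - Var v * q \<in> vars_ideal U"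
proof -
  let ?A = "{a \<in> Poly_Mapping.keys p. Poly_Mapping.lookup a v \<noteq> 0}"
  define q where "q = (\<Sum>a\<in>?A. Poly_Mapping.single (a - Poly_Mapping.single v 1) (Poly_Mapping.lookup p a))"
  have a: "Poly_Mapping.single v 1 + (a - Poly_Mapping.single v 1) = a" if "Poly_Mapping.lookup a v \<noteq> 0" for a :: "'a \<Rightarrow>\<^sub>0 nat"
    using that by (intro poly_mapping_eqI) (auto simp: lookup_add lookup_minus lookup_single when_def)
  have q: "q \<in> homogeneous (d - 1)"
    unfolding q_def
  proof (rule psc.subspace_sum[OF subspace_homogeneous])
    fix b assume b: "b \<in> ?A"
    have "mdeg (Poly_Mapping.single v 1 + (b - Poly_Mapping.single v 1)) = d"
      using a[of b] b assms(2) unfolding homogeneous_iff by auto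
    hence "mdeg (b - Poly_Mapping.single v 1) = d - 1" unfolding mdeg_add by simp
    thus "Poly_Mapping.single (b - Poly_Mapping.single v 1) (Poly_Mapping.lookup p b) \<in> homogeneous (d - 1)"
      using homogeneous_single[of "b - Poly_Mapping.single v 1" "Poly_Mapping.lookup p b"] by simp
  qed
  have "Var v * q = (\<Sum>a\<in>?A. Poly_Mapping.single a (Poly_Mapping.lookup p a))"
    unfolding q_def Var_def sum_distrib_left mult_single using a by (intro sum.cong) auto
  hence "Poly_Mapping.lookup (p - Var v * q) m = 0" if "Poly_Mapping.lookup m v \<noteq> 0" for m
    using that by (simp add: lookup_minus lookup_sum lookup_single when_def in_keys_iff)
  moreover have "Poly_Mapping.lookup (p - Var v * q) m = Poly_Mapping.lookup p m"
    if "Poly_Mapping.lookup m v = 0" for m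
    using lookup_Var_mult_0[OF that] by (simp add: lookup_minus)
  ultimately have "p - Var v * q \<in> vars_ideal U"
    using assms(1) unfolding vars_ideal_iff by (metis insert_iff)
  thus ?thesis using q by blast
qed

text \<open>Choice for chains: the values at different lists are independent of each other, so they
  can be chosen one by one.\<close>

lemma chain_lift:
  assumes "\<And>s. length s = n \<Longrightarrow> count_list s True = i \<Longrightarrow> \<exists>a\<in>G (j - int i). P s a"
    and "\<And>s. length s \<noteq> n \<or> count_list s True \<noteq> i \<Longrightarrow> P s 0"
  shows "\<exists>c\<in>kchains G n i j. \<forall>s. P s (c s)"
proof -
  have "\<forall>s. \<exists>a. P s a \<and> a \<in> (if length s = n \<and> count_list s True = i then G (j - int i) else {0})"
    using assms by (auto split: if_splits)
  from choice[OF this] obtain c where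
    c: "\<forall>s. P s (c s) \<and> c s \<in> (if length s = n \<and> count_list s True = i then G (j - int i) else {0})"
    by (rule exE)
  hence "c \<in> kchains G n i j" "\<forall>s. P s (c s)" unfolding kchains_def by simp_all
  thus ?thesis by (intro bexI[of _ c])
qed

text \<open>Induction along the mapping cones, using that \<open>v\<close> is a nonzerodivisor
  modulo the other variables. The two parts are proved together, because exactness in degree 1 uses
  the description of the boundaries in degree 0 for the shorter list.\<close>

lemma koszul_poly_exact:
  fixes vs :: "'v::finite list" and c :: "bool list \<Rightarrow> ('v, 'k::field) mpol"
  assumes "distinct vs"
  shows "c \<in> kchains homogeneous (length vs) 0 j \<Longrightarrow> (\<And>s. c s \<in> vars_ideal (set vs)) \<Longrightarrow>
      \<exists>e\<in>kchains homogeneous (length vs) 1 j. koszul vmul vs e = c"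
    and "c \<in> kchains homogeneous (length vs) (Suc i) j \<Longrightarrow> koszul vmul vs c = 0 \<Longrightarrow>
      \<exists>e\<in>kchains homogeneous (length vs) (Suc (Suc i)) j. koszul vmul vs e = c"
  using assms
proof (induction vs arbitrary: c i j)
  case Nil
  {
    case 1
    have "c s = 0" for s
      using 1(2)[of s] unfolding vars_ideal_iff by (auto intro: poly_mapping_eqI)
    hence "koszul vmul [] 0 = c" by (auto simp: fun_eq_iff)
    thus ?case using poly.ch.subspace_0[OF poly.subspace_chains] by (intro bexI[of _ 0]) auto
  next
    case 2
    have "c s = 0" for s using chains_D2[OF 2(1), of s] by (cases s) auto
    hence "koszul vmul [] 0 = c" by (auto simp: fun_eq_iff)
    thus ?case using poly.ch.subspace_0[OF poly.subspace_chains] by (intro bexI[of _ 0]) auto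
  }
next
  case (Cons v vs)
  {
    case 1
    let ?c0 = "\<lambda>t. c (False # t)"
    have c: "c [] = 0" "?c0 \<in> kchains homogeneous (length vs) 0 j" "\<And>t. c (True # t) = 0"
      using 1(1) unfolding length_Cons poly.chains_Suc_iff by auto
    have "\<exists>q\<in>kchains homogeneous (length vs) 0 (j - 1). \<forall>s. ?c0 s - Var v * q s \<in> vars_ideal (set vs)"
    proof (rule chain_lift)
      show "\<exists>a\<in>homogeneous (j - 1 - int 0). ?c0 s - Var v * a \<in> vars_ideal (set vs)"
        if "length s = length vs" "count_list s True = 0" for s
        using vars_ideal_split[of "?c0 s" v "set vs" j] 1(2)[of "False # s"] chains_D1[OF c(2) that] by simp
      show "?c0 s - Var v * 0 \<in> vars_ideal (set vs)" if "length s \<noteq> length vs \<or> count_list s True \<noteq> 0" for s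
        using chains_D2[OF c(2) that] by simp
    qed
    then obtain q where q: "q \<in> kchains homogeneous (length vs) 0 (j - 1)"
      "\<And>s. ?c0 s - Var v * q s \<in> vars_ideal (set vs)" by blast
    have "(\<lambda>t. Var v * q t) \<in> kchains homogeneous (length vs) 0 j"
      using poly.X_chains[OF q(1)] by simp
    hence "?c0 - (\<lambda>t. Var v * q t) \<in> kchains homogeneous (length vs) 0 j"
      by (rule poly.ch.subspace_diff[OF poly.subspace_chains c(2)])
    hence "\<exists>e0\<in>kchains homogeneous (length vs) 1 j. koszul vmul vs e0 = ?c0 - (\<lambda>t. Var v * q t)"
    proof (rule Cons.IH(1))
      show "(?c0 - (\<lambda>t. Var v * q t)) s \<in> vars_ideal (set vs)" for s using q(2)[of s] by simp
      show "distinct vs" using 1(3) by simp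
    qed
    then obtain e0 where e0: "e0 \<in> kchains homogeneous (length vs) 1 j"
      "koszul vmul vs e0 = ?c0 - (\<lambda>t. Var v * q t)" by blast
    let ?e = "\<lambda>s. case s of [] \<Rightarrow> 0 | d # t \<Rightarrow> if d then q t else e0 t"
    have "?e \<in> kchains homogeneous (length (v # vs)) 1 j"
      using e0(1) q(1) unfolding length_Cons poly.chains_Suc_iff by simp
    moreover have "koszul vmul (v # vs) ?e = c"
    proof
      fix s show "koszul vmul (v # vs) ?e s = c s"
      proof (cases s)
        case Nil thus ?thesis using c(1) by simp
      next
        case (Cons d t)
        thus ?thesis using poly.koszul_chains_0[OF q(1), of t] c(3)[of t] fun_cong[OF e0(2), of t]
          by (cases d) auto
      qed
    qed
    ultimately show ?case by blast
  next
    case 2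
    let ?c0 = "\<lambda>t. c (False # t)" and ?c1 = "\<lambda>t. c (True # t)"
    have dv: "distinct vs" "v \<notin> set vs" using 2(3) by auto
    have c: "c [] = 0" "?c0 \<in> kchains homogeneous (length vs) (Suc i) j"
      "?c1 \<in> kchains homogeneous (length vs) i (j - 1)"
      using 2(1) unfolding length_Cons poly.chains_Suc_iff by auto
    have k0: "koszul vmul vs ?c0 t + Var v * ?c1 t = 0" for t
      using fun_cong[OF 2(2), of "False # t"] by simp
    have k1: "koszul vmul vs ?c1 t = 0" for t
      using fun_cong[OF 2(2), of "True # t"] by simp
    \<comment> \<open>The \<open>True\<close> half of \<open>c\<close> is a cycle of the shorter
      complex. For \<open>i = 0\<close> it must be shown to lie in the ideal of the other variables,
      which holds because its product with \<open>Var v\<close> does.\<close>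
    have "\<exists>e1\<in>kchains homogeneous (length vs) (Suc i) (j - 1). koszul vmul vs e1 = ?c1"
    proof (cases i)
      case 0
      have "?c1 t \<in> vars_ideal (set vs)" for t
      proof (rule vars_ideal_cancel)
        have "Var v * ?c1 t = - koszul vmul vs ?c0 t" using k0[of t] by (simp add: eq_neg_iff_add_eq_0 add.commute)
        thus "Var v * ?c1 t \<in> vars_ideal (set vs)" using koszul_vars_ideal vars_ideal_uminus by metis
        show "v \<notin> set vs" by (rule dv(2))
      qed
      thus ?thesis using Cons.IH(1)[OF c(3)[unfolded 0] _ dv(1)] unfolding 0 One_nat_def by blast
    next
      case (Suc i')
      have "koszul vmul vs ?c1 = 0" by (rule ext) (simp add: k1)
      thus ?thesis using Cons.IH(2)[OF c(3)[unfolded Suc] _ dv(1)] unfolding Suc by blast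
    qed
    then obtain e1 where e1: "e1 \<in> kchains homogeneous (length vs) (Suc i) (j - 1)" "koszul vmul vs e1 = ?c1" by blast
    have x: "(\<lambda>t. Var v * e1 t) \<in> kchains homogeneous (length vs) (Suc i) j"
      using poly.X_chains[OF e1(1)] by simp
    let ?d = "\<lambda>t. ?c0 t + Var v * e1 t"
    have d: "?d \<in> kchains homogeneous (length vs) (Suc i) j"
      using poly.ch.subspace_add[OF poly.subspace_chains c(2) x] by (simp add: plus_fun_def)
    have "koszul vmul vs ?d t = 0" for t
      using k0[of t] unfolding poly.koszul_plus poly.X_koszul[symmetric] e1(2) .
    hence d0: "koszul vmul vs ?d = 0" by (intro ext) simp
    then obtain e0 where e0: "e0 \<in> kchains homogeneous (length vs) (Suc (Suc i)) j" "koszul vmul vs e0 = ?d"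
      using Cons.IH(2)[OF d d0 dv(1)] by blast
    \<comment> \<open>The minus sign compensates the sign of the differential on the
      \<open>True\<close> half and makes \<open>Var v * e1\<close> cancel on the
      \<open>False\<close> half.\<close>
    let ?e = "\<lambda>s. case s of [] \<Rightarrow> 0 | d # t \<Rightarrow> if d then - e1 t else e0 t"
    have "(\<lambda>t. - e1 t) \<in> kchains homogeneous (length vs) (Suc i) (j - 1)"
      using poly.ch.subspace_neg[OF poly.subspace_chains e1(1)] by (simp add: fun_Compl_def)
    hence "?e \<in> kchains homogeneous (length (v # vs)) (Suc (Suc i)) j"
      using e0(1) unfolding length_Cons poly.chains_Suc_iff by simp
    moreover have "koszul vmul (v # vs) ?e = c"
    proof
      fix s show "koszul vmul (v # vs) ?e s = c s"
      proof (cases s)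
        case Nil thus ?thesis using c(1) by simp
      next
        case (Cons d t)
        thus ?thesis using fun_cong[OF e1(2), of t] fun_cong[OF e0(2), of t]
          by (cases d) (auto simp: poly.koszul_uminus)
      qed
    qed
    ultimately show ?case by blast
  }
qed

section \<open>Koszul homology of quotients of the polynomial ring\<close>

lemma sum_fun_apply: "(\<Sum>a\<in>A. F a) s = (\<Sum>a\<in>A. F a s :: 'm::comm_monoid_add)"
  by (induction A rule: infinite_finite_induct) auto

lemma wedge_map:
  assumes "\<And>a b. f (a + b) = f a + (f b :: 'm::ab_group_add)"
  shows "wedge v vs (\<lambda>s. f (c s)) s = f (wedge v vs (c :: bool list \<Rightarrow> 'n::ab_group_add) s)"
proof -
  have 0: "f 0 = 0" using assms(1)[of 0 0] by simp
  have m: "f (- a) = - f a" for a using assms(1)[of a "- a"] 0 by (simp add: eq_neg_iff_add_eq_0 add.commute)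
  show ?thesis
  proof (induction vs arbitrary: c s)
    case (Cons u us)
    show ?case
    proof (cases s)
      case (Cons d t)
      show ?thesis
        using Cons.IH[of "\<lambda>t. c (d # t)" t] unfolding Cons
        by (cases d) (simp_all add: assms 0 m)
    qed (simp add: 0)
  qed (simp add: 0)
qed

context graded_ops
begin

lemma wedge_stable:
  assumes "stable J" "\<And>s. c s \<in> J"
  shows "wedge v vs c s \<in> J"
  using assms(2)
proof (induction vs arbitrary: c s)
  case Nil
  show ?case using assms(1) subspace_0 unfolding stable_def by simp
next
  case (Cons u us)
  have J: "subspace J" using assms(1) unfolding stable_def by auto
  show ?case
  proof (cases s)
    case Nil
    thus ?thesis using subspace_0 J by simp
  next
    case (Cons d t)
    have "wedge v us (\<lambda>t. c (d # t)) t \<in> J" using Cons.IH Cons.prems by simp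
    thus ?thesis
      using Cons J Cons.prems subspace_0[OF J] by (cases d) (simp_all add: subspace_neg)
  qed
qed

lemma wedge_koszul_chains:
  assumes "c \<in> kchains G (length vs) i j"
  shows "wedge v vs (koszul X vs c) \<in> kchains G (length vs) i (j + 1)"
proof (cases i)
  case 0
  have "koszul X vs c = (\<lambda>s. 0)"
    by (rule ext) (rule koszul_chains_0[OF assms[unfolded 0]])
  hence "wedge v vs (koszul X vs c) = (\<lambda>s. 0)" by (intro ext) (simp add: wedge_0)
  thus ?thesis by (auto intro: chains_I)
next
  case (Suc i')
  show ?thesis using wedge_chains[OF koszul_chains[OF assms[unfolded Suc]]] unfolding Suc .
qed

lemma wedge_homotopy_fun:
  assumes c: "c \<in> kchains G (length vs) i j" and v: "v \<in> set vs"
  shows "koszul X vs (wedge v vs c) + wedge v vs (koszul X vs c) = (\<lambda>s. X v (c s))"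
proof
  fix s
  show "(koszul X vs (wedge v vs c) + wedge v vs (koszul X vs c)) s = X v (c s)"
  proof (cases "length s = length vs")
    case True
    thus ?thesis using wedge_homotopy[OF v True, of c] by simp
  next
    case False
    thus ?thesis
      using chains_D2[OF koszul_chains[OF wedge_chains[OF c]], of s] chains_D2[OF c, of s]
        chains_D2[OF wedge_koszul_chains[OF c], of s]
      by simp
  qed
qed

end

section \<open>Homogeneous ideals and the Koszul homology of their quotients\<close>

definition hideal :: "('v::finite, 'k::field) mpol set \<Rightarrow> bool" where
  "hideal J \<longleftrightarrow> 0 \<in> J \<and> (\<forall>p\<in>J. \<forall>q\<in>J. p + q \<in> J) \<and> (\<forall>p\<in>J. \<forall>q. q * p \<in> J) \<and> (\<forall>p\<in>J. \<forall>d. hcomp d p \<in> J)"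

lemma hidealD:
  assumes "hideal J"
  shows "0 \<in> J" "p \<in> J \<Longrightarrow> q \<in> J \<Longrightarrow> p + q \<in> J" "p \<in> J \<Longrightarrow> q * p \<in> J" "p \<in> J \<Longrightarrow> hcomp d p \<in> J"
    "p \<in> J \<Longrightarrow> p * q \<in> J" "p \<in> J \<Longrightarrow> - p \<in> J" "p \<in> J \<Longrightarrow> q \<in> J \<Longrightarrow> p - q \<in> J"
proof -
  show m: "p \<in> J \<Longrightarrow> q * p \<in> J" for p q using assms unfolding hideal_def by auto
  show a: "p \<in> J \<Longrightarrow> q \<in> J \<Longrightarrow> p + q \<in> J" for p q using assms unfolding hideal_def by auto
  show "p \<in> J \<Longrightarrow> p * q \<in> J" using m[of p q] by (simp add: mult.commute)
  show n: "p \<in> J \<Longrightarrow> - p \<in> J" for p using m[of p "- 1"] by simp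
  show "p \<in> J \<Longrightarrow> q \<in> J \<Longrightarrow> p - q \<in> J" using a[of p "- q"] n[of q] by simp
qed (use assms in \<open>auto simp: hideal_def\<close>)

lemma hideal_subspace: "hideal J \<Longrightarrow> psc.subspace J"
  by (rule psc.subspaceI) (auto simp: hidealD psc_def)

lemma hideal_stable: "hideal J \<Longrightarrow> poly.stable J"
  unfolding poly.stable_def by (simp add: hideal_subspace hidealD)

text \<open>The value \<open>h\<close> is the dimension of the part of internal degree
  \<open>j\<close> of Tor in homological degree \<open>i\<close> of \<open>Q / J\<close> and the
  residue field, computed from the Koszul resolution of the latter.\<close>

definition kbetti :: "'v::finite list \<Rightarrow> ('v, 'k::field) mpol set \<Rightarrow> nat \<Rightarrow> int \<Rightarrow> nat \<Rightarrow> bool" where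
  "kbetti vs J i j h \<longleftrightarrow>
     has_qdim (pw psc) (koszul_cycles vmul homogeneous J vs i j) (koszul_bounds vmul homogeneous J vs i j) h"

definition ideal_plus :: "('v::finite, 'k::field) mpol set \<Rightarrow> ('v, 'k) mpol \<Rightarrow> ('v, 'k) mpol set" where
  "ideal_plus J f = {a + f * b | a b. a \<in> J}"

lemma hideal_plus:
  assumes J: "hideal J" and f: "f \<in> homogeneous e"
  shows "hideal (ideal_plus J f)"
  unfolding hideal_def
proof (intro conjI ballI allI)
  show "0 \<in> ideal_plus J f" unfolding ideal_plus_def using hidealD(1)[OF J] by (auto intro!: exI[of _ 0])
next
  fix p q assume "p \<in> ideal_plus J f" "q \<in> ideal_plus J f"
  then obtain a b a' b' where "a \<in> J" "p = a + f * b" "a' \<in> J" "q = a' + f * b'"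
    unfolding ideal_plus_def by auto
  hence "p + q = (a + a') + f * (b + b')" "a + a' \<in> J" using hidealD(2)[OF J] by (auto simp: algebra_simps)
  thus "p + q \<in> ideal_plus J f" unfolding ideal_plus_def by auto
next
  fix p q assume "p \<in> ideal_plus J f"
  then obtain a b where "a \<in> J" "p = a + f * b" unfolding ideal_plus_def by auto
  hence "q * p = q * a + f * (q * b)" "q * a \<in> J" using hidealD(3)[OF J] by (auto simp: algebra_simps)
  thus "q * p \<in> ideal_plus J f" unfolding ideal_plus_def by auto
next
  fix p d assume "p \<in> ideal_plus J f"
  then obtain a b where "a \<in> J" "p = a + f * b" unfolding ideal_plus_def by auto
  hence "hcomp d p = hcomp d a + f * hcomp (d - e) b" "hcomp d a \<in> J"
    using hidealD(4)[OF J] hcomp_mult[OF f] by (auto simp: hcomp_plus)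
  thus "hcomp d p \<in> ideal_plus J f" unfolding ideal_plus_def by auto
qed

text \<open>Taking components of degree \<open>d\<close> in any representation of \<open>y\<close>
  makes the multiplier of \<open>f\<close> homogeneous.\<close>

lemma ideal_plus_homogeneous:
  assumes J: "hideal J" and f: "f \<in> homogeneous e" and y: "y \<in> ideal_plus J f" "y \<in> homogeneous d"
  shows "\<exists>b\<in>homogeneous (d - e). y - f * b \<in> J"
proof -
  obtain a b where "a \<in> J" "y = a + f * b" using y(1) unfolding ideal_plus_def by auto
  hence "hcomp d a + f * hcomp (d - e) b = y" "hcomp d a \<in> J"
    using hcomp_same[OF y(2)] hcomp_mult[OF f, of d b] hidealD(4)[OF J] by (auto simp: hcomp_plus)
  hence "y - f * hcomp (d - e) b = hcomp d a" "hcomp d a \<in> J" by (auto simp: algebra_simps)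
  thus ?thesis using hcomp_homogeneous by metis
qed

lemma ideal_plus_mem: "hideal J \<Longrightarrow> a \<in> J \<Longrightarrow> a \<in> ideal_plus J f" "hideal J \<Longrightarrow> f * b \<in> ideal_plus J f"
proof -
  show "a \<in> ideal_plus J f" if "a \<in> J"
  proof -
    have "a = a + f * 0" by simp
    thus ?thesis using that unfolding ideal_plus_def by blast
  qed
  show "f * b \<in> ideal_plus J f" if "hideal J" using hidealD(1)[OF that] unfolding ideal_plus_def by force
qed

lemma mult_chains:
  assumes f: "f \<in> homogeneous e" and c: "c \<in> kchains homogeneous n i j"
  shows "(\<lambda>s. f * c s) \<in> kchains homogeneous n i (j + e)"
proof (rule chains_I)
  fix s assume "length s = n" "count_list s True = i"
  from homogeneous_mult[OF f chains_D1[OF c this]]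
  show "f * c s \<in> homogeneous (j + e - int i)" by (simp add: algebra_simps)
qed (use chains_D2[OF c] in auto)

lemma koszul_mult: "koszul vmul vs (\<lambda>s. f * c s) = (\<lambda>s. f * koszul vmul vs c s)"
  by (rule ext) (rule koszul_map, simp_all add: algebra_simps)

lemma chains_ideal_plus:
  assumes J: "hideal J" and f: "f \<in> homogeneous e"
    and c: "c \<in> kchains homogeneous n i j" "\<And>s. c s \<in> ideal_plus J f"
  shows "\<exists>b\<in>kchains homogeneous n i (j - e). \<forall>s. c s - f * b s \<in> J"
proof (rule chain_lift)
  show "\<exists>a\<in>homogeneous (j - e - int i). c s - f * a \<in> J"
    if "length s = n" "count_list s True = i" for s
    using ideal_plus_homogeneous[OF J f c(2) chains_D1[OF c(1) that]] by (simp add: algebra_simps)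
  show "c s - f * 0 \<in> J" if "length s \<noteq> n \<or> count_list s True \<noteq> i" for s
    using chains_D2[OF c(1) that] hidealD(1)[OF J] by simp
qed

text \<open>The quadric is given by a presentation as a sum of products \<open>Var v * g v\<close>,
  and the homotopy is built from this presentation. It is used with a single nonzero
  \<open>g w = Var w\<close> and with all \<open>g v\<close> equal to \<open>sigma\<close>.\<close>

locale quadric =
  fixes g :: "'v::finite \<Rightarrow> ('v, 'k::field) mpol" and vs :: "'v list"
  assumes g_linear: "g v \<in> homogeneous 1" and set_vs: "set vs = UNIV"
begin

definition f :: "('v, 'k) mpol" where
  "f = (\<Sum>v\<in>UNIV. Var v * g v)"

definition htpy :: "(bool list \<Rightarrow> ('v, 'k) mpol) \<Rightarrow> bool list \<Rightarrow> ('v, 'k) mpol" where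
  "htpy c = (\<lambda>s. \<Sum>v\<in>UNIV. g v * wedge v vs c s)"

lemma f_homogeneous: "f \<in> homogeneous 2"
  unfolding f_def
  by (intro psc.subspace_sum[OF subspace_homogeneous]) (use homogeneous_mult[OF homogeneous_Var g_linear] in simp)

lemma htpy_plus: "htpy (a + b) = htpy a + htpy b"
  unfolding htpy_def
  by (rule ext) (simp add: plus_fun_def poly.wedge_plus distrib_left sum.distrib)

lemma htpy_mult: "htpy (\<lambda>s. q * c s) = (\<lambda>s. q * htpy c s)"
proof -
  have "wedge v vs (\<lambda>s. q * c s) s = q * wedge v vs c s" for v s
    by (rule wedge_map) (rule distrib_left)
  thus ?thesis unfolding htpy_def by (simp add: sum_distrib_left mult.left_commute)
qed

lemma htpy_zero: "htpy 0 = 0"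
  using htpy_plus[of 0 0] by simp

lemma htpy_pw: "htpy (pw psc c a) = pw psc c (htpy a)"
  using htpy_mult[of "Const c" a] by (simp add: pw_def psc_def)

lemma linear_htpy: "Vector_Spaces.linear (pw psc) (pw psc) htpy"
  by (simp add: Vector_Spaces.linear_iff poly.ch.vector_space_axioms htpy_plus htpy_pw)

lemma htpy_ideal:
  assumes "hideal J" "\<And>s. c s \<in> J"
  shows "htpy c s \<in> J"
  unfolding htpy_def
  by (intro psc.subspace_sum[OF hideal_subspace[OF assms(1)]] hidealD(3)[OF assms(1)]
        poly.wedge_stable[OF hideal_stable[OF assms(1)] assms(2)])

lemma htpy_chains:
  assumes "c \<in> kchains homogeneous (length vs) i j"
  shows "htpy c \<in> kchains homogeneous (length vs) (Suc i) (j + 2)"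
proof -
  have "htpy c = (\<Sum>v\<in>UNIV. (\<lambda>s. g v * wedge v vs c s))"
    by (rule ext) (simp add: htpy_def sum_fun_apply)
  also have "\<dots> \<in> kchains homogeneous (length vs) (Suc i) (j + 2)"
    using mult_chains[OF g_linear poly.wedge_chains[OF assms]]
    by (intro poly.ch.subspace_sum[OF poly.subspace_chains]) (simp add: add.commute)
  finally show ?thesis .
qed

lemma htpy:
  assumes c: "c \<in> kchains homogeneous (length vs) i j"
  shows "koszul vmul vs (htpy c) + htpy (koszul vmul vs c) = (\<lambda>s. f * c s)"
proof -
  have "koszul vmul vs (htpy c) = (\<Sum>v\<in>UNIV. (\<lambda>s. g v * koszul vmul vs (wedge v vs c) s))"
  proof -
    have "htpy c = (\<Sum>v\<in>UNIV. (\<lambda>s. g v * wedge v vs c s))"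
      by (rule ext) (simp add: htpy_def sum_fun_apply)
    thus ?thesis by (simp add: poly.kz.sum koszul_mult)
  qed
  hence "koszul vmul vs (htpy c) + htpy (koszul vmul vs c)
      = (\<lambda>s. \<Sum>v\<in>UNIV. g v * (koszul vmul vs (wedge v vs c) + wedge v vs (koszul vmul vs c)) s)"
    by (intro ext) (simp add: htpy_def sum_fun_apply sum.distrib distrib_left)
  also have "\<dots> = (\<lambda>s. \<Sum>v\<in>UNIV. g v * (Var v * c s))"
  proof -
    have "koszul vmul vs (wedge v vs c) + wedge v vs (koszul vmul vs c) = (\<lambda>s. Var v * c s)" for v
      using poly.wedge_homotopy_fun[OF c] set_vs by blast
    thus ?thesis by simp
  qed
  also have "\<dots> = (\<lambda>s. f * c s)"
    unfolding f_def sum_distrib_right by (intro ext sum.cong refl) (simp add: mult_ac)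
  finally show ?thesis .
qed

text \<open>In homological degree 0 every multiple of \<open>f\<close> is already a boundary, namely
  that of \<open>htpy b\<close>, so adding \<open>f\<close> to the ideal changes nothing.\<close>

lemma kbetti_quotient_0:
  assumes J: "hideal J" and a: "kbetti vs J 0 j a"
  shows "kbetti vs (ideal_plus J f) 0 j a"
proof -
  let ?J' = "ideal_plus J f"
  have cyc: "koszul_cycles vmul homogeneous I vs 0 j = kchains homogeneous (length vs) 0 j"
    if "hideal I" for I :: "('v, 'k) mpol set"
    using hidealD(1)[OF that] unfolding koszul_cycles_def by (auto simp: poly.koszul_chains_0[of _ vs j])
  have "koszul_bounds vmul homogeneous ?J' vs 0 j = koszul_bounds vmul homogeneous J vs 0 j"
  proof
    show "koszul_bounds vmul homogeneous J vs 0 j \<subseteq> koszul_bounds vmul homogeneous ?J' vs 0 j"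
      unfolding koszul_bounds_def using ideal_plus_mem(1)[OF J] by blast
    show "koszul_bounds vmul homogeneous ?J' vs 0 j \<subseteq> koszul_bounds vmul homogeneous J vs 0 j"
    proof
      fix x assume "x \<in> koszul_bounds vmul homogeneous ?J' vs 0 j"
      then obtain e c where x: "e \<in> kchains homogeneous (length vs) (Suc 0) j"
        "c \<in> kchains homogeneous (length vs) 0 j" "\<And>s. c s \<in> ?J'" "x = koszul vmul vs e + c"
        using poly.koszul_boundsD by metis
      obtain b where b: "b \<in> kchains homogeneous (length vs) 0 (j - 2)" "\<And>s. c s - f * b s \<in> J"
        using chains_ideal_plus[OF J f_homogeneous x(2,3)] by blast
      have "koszul vmul vs b = 0" by (rule ext) (simp add: poly.koszul_chains_0[OF b(1)])
      hence fb: "koszul vmul vs (htpy b) = (\<lambda>s. f * b s)"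
        using htpy[OF b(1)] by (simp add: htpy_zero)
      have "c - (\<lambda>s. f * b s) \<in> kchains homogeneous (length vs) 0 j"
        using mult_chains[OF f_homogeneous b(1)] by (intro poly.ch.subspace_diff[OF poly.subspace_chains x(2)]) simp
      moreover have "e + htpy b \<in> kchains homogeneous (length vs) (Suc 0) j"
        using htpy_chains[OF b(1)] by (intro poly.ch.subspace_add[OF poly.subspace_chains x(1)]) simp
      moreover have "(c - (\<lambda>s. f * b s)) s \<in> J" for s using b(2)[of s] by simp
      ultimately have "koszul vmul vs (e + htpy b) + (c - (\<lambda>s. f * b s)) \<in> koszul_bounds vmul homogeneous J vs 0 j"
        by (intro poly.koszul_boundsI)
      thus "x \<in> koszul_bounds vmul homogeneous J vs 0 j"
        unfolding x(4) poly.koszul_fun_plus fb by (simp add: algebra_simps)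
    qed
  qed
  thus ?thesis using a cyc[OF J] cyc[OF hideal_plus[OF J f_homogeneous]] unfolding kbetti_def by simp
qed

text \<open>
  If \<open>f\<close> is a nonzerodivisor on \<open>Q / J\<close> in the two degrees that matter, the long exact sequence of
  \<open>0 \<rightarrow> Q/J (-2) \<rightarrow> Q/J \<rightarrow> Q/(J,f) \<rightarrow> 0\<close> splits, because \<open>f\<close> acts null-homotopically.
\<close>

lemma kbetti_quotient_Suc:
  assumes J: "hideal J"
    and inj1: "\<And>u. u \<in> homogeneous (j - int i - 1) \<Longrightarrow> f * u \<in> J \<Longrightarrow> u \<in> J"
    and inj2: "\<And>u. u \<in> homogeneous (j - int i - 2) \<Longrightarrow> f * u \<in> J \<Longrightarrow> u \<in> J"
    and a: "kbetti vs J (Suc i) j a" and b: "kbetti vs J i (j - 2) b"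
  shows "kbetti vs (ideal_plus J f) (Suc i) j (a + b)"
proof -
  let ?K = "koszul vmul vs" and ?J' = "ideal_plus J f"
  let ?C = "\<lambda>i j. kchains homogeneous (length vs) i j :: (bool list \<Rightarrow> ('v, 'k) mpol) set"
  define Z where "Z = koszul_cycles vmul homogeneous J vs (Suc i) j"
  define B where "B = koszul_bounds vmul homogeneous J vs (Suc i) j"
  define Z' where "Z' = koszul_cycles vmul homogeneous ?J' vs (Suc i) j"
  define B' where "B' = koszul_bounds vmul homogeneous ?J' vs (Suc i) j"
  \<comment> \<open>\<open>U / B'\<close> is the image of the homology of \<open>Q / J\<close>, and
    \<open>Z' / U\<close> is its cokernel, which the connecting map identifies with the homology of
    \<open>Q / J\<close> in degree \<open>i\<close>.\<close>
  define U where "U = {z + y | z y. z \<in> Z \<and> y \<in> B'}"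
  have J': "hideal ?J'" by (rule hideal_plus[OF J f_homogeneous])
  note st = hideal_stable[OF J] and st' = hideal_stable[OF J']
  have sZ: "poly.ch.subspace Z" unfolding Z_def by (rule poly.subspace_cycles[OF st])
  have sZ': "poly.ch.subspace Z'" unfolding Z'_def by (rule poly.subspace_cycles[OF st'])
  have sB': "poly.ch.subspace B'" unfolding B'_def by (rule poly.subspace_bounds[OF st'])
  have sU: "poly.ch.subspace U" unfolding U_def by (rule poly.ch.subspace_sums[OF sZ sB'])
  have JJ': "x \<in> ?J'" if "x \<in> J" for x using ideal_plus_mem(1)[OF J that] .
  have BB': "B \<subseteq> B'" unfolding B_def B'_def koszul_bounds_def using JJ' by blast
  have BZ: "B' \<subseteq> Z'" unfolding B'_def Z'_def by (rule poly.bounds_subset_cycles[OF st'])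
  have ZZ': "Z \<subseteq> Z'" unfolding Z_def Z'_def koszul_cycles_def using JJ' by blast
  have BU: "B' \<subseteq> U"
  proof
    fix y assume "y \<in> B'"
    moreover have "y = 0 + y" by simp
    ultimately show "y \<in> U" unfolding U_def using poly.ch.subspace_0[OF sZ] by blast
  qed
  have ZU: "Z \<subseteq> U"
  proof
    fix z assume "z \<in> Z"
    moreover have "z = z + 0" by simp
    ultimately show "z \<in> U" unfolding U_def using poly.ch.subspace_0[OF sB'] by blast
  qed
  have UZ: "U \<subseteq> Z'" unfolding U_def using ZZ' BZ poly.ch.subspace_add[OF sZ'] by blast
  have degs: "j - 2 - int i = j - int i - 2" "j - 1 - int i = j - int i - 1" by auto
  have B'_D: "\<exists>e g b. e \<in> ?C (Suc (Suc i)) j \<and> g \<in> ?C (Suc i) j \<and> b \<in> ?C (Suc i) (j - 2) \<and> (\<forall>s. g s \<in> J)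
      \<and> y = ?K e + g + (\<lambda>s. f * b s)" if yB: "y \<in> B'" for y
  proof -
    obtain e c where x: "e \<in> ?C (Suc (Suc i)) j" "c \<in> ?C (Suc i) j" "\<And>s. c s \<in> ?J'" "y = ?K e + c"
      using poly.koszul_boundsD[OF yB[unfolded B'_def]] by metis
    obtain b where b: "b \<in> ?C (Suc i) (j - 2)" "\<And>s. c s - f * b s \<in> J"
      using chains_ideal_plus[OF J f_homogeneous x(2,3)] by blast
    have "c - (\<lambda>s. f * b s) \<in> ?C (Suc i) j"
      using mult_chains[OF f_homogeneous b(1)] by (intro poly.ch.subspace_diff[OF poly.subspace_chains x(2)]) simp
    thus ?thesis using x b
      by (intro exI[of _ e] exI[of _ "c - (\<lambda>s. f * b s)"] exI[of _ b]) (simp add: algebra_simps)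
  qed
  have range: "x s \<in> homogeneous (j - int i - 2)" if "x \<in> ?C i (j - 2)" for x s
    using poly.chains_range[OF that, of s] degs by simp
  have Krange: "?K x s \<in> homogeneous (j - int i - 1)" if "x \<in> ?C i (j - 2)" for x s
    using poly.koszul_range[OF that, of s] degs by simp
  have f_chain: "(\<lambda>s. f * x s) \<in> ?C i j" if "x \<in> ?C i (j - 2)" for x i
    using mult_chains[OF f_homogeneous that] by simp
  have h_chain: "htpy x \<in> ?C (Suc i) j" if "x \<in> ?C i (j - 2)" for x i
    using htpy_chains[OF that] by simp
  note cadd = poly.ch.subspace_add[OF poly.subspace_chains] and cdiff = poly.ch.subspace_diff[OF poly.subspace_chains]
    and cneg = poly.ch.subspace_neg[OF poly.subspace_chains]
  note Jadd = hidealD(2)[OF J] and Jdiff = hidealD(7)[OF J]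
  have K_htpy: "?K (htpy x) = (\<lambda>s. f * x s) - htpy (?K x)" if "x \<in> ?C i (j - 2)" for x i
    using htpy[OF that] by (simp add: eq_diff_eq)
  \<comment> \<open>The map from the homology of \<open>Q / J\<close> is injective: if
    \<open>z\<close> is a boundary modulo \<open>(J, f)\<close>, then \<open>inj2\<close> puts
    \<open>?K b\<close> into \<open>J\<close>, and the homotopy writes \<open>f * b\<close> as a
    boundary plus a chain with values in \<open>J\<close>.\<close>
  have 1: "has_qdim (pw psc) U B' a"
  proof -
    have "has_qdim (pw psc) U B' a \<longleftrightarrow> has_qdim (pw psc) Z B a"
    proof (rule has_qdim_image[where f = "\<lambda>x. x"])
      show "Vector_Spaces.linear (pw psc) (pw psc) (\<lambda>x. x :: bool list \<Rightarrow> ('v, 'k) mpol)"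
        by (simp add: Vector_Spaces.linear_iff poly.ch.vector_space_axioms)
      show "\<exists>z\<in>Z. u - z \<in> B'" if "u \<in> U" for u using that unfolding U_def by force
      show "z \<in> B' \<longleftrightarrow> z \<in> B" if z: "z \<in> Z" for z
      proof
        assume "z \<in> B'"
        then obtain e g b where y: "e \<in> ?C (Suc (Suc i)) j" "g \<in> ?C (Suc i) j" "b \<in> ?C (Suc i) (j - 2)"
          "\<And>s. g s \<in> J" "z = ?K e + g + (\<lambda>s. f * b s)" using B'_D by metis
        have Kb: "?K b \<in> ?C i (j - 2)" using poly.koszul_chains[OF y(3)] .
        have KbJ: "?K b s \<in> J" for s
        proof (rule inj2[OF range[OF Kb]])
          have "f * ?K b s = ?K z s - ?K g s"
            unfolding y(5) by (simp add: poly.koszul_fun_plus koszul_mult)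
          moreover have "?K z s \<in> J" using z unfolding Z_def koszul_cycles_def by auto
          moreover have "?K g s \<in> J" by (rule poly.koszul_stable[OF st y(4)])
          ultimately show "f * ?K b s \<in> J" using Jdiff by simp
        qed
        have "?K (e + htpy b) + (g + htpy (?K b)) \<in> B"
          unfolding B_def
          using htpy_ideal[OF J KbJ] y(4) Jadd
          by (intro poly.koszul_boundsI cadd y h_chain Kb) auto
        moreover have "z = ?K (e + htpy b) + (g + htpy (?K b))"
          unfolding y(5) poly.koszul_fun_plus K_htpy[OF y(3)] by simp
        ultimately show "z \<in> B" by simp
      qed (use BB' in blast)
    qed (use sB' sZ ZU in auto)
    thus ?thesis using a unfolding kbetti_def Z_def B_def by simp
  qed
  \<comment> \<open>Here \<open>htpy\<close> inverts the connecting map: for a cycle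
    \<open>c\<close> modulo \<open>J\<close> the differential of \<open>htpy c\<close> is
    \<open>f * c\<close> up to \<open>J\<close>. So \<open>htpy c\<close> is a cycle modulo
    \<open>(J, f)\<close>, and its connecting image is \<open>c\<close>.\<close>
  have 2: "has_qdim (pw psc) Z' U b"
  proof -
    let ?V = "koszul_cycles vmul homogeneous J vs i (j - 2)"
    let ?W = "koszul_bounds vmul homogeneous J vs i (j - 2)"
    have "has_qdim (pw psc) Z' U b \<longleftrightarrow> has_qdim (pw psc) ?V ?W b"
    proof (rule has_qdim_image[OF linear_htpy sU])
      show "poly.ch.subspace ?V" by (rule poly.subspace_cycles[OF st])
    next
      fix c assume c: "c \<in> ?V"
      have cC: "c \<in> ?C i (j - 2)" and cJ: "\<And>s. ?K c s \<in> J" using c by (auto simp: koszul_cycles_def)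
      have hK: "htpy (?K c) s \<in> J" for s by (rule htpy_ideal[OF J cJ])
      have "?K (htpy c) s \<in> ?J'" for s
        unfolding K_htpy[OF cC] using hidealD(7)[OF J' ideal_plus_mem(2)[OF J] JJ'[OF hK]] by simp
      thus "htpy c \<in> Z'" unfolding Z'_def koszul_cycles_def using h_chain[OF cC] by simp
      show "htpy c \<in> U \<longleftrightarrow> c \<in> ?W"
      proof
        assume "c \<in> ?W"
        then obtain e g where x: "e \<in> ?C (Suc i) (j - 2)" "g \<in> ?C i (j - 2)" "\<And>s. g s \<in> J" "c = ?K e + g"
          using poly.koszul_boundsD by metis
        have "?K (- htpy e) + ((\<lambda>s. f * e s) + htpy g) \<in> B'"
          unfolding B'_def
          using hidealD(2)[OF J' ideal_plus_mem(2)[OF J] JJ'[OF htpy_ideal[OF J x(3)]]]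
          by (intro poly.koszul_boundsI cadd cneg f_chain h_chain x) auto
        moreover have "htpy c = ?K (- htpy e) + ((\<lambda>s. f * e s) + htpy g)"
          unfolding x(4) htpy_plus poly.kz.neg K_htpy[OF x(1)] by simp
        ultimately show "htpy c \<in> U" using BU by auto
      next
        assume "htpy c \<in> U"
        then obtain z y where zy: "z \<in> Z" "y \<in> B'" "htpy c = z + y" unfolding U_def by blast
        obtain e g b where y: "e \<in> ?C (Suc (Suc i)) j" "g \<in> ?C (Suc i) j" "b \<in> ?C (Suc i) (j - 2)"
          "\<And>s. g s \<in> J" "y = ?K e + g + (\<lambda>s. f * b s)" using B'_D[OF zy(2)] by metis
        have d: "c - ?K b \<in> ?C i (j - 2)" using cdiff[OF cC poly.koszul_chains[OF y(3)]] .
        have "?K (htpy c) s = ?K z s + (?K g s + f * ?K b s)" for s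
          unfolding zy(3) y(5) by (simp add: poly.koszul_fun_plus koszul_mult)
        moreover have "?K (htpy c) s = f * c s - htpy (?K c) s" for s unfolding K_htpy[OF cC] by simp
        moreover have "f * (c - ?K b) s = f * c s - f * ?K b s" for s by (simp add: right_diff_distrib)
        ultimately have eq: "f * (c - ?K b) s = htpy (?K c) s + ?K z s + ?K g s" for s
          by (simp add: eq_diff_eq diff_eq_eq add_ac)
        have "(c - ?K b) s \<in> J" for s
        proof (rule inj2[OF range[OF d]])
          have "?K z s \<in> J" using zy(1) unfolding Z_def koszul_cycles_def by auto
          moreover have "?K g s \<in> J" by (rule poly.koszul_stable[OF st y(4)])
          ultimately show "f * (c - ?K b) s \<in> J" unfolding eq using hK Jadd by blast
        qed
        from poly.koszul_boundsI[OF y(3) d this] show "c \<in> ?W"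
          unfolding add.commute[of "?K b"] diff_add_cancel .
      qed
    next
      fix c assume "c \<in> Z'"
      hence c: "c \<in> ?C (Suc i) j" "\<And>s. ?K c s \<in> ?J'" unfolding Z'_def koszul_cycles_def by auto
      obtain b where b: "b \<in> ?C i (j - 2)" "\<And>s. ?K c s - f * b s \<in> J"
        using chains_ideal_plus[OF J f_homogeneous poly.koszul_chains[OF c(1)] c(2)] by blast
      \<comment> \<open>\<open>inj1\<close> serves one degree above \<open>inj2\<close>: the values
        of \<open>b\<close> have degree \<open>j - i - 2\<close>, those of \<open>?K b\<close>
        degree \<open>j - i - 1\<close>.\<close>
      have KbJ: "?K b s \<in> J" for s
      proof (rule inj1[OF Krange[OF b(1)]])
        have "?K (?K c - (\<lambda>s. f * b s)) s \<in> J"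
          using b(2) by (intro poly.koszul_stable[OF st]) simp
        hence "- (f * ?K b s) \<in> J" unfolding poly.kz.diff koszul_mult by simp
        thus "f * ?K b s \<in> J" using hidealD(6)[OF J] by fastforce
      qed
      have "?K (c - htpy b) s \<in> J" for s
      proof -
        have "?K (c - htpy b) s = (?K c s - f * b s) + htpy (?K b) s"
          unfolding poly.kz.diff K_htpy[OF b(1)] by simp
        moreover have "htpy (?K b) s \<in> J" by (rule htpy_ideal[OF J KbJ])
        ultimately show ?thesis using Jadd[OF b(2)] by simp
      qed
      hence "c - htpy b \<in> Z" unfolding Z_def koszul_cycles_def using cdiff[OF c(1) h_chain[OF b(1)]] by simp
      moreover have "b \<in> ?V" using b KbJ unfolding koszul_cycles_def by simp
      ultimately show "\<exists>v\<in>?V. c - htpy v \<in> U" using ZU by (intro bexI[of _ b]) auto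
    qed
    thus ?thesis using b unfolding kbetti_def by simp
  qed
  show ?thesis
    using poly.ch.has_qdim_trans[OF sB' sU BU UZ 1 2] unfolding kbetti_def Z'_def B'_def .
qed

end

text \<open>In the relevant degree a cycle \<open>c\<close> equals \<open>Var v * b\<close> modulo
  \<open>J\<close>. As \<open>Var v\<close> is a nonzerodivisor, \<open>b\<close> is again a cycle,
  and multiplication by a variable is zero on Koszul homology.\<close>

lemma kbetti_vanish:
  assumes J: "hideal J" and v: "v \<in> set vs"
    and inj: "\<And>u. Var v * u \<in> J \<Longrightarrow> u \<in> J"
    and gen: "\<And>u. u \<in> homogeneous (j - int i) \<Longrightarrow> \<exists>u'\<in>homogeneous (j - int i - 1). u - Var v * u' \<in> J"
  shows "kbetti vs J i j 0"
proof -
  let ?K = "koszul vmul vs"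
  note st = hideal_stable[OF J]
  have "koszul_cycles vmul homogeneous J vs i j \<subseteq> koszul_bounds vmul homogeneous J vs i j"
  proof
    fix c assume "c \<in> koszul_cycles vmul homogeneous J vs i j"
    hence c: "c \<in> kchains homogeneous (length vs) i j" "\<And>s. ?K c s \<in> J" by (auto simp: koszul_cycles_def)
    have "\<exists>b\<in>kchains homogeneous (length vs) i (j - 1). \<forall>s. c s - Var v * b s \<in> J"
    proof (rule chain_lift)
      show "\<exists>a\<in>homogeneous (j - 1 - int i). c s - Var v * a \<in> J"
        if "length s = length vs" "count_list s True = i" for s
        using gen[OF chains_D1[OF c(1) that]] by (simp add: algebra_simps)
      show "c s - Var v * 0 \<in> J" if "length s \<noteq> length vs \<or> count_list s True \<noteq> i" for s
        using chains_D2[OF c(1) that] hidealD(1)[OF J] by simp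
    qed
    then obtain b where b: "b \<in> kchains homogeneous (length vs) i (j - 1)" "\<And>s. c s - Var v * b s \<in> J" by blast
    let ?g = "\<lambda>s. c s - Var v * b s"
    have KbJ: "?K b s \<in> J" for s
    proof (rule inj)
      have "?K (c - (\<lambda>s. Var v * b s)) s \<in> J"
        using b(2) by (intro poly.koszul_stable[OF st]) simp
      hence "?K c s - Var v * ?K b s \<in> J" unfolding poly.kz.diff koszul_mult by simp
      from hidealD(7)[OF J c(2)[of s] this] show "Var v * ?K b s \<in> J" by simp
    qed
    have w: "wedge v vs (?K b) s \<in> J" for s by (rule poly.wedge_stable[OF st KbJ])
    have h: "?K (wedge v vs b) + wedge v vs (?K b) = (\<lambda>s. Var v * b s)"
      by (rule poly.wedge_homotopy_fun[OF b(1) v])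
    have "(\<lambda>s. Var v * b s) \<in> kchains homogeneous (length vs) i j"
      using poly.X_chains[OF b(1)] by simp
    hence gC: "c - (\<lambda>s. Var v * b s) \<in> kchains homogeneous (length vs) i j"
      by (rule poly.ch.subspace_diff[OF poly.subspace_chains c(1)])
    have wC: "wedge v vs b \<in> kchains homogeneous (length vs) (Suc i) j"
      "wedge v vs (?K b) \<in> kchains homogeneous (length vs) i j"
      using poly.wedge_chains[OF b(1)] poly.wedge_koszul_chains[OF b(1)] by auto
    have "?K (wedge v vs b) + (wedge v vs (?K b) + (c - (\<lambda>s. Var v * b s)))
        \<in> koszul_bounds vmul homogeneous J vs i j"
      using hidealD(2)[OF J w b(2)]
      by (intro poly.koszul_boundsI wC poly.ch.subspace_add[OF poly.subspace_chains wC(2) gC]) simp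
    moreover have "?K (wedge v vs b) + (wedge v vs (?K b) + (c - (\<lambda>s. Var v * b s))) = c"
      unfolding add.assoc[symmetric] h by simp
    ultimately show "c \<in> koszul_bounds vmul homogeneous J vs i j" by simp
  qed
  thus ?thesis unfolding kbetti_def by (rule poly.ch.has_qdim_self[OF poly.subspace_bounds[OF st]])
qed

section \<open>Euler characteristics\<close>

lemma has_qdim_chains:
  assumes G: "graded_ops sc X G" and G': "graded_ops sc X G'" and sub: "\<And>d. G' d \<subseteq> G d"
    and t: "\<And>d. has_qdim sc (G d) (G' d) (t d)"
  shows "has_qdim (pw sc) (kchains G n i j) (kchains G' n i j) ((n choose i) * t (j - int i))"
proof -
  interpret G: graded_ops sc X G by fact
  interpret G': graded_ops sc X G' by fact
  have mono: "kchains G' n i j \<subseteq> kchains G n i j" for n i j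
  proof
    fix c assume c: "c \<in> kchains G' n i j"
    show "c \<in> kchains G n i j"
      using chains_D1[OF c] chains_D2[OF c] sub by (intro chains_I) blast+
  qed
  show ?thesis
  proof (induction n arbitrary: i j)
    case 0
    show ?case
    proof (cases i)
      case (Suc i')
      have "kchains G 0 i j \<subseteq> kchains G' 0 i j"
      proof
        fix c assume c: "c \<in> kchains G 0 i j"
        have "c s = 0" for s using chains_D2[OF c[unfolded Suc], of s] by (cases s) auto
        thus "c \<in> kchains G' 0 i j" by (intro chains_I) auto
      qed
      moreover have "(0 choose i) * t (j - int i) = 0" using Suc by simp
      ultimately show ?thesis using G.ch.has_qdim_self[OF G'.subspace_chains] Suc by metis
    next
      case i0: 0
      have mem: "c \<in> kchains H 0 0 j \<longleftrightarrow> c [] \<in> H j \<and> (\<forall>s. c (False # s) = 0) \<and> (\<forall>s. c (True # s) = 0)"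
        for c and H :: "int \<Rightarrow> 'b set"
        unfolding kchains_def mem_Collect_eq all_bool_list[of "\<lambda>s. c s \<in> _ s"] by simp
      have "has_qdim sc (G j) (G' j) (t j) \<longleftrightarrow> has_qdim (pw sc) (kchains G 0 0 j) (kchains G' 0 0 j) (t j)"
      proof (rule has_qdim_image[where f = "\<lambda>c. c []"])
        show "Vector_Spaces.linear (pw sc) sc (\<lambda>c. c [])"
          by (simp add: Vector_Spaces.linear_iff G.ch.vector_space_axioms G.vector_space_axioms)
        show "\<exists>v\<in>kchains G 0 0 j. a - v [] \<in> G' j" if "a \<in> G j" for a
          using that mem[of _ G] by (intro bexI[of _ "\<lambda>s. if s = [] then a else 0"]) auto
      qed (use mem[of _ G] mem[of _ G'] G'.G_subspace G.subspace_chains in auto)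
      hence "has_qdim (pw sc) (kchains G 0 0 j) (kchains G' 0 0 j) ((0 choose 0) * t (j - int 0))"
        using t[of j] by simp
      thus ?thesis unfolding i0 .
    qed
  next
    case (Suc n)
    \<comment> \<open>The intermediate space realizes Pascal's rule: all chains modulo
      \<open>V\<close> see only the \<open>False\<close> half, and \<open>V\<close> modulo the
      chains of \<open>G'\<close> sees only the \<open>True\<close> half.\<close>
    define V where "V = {c \<in> kchains G (Suc n) i j. (\<lambda>t. c (False # t)) \<in> kchains G' n i j}"
    have sV: "G.ch.subspace V"
      unfolding V_def using G.subspace_chains[of "Suc n" i j] G'.subspace_chains[of n i j]
      by (auto simp: G.ch.subspace_def zero_fun_def plus_fun_def pw_def)
    have WV: "kchains G' (Suc n) i j \<subseteq> V"
      unfolding V_def using mono G'.chains_Suc_iff[of _ n i j] by auto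
    have "has_qdim (pw sc) (kchains G n i j) (kchains G' n i j) ((n choose i) * t (j - int i))
      \<longleftrightarrow> has_qdim (pw sc) (kchains G (Suc n) i j) V ((n choose i) * t (j - int i))"
    proof (rule has_qdim_image[where f = "\<lambda>c t. c (False # t)"])
      show "Vector_Spaces.linear (pw sc) (pw sc) (\<lambda>c t. c (False # t))"
        by (simp add: Vector_Spaces.linear_iff G.ch.vector_space_axioms fun_eq_iff)
      show "\<exists>v\<in>kchains G (Suc n) i j. a - (\<lambda>t. v (False # t)) \<in> kchains G' n i j"
        if "a \<in> kchains G n i j" for a
      proof -
        let ?v = "\<lambda>s. case s of [] \<Rightarrow> 0 | b # t \<Rightarrow> if b then 0 else a t"
        have z: "(\<lambda>t. 0) \<in> kchains G n i' j'" for i' j' by (rule chains_I) auto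
        have "?v \<in> kchains G (Suc n) i j"
          unfolding G.chains_Suc_iff using that z by (auto split: nat.split)
        moreover have "a - (\<lambda>t. ?v (False # t)) = 0" by (simp add: fun_eq_iff)
        hence "a - (\<lambda>t. ?v (False # t)) \<in> kchains G' n i j"
          using G.ch.subspace_0[OF G'.subspace_chains] by metis
        ultimately show ?thesis by blast
      qed
    qed (auto simp: V_def G.chains_Suc_iff G'.subspace_chains G.subspace_chains)
    hence 1: "has_qdim (pw sc) (kchains G (Suc n) i j) V ((n choose i) * t (j - int i))"
      using Suc.IH by blast
    have 2: "has_qdim (pw sc) V (kchains G' (Suc n) i j)
        (case i of 0 \<Rightarrow> 0 | Suc i' \<Rightarrow> (n choose i') * t (j - int i))"
    proof (cases i)
      case 0
      have "V \<subseteq> kchains G' (Suc n) i j"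
        unfolding V_def 0 by (auto simp: G.chains_Suc_iff G'.chains_Suc_iff)
      thus ?thesis using G.ch.has_qdim_self[OF G'.subspace_chains] 0 by simp
    next
      case i: (Suc i')
      have "has_qdim (pw sc) (kchains G n i' (j - 1)) (kchains G' n i' (j - 1)) ((n choose i') * t (j - 1 - int i'))
        \<longleftrightarrow> has_qdim (pw sc) V (kchains G' (Suc n) i j) ((n choose i') * t (j - 1 - int i'))"
      proof (rule has_qdim_image[where f = "\<lambda>c t. c (True # t)"])
        show "G.ch.subspace V" by (rule sV)
        show "Vector_Spaces.linear (pw sc) (pw sc) (\<lambda>c t. c (True # t))"
          by (simp add: Vector_Spaces.linear_iff G.ch.vector_space_axioms fun_eq_iff)
        show "\<exists>v\<in>V. a - (\<lambda>t. v (True # t)) \<in> kchains G' n i' (j - 1)"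
          if "a \<in> kchains G n i' (j - 1)" for a
        proof -
          let ?v = "\<lambda>s. case s of [] \<Rightarrow> 0 | b # t \<Rightarrow> if b then a t else 0"
          have z: "(\<lambda>t. 0) \<in> kchains G n i j" "(\<lambda>t. 0) \<in> kchains G' n i j" by (auto intro: chains_I)
          have "?v \<in> V"
            unfolding V_def G.chains_Suc_iff using that z i by auto
          moreover have "a - (\<lambda>t. ?v (True # t)) = 0" by (simp add: fun_eq_iff)
          hence "a - (\<lambda>t. ?v (True # t)) \<in> kchains G' n i' (j - 1)"
            using G.ch.subspace_0[OF G'.subspace_chains] by metis
          ultimately show ?thesis by blast
        qed
      qed (auto simp: V_def G.chains_Suc_iff G'.chains_Suc_iff G'.subspace_chains i)
      from this Suc.IH[of i' "j - 1"]
      have "has_qdim (pw sc) V (kchains G' (Suc n) i j) ((n choose i') * t (j - 1 - int i'))"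
        by (rule iffD1)
      thus ?thesis using i by (simp add: algebra_simps)
    qed
    have "(case i of 0 \<Rightarrow> 0 | Suc i' \<Rightarrow> (n choose i') * t (j - int i)) + (n choose i) * t (j - int i)
      = (Suc n choose i) * t (j - int i)"
      by (cases i) (simp_all add: algebra_simps)
    moreover have "V \<subseteq> kchains G (Suc n) i j" by (auto simp: V_def)
    ultimately show ?case
      using G.ch.has_qdim_trans[OF G'.subspace_chains sV WV _ 2 1] by metis
  qed
qed

text \<open>For fixed internal degree \<open>j\<close> the complex of \<open>Q / J\<close> is finite
  dimensional and vanishes above \<open>length vs\<close>, so the alternating sums of its homology
  and of its terms agree.\<close>

lemma kbetti_euler:
  fixes J :: "('v::finite, 'k::field) mpol set"
  assumes J: "hideal J" and t: "\<And>d. has_qdim psc (homogeneous d) (homogeneous d \<inter> J) (t d)"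
  obtains h where "\<And>i. kbetti vs J i j (h i)" "\<And>i. i > length vs \<Longrightarrow> h i = 0"
    "(\<Sum>i\<le>length vs. (- 1) ^ i * int (h i)) = (\<Sum>i\<le>length vs. (- 1) ^ i * int ((length vs choose i) * t (j - int i)))"
proof -
  let ?n = "length vs" and ?K = "koszul vmul vs"
  note st = hideal_stable[OF J]
  define C :: "nat \<Rightarrow> (bool list \<Rightarrow> ('v, 'k) mpol) set" where "C i = kchains homogeneous ?n i j" for i
  define CJ where "CJ i = kchains (\<lambda>d. homogeneous d \<inter> J) ?n i j" for i
  define Z where "Z i = koszul_cycles vmul homogeneous J vs i j" for i
  define B where "B i = koszul_bounds vmul homogeneous J vs i j" for i
  define k where "k i = (?n choose i) * t (j - int i)" for i
  interpret GJ: graded_ops psc vmul "\<lambda>d. homogeneous d \<inter> J" by (rule poly.graded_ops_Int[OF st])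
  have sC: "poly.ch.subspace (C i)" for i unfolding C_def by (rule poly.subspace_chains)
  have sCJ: "poly.ch.subspace (CJ i)" for i unfolding CJ_def by (rule GJ.subspace_chains)
  have sZ: "poly.ch.subspace (Z i)" for i unfolding Z_def by (rule poly.subspace_cycles[OF st])
  have sB: "poly.ch.subspace (B i)" for i unfolding B_def by (rule poly.subspace_bounds[OF st])
  have CJ_iff: "c \<in> CJ i \<longleftrightarrow> c \<in> C i \<and> (\<forall>s. c s \<in> J)" for c i
    unfolding CJ_def C_def by (rule poly.chains_Int_iff[OF st])
  have CJB: "CJ i \<subseteq> B i" for i
  proof
    fix c assume "c \<in> CJ i"
    hence "?K 0 + c \<in> B i" unfolding B_def CJ_iff C_def
      by (intro poly.koszul_boundsI poly.ch.subspace_0[OF poly.subspace_chains]) auto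
    thus "c \<in> B i" by simp
  qed
  have BZ: "B i \<subseteq> Z i" for i unfolding B_def Z_def by (rule poly.bounds_subset_cycles[OF st])
  have ZC: "Z i \<subseteq> C i" for i unfolding Z_def C_def koszul_cycles_def by auto
  have k: "has_qdim (pw psc) (C i) (CJ i) (k i)" for i
    unfolding C_def CJ_def k_def
    by (rule has_qdim_chains[OF poly.graded_ops_axioms GJ.graded_ops_axioms _ t]) auto
  \<comment> \<open>The three numbers are the dimensions of the boundaries, of the homology and of
    the chains modulo cycles. The differential gives \<open>z (Suc i) = b i\<close>, so the
    alternating sum telescopes.\<close>
  have "\<exists>b h z. has_qdim (pw psc) (B i) (CJ i) b \<and> has_qdim (pw psc) (Z i) (B i) h \<and>
      has_qdim (pw psc) (C i) (Z i) z \<and> b + h + z = k i" for i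
  proof -
    obtain b x where 1: "has_qdim (pw psc) (B i) (CJ i) b" "has_qdim (pw psc) (C i) (B i) x" "b + x = k i"
      using poly.ch.has_qdim_split[OF sCJ sB sC CJB subset_trans[OF BZ ZC] k] by blast
    obtain h z where 2: "has_qdim (pw psc) (Z i) (B i) h" "has_qdim (pw psc) (C i) (Z i) z" "h + z = x"
      using poly.ch.has_qdim_split[OF sB sZ sC BZ ZC 1(2)] by blast
    show ?thesis using 1 2 by (intro exI[of _ b] exI[of _ h] exI[of _ z]) auto
  qed
  then obtain b h z where bhz: "\<And>i. has_qdim (pw psc) (B i) (CJ i) (b i)" "\<And>i. has_qdim (pw psc) (Z i) (B i) (h i)"
      "\<And>i. has_qdim (pw psc) (C i) (Z i) (z i)" "\<And>i. b i + h i + z i = k i"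
    by metis
  have z0: "z 0 = 0"
  proof -
    have "C 0 \<subseteq> Z 0" unfolding C_def Z_def koszul_cycles_def
      using hidealD(1)[OF J] by (auto simp: poly.koszul_chains_0[of _ vs j])
    from poly.ch.has_qdim_unique'[OF sZ bhz(3)[of 0] poly.ch.has_qdim_self[OF sZ this]] show ?thesis .
  qed
  have zS: "z (Suc i) = b i" for i
  proof -
    have "has_qdim (pw psc) (B i) (CJ i) (b i) \<longleftrightarrow> has_qdim (pw psc) (C (Suc i)) (Z (Suc i)) (b i)"
    proof (rule has_qdim_image[OF poly.linear_koszul sCJ _ sC])
      show "?K c \<in> B i" if "c \<in> C (Suc i)" for c
        using poly.koszul_boundsI[OF that[unfolded C_def] poly.ch.subspace_0[OF poly.subspace_chains], of J]
          hidealD(1)[OF J] unfolding B_def by simp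
      show "?K c \<in> CJ i \<longleftrightarrow> c \<in> Z (Suc i)" if "c \<in> C (Suc i)" for c
        using that poly.koszul_chains[of c vs i j] unfolding CJ_iff Z_def C_def koszul_cycles_def by auto
      show "\<exists>v\<in>C (Suc i). y - ?K v \<in> CJ i" if "y \<in> B i" for y
        using poly.koszul_boundsD[OF that[unfolded B_def]] unfolding CJ_iff C_def by force
    qed
    with bhz(1)[of i] poly.ch.has_qdim_unique'[OF sZ bhz(3)[of "Suc i"]] show ?thesis by simp
  qed
  have kn: "k i = 0" if "i > ?n" for i using that by (simp add: k_def binomial_eq_0)
  have hn: "h i = 0" if "i > ?n" for i using bhz(4)[of i] kn[OF that] by simp
  have bn: "b ?n = 0" using zS[of ?n] bhz(4)[of "Suc ?n"] kn[of "Suc ?n"] by simp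
  have "(\<Sum>i\<le>N. (- 1) ^ i * int (k i)) = (\<Sum>i\<le>N. (- 1) ^ i * int (h i)) + (- 1) ^ N * int (b N)" for N
  proof (induction N)
    case 0
    show ?case using bhz(4)[of 0] z0 by simp
  next
    case (Suc N)
    have "int (k (Suc N)) = int (b (Suc N)) + int (h (Suc N)) + int (b N)"
      using bhz(4)[of "Suc N"] zS[of N] by simp
    thus ?case using Suc by (simp add: algebra_simps)
  qed
  from this[of ?n] have "(\<Sum>i\<le>?n. (- 1) ^ i * int (h i)) = (\<Sum>i\<le>?n. (- 1) ^ i * int (k i))"
    using bn by simp
  moreover have "kbetti vs J i j (h i)" for i using bhz(2)[of i] unfolding kbetti_def Z_def B_def .
  ultimately show thesis using that hn unfolding k_def by blast
qed

section \<open>Squares of the variables\<close>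

text \<open>The ideal generated by the squares of the variables in \<open>U\<close>. In terms of
  monomials it is clear that the square of a variable outside \<open>U\<close> is a nonzerodivisor
  modulo it.\<close>

definition sq_ideal :: "'v set \<Rightarrow> ('v, 'k::field) mpol set" where
  "sq_ideal U = {p. \<forall>a. (\<forall>v\<in>U. Poly_Mapping.lookup a v < 2) \<longrightarrow> Poly_Mapping.lookup p a = 0}"

lemma sq_ideal_iff:
  "p \<in> sq_ideal U \<longleftrightarrow> (\<forall>a. (\<forall>v\<in>U. Poly_Mapping.lookup a v < 2) \<longrightarrow> Poly_Mapping.lookup p a = 0)"
  by (simp add: sq_ideal_def)

lemma sq_ideal_mult:
  assumes "p \<in> sq_ideal U"
  shows "q * p \<in> sq_ideal U"
  unfolding sq_ideal_iff
proof (intro allI impI)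
  fix a :: "'a \<Rightarrow>\<^sub>0 nat" assume a: "\<forall>v\<in>U. Poly_Mapping.lookup a v < 2"
  show "Poly_Mapping.lookup (q * p) a = 0"
  proof (rule ccontr)
    assume "Poly_Mapping.lookup (q * p) a \<noteq> 0"
    hence "a \<in> Poly_Mapping.keys (q * p)" by (simp add: in_keys_iff)
    then obtain b c where bc: "a = b + c" "c \<in> Poly_Mapping.keys p"
      using keys_mult[of q p] by blast
    have "\<forall>v\<in>U. Poly_Mapping.lookup c v < 2"
      using a unfolding bc(1) lookup_add by fastforce
    hence "Poly_Mapping.lookup p c = 0" using assms unfolding sq_ideal_iff by blast
    thus False using bc(2) by (simp add: in_keys_iff)
  qed
qed

lemma hideal_sq: "hideal (sq_ideal U)"
  unfolding hideal_def
  by (auto simp: sq_ideal_mult) (auto simp: sq_ideal_iff lookup_add lookup_hcomp when_def)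

lemma Var_sq: "Var v * Var v = (Poly_Mapping.single (Poly_Mapping.single v (2::nat)) 1 :: ('v, 'k::field) mpol)"
  unfolding Var_def mult_single single_add[symmetric] by (simp add: numeral_2_eq_2)

lemma lookup_sq_mult:
  "Poly_Mapping.lookup (Var v * Var v * p) (Poly_Mapping.single v 2 + b) = Poly_Mapping.lookup p b"
  unfolding Var_sq using lookup_single_mult[of "Poly_Mapping.single v 2" 1 p b] by simp

lemma lookup_sq_mult_0:
  assumes "Poly_Mapping.lookup m v < 2"
  shows "Poly_Mapping.lookup (Var v * Var v * p) m = 0"
proof -
  have "m \<noteq> Poly_Mapping.single v 2 + b" for b
    using assms by (auto simp: lookup_add)
  thus ?thesis unfolding Var_sq using lookup_single_mult_0[of m "Poly_Mapping.single v 2" 1 p] by simp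
qed

lemma sq_mult_cancel:
  assumes "Var v * Var v * p \<in> sq_ideal U" "v \<notin> U"
  shows "p \<in> sq_ideal U"
  unfolding sq_ideal_iff
proof (intro allI impI)
  fix a :: "'a \<Rightarrow>\<^sub>0 nat" assume a: "\<forall>u\<in>U. Poly_Mapping.lookup a u < 2"
  hence "\<forall>u\<in>U. Poly_Mapping.lookup (Poly_Mapping.single v 2 + a) u < 2"
    using assms(2) by (auto simp: lookup_add lookup_single when_def)
  hence "Poly_Mapping.lookup (Var v * Var v * p) (Poly_Mapping.single v 2 + a) = 0"
    using assms(1) unfolding sq_ideal_iff by blast
  thus "Poly_Mapping.lookup p a = 0" unfolding lookup_sq_mult .
qed

lemma sq_ideal_insert: "sq_ideal (insert v U) = ideal_plus (sq_ideal U) (Var v * Var v)"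
proof
  show "ideal_plus (sq_ideal U) (Var v * Var v) \<subseteq> sq_ideal (insert v U)"
    unfolding ideal_plus_def by (auto simp: sq_ideal_iff lookup_add lookup_sq_mult_0)
next
  show "sq_ideal (insert v U) \<subseteq> ideal_plus (sq_ideal U) (Var v * Var v :: ('a, 'b) mpol)"
  proof
    fix p :: "('a, 'b) mpol" assume p: "p \<in> sq_ideal (insert v U)"
    let ?A = "{a \<in> Poly_Mapping.keys p. 2 \<le> Poly_Mapping.lookup a v}"
    define q where "q = (\<Sum>a\<in>?A. Poly_Mapping.single (a - Poly_Mapping.single v 2) (Poly_Mapping.lookup p a))"
    have a: "Poly_Mapping.single v 2 + (a - Poly_Mapping.single v 2) = a" if "2 \<le> Poly_Mapping.lookup a v" for a :: "'a \<Rightarrow>\<^sub>0 nat"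
      using that by (intro poly_mapping_eqI) (auto simp: lookup_add lookup_minus lookup_single when_def)
    have eq: "Var v * Var v * q = (\<Sum>a\<in>?A. Poly_Mapping.single a (Poly_Mapping.lookup p a))"
      unfolding q_def Var_sq sum_distrib_left mult_single using a by (intro sum.cong) auto
    have "Poly_Mapping.lookup (p - Var v * Var v * q) m = 0" if "2 \<le> Poly_Mapping.lookup m v" for m
      unfolding eq using that by (simp add: lookup_minus lookup_sum lookup_single when_def in_keys_iff)
    moreover have "Poly_Mapping.lookup (p - Var v * Var v * q) m = Poly_Mapping.lookup p m"
      if "Poly_Mapping.lookup m v < 2" for m
      using lookup_sq_mult_0[OF that] by (simp add: lookup_minus)
    ultimately have "p - Var v * Var v * q \<in> sq_ideal U"
      using p unfolding sq_ideal_iff by (metis insert_iff not_le)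
    moreover have "p = (p - Var v * Var v * q) + Var v * Var v * q" by simp
    ultimately show "p \<in> ideal_plus (sq_ideal U) (Var v * Var v)" unfolding ideal_plus_def by blast
  qed
qed

lemma quadric_single:
  assumes "set vs = (UNIV :: 'v::finite set)"
  shows "quadric (\<lambda>u. if u = v then Var v else (0 :: ('v, 'k::field) mpol)) vs"
  using assms homogeneous_Var poly.zero_G by unfold_locales auto

lemma quadric_single_f:
  assumes "set vs = (UNIV :: 'v::finite set)"
  shows "quadric.f (\<lambda>u. if u = v then Var v else (0 :: ('v, 'k::field) mpol)) = Var v * Var v"
  unfolding quadric.f_def[OF quadric_single[OF assms]] by (simp add: if_distrib cong: if_cong)

text \<open>The Koszul complex of \<open>Q\<close> resolves the residue field. In degree 0 the class
  of a chain is the constant coefficient of its value at the all-\<open>False\<close> list.\<close>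

lemma kbetti_zero_ideal:
  fixes vs :: "'v::finite list"
  assumes vs: "distinct vs" "set vs = UNIV"
  shows "kbetti vs ({0} :: ('v, 'k::field) mpol set) i j (if i = 0 \<and> j = 0 then 1 else 0)"
proof (cases i)
  case (Suc i')
  have "koszul_cycles vmul homogeneous {0} vs (Suc i') j \<subseteq>
      (koszul_bounds vmul homogeneous {0} vs (Suc i') j :: (bool list \<Rightarrow> ('v, 'k) mpol) set)"
    unfolding poly.koszul_bounds_0
  proof
    fix c :: "bool list \<Rightarrow> ('v, 'k) mpol" assume "c \<in> koszul_cycles vmul homogeneous {0} vs (Suc i') j"
    hence "c \<in> kchains homogeneous (length vs) (Suc i') j" "koszul vmul vs c = 0"
      by (auto simp: koszul_cycles_def fun_eq_iff)
    from koszul_poly_exact(2)[OF vs(1) this]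
    show "c \<in> koszul vmul vs ` kchains homogeneous (length vs) (Suc (Suc i')) j" by blast
  qed
  from poly.ch.has_qdim_self[OF poly.subspace_bounds[OF poly.stable_0] this]
  show ?thesis using Suc unfolding kbetti_def by simp
next
  case i: 0
  let ?C = "kchains homogeneous (length vs) 0 j :: (bool list \<Rightarrow> ('v, 'k) mpol) set"
  let ?z = "replicate (length vs) False"
  have cyc: "koszul_cycles vmul homogeneous {0} vs 0 j = ?C"
    unfolding koszul_cycles_def by (auto simp: poly.koszul_chains_0[of _ vs j])
  have bnd: "c \<in> koszul_bounds vmul homogeneous {0} vs 0 j \<longleftrightarrow> Poly_Mapping.lookup (c ?z) 0 = 0" if c: "c \<in> ?C" for c
  proof
    assume "c \<in> koszul_bounds vmul homogeneous {0} vs 0 j"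
    then obtain e where "c = koszul vmul vs e" unfolding poly.koszul_bounds_0 by blast
    hence "c ?z \<in> vars_ideal UNIV" using koszul_vars_ideal[of vs e ?z] vs by simp
    thus "Poly_Mapping.lookup (c ?z) 0 = 0" unfolding vars_ideal_iff by simp
  next
    assume z: "Poly_Mapping.lookup (c ?z) 0 = 0"
    have "c s \<in> vars_ideal (set vs)" for s
    proof (cases "s = ?z")
      case True
      thus ?thesis using z unfolding vars_ideal_iff vs(2)
        by (metis (full_types) UNIV_I lookup_zero poly_mapping_eqI)
    next
      case False
      hence "length s \<noteq> length vs \<or> count_list s True \<noteq> 0"
        by (metis (full_types) count_list_0_iff replicate_eqI)
      from chains_D2[OF c this] show ?thesis by simp
    qed
    from koszul_poly_exact(1)[OF vs(1) c this]
    show "c \<in> koszul_bounds vmul homogeneous {0} vs 0 j" unfolding poly.koszul_bounds_0 by auto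
  qed
  show ?thesis
  proof (cases "j = 0")
    case False
    have "?C \<subseteq> koszul_bounds vmul homogeneous {0} vs 0 j"
    proof
      fix c assume c: "c \<in> ?C"
      have "c ?z \<in> homogeneous j" using poly.chains_range[OF c] by simp
      hence "Poly_Mapping.lookup (c ?z) 0 = 0" using False unfolding homogeneous_iff_lookup by simp
      thus "c \<in> koszul_bounds vmul homogeneous {0} vs 0 j" using bnd[OF c] by simp
    qed
    from poly.ch.has_qdim_self[OF poly.subspace_bounds[OF poly.stable_0] this]
    show ?thesis using False unfolding kbetti_def i cyc by simp
  next
    case j: True
    interpret k: kspace "(*) :: 'k \<Rightarrow> _" by standard (auto simp: algebra_simps)
    have "has_qdim (*) (UNIV :: 'k set) {0} 1"
      unfolding has_qdim_def k.quotient_basis_iff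
    proof (intro exI[of _ "{1}"] conjI ballI)
      show "k.indep_mod {0} {1}"
        unfolding k.indep_mod_def by (auto simp: subset_singleton_iff)
      show "\<exists>u\<in>k.span {1}. v - u \<in> {0}" for v :: 'k
        using k.span_scale[OF k.span_base[of 1 "{1}"], of v] by (intro bexI[of _ v]) auto
    qed auto
    moreover have "has_qdim (*) (UNIV :: 'k set) {0} 1 \<longleftrightarrow>
        has_qdim (pw psc) ?C (koszul_bounds vmul homogeneous {0} vs 0 j) 1"
    proof (rule has_qdim_image[where f = "\<lambda>c :: bool list \<Rightarrow> ('v, 'k) mpol. Poly_Mapping.lookup (c ?z) 0"])
      show "Vector_Spaces.linear (pw psc) (*) (\<lambda>c :: bool list \<Rightarrow> ('v, 'k) mpol. Poly_Mapping.lookup (c ?z) 0)"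
        by (simp add: Vector_Spaces.linear_iff poly.ch.vector_space_axioms k.vector_space_axioms lookup_add)
      show "poly.ch.subspace ?C" by (rule poly.subspace_chains)
      show "\<exists>c\<in>?C. a - Poly_Mapping.lookup (c ?z) 0 \<in> {0}" for a :: 'k
      proof
        show "(\<lambda>s. if s = ?z then Const a else 0) \<in> ?C"
          using homogeneous_Const[of a] j poly.zero_G[of j]
          by (intro chains_I) (auto simp: count_list_0_iff)
      qed (simp add: Const_def)
    qed (auto simp: bnd)
    ultimately show ?thesis using j unfolding kbetti_def i cyc by simp
  qed
qed

text \<open>The squares form a regular sequence of quadrics, so each new one adds a copy of the
  table shifted by 1 and 2. Pascal's rule gives the binomial coefficients.\<close>

lemma kbetti_sq_ideal:
  fixes vs :: "'v::finite list"
  assumes vs: "distinct vs" "set vs = UNIV"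
  shows "kbetti vs (sq_ideal U :: ('v, 'k::field) mpol set) i j (if j = 2 * int i then card U choose i else 0)"
proof -
  have "finite U" by simp
  thus ?thesis
  proof (induction U arbitrary: i j rule: finite_induct)
    case empty
    have "sq_ideal {} = ({0} :: ('v, 'k) mpol set)"
      by (auto simp: sq_ideal_iff intro: poly_mapping_eqI)
    thus ?case using kbetti_zero_ideal[OF vs, of i j] by (cases i) auto
  next
    case (insert v U)
    let ?J = "sq_ideal U :: ('v, 'k) mpol set"
    interpret quadric "\<lambda>u. if u = v then Var v else (0 :: ('v, 'k) mpol)" vs
      by (rule quadric_single[OF vs(2)])
    have f: "f = Var v * Var v" by (rule quadric_single_f[OF vs(2)])
    have J': "sq_ideal (insert v U) = ideal_plus ?J f" unfolding f by (rule sq_ideal_insert)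
    show ?case
    proof (cases i)
      case 0
      have "kbetti vs (ideal_plus ?J f) 0 j (if j = 2 * int 0 then card U choose 0 else 0)"
        by (rule kbetti_quotient_0[OF hideal_sq insert.IH])
      thus ?thesis unfolding J' 0 by (cases "j = 0") simp_all
    next
      case (Suc i')
      have c: "u \<in> ?J" if "f * u \<in> ?J" for u
        using sq_mult_cancel[of v u U] that insert.hyps(2) unfolding f by simp
      have "kbetti vs (ideal_plus ?J f) (Suc i') j
        ((if j = 2 * int (Suc i') then card U choose (Suc i') else 0) +
         (if j - 2 = 2 * int i' then card U choose i' else 0))"
        using c by (intro kbetti_quotient_Suc[OF hideal_sq _ _ insert.IH insert.IH]) auto
      moreover have "(if j = 2 * int (Suc i') then card U choose (Suc i') else 0) +
         (if j - 2 = 2 * int i' then card U choose i' else 0)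
         = (if j = 2 * int i then card (insert v U) choose i else 0)"
        using Suc insert.hyps by auto
      ultimately show ?thesis unfolding J' Suc by simp
    qed
  qed
qed

section \<open>Powers of linear forms modulo squares\<close>

lemma binomial_mod_square:
  fixes a x :: "'a::comm_ring_1"
  shows "\<exists>q. (a + x) ^ Suc m = a ^ Suc m + of_nat (Suc m) * a ^ m * x + x * x * q"
proof (induction m)
  case 0
  show ?case by (intro exI[of _ 0]) simp
next
  case (Suc m)
  then obtain q where q: "(a + x) ^ Suc m = a ^ Suc m + of_nat (Suc m) * a ^ m * x + x * x * q" by blast
  have "(a + x) ^ Suc (Suc m) = (a + x) * (a ^ Suc m + of_nat (Suc m) * a ^ m * x + x * x * q)"
    using q by simp
  also have "\<dots> = a ^ Suc (Suc m) + of_nat (Suc (Suc m)) * a ^ Suc m * x +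
      x * x * (of_nat (Suc m) * a ^ m + (a + x) * q)"
    by (simp add: algebra_simps)
  finally show ?case by blast
qed

text \<open>In the binomial expansion of exponent \<open>k + 1\<close>, all terms not divisible by
  \<open>s * s\<close> are divisible by \<open>b ^ k\<close>; their exact coefficients are
  irrelevant for membership in an ideal.\<close>

lemma power_diff_mod_square:
  fixes s b :: "'a::comm_ring_1"
  shows "\<exists>p c d. (s - b) ^ Suc k = s * s * p + b ^ k * (c * s + d * b)"
proof (induction k)
  case 0
  show ?case by (intro exI[of _ 0] exI[of _ 1] exI[of _ "- 1"]) simp
next
  case (Suc k)
  then obtain p c d where q: "(s - b) ^ Suc k = s * s * p + b ^ k * (c * s + d * b)" by blast
  have "(s - b) ^ Suc (Suc k) = (s - b) * (s * s * p + b ^ k * (c * s + d * b))"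
    using q by simp
  also have "\<dots> = s * s * ((s - b) * p + c * b ^ k) + b ^ Suc k * ((d - c) * s + (- d) * b)"
    by (simp add: algebra_simps)
  finally show ?case by blast
qed

text \<open>The multinomial theorem modulo squares: in degree \<open>card S\<close> only the
  squarefree monomial survives, with coefficient the factorial, and one degree higher nothing does.
  The second fact is needed to carry the first through the induction.\<close>

lemma linear_form_power:
  fixes J :: "('v::finite, 'k::field) mpol set"
  assumes J: "hideal J" and sq: "\<And>v. Var v * Var v \<in> J"
  shows "(\<Sum>v\<in>S. Var v) ^ card S - of_nat (fact (card S)) * (\<Prod>v\<in>S. Var v) \<in> J \<and>
    (\<Sum>v\<in>S. Var v) ^ Suc (card S) \<in> J"
proof -
  have "finite S" by simp
  thus ?thesis
  proof (induction S rule: finite_induct)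
    case empty
    show ?case using hidealD(1)[OF J] by simp
  next
    case (insert v S)
    let ?a = "(\<Sum>v\<in>S. Var v) :: ('v, 'k) mpol" and ?x = "Var v :: ('v, 'k) mpol" and ?k = "card S"
    let ?y = "(\<Prod>v\<in>S. Var v) :: ('v, 'k) mpol"
    have s: "(\<Sum>v\<in>insert v S. Var v) = ?a + ?x" "card (insert v S) = Suc ?k"
      "(\<Prod>v\<in>insert v S. Var v) = ?x * ?y" using insert.hyps by (auto simp: add.commute)
    have IH: "?a ^ ?k - of_nat (fact ?k) * ?y \<in> J" "?a ^ Suc ?k \<in> J" using insert.IH by auto
    obtain q where q: "(?a + ?x) ^ Suc ?k = ?a ^ Suc ?k + of_nat (Suc ?k) * ?a ^ ?k * ?x + ?x * ?x * q"
      using binomial_mod_square by blast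
    obtain q' where q': "(?a + ?x) ^ Suc (Suc ?k)
        = ?a ^ Suc (Suc ?k) + of_nat (Suc (Suc ?k)) * ?a ^ Suc ?k * ?x + ?x * ?x * q'"
      using binomial_mod_square by blast
    have "(?a + ?x) ^ Suc ?k - of_nat (fact (Suc ?k)) * (?x * ?y)
        = ?a ^ Suc ?k + (of_nat (Suc ?k) * ?x) * (?a ^ ?k - of_nat (fact ?k) * ?y) + q * (?x * ?x)"
      unfolding q by (simp add: algebra_simps)
    moreover have "?a ^ Suc ?k + (of_nat (Suc ?k) * ?x) * (?a ^ ?k - of_nat (fact ?k) * ?y) + q * (?x * ?x) \<in> J"
      by (intro hidealD(2)[OF J] hidealD(3)[OF J] IH sq)
    moreover have "(?a + ?x) ^ Suc (Suc ?k)
        = (?a + of_nat (Suc (Suc ?k)) * ?x) * ?a ^ Suc ?k + q' * (?x * ?x)"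
      unfolding q' by (simp add: algebra_simps)
    moreover have "(?a + of_nat (Suc (Suc ?k)) * ?x) * ?a ^ Suc ?k + q' * (?x * ?x) \<in> J"
      by (intro hidealD(2)[OF J] hidealD(3)[OF J] IH sq)
    ultimately show ?case unfolding s by simp
  qed
qed

section \<open>Squarefree monomials and the ideal of \<open>R\<close>\<close>

definition ind :: "'v::finite set \<Rightarrow> 'v \<Rightarrow>\<^sub>0 nat" where
  "ind T = (\<Sum>v\<in>T. Poly_Mapping.single v 1)"

lemma lookup_ind: "Poly_Mapping.lookup (ind T) v = (if v \<in> T then 1 else 0)"
  unfolding ind_def lookup_sum lookup_single by (simp add: when_def)

lemma mdeg_ind: "mdeg (ind T) = int (card T)"
  unfolding mdeg_def by (simp add: lookup_ind sum.If_cases)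

lemma squarefree_ind:
  assumes "\<And>v. Poly_Mapping.lookup a v < 2"
  shows "a = ind {v. Poly_Mapping.lookup a v \<noteq> 0}"
proof (rule poly_mapping_eqI)
  fix v show "Poly_Mapping.lookup a v = Poly_Mapping.lookup (ind {v. Poly_Mapping.lookup a v \<noteq> 0}) v"
    using assms[of v] by (auto simp: lookup_ind)
qed

lemma single_ind: "Poly_Mapping.single (ind T) (1::'k::field) = (\<Prod>v\<in>T. Var v)"
proof -
  have "finite T" by simp
  thus ?thesis
  proof (induction T rule: finite_induct)
    case (insert v T)
    hence "ind (insert v T) = Poly_Mapping.single v 1 + ind T" by (simp add: ind_def)
    hence "Poly_Mapping.single (ind (insert v T)) (1::'k) = Var v * Poly_Mapping.single (ind T) 1"
      unfolding Var_def mult_single by simp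
    thus ?case using insert by simp
  qed (simp add: ind_def)
qed

lemma inj_ind: "inj ind"
proof (rule injI)
  fix S T :: "'a set" assume "ind S = ind T"
  hence "v \<in> S \<longleftrightarrow> v \<in> T" for v by (metis lookup_ind zero_neq_one)
  thus "S = T" by blast
qed

abbreviation sigma :: "('v::finite, 'k::field) mpol" where
  "sigma \<equiv> (\<Sum>v\<in>UNIV. Var v)"

lemma homogeneous_sigma: "sigma \<in> homogeneous 1"
  by (intro psc.subspace_sum[OF subspace_homogeneous] homogeneous_Var)

text \<open>Extended by 0 to negative arguments, because shifts by 2 and by homological degrees lead
  below 0.\<close>

definition cn :: "nat \<Rightarrow> int \<Rightarrow> nat" where
  "cn n d = (if d < 0 then 0 else n choose nat d)"

lemma has_qdim_sq:
  "has_qdim psc (homogeneous d) (homogeneous d \<inter> (sq_ideal UNIV :: ('v::finite, 'k::field) mpol set)) (cn CARD('v) d)"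
proof (cases "d < 0")
  case True
  have "homogeneous d \<subseteq> homogeneous d \<inter> (sq_ideal UNIV :: ('v, 'k) mpol set)"
  proof
    fix p :: "('v, 'k) mpol" assume p: "p \<in> homogeneous d"
    hence "p = 0" by (rule homogeneous_negative[OF True])
    thus "p \<in> homogeneous d \<inter> sq_ideal UNIV" using p hidealD(1)[OF hideal_sq] by auto
  qed
  from psc.has_qdim_self[OF psc.subspace_inter[OF subspace_homogeneous hideal_subspace[OF hideal_sq]] this]
  show ?thesis using True by (simp add: cn_def)
next
  case False
  define D where "D = {T :: 'v set. card T = nat d}"
  define e where "e T = (Poly_Mapping.single (ind T) 1 :: ('v, 'k) mpol)" for T
  have inj: "inj_on e D"
  proof (rule inj_onI)
    fix S T assume "e S = e T"
    hence "ind S = ind T" unfolding e_def by (metis keys_single singleton_inject zero_neq_one)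
    thus "S = T" using inj_ind by (auto dest: injD)
  qed
  have lookup_e: "Poly_Mapping.lookup (e T) (ind S) = (if S = T then 1 else 0)" for S T
    unfolding e_def lookup_single using inj_ind by (auto simp: when_def dest: injD)
  have card: "card (e ` D) = cn CARD('v) d"
    using n_subsets[of "UNIV :: 'v set" "nat d"] False unfolding card_image[OF inj] unfolding D_def cn_def by simp
  have hom: "e T \<in> homogeneous d" if "T \<in> D" for T
    using homogeneous_single[of "ind T" 1] that False unfolding e_def D_def mdeg_ind by simp
  have indep: "psc.indep_mod (homogeneous d \<inter> sq_ideal UNIV) (e ` D)"
    unfolding psc.indep_mod_def
  proof (intro allI impI, elim conjE)
    fix B c assume B: "finite B" "B \<subseteq> e ` D" "(\<Sum>s\<in>B. psc (c s) s) \<in> homogeneous d \<inter> sq_ideal UNIV"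
    show "\<forall>s\<in>B. c s = 0"
    proof
      fix s assume s: "s \<in> B"
      then obtain T where T: "s = e T" using B(2) by blast
      have "Poly_Mapping.lookup (\<Sum>s\<in>B. psc (c s) s) (ind T) = 0"
      proof -
        have "\<forall>v\<in>UNIV. Poly_Mapping.lookup (ind T) v < 2" by (simp add: lookup_ind)
        moreover have "(\<Sum>s\<in>B. psc (c s) s) \<in> sq_ideal UNIV" using B(3) by (rule IntD2)
        ultimately show ?thesis unfolding sq_ideal_iff by meson
      qed
      moreover have "Poly_Mapping.lookup (\<Sum>s\<in>B. psc (c s) s) (ind T) = (\<Sum>u\<in>B. if u = s then c s else 0)"
        unfolding lookup_sum
      proof (rule sum.cong)
        fix u assume "u \<in> B"
        then obtain T' where "u = e T'" using B(2) by blast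
        moreover have "e T' = e T \<longleftrightarrow> T' = T" by (metis lookup_e zero_neq_one)
        ultimately show "Poly_Mapping.lookup (psc (c u) u) (ind T) = (if u = s then c s else 0)"
          using lookup_e T by auto
      qed simp
      ultimately show "c s = 0" using s B(1) by simp
    qed
  qed
  have span: "\<exists>u\<in>psc.span (e ` D). p - u \<in> homogeneous d \<inter> sq_ideal UNIV" if p: "p \<in> homogeneous d" for p
  proof -
    define u where "u = (\<Sum>T\<in>D. psc (Poly_Mapping.lookup p (ind T)) (e T))"
    have u: "u \<in> psc.span (e ` D)" unfolding u_def by (intro psc.span_sum psc.span_scale psc.span_base) auto
    have "u \<in> homogeneous d"
      unfolding u_def using hom by (intro psc.subspace_sum[OF subspace_homogeneous] psc.subspace_scale[OF subspace_homogeneous])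
    hence h: "p - u \<in> homogeneous d" using p psc.subspace_diff[OF subspace_homogeneous] by blast
    have "Poly_Mapping.lookup (p - u) a = 0" if a: "\<forall>v\<in>UNIV. Poly_Mapping.lookup a v < 2" for a
    proof (cases "mdeg a = d")
      case False
      thus ?thesis using h unfolding homogeneous_iff_lookup by blast
    next
      case True
      obtain T where T: "a = ind T" using squarefree_ind[of a] a by blast
      hence "T \<in> D" using True mdeg_ind[of T] unfolding D_def by auto
      moreover have "finite D" by simp
      ultimately have "Poly_Mapping.lookup u a = Poly_Mapping.lookup p a"
        unfolding u_def T lookup_sum by (simp add: lookup_e if_distrib cong: if_cong)
      thus ?thesis by (simp add: lookup_minus)
    qed
    hence "p - u \<in> sq_ideal UNIV" unfolding sq_ideal_iff by blast
    thus ?thesis using u h by blast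
  qed
  show ?thesis
    unfolding has_qdim_def psc.quotient_basis_iff
    using card indep span hom by (intro exI[of _ "e ` D"]) auto
qed

interpretation Qmod: module "(*) :: ('v, 'k::field) mpol \<Rightarrow> _"
  by (rule module_mult)

lemma ideal_plus_subset:
  assumes "\<And>p q. p \<in> K \<Longrightarrow> q \<in> K \<Longrightarrow> p + q \<in> K" "\<And>p q. q \<in> K \<Longrightarrow> p * q \<in> K" "J \<subseteq> K" "f \<in> K"
  shows "ideal_plus J f \<subseteq> K"
proof
  fix x assume "x \<in> ideal_plus J f"
  then obtain a b where "a \<in> J" "x = a + f * b" unfolding ideal_plus_def by auto
  moreover have "b * f \<in> K" using assms(2,4) by blast
  ultimately show "x \<in> K" using assms(1,3) by (auto simp: mult.commute[of f])
qed

lemma squares_ideal_plus: "squares_ideal = ideal_plus (sq_ideal UNIV) (sigma * sigma :: ('v::finite, 'k::field) mpol)"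
proof
  let ?G = "insert (sigma\<^sup>2) (range (\<lambda>v. (Var v)\<^sup>2)) :: ('v, 'k) mpol set"
  have h: "hideal (ideal_plus (sq_ideal UNIV) (sigma * sigma :: ('v, 'k) mpol))"
    by (rule hideal_plus[OF hideal_sq homogeneous_mult[OF homogeneous_sigma homogeneous_sigma]])
  have sq: "Var v * Var v \<in> sq_ideal UNIV" for v :: 'v
    using lookup_sq_mult_0[of _ v 1] by (auto simp: sq_ideal_iff)
  show "squares_ideal \<subseteq> ideal_plus (sq_ideal UNIV) (sigma * sigma :: ('v, 'k) mpol)"
    unfolding squares_ideal_def
  proof (rule Qmod.span_minimal)
    show "?G \<subseteq> ideal_plus (sq_ideal UNIV) (sigma * sigma)"
      using ideal_plus_mem(2)[OF hideal_sq, of "sigma * sigma" 1 UNIV] ideal_plus_mem(1)[OF hideal_sq sq]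
      by (auto simp: power2_eq_square)
    show "Qmod.subspace (ideal_plus (sq_ideal UNIV) (sigma * sigma :: ('v, 'k) mpol))"
      using hidealD[OF h] by (intro Qmod.subspaceI)
  qed
  have "sq_ideal U \<subseteq> (squares_ideal :: ('v, 'k) mpol set)" for U :: "'v set"
  proof -
    have "finite U" by simp
    thus ?thesis
    proof (induction U rule: finite_induct)
      case empty
      have "p = 0" if "p \<in> sq_ideal {}" for p :: "('v, 'k) mpol"
        using that by (auto simp: sq_ideal_iff intro: poly_mapping_eqI)
      thus ?case using squares_ideal_closed(1) by blast
    next
      case (insert v U)
      have V: "Var v * Var v \<in> (squares_ideal :: ('v, 'k) mpol set)"
        unfolding squares_ideal_def by (intro Qmod.span_base) (auto simp: power2_eq_square)
      show ?case unfolding sq_ideal_insert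
        by (rule ideal_plus_subset) (fact squares_ideal_closed insert.IH V)+
    qed
  qed
  hence sub: "sq_ideal UNIV \<subseteq> (squares_ideal :: ('v, 'k) mpol set)" .
  have V: "sigma * sigma \<in> (squares_ideal :: ('v, 'k) mpol set)"
    unfolding squares_ideal_def by (intro Qmod.span_base) (auto simp: power2_eq_square)
  show "ideal_plus (sq_ideal UNIV) (sigma * sigma) \<subseteq> (squares_ideal :: ('v, 'k) mpol set)"
    by (rule ideal_plus_subset) (fact squares_ideal_closed sub V)+
qed

lemma hideal_squares: "hideal (squares_ideal :: ('v::finite, 'k::field) mpol set)"
  unfolding squares_ideal_plus
  by (rule hideal_plus[OF hideal_sq homogeneous_mult[OF homogeneous_sigma homogeneous_sigma]])

lemma Var_sq_mem: "Var v * Var v \<in> (squares_ideal :: ('v::finite, 'k::field) mpol set)"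
  unfolding squares_ideal_def by (intro Qmod.span_base) (auto simp: power2_eq_square)

lemma sigma_sq_mem: "sigma * sigma \<in> (squares_ideal :: ('v::finite, 'k::field) mpol set)"
  unfolding squares_ideal_def by (intro Qmod.span_base) (auto simp: power2_eq_square)

text \<open>Write the sum over \<open>S\<close> as \<open>sigma - ?b\<close> with \<open>?b\<close>
  the sum over the complement. In its power of exponent \<open>card S\<close>, every term is
  divisible by \<open>sigma * sigma\<close> or by \<open>?b ^ (card S - 1)\<close>. The latter is in
  the ideal as \<open>card (- S) + 1 <= card S - 1\<close>, which is the assumption on
  \<open>card S\<close>. Modulo squares the same power is the factorial times the product.\<close>

lemma Prod_Var_mem:
  fixes S :: "'v::finite set"
  assumes "CARD('v) + 2 \<le> 2 * card S" and char: "of_nat (fact (card S)) \<noteq> (0::'k::field)"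
  shows "(\<Prod>v\<in>S. Var v) \<in> (squares_ideal :: ('v, 'k) mpol set)"
proof -
  let ?I = "squares_ideal :: ('v, 'k) mpol set"
  let ?a = "(\<Sum>v\<in>S. Var v) :: ('v, 'k) mpol" and ?b = "(\<Sum>v\<in>-S. Var v) :: ('v, 'k) mpol"
  let ?y = "(\<Prod>v\<in>S. Var v) :: ('v, 'k) mpol"
  obtain k where k: "card S = Suc k" using assms(1) by (cases "card S") auto
  have sigma: "?a = sigma - ?b"
    using sum.union_disjoint[of S "- S" "Var :: 'v \<Rightarrow> ('v, 'k) mpol"] by (simp add: Compl_partition)
  have "card (- S) = CARD('v) - card S" by (simp add: Compl_eq_Diff_UNIV card_Diff_subset)
  moreover have "card S \<le> CARD('v)" by (intro card_mono) auto
  ultimately have le: "Suc (card (- S)) \<le> k" using assms(1) k by simp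
  have "?b ^ Suc (card (- S)) \<in> ?I"
    using linear_form_power[OF hideal_squares Var_sq_mem, where S = "- S"] by blast
  hence "?b ^ (k - Suc (card (- S))) * ?b ^ Suc (card (- S)) \<in> ?I" by (rule squares_ideal_closed(5))
  hence bk: "?b ^ k \<in> ?I" unfolding power_add[symmetric] using le by simp
  obtain p c d where pcd: "(sigma - ?b) ^ Suc k = sigma * sigma * p + ?b ^ k * (c * sigma + d * ?b)"
    using power_diff_mod_square by blast
  have "p * (sigma * sigma) + (c * sigma + d * ?b) * ?b ^ k \<in> ?I"
    by (intro squares_ideal_closed(2,5) bk sigma_sq_mem)
  moreover have "?a ^ card S = p * (sigma * sigma) + (c * sigma + d * ?b) * ?b ^ k"
    unfolding k sigma pcd mult.commute[of "sigma * sigma"] mult.commute[of "?b ^ k"] by (rule refl)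
  ultimately have "?a ^ card S \<in> ?I" by (rule ssubst[rotated])
  moreover have "?a ^ card S - of_nat (fact (card S)) * ?y \<in> ?I"
    using linear_form_power[OF hideal_squares Var_sq_mem, where S = S] by blast
  ultimately have "?a ^ card S - (?a ^ card S - of_nat (fact (card S)) * ?y) \<in> ?I"
    by (rule squares_ideal_closed(3))
  hence y: "of_nat (fact (card S)) * ?y \<in> ?I" by (simp only: diff_diff_eq2 add_diff_cancel_left')
  define F where "F = (of_nat (fact (card S)) :: 'k)"
  have cF: "of_nat (fact (card S)) = (Const F :: ('v, 'k) mpol)"
    unfolding Const_def F_def single_of_nat by (rule refl)
  have "Const (inverse F) * (Const F * ?y) \<in> ?I"
    using y unfolding cF by (rule squares_ideal_closed(5))
  moreover have "Const (inverse F) * Const F = (1 :: ('v, 'k) mpol)"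
    using char[folded F_def] unfolding Const_def mult_single by simp
  ultimately show ?thesis unfolding mult.assoc[symmetric] by (simp only: mult_1)
qed

section \<open>Evaluation at sign vectors\<close>

definition point_value :: "'v::finite set \<Rightarrow> ('v \<Rightarrow>\<^sub>0 nat) \<Rightarrow> 'k::field" where
  "point_value S a = (\<Prod>v\<in>UNIV. (if v \<in> S then 1 else - 1) ^ Poly_Mapping.lookup a v)"

definition ev :: "'v::finite set \<Rightarrow> ('v, 'k::field) mpol \<Rightarrow> 'k" where
  "ev S p = (\<Sum>a\<in>Poly_Mapping.keys p. Poly_Mapping.lookup p a * point_value S a)"

lemma ev_superset:
  assumes "finite K" "Poly_Mapping.keys p \<subseteq> K"
  shows "ev S p = (\<Sum>a\<in>K. Poly_Mapping.lookup p a * point_value S a)"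
  unfolding ev_def using assms by (intro sum.mono_neutral_left) (auto simp: in_keys_iff)

lemma ev_add: "ev S (p + q) = ev S p + ev S q"
proof -
  let ?K = "Poly_Mapping.keys p \<union> Poly_Mapping.keys q"
  have "Poly_Mapping.keys (p + q) \<subseteq> ?K" by (rule keys_add)
  thus ?thesis using ev_superset[of ?K "p + q" S] ev_superset[of ?K p S] ev_superset[of ?K q S]
    by (simp add: lookup_add distrib_right sum.distrib)
qed

lemma ev_zero [simp]: "ev S 0 = 0"
  by (simp add: ev_def)

lemma ev_single: "ev S (Poly_Mapping.single a c) = c * point_value S a"
  by (simp add: ev_def)

lemma ev_minus: "ev S (p - q) = ev S p - ev S q"
  using ev_add[of S "p - q" q] by simp

lemma ev_sum: "ev S (\<Sum>a\<in>A. f a) = (\<Sum>a\<in>A. ev S (f a))"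
  by (induction A rule: infinite_finite_induct) (auto simp: ev_add)

lemma ev_psc: "ev S (psc c p) = c * ev S p"
proof -
  have "Poly_Mapping.keys (psc c p) \<subseteq> Poly_Mapping.keys p" by (auto simp: in_keys_iff)
  from ev_superset[OF finite_keys this] show ?thesis
    by (simp add: ev_def sum_distrib_left mult.assoc)
qed

lemma ev_Var_mult:
  fixes p :: "('v::finite, 'k::field) mpol"
  shows "ev S (Var v * p) = (if v \<in> S then 1 else - 1) * ev S p"
proof -
  have pv: "point_value S (Poly_Mapping.single v 1 + a) = (if v \<in> S then 1 else - 1) * (point_value S a :: 'k)" for a
  proof -
    have "point_value S (Poly_Mapping.single v 1) = (\<Prod>u\<in>UNIV. if u = v then if v \<in> S then 1 else - 1 else (1::'k))"
      unfolding point_value_def lookup_single by (intro prod.cong) (auto simp: when_def)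
    thus ?thesis unfolding point_value_def lookup_add power_add prod.distrib by simp
  qed
  have "Var v * p = (\<Sum>m\<in>Poly_Mapping.keys p. Poly_Mapping.single (Poly_Mapping.single v 1 + m) (Poly_Mapping.lookup p m))"
    by (subst (1) sum_single[of p]) (simp only: Var_def sum_distrib_left mult_single mult_1)
  hence "ev S (Var v * p) = (\<Sum>m\<in>Poly_Mapping.keys p.
      Poly_Mapping.lookup p m * ((if v \<in> S then 1 else - 1) * point_value S m))"
    by (simp only: ev_sum ev_single pv)
  also have "\<dots> = (if v \<in> S then 1 else - 1) * ev S p"
    unfolding ev_def sum_distrib_left by (intro sum.cong refl) (rule mult.left_commute)
  finally show ?thesis .
qed

lemma ev_Var_Var_mult: "ev S (Var v * (Var v * p)) = ev S p"
  unfolding ev_Var_mult by simp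

lemma ev_sigma_mult:
  fixes p :: "('v::finite, 'k::field) mpol"
  shows "ev S (sigma * p) = (of_nat (card S) - of_nat (card (- S))) * ev S p"
proof -
  have "ev S (sigma * p) = (\<Sum>v\<in>UNIV. (if v \<in> S then 1 else - 1)) * ev S p"
    by (simp add: sum_distrib_right ev_sum ev_Var_mult)
  also have "(\<Sum>v\<in>UNIV. (if v \<in> S then 1 else - 1 :: 'k)) = of_nat (card S) - of_nat (card (- S))"
    by (simp add: sum.If_cases Compl_eq)
  finally show ?thesis .
qed

section \<open>The ideal defining \<open>T\<close> and its zeros\<close>

definition lift_ideal :: "'v \<Rightarrow> ('v::finite, 'k::field) mpol set" where
  "lift_ideal w = Qmod.span (insert (sigma * sigma - Var w * Var w) (range (\<lambda>v. Var v * Var v - Var w * Var w)))"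

lemma hideal_lift: "hideal (lift_ideal w :: ('v::finite, 'k::field) mpol set)"
proof -
  let ?G = "insert (sigma * sigma - Var w * Var w) (range (\<lambda>v. Var v * Var v - Var w * Var w)) :: ('v, 'k) mpol set"
  have G: "g \<in> homogeneous 2" if "g \<in> ?G" for g
  proof -
    have "Var v * Var v \<in> homogeneous 2" "sigma * sigma \<in> (homogeneous 2 :: ('v, 'k) mpol set)" for v :: 'v
      using homogeneous_mult[OF homogeneous_Var homogeneous_Var, of v v]
        homogeneous_mult[OF homogeneous_sigma homogeneous_sigma] by simp_all
    thus ?thesis using that by (auto intro!: psc.subspace_diff[OF subspace_homogeneous])
  qed
  have "hcomp d p \<in> lift_ideal w" if "p \<in> lift_ideal w" for p :: "('v, 'k) mpol" and d
    using that unfolding lift_ideal_def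
  proof (induction rule: Qmod.span_induct_alt)
    case base
    show ?case using Qmod.span_zero by simp
  next
    case (step c x y)
    have "hcomp d (c * x) = hcomp (d - 2) c * x"
      using hcomp_mult[OF G[OF step(1)], of d c] by (simp add: mult.commute)
    thus ?case unfolding hcomp_plus by (simp only: Qmod.span_add Qmod.span_scale Qmod.span_base step)
  qed
  thus ?thesis unfolding hideal_def lift_ideal_def
    using Qmod.span_zero Qmod.span_add Qmod.span_scale by blast
qed

lemma squares_ideal_lift:
  "squares_ideal = ideal_plus (lift_ideal w) (Var w * Var w :: ('v::finite, 'k::field) mpol)"
proof
  let ?L = "lift_ideal w :: ('v, 'k) mpol set" and ?x = "Var w * Var w :: ('v, 'k) mpol"
  have h: "hideal (ideal_plus ?L ?x)"
    by (rule hideal_plus[OF hideal_lift homogeneous_mult[OF homogeneous_Var homogeneous_Var]])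
  have gen: "a \<in> ideal_plus ?L ?x" if "a - ?x \<in> ?L" for a
  proof -
    have "a = (a - ?x) + ?x * 1" by simp
    thus ?thesis using that unfolding ideal_plus_def by blast
  qed
  have "(\<Sum>v\<in>UNIV. Var v)\<^sup>2 \<in> ideal_plus ?L ?x" "(Var v)\<^sup>2 \<in> ideal_plus ?L ?x" for v
    unfolding power2_eq_square lift_ideal_def
    by (rule gen[unfolded lift_ideal_def], rule Qmod.span_base, simp)+
  thus "squares_ideal \<subseteq> ideal_plus ?L ?x"
    unfolding squares_ideal_def using hidealD[OF h]
    by (intro Qmod.span_minimal Qmod.subspaceI) auto
  have "?L \<subseteq> squares_ideal"
    unfolding lift_ideal_def
  proof (rule Qmod.span_minimal)
    show "Qmod.subspace (squares_ideal :: ('v, 'k) mpol set)"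
      using squares_ideal_closed by (intro Qmod.subspaceI) auto
    show "insert (sigma * sigma - ?x) (range (\<lambda>v. Var v * Var v - ?x)) \<subseteq> squares_ideal"
      using squares_ideal_closed(3) Var_sq_mem sigma_sq_mem by blast
  qed
  thus "ideal_plus ?L ?x \<subseteq> squares_ideal"
    unfolding ideal_plus_def using hidealD(2,5)[OF hideal_squares] Var_sq_mem by blast
qed

text \<open>At such a sign vector the coordinate sum is 1, so \<open>sigma * sigma\<close> and all
  squares of variables take the value 1 and the differences in the generators vanish.\<close>

lemma ev_lift_ideal:
  fixes p :: "('v::finite, 'k::field) mpol"
  assumes S: "card S = Suc (card (- S))" and p: "p \<in> lift_ideal w"
  shows "ev S p = 0"
proof -
  \<comment> \<open>Vanishing of all multiples is required so that the set is visibly closed under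
    multiplication by polynomials.\<close>
  have "lift_ideal w \<subseteq> {p :: ('v, 'k) mpol. \<forall>q. ev S (q * p) = 0}"
    unfolding lift_ideal_def
  proof (rule Qmod.span_minimal)
    show "Qmod.subspace {p :: ('v, 'k) mpol. \<forall>q. ev S (q * p) = 0}"
      by (rule Qmod.subspaceI) (auto simp: distrib_left ev_add mult.assoc[symmetric])
    have s: "ev S (sigma * q) = ev S q" for q :: "('v, 'k) mpol" using S by (simp add: ev_sigma_mult)
    have h: "q * (sigma * sigma) = sigma * (sigma * q)" "q * (Var v * Var v) = Var v * (Var v * q)" for q :: "('v, 'k) mpol" and v
      by (simp_all only: mult_ac)
    have "ev S (q * (sigma * sigma)) = ev S q" for q :: "('v, 'k) mpol" unfolding h(1) s by (rule refl)
    moreover have "ev S (q * (Var v * Var v)) = ev S q" for q :: "('v, 'k) mpol" and v unfolding h(2) ev_Var_Var_mult by (rule refl)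
    ultimately show "insert (sigma * sigma - Var w * Var w) (range (\<lambda>v. Var v * Var v - Var w * Var w)) \<subseteq> {p :: ('v, 'k) mpol. \<forall>q. ev S (q * p) = 0}"
      by (auto simp: right_diff_distrib ev_minus)
  qed
  hence "ev S (1 * p) = 0" using p by blast
  thus ?thesis by simp
qed

text \<open>Since \<open>sigma\<close> has value 1 at \<open>S'\<close>, the factor
  \<open>Var v + sigma\<close> is a homogeneous version of \<open>Var v + 1\<close>: it has value 2
  for \<open>v\<close> in \<open>S'\<close> and 0 otherwise. As the sets have the same size, the
  product is nonzero only if they coincide, given that 2 is nonzero.\<close>

lemma ev_separating:
  assumes S': "card S' = Suc (card (- S'))" and c: "card S = card S'"
  shows "ev S' (\<Prod>v\<in>S. Var v + sigma) = (if S = S' then 2 ^ card S else (0::'k::field))"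
proof -
  have m: "ev S' ((Var v + sigma) * q) = (if v \<in> S' then 2 else 0) * ev S' q" for v and q :: "('a, 'k) mpol"
    using S' by (simp add: distrib_right ev_add ev_Var_mult ev_sigma_mult)
  have "finite S" by simp
  hence "ev S' (\<Prod>v\<in>S. Var v + sigma) = (\<Prod>v\<in>S. if v \<in> S' then 2 else (0::'k))"
  proof (induction S rule: finite_induct)
    case empty
    have "ev S' (1 :: ('a, 'k) mpol) = 1"
      unfolding single_one[symmetric] ev_single point_value_def by simp
    thus ?case by simp
  qed (simp add: m)
  also have "\<dots> = (if S = S' then 2 ^ card S else 0)"
  proof (cases "S \<subseteq> S'")
    case True
    hence "S = S'" using c by (simp add: card_subset_eq)
    thus ?thesis by simp
  next
    case False
    hence "S \<noteq> S'" by blast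
    moreover have "\<exists>v\<in>S. (if v \<in> S' then 2 else (0::'k)) = 0" using False by auto
    hence "(\<Prod>v\<in>S. if v \<in> S' then 2 else (0::'k)) = 0" by (simp only: prod_zero_iff finite)
    ultimately show ?thesis by (simp only: if_False)
  qed
  finally show ?thesis .
qed

lemma homogeneous_Prod: "finite S \<Longrightarrow> (\<And>v. v \<in> S \<Longrightarrow> f v \<in> homogeneous 1) \<Longrightarrow> (\<Prod>v\<in>S. f v) \<in> homogeneous (int (card S))"
proof (induction S rule: finite_induct)
  case empty
  show ?case using homogeneous_Const[of 1] by (simp add: Const_def)
next
  case (insert v S)
  thus ?case using homogeneous_mult[of "f v" 1 "\<Prod>v\<in>S. f v" "int (card S)"] by (simp add: add.commute)
qed

text \<open>Lagrange interpolation: the forms \<open>u S\<close> are dual to the points up to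
  nonzero factors, so evaluation maps the forms of degree \<open>d\<close> onto all families of
  values.\<close>

lemma has_qdim_points:
  fixes u :: "'v::finite set \<Rightarrow> ('v, 'k::field) mpol"
  assumes u: "\<And>S. S \<in> X \<Longrightarrow> u S \<in> homogeneous d"
    and ev: "\<And>S S'. S \<in> X \<Longrightarrow> S' \<in> X \<Longrightarrow> ev S' (u S) = 0 \<longleftrightarrow> S \<noteq> S'"
  shows "has_qdim psc (homogeneous d) {p \<in> homogeneous d. \<forall>S\<in>X. ev S p = (0::'k)} (card X)"
proof -
  let ?E = "{p \<in> homogeneous d. \<forall>S\<in>X. ev S p = (0::'k)}"
  have inj: "inj_on u X" by (rule inj_onI) (metis ev)
  have indep: "psc.indep_mod ?E (u ` X)"
    unfolding psc.indep_mod_def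
  proof (intro allI impI, elim conjE)
    fix T c assume T: "finite T" "T \<subseteq> u ` X" "(\<Sum>s\<in>T. psc (c s) s) \<in> ?E"
    show "\<forall>s\<in>T. c s = 0"
    proof
      fix s assume s: "s \<in> T"
      then obtain S where S: "S \<in> X" "s = u S" using T(2) by blast
      have "0 = ev S (\<Sum>s\<in>T. psc (c s) s)" using T(3) S by simp
      also have "\<dots> = (\<Sum>t\<in>T. if t = s then c s * ev S s else 0)"
        unfolding ev_sum ev_psc
      proof (rule sum.cong)
        fix t assume "t \<in> T"
        then obtain S' where S': "S' \<in> X" "t = u S'" using T(2) by blast
        show "c t * ev S t = (if t = s then c s * ev S s else 0)"
          using ev[OF S'(1) S(1)] S S' inj by (auto dest: inj_onD)
      qed simp
      also have "\<dots> = c s * ev S s" using s T(1) by simp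
      finally show "c s = 0" using ev[OF S(1) S(1)] S by simp
    qed
  qed
  have "\<exists>q\<in>psc.span (u ` X). p - q \<in> ?E" if p: "p \<in> homogeneous d" for p
  proof -
    define q where "q = (\<Sum>S\<in>X. psc (ev S p / ev S (u S)) (u S))"
    have q: "q \<in> psc.span (u ` X)" unfolding q_def by (intro psc.span_sum psc.span_scale psc.span_base) auto
    have qh: "q \<in> homogeneous d" unfolding q_def
      using u by (intro psc.subspace_sum[OF subspace_homogeneous] psc.subspace_scale[OF subspace_homogeneous])
    have "ev S q = ev S p" if S: "S \<in> X" for S
    proof -
      have "ev S q = (\<Sum>S'\<in>X. if S' = S then ev S p else 0)"
        unfolding q_def ev_sum ev_psc using ev S by (intro sum.cong) auto
      thus ?thesis using S by simp
    qed
    hence "p - q \<in> ?E" using p qh psc.subspace_diff[OF subspace_homogeneous] by (auto simp: ev_minus)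
    thus ?thesis using q by blast
  qed
  thus ?thesis
    unfolding has_qdim_def psc.quotient_basis_iff
    using u indep card_image[OF inj] by (intro exI[of _ "u ` X"]) auto
qed

text \<open>Multiplication by \<open>f\<close> identifies the quotient by the colon ideal of
  \<open>J\<close> and \<open>f\<close>, in degree \<open>d - e\<close>, with the part of degree
  \<open>d\<close> of \<open>(J, f) / J\<close>.\<close>

lemma has_qdim_ideal_plus:
  fixes J :: "('v::finite, 'k::field) mpol set"
  assumes J: "hideal J" and f: "f \<in> homogeneous e"
  shows "has_qdim psc (homogeneous d \<inter> ideal_plus J f) (homogeneous d \<inter> J) h \<longleftrightarrow>
    has_qdim psc (homogeneous (d - e)) {u \<in> homogeneous (d - e). f * u \<in> J} h"
proof (rule has_qdim_image[where f = "\<lambda>u. f * u"])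
  show "Vector_Spaces.linear psc psc (\<lambda>u. f * u)"
    by (simp add: Vector_Spaces.linear_iff psc.vector_space_axioms distrib_left psc_def mult.left_commute)
  show "psc.subspace (homogeneous d \<inter> J)"
    by (rule psc.subspace_inter[OF subspace_homogeneous hideal_subspace[OF J]])
  have fu: "f * u \<in> homogeneous d" if "u \<in> homogeneous (d - e)" for u
    using homogeneous_mult[OF f that] by simp
  show "f * u \<in> homogeneous d \<inter> ideal_plus J f" if "u \<in> homogeneous (d - e)" for u
    using fu[OF that] ideal_plus_mem(2)[OF J] by auto
  show "f * u \<in> homogeneous d \<inter> J \<longleftrightarrow> u \<in> {u \<in> homogeneous (d - e). f * u \<in> J}"
    if "u \<in> homogeneous (d - e)" for u
    using fu[OF that] that by auto
  show "\<exists>u\<in>homogeneous (d - e). y - f * u \<in> homogeneous d \<inter> J" if y: "y \<in> homogeneous d \<inter> ideal_plus J f" for y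
  proof -
    obtain u where u: "u \<in> homogeneous (d - e)" "y - f * u \<in> J"
      using ideal_plus_homogeneous[OF J f, of y d] y by blast
    thus ?thesis using fu[OF u(1)] y psc.subspace_diff[OF subspace_homogeneous] by blast
  qed
qed (rule subspace_homogeneous)

section \<open>Lifting to a one-dimensional ring\<close>

lemma kbetti_unique:
  "hideal J \<Longrightarrow> kbetti vs J i j a \<Longrightarrow> kbetti vs J i j b \<Longrightarrow> a = b"
  unfolding kbetti_def by (rule poly.ch.has_qdim_unique'[OF poly.subspace_bounds[OF hideal_stable]])

lemma subspace_hom_Int: "hideal J \<Longrightarrow> psc.subspace (homogeneous d \<inter> J)"
  by (rule psc.subspace_inter[OF subspace_homogeneous hideal_subspace])

lemma subspace_colon:
  assumes J: "hideal J"
  shows "psc.subspace {u \<in> homogeneous d. f * u \<in> J}"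
proof (rule psc.subspaceI)
  show "0 \<in> {u \<in> homogeneous d. f * u \<in> J}" using hidealD(1)[OF J] by simp
  show "a + b \<in> {u \<in> homogeneous d. f * u \<in> J}"
    if "a \<in> {u \<in> homogeneous d. f * u \<in> J}" "b \<in> {u \<in> homogeneous d. f * u \<in> J}" for a b
    using that psc.subspace_add[OF subspace_homogeneous] hidealD(2)[OF J] by (auto simp: distrib_left)
  show "psc c a \<in> {u \<in> homogeneous d. f * u \<in> J}" if "a \<in> {u \<in> homogeneous d. f * u \<in> J}" for a c
    using that psc.subspace_scale[OF subspace_homogeneous] psc.subspace_scale[OF hideal_subspace[OF J]]
    by (auto simp: psc_mult(2)[symmetric])
qed

lemma mult_decomp: "(g + s * h) * u = u * g + h * (s * u)" for g :: "'a::comm_ring"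
  by (simp add: algebra_simps)

text \<open>The variable \<open>w\<close> is the one singled out in \<open>T\<close>, and
  \<open>K\<close> carries the coefficient type. The condition on the characteristic is stated as
  invertibility of factorials, the form in which \<open>Prod_Var_mem\<close> and the separation of
  points use it.\<close>

locale squares_setup =
  fixes r :: nat and w :: "'v::finite" and K :: "'k::field itself"
  assumes card_vars: "CARD('v) = 2 * r + 3"
    and char: "\<And>k. k \<le> 2 * r + 3 \<Longrightarrow> of_nat (fact k) \<noteq> (0::'k)"
begin

abbreviation I :: "('v, 'k) mpol set" where "I \<equiv> squares_ideal"
abbreviation S2 :: "('v, 'k) mpol set" where "S2 \<equiv> sq_ideal UNIV"
abbreviation T :: "('v, 'k) mpol set" where "T \<equiv> lift_ideal w"
abbreviation x :: "('v, 'k) mpol" where "x \<equiv> Var w"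
abbreviation hom :: "int \<Rightarrow> ('v, 'k) mpol set" where "hom \<equiv> homogeneous"
abbreviation X :: "'v set set" where "X \<equiv> {S. card S = r + 2}"
abbreviation c :: "int \<Rightarrow> nat" where "c \<equiv> cn (2 * r + 3)"

lemma card_Compl: "card (- S :: 'v set) = 2 * r + 3 - card S"
  using card_vars by (simp add: Compl_eq_Diff_UNIV card_Diff_subset)

lemma card_le: "card (S :: 'v set) \<le> 2 * r + 3"
  unfolding card_vars[symmetric] by (intro card_mono) auto

text \<open>A monomial that is not squarefree contains a square. A squarefree one of degree at least
  \<open>r + 3\<close> is covered by \<open>Prod_Var_mem\<close>, because \<open>2 * (r + 3)\<close>
  is at least \<open>n + 2 = 2 * r + 5\<close>.\<close>

lemma high_degree:
  assumes p: "p \<in> hom d" and d: "d \<ge> int r + 3"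
  shows "p \<in> I"
proof -
  have "Poly_Mapping.single m (Poly_Mapping.lookup p m) \<in> I" if m: "m \<in> Poly_Mapping.keys p" for m
  proof (cases "\<forall>v. Poly_Mapping.lookup m v < 2")
    case True
    then obtain S where S: "m = ind S" using squarefree_ind[of m] by blast
    have "mdeg m = d" using p m unfolding homogeneous_iff by blast
    hence "int (card S) = d" unfolding S mdeg_ind .
    hence "CARD('v) + 2 \<le> 2 * card S" using d card_vars by simp
    hence "(\<Prod>v\<in>S. Var v) \<in> I" using char[OF card_le] by (rule Prod_Var_mem)
    hence "Const (Poly_Mapping.lookup p m) * Poly_Mapping.single m 1 \<in> I"
      unfolding S single_ind by (rule squares_ideal_closed(5))
    thus ?thesis unfolding Const_def mult_single by simp
  next
    case False
    have "Poly_Mapping.single m (Poly_Mapping.lookup p m) \<in> S2"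
      using False unfolding sq_ideal_iff lookup_single by (auto simp: when_def)
    thus ?thesis unfolding squares_ideal_plus by (rule ideal_plus_mem(1)[OF hideal_sq])
  qed
  hence "(\<Sum>m\<in>Poly_Mapping.keys p. Poly_Mapping.single m (Poly_Mapping.lookup p m)) \<in> I"
    by (intro psc.subspace_sum[OF hideal_subspace[OF hideal_squares]])
  thus ?thesis unfolding sum_single[symmetric] .
qed

text \<open>
  The coefficient of \<open>u\<close> at a squarefree monomial is read off from the product of \<open>u\<close> with the
  complementary monomial, which lies in \<open>I\<close> by \<open>high_degree\<close>.
\<close>

lemma sigma_sq_cancel:
  assumes u: "u \<in> hom d" and d: "d \<le> int r" and su: "sigma * sigma * u \<in> S2"
  shows "u \<in> S2"
  unfolding sq_ideal_iff
proof (intro allI impI)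
  fix a :: "'v \<Rightarrow>\<^sub>0 nat" assume a: "\<forall>v\<in>UNIV. Poly_Mapping.lookup a v < 2"
  show "Poly_Mapping.lookup u a = 0"
  proof (cases "mdeg a = d")
    case False
    thus ?thesis using u unfolding homogeneous_iff_lookup by blast
  next
    case True
    obtain S where S: "a = ind S" using squarefree_ind[of a] a by blast
    let ?m = "Poly_Mapping.single (ind (- S)) (1::'k)"
    have "int (card S) \<le> int r" using True d unfolding S mdeg_ind by simp
    hence "mdeg (ind (- S)) \<ge> int r + 3" unfolding mdeg_ind card_Compl by simp
    hence "?m \<in> I" by (rule high_degree[OF homogeneous_single])
    then obtain g h where gh: "g \<in> S2" "?m = g + sigma * sigma * h"
      unfolding squares_ideal_plus ideal_plus_def by auto
    have "?m * u = u * g + h * (sigma * sigma * u)" unfolding gh(2) by (rule mult_decomp)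
    moreover have "u * g + h * (sigma * sigma * u) \<in> S2"
      by (intro hidealD(2)[OF hideal_sq] sq_ideal_mult gh su)
    ultimately have "?m * u \<in> S2" by (rule ssubst)
    moreover have "\<forall>v\<in>UNIV. Poly_Mapping.lookup (ind (- S) + a) v < 2"
      unfolding S lookup_add lookup_ind by auto
    ultimately have "Poly_Mapping.lookup (?m * u) (ind (- S) + a) = 0" unfolding sq_ideal_iff by blast
    thus ?thesis unfolding lookup_single_mult by simp
  qed
qed

lemma sigma_sq_hom: "sigma * sigma \<in> hom 2"
  using homogeneous_mult[OF homogeneous_sigma homogeneous_sigma] by simp

lemma x_sq_hom: "x * x \<in> hom 2"
  using homogeneous_mult[OF homogeneous_Var homogeneous_Var, of w w] by simp

lemma S2_I: "S2 \<subseteq> I"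
  unfolding squares_ideal_plus using ideal_plus_mem(1)[OF hideal_sq] by blast

text \<open>By \<open>sigma_sq_cancel\<close> in degree \<open>d - 2 <= r\<close>, the ideal
  generated by \<open>sigma * sigma\<close> contributes a full copy of the squarefree monomials of
  degree \<open>d - 2\<close>. The difference of binomial coefficients is written as a sum in
  \<open>nat\<close>.\<close>

lemma R_dim: "\<exists>e. has_qdim psc (hom d) (hom d \<inter> I) e \<and> (d \<le> int r + 2 \<longrightarrow> e + c (d - 2) = c d)"
proof -
  have sq: "has_qdim psc (hom d) (hom d \<inter> S2) (c d)" for d
    using has_qdim_sq[of d, where ?'v = 'v and ?'k = 'k] unfolding card_vars .
  obtain a e where ae: "has_qdim psc (hom d \<inter> I) (hom d \<inter> S2) a" "has_qdim psc (hom d) (hom d \<inter> I) e"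
      "a + e = c d"
  proof (rule psc.has_qdim_split[OF subspace_hom_Int[OF hideal_sq] subspace_hom_Int[OF hideal_squares]
      subspace_homogeneous _ _ sq])
    show "hom d \<inter> S2 \<subseteq> hom d \<inter> I" "hom d \<inter> I \<subseteq> hom d" using S2_I by auto
  qed
  have "a = c (d - 2)" if d: "d \<le> int r + 2"
  proof -
    have "{u \<in> hom (d - 2). sigma * sigma * u \<in> S2} = hom (d - 2) \<inter> S2"
      using sigma_sq_cancel[of _ "d - 2"] d sq_ideal_mult by auto
    moreover have "has_qdim psc (hom (d - 2)) {u \<in> hom (d - 2). sigma * sigma * u \<in> S2} a"
      using ae(1) unfolding squares_ideal_plus has_qdim_ideal_plus[OF hideal_sq sigma_sq_hom] .
    ultimately show ?thesis
      using psc.has_qdim_unique'[OF subspace_hom_Int[OF hideal_sq] _ sq[of "d - 2"]] by simp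
  qed
  thus ?thesis using ae by (intro exI[of _ e]) auto
qed

section \<open>The points of \<open>T\<close> and its Hilbert function\<close>

lemma X_card: "S \<in> X \<Longrightarrow> card S = Suc (card (- S))"
  unfolding card_Compl by simp

text \<open>The two middle binomial coefficients of an odd row are equal, so the number of points
  meets the dimension bound in two consecutive degrees. This starts the descent in
  \<open>tdim_low\<close> for both parities.\<close>

lemma card_X: "card X = c (int r + 1)" "card X = c (int r + 2)"
proof -
  have 1: "card X = (2 * r + 3) choose (r + 2)"
    using n_subsets[of "UNIV :: 'v set" "r + 2"] card_vars by simp
  have "(2 * r + 3) choose (r + 2) = (2 * r + 3) choose (r + 1)"
    using binomial_symmetric[of "r + 2" "2 * r + 3"] by simp
  moreover have "nat (int r + 1) = r + 1" "nat (int r + 2) = r + 2" by auto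
  ultimately show "card X = c (int r + 1)" "card X = c (int r + 2)" using 1 by (simp_all add: cn_def)
qed

lemma ev_T: "S \<in> X \<Longrightarrow> p \<in> T \<Longrightarrow> ev S p = 0"
  by (rule ev_lift_ideal[OF X_card])

lemma I_lift:
  assumes "p \<in> hom d" "p \<in> I"
  obtains u where "u \<in> hom (d - 2)" "p - x * x * u \<in> T"
  using ideal_plus_homogeneous[OF hideal_lift x_sq_hom, of p w d] assms squares_ideal_lift[of w] by auto

text \<open>In degree \<open>r + 2\<close> the products of \<open>ev_separating\<close> separate the
  points. For degree \<open>r + 1\<close> they are multiplied by \<open>x\<close> and then divided
  by \<open>x * x\<close>, which changes the values only by signs.\<close>

lemma ev_points:
  assumes "d = int r + 1 \<or> d = int r + 2"
  shows "\<exists>U. (\<forall>S\<in>X. U S \<in> hom d) \<and> (\<forall>S\<in>X. \<forall>S'\<in>X. ev S' (U S) = 0 \<longleftrightarrow> S \<noteq> S')"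
proof -
  define P where "P S = (\<Prod>v\<in>S. Var v + sigma :: ('v, 'k) mpol)" for S
  have "of_nat (fact 2) \<noteq> (0::'k)" by (rule char) simp
  hence two: "(2::'k) \<noteq> 0" by (simp only: fact_2 of_nat_numeral not_False_eq_True)
  have P: "P S \<in> hom (int r + 2)" if "S \<in> X" for S
  proof -
    have "P S \<in> hom (int (card S))"
      unfolding P_def
      by (rule homogeneous_Prod) (simp_all add: psc.subspace_add[OF subspace_homogeneous homogeneous_Var homogeneous_sigma])
    moreover have "int (card S) = int r + 2" using that by simp
    ultimately show ?thesis by (simp only:)
  qed
  have evP: "ev S' (P S) = 0 \<longleftrightarrow> S \<noteq> S'" if "S \<in> X" "S' \<in> X" for S S'
  proof -
    have "card S = card S'" using that by simp
    hence "ev S' (P S) = (if S = S' then 2 ^ card S else 0)"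
      unfolding P_def by (rule ev_separating[OF X_card[OF that(2)]])
    thus ?thesis using two by (simp del: mem_Collect_eq)
  qed
  show ?thesis
  proof (cases "d = int r + 2")
    case True
    show ?thesis using P evP True by (intro exI[of _ P]) auto
  next
    case False
    hence d: "d = int r + 1" using assms by blast
    \<comment> \<open>The form \<open>x * P S\<close> has degree \<open>r + 3\<close> and so lies in
      \<open>I\<close>; modulo \<open>T\<close> it is therefore \<open>x * x\<close> times a form of
      degree \<open>r + 1\<close>.\<close>
    have "\<forall>S\<in>X. \<exists>u. u \<in> hom d \<and> x * P S - x * x * u \<in> T"
    proof
      fix S :: "'v set" assume S: "S \<in> X"
      have h: "x * P S \<in> hom (int r + 3)" using homogeneous_mult[OF homogeneous_Var P[OF S], of w] by (simp add: add.commute)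
      have "x * P S \<in> I" by (rule high_degree[OF h]) simp
      then obtain u where "u \<in> hom (int r + 3 - 2)" "x * P S - x * x * u \<in> T" by (rule I_lift[OF h])
      moreover have "int r + 3 - 2 = d" using d by simp
      ultimately show "\<exists>u. u \<in> hom d \<and> x * P S - x * x * u \<in> T" by (intro exI[of _ u]) (simp only: simp_thms)
    qed
    from bchoice[OF this] obtain U where UU: "\<forall>S\<in>X. U S \<in> hom d \<and> x * P S - x * x * U S \<in> T" by (rule exE)
    note U = conjunct1[OF bspec[OF UU]] conjunct2[OF bspec[OF UU]]
    have "ev S' (U S) = 0 \<longleftrightarrow> S \<noteq> S'" if S: "S \<in> X" "S' \<in> X" for S S'
    proof -
      have "ev S' (x * P S - x * x * U S) = 0" by (rule ev_T[OF S(2) U(2)[OF S(1)]])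
      moreover have "ev S' (x * P S) = (if w \<in> S' then 1 else - 1) * ev S' (P S)" by (rule ev_Var_mult)
      moreover have "ev S' (x * x * U S) = ev S' (U S)" unfolding mult.assoc by (rule ev_Var_Var_mult)
      ultimately have "ev S' (U S) = (if w \<in> S' then 1 else - 1) * ev S' (P S)"
        unfolding ev_minus by (simp only: right_minus_eq)
      thus ?thesis using evP[OF S] by (simp del: mem_Collect_eq split: if_splits)
    qed
    thus ?thesis using U(1) by (intro exI[of _ U]) auto
  qed
qed

text \<open>Since \<open>I\<close> is \<open>T\<close> plus multiples of \<open>x * x\<close>, the
  dimension in degree \<open>d\<close> is that of \<open>R\<close> plus at most that of
  \<open>T\<close> in degree \<open>d - 2\<close>. The bounds add up to \<open>c d\<close> by
  \<open>R_dim\<close>.\<close>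

lemma tdim_exists: "\<exists>t. has_qdim psc (hom d) (hom d \<inter> T) t \<and> (d \<le> int r + 2 \<longrightarrow> t \<le> c d)"
\<comment> \<open>The shift by 2 makes the measure decrease from \<open>d = 0\<close> to
  \<open>d = -2\<close>, where truncation of \<open>nat\<close> would otherwise hide the
  descent.\<close>
proof (induction "nat (d + 2)" arbitrary: d rule: less_induct)
  case less
  show ?case
  proof (cases "d < 0")
    case True
    have "hom d \<subseteq> hom d \<inter> T"
    proof
      fix p assume p: "p \<in> hom d"
      hence "p = 0" by (rule homogeneous_negative[OF True])
      thus "p \<in> hom d \<inter> T" using p hidealD(1)[OF hideal_lift] by auto
    qed
    from psc.has_qdim_self[OF subspace_hom_Int[OF hideal_lift] this] show ?thesis by auto
  next
    case False
    hence "nat (d - 2 + 2) < nat (d + 2)" by simp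
    from less.hyps[OF this] obtain t where t: "has_qdim psc (hom (d - 2)) (hom (d - 2) \<inter> T) t"
      "d - 2 \<le> int r + 2 \<longrightarrow> t \<le> c (d - 2)" by blast
    let ?V = "{u \<in> hom (d - 2). x * x * u \<in> T}"
    have sV: "psc.subspace ?V"
      by (rule subspace_colon[OF hideal_lift])
    have sub: "hom (d - 2) \<inter> T \<subseteq> ?V" "?V \<subseteq> hom (d - 2)" using hidealD(3)[OF hideal_lift] by auto
    obtain a s where as: "has_qdim psc ?V (hom (d - 2) \<inter> T) a" "has_qdim psc (hom (d - 2)) ?V s" "a + s = t"
      using psc.has_qdim_split[OF subspace_hom_Int[OF hideal_lift] sV subspace_homogeneous sub t(1)] .
    have 1: "has_qdim psc (hom d \<inter> I) (hom d \<inter> T) s"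
      using as(2) unfolding squares_ideal_lift[of w] has_qdim_ideal_plus[OF hideal_lift x_sq_hom] .
    obtain e where e: "has_qdim psc (hom d) (hom d \<inter> I) e" "d \<le> int r + 2 \<Longrightarrow> e + c (d - 2) = c d"
      using R_dim[of d] by blast
    have "T \<subseteq> I" unfolding squares_ideal_lift[of w] using ideal_plus_mem(1)[OF hideal_lift] by blast
    hence "has_qdim psc (hom d) (hom d \<inter> T) (s + e)"
      by (intro psc.has_qdim_trans[OF subspace_hom_Int[OF hideal_lift] subspace_hom_Int[OF hideal_squares] _ _ 1 e(1)]) auto
    moreover have "s + e \<le> c d" if d: "d \<le> int r + 2" using e(2)[OF d] as(3) t(2) d by simp
    ultimately show ?thesis by blast
  qed
qed

definition tdim :: "int \<Rightarrow> nat" where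
  "tdim d = (SOME t. has_qdim psc (hom d) (hom d \<inter> T) t)"

lemma tdim: "has_qdim psc (hom d) (hom d \<inter> T) (tdim d)"
  unfolding tdim_def using tdim_exists[of d] by (intro someI_ex[of "has_qdim psc (hom d) (hom d \<inter> T)"]) blast

lemma tdim_eq: "has_qdim psc (hom d) (hom d \<inter> T) t \<Longrightarrow> tdim d = t"
  using psc.has_qdim_unique'[OF subspace_hom_Int[OF hideal_lift] tdim] .

lemma tdim_le: "d \<le> int r + 2 \<Longrightarrow> tdim d \<le> c d"
  using tdim_exists[of d] tdim_eq by blast

text \<open>Evaluation is onto the functions on the points and factors through the quotient by
  \<open>T\<close>, whose dimension is at most the number of points. Hence it is an isomorphism in
  these two degrees.\<close>

lemma T_points:
  assumes d: "d = int r + 1 \<or> d = int r + 2"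
  shows "tdim d = c d" and "\<And>u. u \<in> hom d \<Longrightarrow> (\<And>S. S \<in> X \<Longrightarrow> ev S u = 0) \<Longrightarrow> u \<in> T"
proof -
  let ?E = "{p \<in> hom d. \<forall>S\<in>X. ev S p = (0::'k)}"
  obtain U where U: "\<And>S. S \<in> X \<Longrightarrow> U S \<in> hom d" "\<And>S S'. S \<in> X \<Longrightarrow> S' \<in> X \<Longrightarrow> ev S' (U S) = 0 \<longleftrightarrow> S \<noteq> S'"
    using ev_points[OF d] by auto
  have E: "has_qdim psc (hom d) ?E (card X)" by (rule has_qdim_points[OF U])
  have cX: "card X = c d" using d card_X by auto
  have sE: "psc.subspace ?E"
    using subspace_homogeneous[of d] by (auto simp: psc.subspace_def ev_add ev_psc)
  have sub: "hom d \<inter> T \<subseteq> ?E" "?E \<subseteq> hom d" using ev_T by auto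
  obtain a b where ab: "has_qdim psc ?E (hom d \<inter> T) a" "has_qdim psc (hom d) ?E b" "a + b = tdim d"
    using psc.has_qdim_split[OF subspace_hom_Int[OF hideal_lift] sE subspace_homogeneous sub tdim] .
  have b: "b = c d" using psc.has_qdim_unique'[OF sE ab(2) E] cX by simp
  moreover have "tdim d \<le> c d" using d by (intro tdim_le) auto
  ultimately have "a = 0" "tdim d = c d" using ab(3) by auto
  thus "tdim d = c d" by simp
  have "?E \<subseteq> hom d \<inter> T" using psc.has_qdim_0D ab(1) \<open>a = 0\<close> by blast
  thus "u \<in> T" if "u \<in> hom d" "\<And>S. S \<in> X \<Longrightarrow> ev S u = 0" for u using that by blast
qed

text \<open>If the bound of \<open>tdim_exists\<close> is attained in degree \<open>d\<close>, every
  inequality in its derivation is an equality. So the bound is attained in degree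
  \<open>d - 2\<close>, and multiplication by \<open>x * x\<close> is injective there.\<close>

lemma tdim_descent:
  assumes d: "d \<le> int r + 2" and t: "tdim d = c d"
  shows "tdim (d - 2) = c (d - 2)" and "\<And>u. u \<in> hom (d - 2) \<Longrightarrow> x * x * u \<in> T \<Longrightarrow> u \<in> T"
proof -
  let ?V = "{u \<in> hom (d - 2). x * x * u \<in> T}"
  have sV: "psc.subspace ?V"
    by (rule subspace_colon[OF hideal_lift])
  have sub: "hom (d - 2) \<inter> T \<subseteq> ?V" "?V \<subseteq> hom (d - 2)" using hidealD(3)[OF hideal_lift] by auto
  obtain a s where as: "has_qdim psc ?V (hom (d - 2) \<inter> T) a" "has_qdim psc (hom (d - 2)) ?V s" "a + s = tdim (d - 2)"
    using psc.has_qdim_split[OF subspace_hom_Int[OF hideal_lift] sV subspace_homogeneous sub tdim] .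
  have 1: "has_qdim psc (hom d \<inter> I) (hom d \<inter> T) s"
    using as(2) unfolding squares_ideal_lift[of w] has_qdim_ideal_plus[OF hideal_lift x_sq_hom] .
  obtain e where e: "has_qdim psc (hom d) (hom d \<inter> I) e" "d \<le> int r + 2 \<Longrightarrow> e + c (d - 2) = c d"
    using R_dim[of d] by blast
  have "T \<subseteq> I" unfolding squares_ideal_lift[of w] using ideal_plus_mem(1)[OF hideal_lift] by blast
  hence "has_qdim psc (hom d) (hom d \<inter> T) (s + e)"
    by (intro psc.has_qdim_trans[OF subspace_hom_Int[OF hideal_lift] subspace_hom_Int[OF hideal_squares] _ _ 1 e(1)]) auto
  hence "s + e = c d" using tdim_eq t by simp
  hence "s = c (d - 2)" using e(2)[OF d] by simp
  moreover have "tdim (d - 2) \<le> c (d - 2)" using d by (intro tdim_le) simp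
  ultimately have a0: "a = 0" "tdim (d - 2) = c (d - 2)" using as(3) by auto
  thus "tdim (d - 2) = c (d - 2)" by simp
  have "?V \<subseteq> hom (d - 2) \<inter> T" using psc.has_qdim_0D as(1) a0(1) by blast
  thus "u \<in> T" if "u \<in> hom (d - 2)" "x * x * u \<in> T" for u using that by blast
qed

lemma tdim_low:
  assumes "d \<le> int r + 2"
  shows "tdim d = c d"
proof -
  \<comment> \<open>Descending from \<open>r + 2\<close> and from \<open>r + 1\<close> in steps of
    two reaches every lower degree.\<close>
  have *: "tdim (int r + 2 - 2 * int k) = c (int r + 2 - 2 * int k) \<and>
      tdim (int r + 1 - 2 * int k) = c (int r + 1 - 2 * int k)" for k
  proof (induction k)
    case 0
    show ?case using T_points(1)[of "int r + 1"] T_points(1)[of "int r + 2"] by simp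
  next
    case (Suc k)
    have "int r + 2 - 2 * int (Suc k) = int r + 2 - 2 * int k - 2"
      "int r + 1 - 2 * int (Suc k) = int r + 1 - 2 * int k - 2" by auto
    thus ?case using Suc tdim_descent(1)[of "int r + 2 - 2 * int k"] tdim_descent(1)[of "int r + 1 - 2 * int k"]
      by simp
  qed
  define m where "m = nat (int r + 2 - d)"
  have m: "d = int r + 2 - int m" using assms by (simp add: m_def)
  have "m = 2 * (m div 2) \<or> m = 2 * (m div 2) + 1" by arith
  hence "int m = 2 * int (m div 2) \<or> int m = 2 * int (m div 2) + 1" by linarith
  hence "d = int r + 2 - 2 * int (m div 2) \<or> d = int r + 1 - 2 * int (m div 2)" using m by linarith
  thus ?thesis using *[of "m div 2"] by metis
qed

text \<open>Above degree \<open>r + 2\<close> a form is \<open>x * x\<close> times another one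
  modulo \<open>T\<close>. Because \<open>x * x\<close> has value 1 at every point, the quotient
  vanishes at the same points, and the degree drops by two.\<close>

lemma ev_zero_T:
  assumes "d \<ge> int r + 1" "u \<in> hom d" "\<And>S. S \<in> X \<Longrightarrow> ev S u = 0"
  shows "u \<in> T"
  using assms
proof (induction "nat d" arbitrary: d u rule: less_induct)
  case less
  show ?case
  proof (cases "d = int r + 1 \<or> d = int r + 2")
    case True
    thus ?thesis using T_points(2)[OF True] less.prems by blast
  next
    case False
    hence d: "d \<ge> int r + 3" using less.prems(1) by linarith
    obtain u' where u': "u' \<in> hom (d - 2)" "u - x * x * u' \<in> T"
      using I_lift[OF less.prems(2) high_degree[OF less.prems(2) d]] .
    have "u' \<in> T"
    proof (rule less.hyps[OF _ _ u'(1)])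
      show "nat (d - 2) < nat d" "d - 2 \<ge> int r + 1" using d by auto
      fix S assume S: "S \<in> X"
      have "ev S (x * x * u') = ev S u'" unfolding mult.assoc by (rule ev_Var_Var_mult)
      thus "ev S u' = 0" using ev_T[OF S u'(2)] less.prems(3)[OF S] by (simp add: ev_minus)
    qed
    hence "x * x * u' \<in> T" by (rule hidealD(3)[OF hideal_lift])
    from hidealD(2)[OF hideal_lift u'(2) this] show ?thesis by (simp only: diff_add_cancel)
  qed
qed

text \<open>Up to degree \<open>r\<close> this is injectivity from the descent. In higher degrees
  membership in \<open>T\<close> is detected by the points, where \<open>x * x\<close> has value
  1.\<close>

lemma x_sq_cancel:
  assumes u: "u \<in> hom d" and t: "x * x * u \<in> T"
  shows "u \<in> T"
proof (cases "d \<le> int r")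
  case True
  thus ?thesis using tdim_descent(2)[of "d + 2" u] tdim_low[of "d + 2"] u t by simp
next
  case False
  have "ev S u = 0" if "S \<in> X" for S
    using ev_T[OF that t] unfolding mult.assoc ev_Var_Var_mult .
  thus ?thesis using ev_zero_T[of d u] False u by simp
qed

lemma x_cancel:
  assumes "x * u \<in> T"
  shows "u \<in> T"
proof -
  have "hcomp d u \<in> T" for d
  proof (rule x_sq_cancel[OF hcomp_homogeneous])
    have "x * hcomp d u = hcomp (d + 1) (x * u)" using hcomp_mult[OF homogeneous_Var, of "d + 1" w u] by simp
    hence "x * hcomp d u \<in> T" using hidealD(4)[OF hideal_lift assms] by simp
    thus "x * x * hcomp d u \<in> T" unfolding mult.assoc by (rule hidealD(3)[OF hideal_lift])
  qed
  hence "(\<Sum>d\<in>mdeg ` Poly_Mapping.keys u. hcomp d u) \<in> T"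
    by (intro psc.subspace_sum[OF hideal_subspace[OF hideal_lift]])
  thus ?thesis by (simp add: sum_hcomp)
qed

lemma x_generates:
  assumes u: "u \<in> hom d" and d: "d \<ge> int r + 2"
  shows "\<exists>u'\<in>hom (d - 1). u - x * u' \<in> T"
proof (cases "d = int r + 2")
  case True
  obtain U where U: "\<And>S. S \<in> X \<Longrightarrow> U S \<in> hom (int r + 1)"
      "\<And>S S'. S \<in> X \<Longrightarrow> S' \<in> X \<Longrightarrow> ev S' (U S) = 0 \<longleftrightarrow> S \<noteq> S'"
    using ev_points[of "int r + 1"] by auto
  \<comment> \<open>The value of \<open>x\<close> at the point \<open>S\<close>. It squares to 1, so
    a form interpolating \<open>s S * ev S u\<close> acquires the values of \<open>u\<close> after
    multiplication by \<open>x\<close>.\<close>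
  define s :: "'v set \<Rightarrow> 'k" where "s S = (if w \<in> S then 1 else - 1)" for S
  define u' where "u' = (\<Sum>S\<in>X. psc (s S * ev S u / ev S (U S)) (U S))"
  have u': "u' \<in> hom (d - 1)"
  proof -
    have "d - 1 = int r + 1" using True by simp
    thus ?thesis unfolding u'_def using U(1)
      by (intro psc.subspace_sum[OF subspace_homogeneous] psc.subspace_scale[OF subspace_homogeneous]) (simp only:)
  qed
  have xu': "x * u' \<in> hom d" using homogeneous_mult[OF homogeneous_Var u', of w] by simp
  have "u - x * u' \<in> T"
  proof (rule T_points(2))
    show "d = int r + 1 \<or> d = int r + 2" using True by simp
    show "u - x * u' \<in> hom d" using psc.subspace_diff[OF subspace_homogeneous u xu'] .
    show "ev S (u - x * u') = 0" if S: "S \<in> X" for S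
    proof -
      have "ev S u' = (\<Sum>S'\<in>X. if S' = S then s S * ev S u else 0)"
        unfolding u'_def ev_sum ev_psc using U(2) S by (intro sum.cong) auto
      also have "\<dots> = s S * ev S u" using S by simp
      finally show ?thesis unfolding ev_minus ev_Var_mult by (simp add: s_def)
    qed
  qed
  thus ?thesis using u' by blast
next
  case False
  hence d3: "d \<ge> int r + 3" using d by linarith
  obtain u' where u': "u' \<in> hom (d - 2)" "u - x * x * u' \<in> T"
    using I_lift[OF u high_degree[OF u d3]] .
  have "x * u' \<in> hom (d - 1)" using homogeneous_mult[OF homogeneous_Var u'(1), of w] by simp
  thus ?thesis using u'(2) unfolding mult.assoc by blast
qed

text \<open>From degree \<open>r + 1\<close> on, multiplication by \<open>x\<close> is bijective
  modulo \<open>T\<close>: injective by \<open>x_cancel\<close> and surjective by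
  \<open>x_generates\<close>.\<close>

lemma tdim_high:
  assumes "d \<ge> int r + 1"
  shows "tdim d = c (int r + 1)"
  using assms
proof (induction d rule: int_ge_induct)
  case base
  show ?case using T_points(1) by simp
next
  case (step d)
  have "has_qdim psc (hom (d + 1)) (hom (d + 1) \<inter> T) (tdim d) \<longleftrightarrow> has_qdim psc (hom d) (hom d \<inter> T) (tdim d)"
  proof (rule has_qdim_image[where f = "\<lambda>u. x * u"])
    show "Vector_Spaces.linear psc psc (\<lambda>u. x * u)"
      by (simp add: Vector_Spaces.linear_iff psc.vector_space_axioms distrib_left psc_def mult.left_commute)
    have xu: "x * u \<in> hom (d + 1)" if "u \<in> hom d" for u
      using homogeneous_mult[OF homogeneous_Var that, of w] by (simp add: add.commute)
    show "x * u \<in> hom (d + 1)" if "u \<in> hom d" for u by (rule xu[OF that])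
    show "x * u \<in> hom (d + 1) \<inter> T \<longleftrightarrow> u \<in> hom d \<inter> T" if "u \<in> hom d" for u
      using xu[OF that] that x_cancel hidealD(3)[OF hideal_lift] by blast
    show "\<exists>u\<in>hom d. y - x * u \<in> hom (d + 1) \<inter> T" if y: "y \<in> hom (d + 1)" for y
    proof -
      obtain u where u: "u \<in> hom (d + 1 - 1)" "y - x * u \<in> T"
        using x_generates[OF y] step.hyps by auto
      have ud: "u \<in> hom d" using u(1) by simp
      have "y - x * u \<in> hom (d + 1)" using psc.subspace_diff[OF subspace_homogeneous y xu[OF ud]] .
      thus ?thesis using u(2) ud by blast
    qed
  qed (simp_all add: subspace_hom_Int hideal_lift subspace_homogeneous)
  hence "tdim (d + 1) = tdim d" using tdim tdim_eq by blast
  thus ?case using step.IH by simp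
qed

lemma tdim_min: "tdim d = c (min d (int r + 1))"
  using tdim_low[of d] tdim_high[of d] by (cases "d \<le> int r + 1") (auto simp: min_def)

text \<open>The two presentations of \<open>R\<close> are compared. The function \<open>a\<close> is
  the strand \<open>j = i + r + 1\<close> of the table of \<open>T\<close>; each such entry appears
  in \<open>R\<close> in its own place and again shifted by 1 and 2. The second conclusion isolates
  \<open>a\<close> in the Euler characteristic of \<open>T\<close>.\<close>

lemma kbetti_squares:
  fixes vs :: "'v list"
  assumes vs: "distinct vs" "set vs = UNIV"
  obtains a where
    "\<And>i j. kbetti vs I i j
       (if j \<le> int (i + r) then (if j = 2 * int i then (2 * r + 4) choose i else 0)
        else if j = int (i + r + 1) then a i + (if i = r + 1 then (2 * r + 3) choose r else 0)
        else if j = int (i + r + 2) \<and> 1 \<le> i then a (i - 1) else 0)"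
    "\<And>k. (- 1) ^ k * int (a k) = (\<Sum>i\<le>2 * r + 3. (- 1) ^ i * int (((2 * r + 3) choose i) *
        c (min (int (k + r + 1) - int i) (int r + 1))))
       - (if even (k + r + 1) \<and> k + r + 1 \<le> 2 * r then (- 1) ^ ((k + r + 1) div 2) * int ((2 * r + 3) choose ((k + r + 1) div 2)) else 0)"
proof -
  let ?n = "2 * r + 3"
  have len: "length vs = ?n" using distinct_card[OF vs(1)] vs(2) card_vars by simp
  have "\<forall>j. \<exists>h. (\<forall>i. kbetti vs T i j (h i)) \<and> (\<forall>i. i > ?n \<longrightarrow> h i = 0) \<and>
      (\<Sum>i\<le>?n. (- 1) ^ i * int (h i)) = (\<Sum>i\<le>?n. (- 1) ^ i * int ((?n choose i) * tdim (j - int i)))"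
  proof
    fix j
    show "\<exists>h. (\<forall>i. kbetti vs T i j (h i)) \<and> (\<forall>i. i > ?n \<longrightarrow> h i = 0) \<and>
      (\<Sum>i\<le>?n. (- 1) ^ i * int (h i)) = (\<Sum>i\<le>?n. (- 1) ^ i * int ((?n choose i) * tdim (j - int i)))"
    proof (rule kbetti_euler[OF hideal_lift tdim, of vs j])
      fix h assume "\<And>i. kbetti vs T i j (h i)" "\<And>i. i > length vs \<Longrightarrow> h i = 0"
        "(\<Sum>i\<le>length vs. (- 1) ^ i * int (h i))
          = (\<Sum>i\<le>length vs. (- 1) ^ i * int ((length vs choose i) * tdim (j - int i)))"
      thus ?thesis unfolding len by (intro exI[of _ h]) simp
    qed
  qed
  from choice[OF this] obtain h where hh: "\<forall>j. (\<forall>i. kbetti vs T i j (h j i)) \<and> (\<forall>i. i > ?n \<longrightarrow> h j i = 0) \<and>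
      (\<Sum>i\<le>?n. (- 1) ^ i * int (h j i)) = (\<Sum>i\<le>?n. (- 1) ^ i * int ((?n choose i) * tdim (j - int i)))"
    by (rule exE)
  have h: "kbetti vs T i j (h j i)" "i > ?n \<Longrightarrow> h j i = 0"
    "(\<Sum>i\<le>?n. (- 1) ^ i * int (h j i)) = (\<Sum>i\<le>?n. (- 1) ^ i * int ((?n choose i) * tdim (j - int i)))" for i j
    using spec[OF hh, of j] by blast+
  have h_high: "h j i = 0" if "j \<ge> int (i + r + 2)" for i j
  proof (rule kbetti_unique[OF hideal_lift h(1)])
    show "kbetti vs T i j 0"
    proof (rule kbetti_vanish[OF hideal_lift])
      show "w \<in> set vs" using vs by simp
      show "x * u \<in> T \<Longrightarrow> u \<in> T" for u by (rule x_cancel)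
      show "\<exists>u'\<in>hom (j - int i - 1). u - x * u' \<in> T" if "u \<in> hom (j - int i)" for u
        using x_generates[OF that] \<open>j \<ge> int (i + r + 2)\<close> by simp
    qed
  qed
  have I_T: "I = ideal_plus T (x * x)" by (rule squares_ideal_lift)
  have R0: "kbetti vs I 0 j (h j 0)" for j
    using quadric.kbetti_quotient_0[OF quadric_single[OF vs(2), of w] hideal_lift h(1)[of 0 j]]
    unfolding quadric_single_f[OF vs(2)] I_T .
  have RS: "kbetti vs I (Suc i) j (h j (Suc i) + h (j - 2) i)" for i j
    unfolding I_T quadric_single_f[OF vs(2), symmetric]
    by (rule quadric.kbetti_quotient_Suc[OF quadric_single[OF vs(2)] hideal_lift _ _ h(1) h(1)])
       (use x_sq_cancel quadric_single_f[OF vs(2), where ?'k = 'k] in auto)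
  interpret q: quadric "\<lambda>_. sigma :: ('v, 'k) mpol" vs
    using homogeneous_sigma vs by unfold_locales
  have qf: "q.f = sigma * sigma" unfolding q.f_def sum_distrib_right ..
  have I_S: "I = ideal_plus S2 q.f" unfolding qf by (rule squares_ideal_plus)
  have sq: "kbetti vs S2 i j (if j = 2 * int i then ?n choose i else 0)" for i j
    using kbetti_sq_ideal[OF vs, of UNIV i j] unfolding card_vars .
  have low: "kbetti vs I i j (if j = 2 * int i then (2 * r + 4) choose i else 0)" if j: "j \<le> int (i + r)" for i j
  proof (cases i)
    case 0
    have "kbetti vs I 0 j (if j = 2 * int 0 then ?n choose 0 else 0)"
      unfolding I_S by (rule q.kbetti_quotient_0[OF hideal_sq sq])
    moreover have "(if j = 2 * int 0 then ?n choose 0 else 0) = (if j = 2 * int i then (2 * r + 4) choose i else 0)"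
      using 0 by simp
    ultimately show ?thesis using 0 by simp
  next
    case (Suc i')
    have "kbetti vs I (Suc i') j ((if j = 2 * int (Suc i') then ?n choose Suc i' else 0) +
        (if j - 2 = 2 * int i' then ?n choose i' else 0))"
      unfolding I_S
    \<comment> \<open>With \<open>j <= i + r\<close> and \<open>i = Suc i'\<close>, both degrees
      \<open>j - i' - 1\<close> and \<open>j - i' - 2\<close> are at most \<open>r\<close>, the
      range of \<open>sigma_sq_cancel\<close>.\<close>
    proof (rule q.kbetti_quotient_Suc[OF hideal_sq _ _ sq sq])
      show "u \<in> S2" if "u \<in> hom (j - int i' - 1)" "q.f * u \<in> S2" for u
        using sigma_sq_cancel[OF that(1)] that(2) j Suc unfolding qf by simp
      show "u \<in> S2" if "u \<in> hom (j - int i' - 2)" "q.f * u \<in> S2" for u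
        using sigma_sq_cancel[OF that(1)] that(2) j Suc unfolding qf by simp
    qed
    moreover have "(if j = 2 * int (Suc i') then ?n choose Suc i' else 0) +
        (if j - 2 = 2 * int i' then ?n choose i' else 0) = (if j = 2 * int i then (2 * r + 4) choose i else 0)"
      using Suc binomial_Suc_Suc[of ?n i'] by (auto simp: numeral_eq_Suc)
    ultimately show ?thesis using Suc by simp
  qed
  \<comment> \<open>Equating the two expressions for the entries of \<open>R\<close> determines
    those of \<open>T\<close> recursively; by Pascal's rule the diagonal of \<open>T\<close> belongs
    to \<open>n\<close> instead of \<open>n + 1\<close> quadrics.\<close>
  have h_low: "h j i = (if j = 2 * int i then ?n choose i else 0)" if "j \<le> int (i + r)" for i j
    using that
  proof (induction i arbitrary: j)
    case 0
    from kbetti_unique[OF hideal_squares R0 low[OF 0]] show ?case by simp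
  next
    case (Suc i)
    have "h j (Suc i) + h (j - 2) i = (if j = 2 * int (Suc i) then (2 * r + 4) choose Suc i else 0)"
      by (rule kbetti_unique[OF hideal_squares RS low[OF Suc.prems]])
    moreover have "h (j - 2) i = (if j - 2 = 2 * int i then ?n choose i else 0)"
      using Suc.prems by (intro Suc.IH) simp
    moreover have "(2 * r + 4) choose Suc i = (?n choose i) + (?n choose Suc i)"
      using binomial_Suc_Suc[of ?n i] by (simp add: numeral_eq_Suc)
    ultimately show ?case by (auto split: if_splits)
  qed
  define a where "a i = h (int (i + r + 1)) i" for i
  show thesis
  proof (rule that[of a])
    fix i j
    show "kbetti vs I i j
       (if j \<le> int (i + r) then (if j = 2 * int i then (2 * r + 4) choose i else 0)
        else if j = int (i + r + 1) then a i + (if i = r + 1 then ?n choose r else 0)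
        else if j = int (i + r + 2) \<and> 1 \<le> i then a (i - 1) else 0)" (is "kbetti vs I i j ?b")
    proof (cases "j \<le> int (i + r)")
      case True
      thus ?thesis using low[OF True] by simp
    next
      case False
      show ?thesis
      proof (cases i)
        case 0
        have "h j 0 = ?b"
        proof (cases "j = int (i + r + 1)")
          case True
          thus ?thesis using 0 by (simp add: a_def)
        next
          case F: False
          hence "h j 0 = 0" using False 0 by (intro h_high) simp
          thus ?thesis using False F 0 by simp
        qed
        thus ?thesis using R0[of j] 0 by simp
      next
        case (Suc i')
        have "h j (Suc i') + h (j - 2) i' = ?b"
        proof (cases "j = int (i + r + 1)")
          case True
          \<comment> \<open>The shifted entry has internal degree \<open>i' + r\<close>. It is on
            the diagonal only for \<open>i' = r\<close>, the source of the summand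
            \<open>n choose r\<close> at \<open>i = r + 1\<close>.\<close>
          have "h (j - 2) i' = (if j - 2 = 2 * int i' then ?n choose i' else 0)"
            using True Suc by (intro h_low) simp
          thus ?thesis using True Suc by (auto simp: a_def)
        next
          case F: False
          hence z: "h j (Suc i') = 0" using False Suc by (intro h_high) simp
          show ?thesis
          proof (cases "j = int (i + r + 2)")
            case True
            hence "j - 2 = int (i' + r + 1)" using Suc by simp
            thus ?thesis using True z Suc by (simp add: a_def)
          next
            case G: False
            hence "h (j - 2) i' = 0" using False F Suc by (intro h_high) simp
            thus ?thesis using False F G z by simp
          qed
        qed
        thus ?thesis using RS[of i' j] Suc by simp
      qed
    qed
  next
    fix k
    let ?j = "k + r + 1"
    \<comment> \<open>In internal degree \<open>k + r + 1\<close> the table of \<open>T\<close> has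
      at most two nonzero entries: the strand entry at \<open>i = k\<close>, and the diagonal entry
      with \<open>2 * i = k + r + 1\<close> and \<open>i <= r\<close>, whose signed value is
      \<open>e\<close>.\<close>
    define e :: int where "e = (if even ?j \<and> ?j \<le> 2 * r then (- 1) ^ (?j div 2) * int (?n choose (?j div 2)) else 0)"
    have e: "e = (- 1) ^ i * int (?n choose i)" if "2 * i = ?j" "i \<le> r" for i
    proof -
      have "?j div 2 = i" "even ?j" "?j \<le> 2 * r" using that by presburger+
      thus ?thesis unfolding e_def by simp
    qed
    have "(- 1) ^ i * int (h (int ?j) i) = (if i = k then (- 1) ^ k * int (a k) else 0) + (if 2 * i = ?j \<and> i \<le> r then e else 0)" for i
    proof -
      consider "i < k" | "i = k" | "i > k" by linarith
      thus ?thesis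
      proof cases
        case 1
        hence "h (int ?j) i = 0" by (intro h_high) simp
        thus ?thesis using 1 by auto
      next
        case 2
        thus ?thesis by (auto simp: a_def)
      next
        case 3
        hence "h (int ?j) i = (if int ?j = 2 * int i then ?n choose i else 0)" by (intro h_low) simp
        moreover have "int ?j = 2 * int i \<longleftrightarrow> 2 * i = ?j" by linarith
        moreover have "i \<le> r" if "2 * i = ?j" using that 3 by linarith
        ultimately show ?thesis using 3 e[of i] by (cases "2 * i = ?j") (simp_all del: of_nat_add)
      qed
    qed
    hence "(\<Sum>i\<le>?n. (- 1) ^ i * int (h (int ?j) i)) = (\<Sum>i\<le>?n. if i = k then (- 1) ^ k * int (a k) else 0)
        + (\<Sum>i\<le>?n. if 2 * i = ?j \<and> i \<le> r then e else 0)"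
      by (simp add: sum.distrib)
    also have "(\<Sum>i\<le>?n. if i = k then (- 1) ^ k * int (a k) else 0) = (- 1) ^ k * int (a k)"
      using h(2)[of k "int ?j"] by (simp add: a_def)
    also have "(\<Sum>i\<le>?n. if 2 * i = ?j \<and> i \<le> r then e else 0) = e"
    proof (cases "even ?j \<and> ?j \<le> 2 * r")
      case True
      have "(\<Sum>i\<le>?n. if 2 * i = ?j \<and> i \<le> r then e else 0) = (\<Sum>i\<le>?n. if i = ?j div 2 then e else 0)"
        using True by (intro sum.cong) auto
      moreover have "?j div 2 \<le> ?n" using True by linarith
      ultimately show ?thesis by simp
    next
      case False
      hence "e = 0" unfolding e_def by (rule if_not_P)
      thus ?thesis by (simp only: if_cancel sum.neutral_const)
    qed
    finally show "(- 1) ^ k * int (a k) = (\<Sum>i\<le>?n. (- 1) ^ i * int ((?n choose i) *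
        c (min (int ?j - int i) (int r + 1)))) - (if even ?j \<and> ?j \<le> 2 * r then (- 1) ^ (?j div 2) * int (?n choose (?j div 2)) else 0)"
      unfolding h(3) tdim_min e_def by simp
  qed
qed

end

section \<open>Free modules and the existence of resolutions\<close>

lemma lookup_map_0: "f 0 = 0 \<Longrightarrow> Poly_Mapping.lookup (Poly_Mapping.map f p) k = f (Poly_Mapping.lookup p k)"
  by (simp add: Poly_Mapping.map.rep_eq when_def)

definition fsc :: "'k \<Rightarrow> (nat \<Rightarrow>\<^sub>0 ('v, 'k::field) mpol) \<Rightarrow> (nat \<Rightarrow>\<^sub>0 ('v, 'k) mpol)" where
  "fsc c = Poly_Mapping.map (psc c)"

definition fmul :: "('v, 'k::field) mpol \<Rightarrow> (nat \<Rightarrow>\<^sub>0 ('v, 'k) mpol) \<Rightarrow> (nat \<Rightarrow>\<^sub>0 ('v, 'k) mpol)" where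
  "fmul q = Poly_Mapping.map ((*) q)"

definition fX :: "'v \<Rightarrow> (nat \<Rightarrow>\<^sub>0 ('v, 'k::field) mpol) \<Rightarrow> (nat \<Rightarrow>\<^sub>0 ('v, 'k) mpol)" where
  "fX v = fmul (Var v)"

definition FG :: "nat set \<Rightarrow> (nat \<Rightarrow> int) \<Rightarrow> int \<Rightarrow> (nat \<Rightarrow>\<^sub>0 ('v::finite, 'k::field) mpol) set" where
  "FG B dg j = {w \<in> supported B. \<forall>b\<in>B. Poly_Mapping.lookup w b \<in> homogeneous (j - dg b)}"

lemma supported_iff: "w \<in> supported B \<longleftrightarrow> (\<forall>b. b \<notin> B \<longrightarrow> Poly_Mapping.lookup w b = 0)"
  unfolding supported_def by (auto simp: in_keys_iff)

lemma lookup_fsc [simp]: "Poly_Mapping.lookup (fsc c w) b = psc c (Poly_Mapping.lookup w b)"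
  unfolding fsc_def by (rule lookup_map_0) (rule psc.scale_zero_right)

lemma lookup_fmul [simp]: "Poly_Mapping.lookup (fmul q w) b = q * Poly_Mapping.lookup w b"
  unfolding fmul_def by (rule lookup_map_0) simp

lemma fsc_fmul: "fsc c w = fmul (Const c) w"
  by (rule poly_mapping_eqI) (simp add: psc_def)

lemma FG_iff:
  "w \<in> FG B dg j \<longleftrightarrow> (\<forall>b. if b \<in> B then Poly_Mapping.lookup w b \<in> homogeneous (j - dg b) else Poly_Mapping.lookup w b = 0)"
  unfolding FG_def mem_Collect_eq supported_iff by auto

lemma FG_lookup: "w \<in> FG B dg j \<Longrightarrow> Poly_Mapping.lookup w b \<in> homogeneous (j - dg b)"
  unfolding FG_iff using poly.zero_G by metis

lemma kspace_fsc: "kspace (fsc :: 'k::field \<Rightarrow> (nat \<Rightarrow>\<^sub>0 ('v, 'k) mpol) \<Rightarrow> _)"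
  by standard (auto intro!: poly_mapping_eqI simp: lookup_add psc.scale_left_distrib psc.scale_right_distrib)

interpretation fsc: kspace "fsc :: 'k::field \<Rightarrow> (nat \<Rightarrow>\<^sub>0 ('v, 'k) mpol) \<Rightarrow> _"
  by (rule kspace_fsc)

lemma graded_ops_FG: "graded_ops (fsc :: 'k::field \<Rightarrow> (nat \<Rightarrow>\<^sub>0 ('v::finite, 'k) mpol) \<Rightarrow> _) fX (FG B dg)"
proof
  show "fX v (a + b) = fX v a + fX v b" for v and a b :: "nat \<Rightarrow>\<^sub>0 ('v, 'k) mpol"
    by (rule poly_mapping_eqI) (simp add: fX_def lookup_add distrib_left)
  show "fX v (fsc c a) = fsc c (fX v a)" for v c and a :: "nat \<Rightarrow>\<^sub>0 ('v, 'k) mpol"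
    by (rule poly_mapping_eqI) (simp add: fX_def psc_mult(2))
  show "fX u (fX v a) = fX v (fX u a)" for u v and a :: "nat \<Rightarrow>\<^sub>0 ('v, 'k) mpol"
    by (rule poly_mapping_eqI) (simp add: fX_def mult.left_commute)
  show "fsc.subspace (FG B dg d :: (nat \<Rightarrow>\<^sub>0 ('v, 'k) mpol) set)" for d
    by (rule fsc.subspaceI)
       (auto simp: FG_iff lookup_add psc.subspace_add[OF subspace_homogeneous] psc.subspace_scale[OF subspace_homogeneous])
  show "fX v a \<in> FG B dg (d + 1)" if "a \<in> FG B dg d" for v and a :: "nat \<Rightarrow>\<^sub>0 ('v, 'k) mpol" and d
    unfolding FG_iff fX_def lookup_fmul
  proof
    fix b
    have "d - dg b + 1 = d + 1 - dg b" by simp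
    with poly.X_G[of "Poly_Mapping.lookup a b" "d - dg b" v] that
    show "if b \<in> B then Var v * Poly_Mapping.lookup a b \<in> homogeneous (d + 1 - dg b) else Var v * Poly_Mapping.lookup a b = 0"
      unfolding FG_iff by (simp split: if_splits)
  qed
qed

lemma lookup_tensor_map:
  assumes s0: "\<And>y. scale 0 y = (0::'n::comm_monoid_add)" and s0': "\<And>q. scale q 0 = 0"
    and K: "finite K" "Poly_Mapping.keys w \<subseteq> K"
  shows "Poly_Mapping.lookup (tensor_map scale D w) c
    = (\<Sum>b\<in>K. scale (Poly_Mapping.lookup (D b) c) (Poly_Mapping.lookup w b))"
proof -
  have "Poly_Mapping.lookup (tensor_map scale D w) c
    = (\<Sum>b\<in>Poly_Mapping.keys w. scale (Poly_Mapping.lookup (D b) c) (Poly_Mapping.lookup w b))"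
    unfolding tensor_map_def lookup_sum by (intro sum.cong refl) (simp add: lookup_map_0 s0)
  also have "\<dots> = (\<Sum>b\<in>K. scale (Poly_Mapping.lookup (D b) c) (Poly_Mapping.lookup w b))"
    using K by (intro sum.mono_neutral_left) (auto simp: in_keys_iff s0')
  finally show ?thesis .
qed

lemma tensor_map_add:
  assumes s0: "\<And>y. scale 0 y = (0::'n::comm_monoid_add)" and s0': "\<And>q. scale q 0 = 0"
    and add: "\<And>q a b. scale q (a + b) = scale q a + scale q b"
  shows "tensor_map scale D (v + w) = tensor_map scale D v + tensor_map scale D w"
proof (rule poly_mapping_eqI)
  fix c
  let ?K = "Poly_Mapping.keys v \<union> Poly_Mapping.keys w"
  have K: "finite ?K" "Poly_Mapping.keys (v + w) \<subseteq> ?K" "Poly_Mapping.keys v \<subseteq> ?K" "Poly_Mapping.keys w \<subseteq> ?K"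
    using keys_add[of v w] by auto
  show "Poly_Mapping.lookup (tensor_map scale D (v + w)) c
    = Poly_Mapping.lookup (tensor_map scale D v + tensor_map scale D w) c"
    unfolding lookup_add
      lookup_tensor_map[of scale, OF s0 s0' K(1,2)] lookup_tensor_map[of scale, OF s0 s0' K(1,3)]
      lookup_tensor_map[of scale, OF s0 s0' K(1,4)]
    by (simp add: lookup_add add sum.distrib)
qed

abbreviation tm :: "(nat \<Rightarrow> (nat \<Rightarrow>\<^sub>0 ('v, 'k::field) mpol)) \<Rightarrow> (nat \<Rightarrow>\<^sub>0 ('v, 'k) mpol) \<Rightarrow> (nat \<Rightarrow>\<^sub>0 ('v, 'k) mpol)" where
  "tm \<equiv> tensor_map (*)"

lemma lookup_tm:
  assumes "finite K" "Poly_Mapping.keys w \<subseteq> K"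
  shows "Poly_Mapping.lookup (tm D w) c = (\<Sum>b\<in>K. Poly_Mapping.lookup (D b) c * Poly_Mapping.lookup w b)"
  by (rule lookup_tensor_map[OF _ _ assms]) simp_all

lemma tm_add: "tm D (v + w) = tm D v + tm D w"
  by (rule tensor_map_add) (simp_all add: distrib_left)

lemma tm_fmul: "tm D (fmul q w) = fmul q (tm D w)"
proof (rule poly_mapping_eqI)
  fix c
  have "Poly_Mapping.keys (fmul q w) \<subseteq> Poly_Mapping.keys w" by (auto simp: in_keys_iff)
  from lookup_tm[OF finite_keys this, of D c] lookup_tm[OF finite_keys subset_refl, of D w c]
  show "Poly_Mapping.lookup (tm D (fmul q w)) c = Poly_Mapping.lookup (fmul q (tm D w)) c"
    unfolding lookup_fmul by (simp only: sum_distrib_left mult.left_commute)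
qed

lemma tm_fX: "tm D (fX v w) = fX v (tm D w)"
  unfolding fX_def by (rule tm_fmul)

lemma tm_zero [simp]: "tm D 0 = 0"
  by (simp add: tensor_map_def)

lemma tm_diff: "tm D (v - w) = tm D v - tm D w"
  using tm_add[of D "v - w" w] by simp

lemma linear_tm: "Vector_Spaces.linear fsc fsc (tm D)"
  by (simp add: Vector_Spaces.linear_iff fsc.vector_space_axioms tm_add fsc_fmul tm_fmul)

lemma tm_single: "tm D (Poly_Mapping.single b 1) = D b"
  by (rule poly_mapping_eqI) (simp add: lookup_tm[of "{b}"])

lemma tm_supported:
  assumes "\<And>b. b \<in> B' \<Longrightarrow> D b \<in> supported B" "w \<in> supported B'"
  shows "tm D w \<in> supported B"
  unfolding supported_iff
proof (intro allI impI)
  fix c assume "c \<notin> B"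
  hence "Poly_Mapping.lookup (D b) c * Poly_Mapping.lookup w b = 0" for b
    using assms unfolding supported_iff by (cases "b \<in> B'") auto
  thus "Poly_Mapping.lookup (tm D w) c = 0" by (simp add: lookup_tm[OF finite_keys subset_refl])
qed

section \<open>Homogeneous components in free modules\<close>

definition gcomp :: "(nat \<Rightarrow> int) \<Rightarrow> int \<Rightarrow> (nat \<Rightarrow>\<^sub>0 ('v::finite, 'k::field) mpol) \<Rightarrow> (nat \<Rightarrow>\<^sub>0 ('v, 'k) mpol)" where
  "gcomp dg j w = (\<Sum>b\<in>Poly_Mapping.keys w. Poly_Mapping.single b (hcomp (j - dg b) (Poly_Mapping.lookup w b)))"

lemma lookup_gcomp [simp]: "Poly_Mapping.lookup (gcomp dg j w) b = hcomp (j - dg b) (Poly_Mapping.lookup w b)"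
  unfolding gcomp_def lookup_sum lookup_single by (simp add: when_def in_keys_iff)

lemma gcomp_FG: "w \<in> supported B \<Longrightarrow> gcomp dg j w \<in> FG B dg j"
  unfolding FG_iff supported_iff by (auto simp: hcomp_homogeneous)

lemma gcomp_same: "w \<in> FG B dg j \<Longrightarrow> gcomp dg j w = w"
  by (rule poly_mapping_eqI) (simp add: hcomp_same[OF FG_lookup])

text \<open>A homogeneous matrix commutes with taking components. Hence a homogeneous element of its
  image has a homogeneous preimage, obtained by taking a component of any preimage.\<close>

lemma tm_gcomp:
  assumes D: "\<And>b. b \<in> B' \<Longrightarrow> D b \<in> supported B"
    and hom: "\<And>b c. b \<in> B' \<Longrightarrow> c \<in> B \<Longrightarrow> Poly_Mapping.lookup (D b) c \<in> homogeneous (dg' b - dg c)"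
    and w: "w \<in> supported B'"
  shows "tm D (gcomp dg' j w) = gcomp dg j (tm D w)"
proof (rule poly_mapping_eqI)
  fix c
  have K: "Poly_Mapping.keys (gcomp dg' j w) \<subseteq> Poly_Mapping.keys w" by (auto simp: in_keys_iff)
  have "Poly_Mapping.lookup (D b) c * hcomp (j - dg' b) (Poly_Mapping.lookup w b)
      = hcomp (j - dg c) (Poly_Mapping.lookup (D b) c * Poly_Mapping.lookup w b)"
    if b: "b \<in> Poly_Mapping.keys w" for b
  proof -
    have bB: "b \<in> B'" using b w unfolding supported_def by blast
    have "Poly_Mapping.lookup (D b) c \<in> homogeneous (dg' b - dg c)"
      using hom[OF bB] D[OF bB] poly.zero_G unfolding supported_iff by (cases "c \<in> B") auto
    from hcomp_mult[OF this, of "j - dg c"] show ?thesis by simp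
  qed
  thus "Poly_Mapping.lookup (tm D (gcomp dg' j w)) c = Poly_Mapping.lookup (gcomp dg j (tm D w)) c"
    unfolding lookup_gcomp lookup_tm[OF finite_keys K] lookup_tm[OF finite_keys subset_refl, of D w] hcomp_sum
    by (intro sum.cong) auto
qed

lemma tm_FG:
  assumes D: "\<And>b. b \<in> B' \<Longrightarrow> D b \<in> supported B"
    and hom: "\<And>b c. b \<in> B' \<Longrightarrow> c \<in> B \<Longrightarrow> Poly_Mapping.lookup (D b) c \<in> homogeneous (dg' b - dg c)"
    and w: "w \<in> FG B' dg' j"
  shows "tm D w \<in> FG B dg j"
proof -
  have s: "w \<in> supported B'" using w unfolding FG_def by blast
  have "tm D (gcomp dg' j w) = gcomp dg j (tm D w)"
    by (rule tm_gcomp[where B' = B' and B = B, OF D hom s])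
  hence "tm D w = gcomp dg j (tm D w)" unfolding gcomp_same[OF w] .
  also have "\<dots> \<in> FG B dg j" by (rule gcomp_FG[OF tm_supported[where D = D, OF D s]])
  finally show ?thesis .
qed

lemma sum_gcomp:
  assumes fin: "finite J" and J: "\<And>b. b \<in> Poly_Mapping.keys w \<Longrightarrow> (\<lambda>m. mdeg m + dg b) ` Poly_Mapping.keys (Poly_Mapping.lookup w b) \<subseteq> J"
  shows "(\<Sum>j\<in>J. gcomp dg j w) = w"
proof (rule poly_mapping_eqI)
  fix b
  have "(\<Sum>j\<in>J. hcomp (j - dg b) (Poly_Mapping.lookup w b)) = (\<Sum>d\<in>(\<lambda>j. j - dg b) ` J. hcomp d (Poly_Mapping.lookup w b))"
    by (subst sum.reindex) (auto simp: inj_on_def)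
  also have "\<dots> = Poly_Mapping.lookup w b"
  proof (rule sum_hcomp)
    show "mdeg ` Poly_Mapping.keys (Poly_Mapping.lookup w b) \<subseteq> (\<lambda>j. j - dg b) ` J"
    proof (cases "b \<in> Poly_Mapping.keys w")
      case True
      show ?thesis
      proof
        fix d assume "d \<in> mdeg ` Poly_Mapping.keys (Poly_Mapping.lookup w b)"
        hence "d + dg b \<in> J" using J[OF True] by auto
        moreover have "d = d + dg b - dg b" by simp
        ultimately show "d \<in> (\<lambda>j. j - dg b) ` J" by (rule rev_image_eqI)
      qed
    next
      case False
      thus ?thesis by (simp add: in_keys_iff)
    qed
  qed (use fin in simp)
  finally show "Poly_Mapping.lookup (\<Sum>j\<in>J. gcomp dg j w) b = Poly_Mapping.lookup w b"
    unfolding lookup_sum lookup_gcomp .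
qed

lemma exists_sum_gcomp: "\<exists>J. finite J \<and> (\<Sum>j\<in>J. gcomp dg j w) = w"
proof -
  let ?J = "\<Union>b\<in>Poly_Mapping.keys w. (\<lambda>m. mdeg m + dg b) ` Poly_Mapping.keys (Poly_Mapping.lookup w b)"
  have "(\<Sum>j\<in>?J. gcomp dg j w) = w" by (rule sum_gcomp) auto
  moreover have "finite ?J" by auto
  ultimately show ?thesis by blast
qed

text \<open>The span of a countable set is an increasing union of spans of finite sets, and each of
  these contains only finitely many elements of \<open>E\<close>.\<close>

lemma (in kspace) countable_independent:
  assumes S: "countable S" and E: "independent E" "E \<subseteq> span S"
  shows "countable E"
proof (cases "S = {}")
  case True
  hence "E \<subseteq> {0}" using E(2) by simp
  thus ?thesis by (rule countable_subset) simp
next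
  case False
  let ?f = "from_nat_into S"
  have ran: "range ?f = S" using range_from_nat_into[OF False S] .
  have "E \<subseteq> (\<Union>n. E \<inter> span (?f ` {..n}))"
  proof
    fix e assume e: "e \<in> E"
    hence "e \<in> span S" using E(2) by blast
    then obtain t u where t: "finite t" "t \<subseteq> S" "e = (\<Sum>a\<in>t. scale (u a) a)" unfolding span_explicit by blast
    have "t \<subseteq> ?f ` UNIV" using t(2) ran by simp
    from finite_subset_image[OF t(1) this] obtain N where N: "finite N" "t = ?f ` N" by blast
    obtain n where "N \<subseteq> {..n}" using N(1) finite_nat_set_iff_bounded_le by (metis atMost_iff subsetI)
    hence "t \<subseteq> ?f ` {..n}" using N(2) by blast
    hence "e \<in> span (?f ` {..n})" unfolding t(3) by (intro span_sum span_scale span_base) blast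
    thus "e \<in> (\<Union>n. E \<inter> span (?f ` {..n}))" using e by blast
  qed
  moreover have "countable (\<Union>n. E \<inter> span (?f ` {..n}))"
  proof (rule countable_UN)
    fix n
    have "independent (E \<inter> span (?f ` {..n}))" using independent_mono[OF E(1)] by blast
    from independent_span_bound[OF _ this, of "?f ` {..n}"]
    show "countable (E \<inter> span (?f ` {..n}))" by (simp add: countable_finite)
  qed simp
  ultimately show ?thesis by (rule countable_subset)
qed

text \<open>The field may be uncountable, but the monomial multiples of the basis elements are
  countable and span over it.\<close>

lemma countable_span_free:
  "\<exists>S. countable S \<and> fsc.span S = (UNIV :: (nat \<Rightarrow>\<^sub>0 ('v::finite, 'k::field) mpol) set)"
proof -
  define g :: "nat \<times> ('v \<Rightarrow>\<^sub>0 nat) \<Rightarrow> (nat \<Rightarrow>\<^sub>0 ('v, 'k) mpol)"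
    where "g = (\<lambda>(b, m). Poly_Mapping.single b (Poly_Mapping.single m 1))"
  have "inj (Poly_Mapping.lookup :: ('v \<Rightarrow>\<^sub>0 nat) \<Rightarrow> _)" by (rule injI) (metis poly_mapping_eq_iff)
  moreover have "countable (range (Poly_Mapping.lookup :: ('v \<Rightarrow>\<^sub>0 nat) \<Rightarrow> _))" by (rule countableI_type)
  ultimately have "countable (UNIV :: ('v \<Rightarrow>\<^sub>0 nat) set)" by (rule countable_image_inj_on[rotated])
  hence "countable (UNIV :: (nat \<times> ('v \<Rightarrow>\<^sub>0 nat)) set)"
    using countable_SIGMA[of "UNIV :: nat set" "\<lambda>_. UNIV :: ('v \<Rightarrow>\<^sub>0 nat) set"] by simp
  hence c: "countable (range g)" by (rule countable_image)
  have "w \<in> fsc.span (range g)" for w :: "nat \<Rightarrow>\<^sub>0 ('v, 'k) mpol"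
  proof -
    have "Poly_Mapping.single b p \<in> fsc.span (range g)" for b p
    proof -
      have "Poly_Mapping.single b p = (\<Sum>m\<in>Poly_Mapping.keys p. fsc (Poly_Mapping.lookup p m) (g (b, m)))"
      proof (rule poly_mapping_eqI)
        fix c
        have "(\<Sum>m\<in>Poly_Mapping.keys p. psc (Poly_Mapping.lookup p m) (Poly_Mapping.single m 1)) = p"
          by (subst (3) sum_single[of p]) (simp add: psc_def Const_def mult_single)
        thus "Poly_Mapping.lookup (Poly_Mapping.single b p) c
          = Poly_Mapping.lookup (\<Sum>m\<in>Poly_Mapping.keys p. fsc (Poly_Mapping.lookup p m) (g (b, m))) c"
          by (simp add: lookup_sum g_def lookup_single when_def)
      qed
      moreover have "(\<Sum>m\<in>Poly_Mapping.keys p. fsc (Poly_Mapping.lookup p m) (g (b, m))) \<in> fsc.span (range g)"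
        by (intro fsc.span_sum fsc.span_scale fsc.span_base) simp
      ultimately show ?thesis by (rule ssubst)
    qed
    hence "(\<Sum>b\<in>Poly_Mapping.keys w. Poly_Mapping.single b (Poly_Mapping.lookup w b)) \<in> fsc.span (range g)"
      by (intro fsc.span_sum)
    moreover have "w = (\<Sum>b\<in>Poly_Mapping.keys w. Poly_Mapping.single b (Poly_Mapping.lookup w b))"
      by (rule poly_mapping_eqI) (simp add: lookup_sum lookup_single when_def in_keys_iff)
    ultimately show ?thesis by (rule ssubst[rotated])
  qed
  thus ?thesis using c by blast
qed

section \<open>Homogeneous covers and the existence of resolutions\<close>

definition graded_submodule :: "nat set \<Rightarrow> (nat \<Rightarrow> int) \<Rightarrow> (nat \<Rightarrow>\<^sub>0 ('v::finite, 'k::field) mpol) set \<Rightarrow> bool" where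
  "graded_submodule B dg K \<longleftrightarrow> K \<subseteq> supported B \<and> 0 \<in> K \<and> (\<forall>v\<in>K. \<forall>w\<in>K. v + w \<in> K) \<and>
     (\<forall>q. \<forall>w\<in>K. fmul q w \<in> K) \<and> (\<forall>j. \<forall>w\<in>K. gcomp dg j w \<in> K)"

text \<open>As generators serve the members of a maximal independent set of homogeneous elements of
  \<open>K\<close>. It is countable, so natural numbers can index it, and its span contains all
  homogeneous components of elements of \<open>K\<close>.\<close>

lemma graded_cover:
  fixes K :: "(nat \<Rightarrow>\<^sub>0 ('v::finite, 'k::field) mpol) set"
  assumes K: "graded_submodule B dg K"
  shows "\<exists>B' dg' D. (\<forall>b\<in>B'. D b \<in> supported B) \<and>
    (\<forall>b\<in>B'. \<forall>c\<in>B. Poly_Mapping.lookup (D b) c \<in> homogeneous (dg' b - dg c)) \<and> tm D ` supported B' = K"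
proof -
  have K1: "K \<subseteq> supported B" "0 \<in> K" "\<And>v w. v \<in> K \<Longrightarrow> w \<in> K \<Longrightarrow> v + w \<in> K" "\<And>q w. w \<in> K \<Longrightarrow> fmul q w \<in> K"
    "\<And>j w. w \<in> K \<Longrightarrow> gcomp dg j w \<in> K" using K unfolding graded_submodule_def by auto
  define H where "H = {w \<in> K. \<exists>d. w \<in> FG B dg d}"
  obtain E where E: "E \<subseteq> H" "fsc.independent E" "H \<subseteq> fsc.span E"
    using fsc.maximal_independent_subset[of H] by metis
  obtain S :: "(nat \<Rightarrow>\<^sub>0 ('v, 'k) mpol) set" where S: "countable S" "fsc.span S = UNIV"
    using countable_span_free by metis
  have cE: "countable E" by (rule fsc.countable_independent[OF S(1) E(2)]) (simp add: S(2))
  define ix where "ix = to_nat_on E"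
  define D where "D = from_nat_into E"
  have Dix: "D (ix e) = e" if "e \<in> E" for e unfolding D_def ix_def by (rule from_nat_into_to_nat_on[OF cE that])
  define B' where "B' = ix ` E"
  have DE: "D b \<in> E" if "b \<in> B'" for b using that Dix unfolding B'_def by auto
  define dg' where "dg' b = (SOME d. D b \<in> FG B dg d)" for b
  have Dh: "D b \<in> FG B dg (dg' b)" if "b \<in> B'" for b
  proof -
    have "\<exists>d. D b \<in> FG B dg d" using DE[OF that] E(1) unfolding H_def by blast
    thus ?thesis unfolding dg'_def by (rule someI_ex)
  qed
  have DK: "D b \<in> K" if "b \<in> B'" for b using DE[OF that] E(1) unfolding H_def by blast
  have sub: "fsc.subspace (supported B' :: (nat \<Rightarrow>\<^sub>0 ('v, 'k) mpol) set)"
    by (rule fsc.subspaceI) (auto simp: supported_iff lookup_add)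
  have "tm D ` supported B' = K"
  proof
    show "tm D ` supported B' \<subseteq> K"
    proof
      fix y assume "y \<in> tm D ` supported B'"
      then obtain w where w: "w \<in> supported B'" "y = tm D w" by blast
      have "y = (\<Sum>b\<in>Poly_Mapping.keys w. fmul (Poly_Mapping.lookup w b) (D b))"
        unfolding w(2) by (rule poly_mapping_eqI) (simp add: lookup_tm[OF finite_keys subset_refl] lookup_sum mult.commute)
      moreover have "fsc.subspace K" using K1 by (intro fsc.subspaceI) (auto simp: fsc_fmul)
      hence "(\<Sum>b\<in>Poly_Mapping.keys w. fmul (Poly_Mapping.lookup w b) (D b)) \<in> K"
        using w(1) unfolding supported_def by (intro fsc.subspace_sum K1(4) DK) auto
      ultimately show "y \<in> K" by simp
    qed
    have img: "fsc.subspace (tm D ` supported B')"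
      by (rule module_hom.subspace_image[OF _ sub]) (simp add: module_hom_iff_linear linear_tm)
    have "E \<subseteq> tm D ` supported B'"
    proof
      fix e assume e: "e \<in> E"
      have "Poly_Mapping.single (ix e) 1 \<in> (supported B' :: (nat \<Rightarrow>\<^sub>0 ('v, 'k) mpol) set)"
        using e unfolding supported_iff lookup_single B'_def by (auto simp: when_def)
      moreover have "e = tm D (Poly_Mapping.single (ix e) 1)" using Dix[OF e] tm_single by metis
      ultimately show "e \<in> tm D ` supported B'" by blast
    qed
    hence spanE: "fsc.span E \<subseteq> tm D ` supported B'" by (rule fsc.span_minimal[OF _ img])
    show "K \<subseteq> tm D ` supported B'"
    proof
      fix y assume y: "y \<in> K"
      obtain J where J: "finite J" "(\<Sum>j\<in>J. gcomp dg j y) = y" using exists_sum_gcomp by blast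
      have "gcomp dg j y \<in> H" for j
        unfolding H_def using K1(5)[OF y] gcomp_FG K1(1) y by blast
      hence "gcomp dg j y \<in> fsc.span E" for j using E(3) by blast
      hence "(\<Sum>j\<in>J. gcomp dg j y) \<in> fsc.span E" by (intro fsc.span_sum)
      thus "y \<in> tm D ` supported B'" using J(2) spanE by auto
    qed
  qed
  moreover have "\<forall>b\<in>B'. D b \<in> supported B" using DK K1(1) by blast
  moreover have "\<forall>b\<in>B'. \<forall>c\<in>B. Poly_Mapping.lookup (D b) c \<in> homogeneous (dg' b - dg c)"
    using Dh FG_lookup by blast
  ultimately show ?thesis by blast
qed

lemma graded_submodule_kernel:
  assumes D: "\<And>b. b \<in> B' \<Longrightarrow> D b \<in> supported B"
    and hom: "\<And>b c. b \<in> B' \<Longrightarrow> c \<in> B \<Longrightarrow> Poly_Mapping.lookup (D b) c \<in> homogeneous (dg' b - dg c)"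
  shows "graded_submodule B' dg' {w \<in> supported B'. tm D w = 0}"
proof -
  have z: "gcomp dg j 0 = 0" for j by (rule poly_mapping_eqI) simp
  have "gcomp dg' j w \<in> supported B'" if "w \<in> supported B'" for j w
    using gcomp_FG[OF that] unfolding FG_def by blast
  moreover have "tm D (gcomp dg' j w) = 0" if "w \<in> supported B'" "tm D w = 0" for j w
    using tm_gcomp[where B' = B' and D = D and B = B and dg' = dg' and dg = dg, OF D hom that(1)] that(2) z by simp
  moreover have "fmul q w \<in> supported B'" if "w \<in> supported B'" for q w using that by (auto simp: supported_iff)
  moreover have "fmul q 0 = 0" for q by (rule poly_mapping_eqI) simp
  ultimately show ?thesis
    unfolding graded_submodule_def by (auto simp: tm_add tm_fmul supported_iff lookup_add)
qed

lemma squares_class_eq_0: "squares_class p = 0 \<longleftrightarrow> p \<in> squares_ideal"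
  unfolding zero_squares_ring_def squares_ring.abs_eq_iff by simp

lemma squares_scale_class: "squares_scale q (squares_class p) = squares_class (q * p)"
  by (simp add: squares_scale_def times_squares_ring.abs_eq)

lemma squares_class_add: "squares_class (p + q) = squares_class p + squares_class q"
  by (simp add: plus_squares_ring.abs_eq)

text \<open>A resolution is built by dependent choice, covering at each stage the kernel left by the
  preceding one.\<close>

lemma resolution_exists:
  "\<exists>F. graded_free_resolution (squares_scale :: ('v::finite, 'k::field) mpol \<Rightarrow> ('v, 'k) squares_ring \<Rightarrow> _) squares_gr F"
proof -
  \<comment> \<open>A state consists of a basis, its degrees, the submodule that the next stage must
    cover, and the differential into the preceding stage. The initial state is \<open>Q\<close> with
    one generator of degree 0 and the ideal as submodule to be covered.\<close>
  let ?Q = "\<lambda>(B, dg, K, D) (B', dg', K', D').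
     (\<forall>b\<in>B'. D' b \<in> supported B) \<and>
     (\<forall>b\<in>B'. \<forall>c\<in>B. Poly_Mapping.lookup (D' b) c \<in> homogeneous (dg' b - dg c)) \<and> tm D' ` supported B' = K \<and>
     K' = {w \<in> supported B'. tm D' w = (0 :: nat \<Rightarrow>\<^sub>0 ('v, 'k) mpol)}"
  let ?K0 = "{w \<in> supported {0}. Poly_Mapping.lookup w 0 \<in> (squares_ideal :: ('v, 'k) mpol set)}"
  let ?P = "\<lambda>n (B, dg, K, D :: nat \<Rightarrow> (nat \<Rightarrow>\<^sub>0 ('v, 'k) mpol)). graded_submodule B dg K \<and>
     (n = 0 \<longrightarrow> B = {0} \<and> dg = (\<lambda>_. 0) \<and> K = ?K0)"
  have "graded_submodule {0} (\<lambda>_. 0) ?K0"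
    unfolding graded_submodule_def
    using hidealD[OF hideal_squares[where ?'v = 'v and ?'k = 'k]]
    by (auto simp: supported_iff lookup_add)
  hence base: "\<exists>s. ?P 0 s" by auto
  have step: "\<exists>s'. ?P (Suc n) s' \<and> ?Q s s'" if "?P n s" for n s
  proof -
    obtain B dg K D where s: "s = (B, dg, K, D)" by (rule prod_cases4)
    have "graded_submodule B dg K" using that unfolding s by simp
    from graded_cover[OF this] obtain B' dg' D' where B': "\<forall>b\<in>B'. D' b \<in> supported B"
      "\<forall>b\<in>B'. \<forall>c\<in>B. Poly_Mapping.lookup (D' b) c \<in> homogeneous (dg' b - dg c)" "tm D' ` supported B' = K" by (elim exE conjE)
    have "graded_submodule B' dg' {w \<in> supported B'. tm D' w = 0}"
      using B' by (intro graded_submodule_kernel[of B' D' B dg' dg]) auto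
    thus ?thesis unfolding s using B' by (intro exI[of _ "(B', dg', {w \<in> supported B'. tm D' w = 0}, D')"]) simp
  qed
  have "\<exists>f. \<forall>n. ?P n (f n) \<and> ?Q (f n) (f (Suc n))"
    by (rule dependent_nat_choice[of ?P "\<lambda>_. ?Q", OF base step])
  then obtain f where ff: "\<forall>n. ?P n (f n) \<and> ?Q (f n) (f (Suc n))" by (rule exE)
  note f = conjunct1[OF spec[OF ff]] conjunct2[OF spec[OF ff]]
  define B where "B n = fst (f n)" for n
  define dg where "dg n = fst (snd (f n))" for n
  define K where "K n = fst (snd (snd (f n)))" for n
  define D where "D n = snd (snd (snd (f n)))" for n
  have fn: "f n = (B n, dg n, K n, D n)" for n by (simp add: B_def dg_def K_def D_def)
  have f0: "B 0 = {0}" "dg 0 = (\<lambda>_. 0)" "K 0 = ?K0" using f(1)[of 0] unfolding fn by auto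
  have Q1: "D (Suc n) b \<in> supported (B n)" if "b \<in> B (Suc n)" for n b using f(2)[of n] that unfolding fn by simp
  have Q2: "Poly_Mapping.lookup (D (Suc n) b) c \<in> homogeneous (dg (Suc n) b - dg n c)"
    if "b \<in> B (Suc n)" "c \<in> B n" for n b c using f(2)[of n] that unfolding fn by simp
  have Q3: "tm (D (Suc n)) ` supported (B (Suc n)) = K n" for n using f(2)[of n] unfolding fn by simp
  have Q4: "K (Suc n) = {w \<in> supported (B (Suc n)). tm (D (Suc n)) w = 0}" for n using f(2)[of n] unfolding fn by simp
  let ?F = "\<lparr>basis = B, bdeg = dg, diff = (\<lambda>n. D (Suc n)), aug = (\<lambda>_. squares_class 1 :: ('v, 'k) squares_ring)\<rparr>"
  have aug: "aug_map squares_scale (\<lambda>_. squares_class 1) w = squares_class (Poly_Mapping.lookup w 0)"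
    if w: "w \<in> supported {0}" for w :: "nat \<Rightarrow>\<^sub>0 ('v, 'k) mpol"
  proof (cases "Poly_Mapping.lookup w 0 = 0")
    case True
    have "w = 0"
    proof (rule poly_mapping_eqI)
      fix b show "Poly_Mapping.lookup w b = Poly_Mapping.lookup 0 b"
        using w True unfolding supported_iff by (cases "b = 0") auto
    qed
    thus ?thesis by (simp add: aug_map_def zero_squares_ring_def)
  next
    case False
    hence "Poly_Mapping.keys w = {0}" using w unfolding supported_def by (auto simp: in_keys_iff)
    thus ?thesis by (simp add: aug_map_def squares_scale_class)
  qed
  have "graded_free_resolution squares_scale squares_gr ?F"
    unfolding graded_free_resolution_def
  proof (intro conjI allI ballI)
    show "aug ?F b \<in> squares_gr (bdeg ?F 0 b)" for b
    proof -
      have "(1 :: ('v, 'k) mpol) \<in> homogeneous 0" using homogeneous_Const[of 1] by (simp add: Const_def)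
      hence "squares_class 1 \<in> (squares_class ` homogeneous 0 :: ('v, 'k) squares_ring set)" by (rule imageI)
      thus ?thesis by (simp add: f0 squares_gr_def)
    qed
    show "diff ?F i b \<in> supported (basis ?F i)" if "b \<in> basis ?F (Suc i)" for i b
      using Q1 that by simp
    show "Poly_Mapping.lookup (diff ?F i b) c \<in> homogeneous (bdeg ?F (Suc i) b - bdeg ?F i c)"
      if "b \<in> basis ?F (Suc i)" "c \<in> basis ?F i" for i b c
      using Q2 that by simp
    show "aug_map squares_scale (aug ?F) ` supported (basis ?F 0) = UNIV"
    proof -
      have "y \<in> aug_map squares_scale (\<lambda>_. squares_class 1) ` supported {0}" for y :: "('v, 'k) squares_ring"
      proof (induct y rule: squares_ring.abs_induct)
        case (1 p)
        have "(Poly_Mapping.single 0 p :: nat \<Rightarrow>\<^sub>0 ('v, 'k) mpol) \<in> supported {0}" by (auto simp: supported_iff lookup_single when_def)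
        moreover from aug[OF this] have "squares_class p = aug_map squares_scale (\<lambda>_. squares_class 1) (Poly_Mapping.single 0 p)"
          by simp
        ultimately show ?case by (rule rev_image_eqI)
      qed
      thus ?thesis using f0 by auto
    qed
    show "tensor_map (*) (diff ?F 0) ` supported (basis ?F 1)
       = {w \<in> supported (basis ?F 0). aug_map squares_scale (aug ?F) w = 0}"
      using Q3[of 0] aug by (auto simp: f0 squares_class_eq_0)
    show "tensor_map (*) (diff ?F (Suc i)) ` supported (basis ?F (Suc (Suc i)))
       = {w \<in> supported (basis ?F (Suc i)). tensor_map (*) (diff ?F i) w = 0}" for i
      using Q3[of "Suc i"] Q4[of i] by simp
  qed
  thus ?thesis by blast
qed

section \<open>Balancing Tor\<close>

lemma keys_finite_support_lists:
  fixes c :: "bool list \<Rightarrow> (nat \<Rightarrow>\<^sub>0 'a::zero)"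
  assumes "\<And>s. length s \<noteq> n \<Longrightarrow> c s = 0"
  shows "finite (\<Union>s. Poly_Mapping.keys (c s))"
proof -
  have "(\<Union>s. Poly_Mapping.keys (c s)) \<subseteq> (\<Union>s\<in>{s. set s \<subseteq> UNIV \<and> length s = n}. Poly_Mapping.keys (c s))"
  proof
    fix b assume "b \<in> (\<Union>s. Poly_Mapping.keys (c s))"
    then obtain s where s: "b \<in> Poly_Mapping.keys (c s)" by blast
    hence "length s = n" using assms[of s] by (cases "length s = n") auto
    thus "b \<in> (\<Union>s\<in>{s. set s \<subseteq> UNIV \<and> length s = n}. Poly_Mapping.keys (c s))" using s by blast
  qed
  moreover have "finite (\<Union>s\<in>{s :: bool list. set s \<subseteq> UNIV \<and> length s = n}. Poly_Mapping.keys (c s))"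
    using finite_lists_length_eq[of "UNIV :: bool set" n] by simp
  ultimately show ?thesis by (rule finite_subset)
qed

lemma koszul_fX_lookup:
  "Poly_Mapping.lookup (koszul fX vs c s) b = koszul vmul vs (\<lambda>s. Poly_Mapping.lookup (c s) b) s"
  by (rule koszul_map[symmetric]) (simp_all add: lookup_add fX_def)

text \<open>A free module is a direct sum of shifted copies of \<open>Q\<close>, so boundaries are
  found in each coordinate. Chains live on finitely many lists, hence only finitely many coordinates
  occur and the solutions sum to a finitely supported one.\<close>

lemma free_lift:
  fixes c :: "bool list \<Rightarrow> (nat \<Rightarrow>\<^sub>0 ('v::finite, 'k::field) mpol)"
  assumes c: "c \<in> kchains (FG B dg) (length vs) i j"
    and lift: "\<And>b. b \<in> B \<Longrightarrow> \<exists>e\<in>kchains homogeneous (length vs) i' (j - dg b).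
      koszul vmul vs e = (\<lambda>s. Poly_Mapping.lookup (c s) b)"
  shows "\<exists>e\<in>kchains (FG B dg) (length vs) i' j. koszul fX vs e = c"
proof -
  interpret F: graded_ops "fsc :: 'k \<Rightarrow> (nat \<Rightarrow>\<^sub>0 ('v, 'k) mpol) \<Rightarrow> _" fX "FG B dg" by (rule graded_ops_FG)
  define B0 where "B0 = (\<Union>s. Poly_Mapping.keys (c s))"
  have fin: "finite B0" unfolding B0_def
    by (rule keys_finite_support_lists[of "length vs"]) (use chains_D2[OF c] in blast)
  have B0: "B0 \<subseteq> B"
  proof
    fix b assume "b \<in> B0"
    then obtain s where s: "b \<in> Poly_Mapping.keys (c s)" unfolding B0_def by blast
    show "b \<in> B" using F.chains_range[OF c, of s] s unfolding FG_def supported_def by blast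
  qed
  have "\<forall>b\<in>B. \<exists>e. e \<in> kchains homogeneous (length vs) i' (j - dg b) \<and>
      koszul vmul vs e = (\<lambda>s. Poly_Mapping.lookup (c s) b)" using lift by blast
  from bchoice[OF this] obtain e where ee: "\<forall>b\<in>B. e b \<in> kchains homogeneous (length vs) i' (j - dg b) \<and>
      koszul vmul vs (e b) = (\<lambda>s. Poly_Mapping.lookup (c s) b)" by (rule exE)
  note e = conjunct1[OF bspec[OF ee]] conjunct2[OF bspec[OF ee]]
  define E where "E s = (\<Sum>b\<in>B0. Poly_Mapping.single b (e b s))" for s
  have lE: "Poly_Mapping.lookup (E s) b = (if b \<in> B0 then e b s else 0)" for s b
    unfolding E_def lookup_sum lookup_single using fin by (simp add: when_def)
  have "E \<in> kchains (FG B dg) (length vs) i' j"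
  proof (rule chains_I)
    fix s :: "bool list" assume s: "length s = length vs" "count_list s True = i'"
    show "E s \<in> FG B dg (j - int i')"
      unfolding FG_iff lE
    proof
      fix b
      have "j - dg b - int i' = j - int i' - dg b" by simp
      hence "b \<in> B \<Longrightarrow> e b s \<in> homogeneous (j - int i' - dg b)" using chains_D1[OF e(1) s, of b] by presburger
      thus "if b \<in> B then (if b \<in> B0 then e b s else 0) \<in> homogeneous (j - int i' - dg b)
        else (if b \<in> B0 then e b s else 0) = 0"
        using B0 by (cases "b \<in> B0") (auto simp: poly.zero_G)
    qed
  next
    fix s assume "length s \<noteq> length vs \<or> count_list s True \<noteq> i'"
    hence "b \<in> B0 \<Longrightarrow> e b s = 0" for b using chains_D2[OF e(1)] B0 by blast
    thus "E s = 0" unfolding E_def by simp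
  qed
  moreover have "koszul fX vs E = c"
  proof (rule ext, rule poly_mapping_eqI)
    fix s b
    show "Poly_Mapping.lookup (koszul fX vs E s) b = Poly_Mapping.lookup (c s) b"
    proof (cases "b \<in> B0")
      case True
      hence "(\<lambda>s. Poly_Mapping.lookup (E s) b) = e b" by (intro ext) (simp add: lE)
      thus ?thesis unfolding koszul_fX_lookup using e(2)[of b] True B0 by (auto dest: fun_cong)
    next
      case False
      hence "(\<lambda>s. Poly_Mapping.lookup (E s) b) = (\<lambda>s. 0)" by (intro ext) (simp add: lE)
      moreover have "Poly_Mapping.lookup (c s) b = 0" using False unfolding B0_def by (simp add: in_keys_iff)
      ultimately show ?thesis unfolding koszul_fX_lookup by simp
    qed
  qed
  ultimately show ?thesis by blast
qed

lemma FG_coordinate: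
  assumes "c \<in> kchains (FG B dg) n i j"
  shows "(\<lambda>s. Poly_Mapping.lookup (c s) b) \<in> kchains homogeneous n i (j - dg b)"
proof (rule chains_I)
  fix s :: "bool list" assume "length s = n" "count_list s True = i"
  from FG_lookup[OF chains_D1[OF assms this], of b]
  show "Poly_Mapping.lookup (c s) b \<in> homogeneous (j - dg b - int i)" by (simp add: algebra_simps)
qed (use chains_D2[OF assms] in simp)

lemma free_exact:
  fixes c :: "bool list \<Rightarrow> (nat \<Rightarrow>\<^sub>0 ('v::finite, 'k::field) mpol)"
  assumes vs: "distinct vs" and c: "c \<in> kchains (FG B dg) (length vs) (Suc i) j" and z: "koszul fX vs c = 0"
  shows "\<exists>e\<in>kchains (FG B dg) (length vs) (Suc (Suc i)) j. koszul fX vs e = c"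
proof (rule free_lift[OF c])
  fix b
  have "koszul vmul vs (\<lambda>s. Poly_Mapping.lookup (c s) b) = 0"
    by (rule ext) (simp add: koszul_fX_lookup[symmetric] z)
  from koszul_poly_exact(2)[OF vs FG_coordinate[OF c] this]
  show "\<exists>e\<in>kchains homogeneous (length vs) (Suc (Suc i)) (j - dg b). koszul vmul vs e = (\<lambda>s. Poly_Mapping.lookup (c s) b)" .
qed

text \<open>The image of \<open>w\<close> in the tensor product with the residue field.\<close>

definition cpart :: "(nat \<Rightarrow>\<^sub>0 ('v, 'k::field) mpol) \<Rightarrow> (nat \<Rightarrow>\<^sub>0 'k)" where
  "cpart w = Poly_Mapping.map (\<lambda>q. Poly_Mapping.lookup q 0) w"

lemma lookup_cpart [simp]: "Poly_Mapping.lookup (cpart w) b = Poly_Mapping.lookup (Poly_Mapping.lookup w b) 0"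
  unfolding cpart_def by (rule lookup_map_0) simp

lemma cpart_eq_0:
  fixes w :: "nat \<Rightarrow>\<^sub>0 ('v, 'k::field) mpol"
  shows "cpart w = 0 \<longleftrightarrow> (\<forall>b. Poly_Mapping.lookup w b \<in> vars_ideal UNIV)"
proof -
  have "p \<in> vars_ideal UNIV \<longleftrightarrow> Poly_Mapping.lookup p 0 = 0" for p :: "('v, 'k) mpol"
  proof -
    have "(\<forall>v\<in>UNIV. Poly_Mapping.lookup a v = 0) \<longleftrightarrow> a = 0" for a :: "'v \<Rightarrow>\<^sub>0 nat"
      by (auto intro: poly_mapping_eqI)
    thus ?thesis unfolding vars_ideal_iff by simp
  qed
  thus ?thesis by (simp add: poly_mapping_eq_iff fun_eq_iff)
qed

text \<open>An element of the module viewed as a Koszul chain of homological degree 0; the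
  all-\<open>False\<close> list stands for the empty wedge.\<close>

definition spike :: "nat \<Rightarrow> 'm \<Rightarrow> bool list \<Rightarrow> 'm::zero" where
  "spike n w = (\<lambda>s. if s = replicate n False then w else 0)"

lemma spike_chains: "(\<And>d. 0 \<in> G d) \<Longrightarrow> w \<in> G j \<Longrightarrow> spike n w \<in> kchains G n 0 j"
  unfolding spike_def by (intro chains_I) (auto simp: count_list_0_iff)

lemma chains_0_spike:
  assumes c: "c \<in> kchains G n 0 j"
  shows "c = spike n (c (replicate n False))"
proof
  fix s show "c s = spike n (c (replicate n False)) s"
  proof (cases "s = replicate n False")
    case False
    hence "length s \<noteq> n \<or> count_list s True \<noteq> 0"
      by (metis (full_types) count_list_0_iff replicate_eqI)
    from chains_D2[OF c this] show ?thesis using False by (simp add: spike_def)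
  qed (simp add: spike_def)
qed

text \<open>Every coordinate of \<open>w\<close> lies in the ideal of the variables. Together with
  \<open>cpart_koszul\<close> this identifies the Koszul homology of a free module in degree 0 with
  its reduction.\<close>

lemma free_boundary_0:
  fixes w :: "nat \<Rightarrow>\<^sub>0 ('v::finite, 'k::field) mpol"
  assumes vs: "distinct vs" "set vs = UNIV" and w: "w \<in> FG B dg j" "cpart w = 0"
  shows "\<exists>e\<in>kchains (FG B dg) (length vs) 1 j. koszul fX vs e = spike (length vs) w"
proof -
  interpret F: graded_ops "fsc :: 'k \<Rightarrow> (nat \<Rightarrow>\<^sub>0 ('v, 'k) mpol) \<Rightarrow> _" fX "FG B dg" by (rule graded_ops_FG)
  have c: "spike (length vs) w \<in> kchains (FG B dg) (length vs) 0 j" by (rule spike_chains) (rule F.zero_G w(1))+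
  show ?thesis
  proof (rule free_lift[OF c])
    fix b
    have "Poly_Mapping.lookup (spike (length vs) w s) b \<in> vars_ideal (set vs)" for s
      using w(2) unfolding cpart_eq_0 vs(2) spike_def by simp
    from koszul_poly_exact(1)[OF vs(1) FG_coordinate[OF c] this]
    show "\<exists>e\<in>kchains homogeneous (length vs) 1 (j - dg b).
      koszul vmul vs e = (\<lambda>s. Poly_Mapping.lookup (spike (length vs) w s) b)" .
  qed
qed

lemma cpart_koszul: "set vs = UNIV \<Longrightarrow> cpart (koszul fX vs e s) = 0"
  unfolding cpart_eq_0 koszul_fX_lookup using koszul_vars_ideal by metis

lemma linear_spike: "kspace sc \<Longrightarrow> Vector_Spaces.linear sc (pw sc) (spike n)"
proof -
  assume "kspace sc"
  then interpret kspace sc .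
  show ?thesis
    using kspace_pw unfolding kspace_def
    by (simp add: Vector_Spaces.linear_iff vector_space_axioms fun_eq_iff spike_def scale_zero_right)
qed

abbreviation ksc :: "'k \<Rightarrow> (nat \<Rightarrow>\<^sub>0 'k) \<Rightarrow> (nat \<Rightarrow>\<^sub>0 'k::field)" where
  "ksc \<equiv> \<lambda>c. Poly_Mapping.map ((*) c)"

lemma lookup_ksc: "Poly_Mapping.lookup (ksc c w) b = c * Poly_Mapping.lookup w b"
  by (rule lookup_map_0) simp

lemma kspace_ksc: "kspace (ksc :: 'k::field \<Rightarrow> _)"
  by standard (auto intro!: poly_mapping_eqI simp: lookup_ksc lookup_add algebra_simps)

interpretation ksc: kspace "ksc :: 'k::field \<Rightarrow> _"
  by (rule kspace_ksc)

lemma cpart_add: "cpart (v + w) = cpart v + cpart w"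
  by (rule poly_mapping_eqI) (simp add: lookup_add)

lemma cpart_diff: "cpart (v - w) = cpart v - cpart w"
  by (rule poly_mapping_eqI) (simp add: lookup_minus)

lemma linear_cpart: "Vector_Spaces.linear fsc ksc (cpart :: (nat \<Rightarrow>\<^sub>0 ('v, 'k::field) mpol) \<Rightarrow> _)"
proof -
  have "cpart (fsc c w) = ksc c (cpart w)" for c and w :: "nat \<Rightarrow>\<^sub>0 ('v, 'k) mpol"
    by (rule poly_mapping_eqI) (simp add: lookup_ksc)
  thus ?thesis by (simp add: Vector_Spaces.linear_iff fsc.vector_space_axioms ksc.vector_space_axioms cpart_add)
qed

abbreviation rm :: "(nat \<Rightarrow> (nat \<Rightarrow>\<^sub>0 ('v, 'k::field) mpol)) \<Rightarrow> (nat \<Rightarrow>\<^sub>0 'k) \<Rightarrow> (nat \<Rightarrow>\<^sub>0 'k)" where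
  "rm \<equiv> tensor_map residue_scale"

lemma residue_scale_0: "residue_scale 0 y = 0" "residue_scale q 0 = 0"
  by (simp_all add: residue_scale_def)

lemma lookup_mult_0: "Poly_Mapping.lookup (p * q) 0 = Poly_Mapping.lookup p 0 * Poly_Mapping.lookup (q :: ('v, 'k::field) mpol) 0"
  using module.scale_scale[OF module_residue, of p q 1] by (simp add: residue_scale_def)

lemma rm_cpart: "rm D (cpart w) = cpart (tm D w)"
proof (rule poly_mapping_eqI)
  fix c
  have K: "Poly_Mapping.keys (cpart w) \<subseteq> Poly_Mapping.keys w" by (auto simp: in_keys_iff)
  have "Poly_Mapping.lookup (rm D (cpart w)) c = (\<Sum>b\<in>Poly_Mapping.keys w.
      residue_scale (Poly_Mapping.lookup (D b) c) (Poly_Mapping.lookup (cpart w) b))"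
    by (rule lookup_tensor_map) (rule residue_scale_0 finite_keys K)+
  also have "\<dots> = Poly_Mapping.lookup (cpart (tm D w)) c"
    by (simp add: lookup_tm[OF finite_keys subset_refl] lookup_sum lookup_mult_0 residue_scale_def)
  finally show "Poly_Mapping.lookup (rm D (cpart w)) c = Poly_Mapping.lookup (cpart (tm D w)) c" .
qed

definition const_lift :: "(nat \<Rightarrow>\<^sub>0 'k) \<Rightarrow> (nat \<Rightarrow>\<^sub>0 ('v, 'k::field) mpol)" where
  "const_lift y = Poly_Mapping.map Const y"

lemma lookup_const_lift: "Poly_Mapping.lookup (const_lift y) b = Const (Poly_Mapping.lookup y b)"
  unfolding const_lift_def by (rule lookup_map_0) (simp add: Const_def)

lemma cpart_const_lift: "cpart (const_lift y) = y"
  by (rule poly_mapping_eqI) (simp add: lookup_const_lift Const_def)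

section \<open>Dimension shifting along the syzygies of a resolution\<close>

locale resolution =
  fixes F :: "('v::finite, 'k::field, 'm::ab_group_add) free_resolution"
    and scale :: "('v, 'k) mpol \<Rightarrow> 'm \<Rightarrow> 'm" and gr :: "int \<Rightarrow> 'm set" and vs :: "'v list"
  assumes F: "graded_free_resolution scale gr F" and vs: "distinct vs" "set vs = UNIV"
begin

abbreviation G :: "nat \<Rightarrow> int \<Rightarrow> (nat \<Rightarrow>\<^sub>0 ('v, 'k) mpol) set" where
  "G i \<equiv> FG (basis F i) (bdeg F i)"

abbreviation \<open>T i \<equiv> tm (diff F i)\<close>

text \<open>Defined as an image, and a kernel by exactness. The quotient of the free module of index
  \<open>p\<close> by \<open>Ker p\<close> is the resolved module for \<open>p = 0\<close> and is
  isomorphic to \<open>Ker (p - 1)\<close> otherwise.\<close>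

definition Ker :: "nat \<Rightarrow> (nat \<Rightarrow>\<^sub>0 ('v, 'k) mpol) set" where
  "Ker p = T p ` supported (basis F (Suc p))"

lemmas F_parts = F[unfolded graded_free_resolution_def]

lemma D_supported: "b \<in> basis F (Suc i) \<Longrightarrow> diff F i b \<in> supported (basis F i)"
  by (rule bspec[OF spec[OF conjunct1[OF conjunct2[OF F_parts]]]])

lemma D_homogeneous: "b \<in> basis F (Suc i) \<Longrightarrow> c \<in> basis F i \<Longrightarrow>
    Poly_Mapping.lookup (diff F i b) c \<in> homogeneous (bdeg F (Suc i) b - bdeg F i c)"
  by (rule bspec[OF bspec[OF spec[OF conjunct1[OF conjunct2[OF conjunct2[OF F_parts]]]]]])

lemma Ker_Suc: "Ker (Suc p) = {w \<in> supported (basis F (Suc p)). T p w = 0}"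
  unfolding Ker_def
  by (rule spec[OF conjunct2[OF conjunct2[OF conjunct2[OF conjunct2[OF conjunct2[OF F_parts]]]]]])

lemma Ker_0: "Ker 0 = {w \<in> supported (basis F 0). aug_map scale (aug F) w = 0}"
  unfolding Ker_def One_nat_def[symmetric]
  by (rule conjunct1[OF conjunct2[OF conjunct2[OF conjunct2[OF conjunct2[OF F_parts]]]]])

lemma T_G: "w \<in> G (Suc i) j \<Longrightarrow> T i w \<in> G i j"
  by (rule tm_FG[OF D_supported D_homogeneous])

sublocale Fg: graded_ops "fsc :: 'k \<Rightarrow> (nat \<Rightarrow>\<^sub>0 ('v, 'k) mpol) \<Rightarrow> _" fX "G i" for i
  by (rule graded_ops_FG)

lemma Ker_lift:
  assumes "y \<in> G p j" "y \<in> Ker p"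
  shows "\<exists>w\<in>G (Suc p) j. T p w = y"
proof -
  obtain w where w: "w \<in> supported (basis F (Suc p))" "y = T p w" using assms(2) unfolding Ker_def by blast
  have "T p (gcomp (bdeg F (Suc p)) j w) = gcomp (bdeg F p) j (T p w)"
    by (rule tm_gcomp[OF D_supported D_homogeneous w(1)])
  also have "\<dots> = y" using gcomp_same[OF assms(1)] w(2) by simp
  finally show ?thesis using gcomp_FG[OF w(1)] by blast
qed

lemma Ker_stable: "Fg.stable (Ker p)"
  unfolding Fg.stable_def
proof (intro conjI allI ballI)
  have s: "fsc.subspace (supported B :: (nat \<Rightarrow>\<^sub>0 ('v, 'k) mpol) set)" for B
    by (rule fsc.subspaceI) (auto simp: supported_iff lookup_add)
  show "fsc.subspace (Ker p)" unfolding Ker_def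
    by (rule module_hom.subspace_image[OF _ s]) (simp add: module_hom_iff_linear linear_tm)
  show "fX v a \<in> Ker p" if a: "a \<in> Ker p" for v a
  proof -
    obtain w where w: "w \<in> supported (basis F (Suc p))" "a = T p w" using a unfolding Ker_def by blast
    have "fX v w \<in> supported (basis F (Suc p))" using w(1) by (auto simp: supported_iff fX_def)
    moreover have "fX v a = T p (fX v w)" using w(2) tm_fX by metis
    ultimately show ?thesis unfolding Ker_def by blast
  qed
qed

definition Hk :: "nat \<Rightarrow> nat \<Rightarrow> int \<Rightarrow> nat \<Rightarrow> bool" where
  "Hk p i j h \<longleftrightarrow> has_qdim (pw fsc) (koszul_cycles fX (G p) (Ker p) vs i j) (koszul_bounds fX (G p) (Ker p) vs i j) h"

text \<open>The connecting isomorphism lowers the degree by one and passes to the Koszul homology of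
  \<open>Ker p\<close>, which is the quotient of the next free module by
  \<open>Ker (Suc p)\<close>.\<close>

lemma Hk_shift: "Hk p (Suc (Suc i)) j h \<longleftrightarrow> Hk (Suc p) (Suc i) j h"
proof -
  have "has_qdim (pw fsc) (koszul_cycles fX (\<lambda>d. G p d \<inter> Ker p) {0} vs (Suc i) j)
      (koszul_bounds fX (\<lambda>d. G p d \<inter> Ker p) {0} vs (Suc i) j) h \<longleftrightarrow> Hk p (Suc (Suc i)) j h"
    unfolding Hk_def
    by (rule Fg.koszul_shift_Suc[OF Ker_stable]) (rule free_exact[OF vs(1)])
  moreover have "has_qdim (pw fsc) (koszul_cycles fX (\<lambda>d. G p d \<inter> Ker p) {0} vs (Suc i) j)
      (koszul_bounds fX (\<lambda>d. G p d \<inter> Ker p) {0} vs (Suc i) j) h \<longleftrightarrow> Hk (Suc p) (Suc i) j h"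
    unfolding Hk_def
  proof (rule Fg.koszul_quotient_map[OF Fg.graded_ops_Int[OF Ker_stable] Ker_stable linear_tm tm_fX])
    show "T p a \<in> G p d \<inter> Ker p" if "a \<in> G (Suc p) d" for d a
      using T_G[OF that] that unfolding Ker_def FG_def by blast
    show "\<exists>a\<in>G (Suc p) d. T p a = b" if "b \<in> G p d \<inter> Ker p" for d b
      using Ker_lift that by blast
    show "T p a = 0 \<longleftrightarrow> a \<in> Ker (Suc p)" if "a \<in> G (Suc p) d" for d a
      using that unfolding Ker_Suc FG_def by blast
  qed
  ultimately show ?thesis by blast
qed

lemma Hk_shifts: "Hk 0 (Suc p) j h \<longleftrightarrow> Hk p 1 j h"
proof -
  have "Hk q (Suc p) j h \<longleftrightarrow> Hk (q + p) 1 j h" for q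
    by (induction p arbitrary: q) (simp_all add: Hk_shift)
  from this[of 0] show ?thesis by simp
qed

text \<open>With \<open>W\<close>, the preimages in the free module of the cycles and boundaries of
  its tensor product with the residue field. Tor can then be compared with Koszul homology inside
  the resolution.\<close>

definition V :: "nat \<Rightarrow> int \<Rightarrow> (nat \<Rightarrow>\<^sub>0 ('v, 'k) mpol) set" where
  "V q j = {w \<in> G q j. case q of 0 \<Rightarrow> True | Suc p \<Rightarrow> cpart (T p w) = 0}"

definition W :: "nat \<Rightarrow> int \<Rightarrow> (nat \<Rightarrow>\<^sub>0 ('v, 'k) mpol) set" where
  "W q j = {w \<in> G q j. \<exists>u\<in>G (Suc q) j. cpart (w - T q u) = 0}"

lemma V_subspace: "fsc.subspace (V q j)"
proof -
  have z: "cpart 0 = (0 :: nat \<Rightarrow>\<^sub>0 'k)" by (rule poly_mapping_eqI) simp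
  have s: "cpart (fsc c w) = ksc c (cpart w)" for c and w :: "nat \<Rightarrow>\<^sub>0 ('v, 'k) mpol"
    by (rule poly_mapping_eqI) (simp add: lookup_ksc)
  have "T p (fsc c w) = fsc c (T p w)" for p c w by (simp add: fsc_fmul tm_fmul)
  thus ?thesis
    unfolding V_def
    by (intro fsc.subspaceI)
       (auto simp: Fg.G_subspace[THEN fsc.subspace_add] Fg.G_subspace[THEN fsc.subspace_scale] z s cpart_add tm_add
         split: nat.splits)
qed

lemma boundaries_subspace: "ksc.subspace (tensor_boundaries F residue_scale residue_gr q j)"
proof -
  have "ksc.subspace (tensor_part F residue_gr (Suc q) j :: (nat \<Rightarrow>\<^sub>0 'k) set)"
    by (rule ksc.subspaceI)
       (auto simp: tensor_part_def supported_iff residue_gr_def lookup_add lookup_ksc split: if_splits, metis add_0)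
  moreover have "Vector_Spaces.linear ksc ksc (rm (diff F q))"
  proof -
    have "rm D (ksc c w) = ksc c (rm D w)" for D :: "nat \<Rightarrow> (nat \<Rightarrow>\<^sub>0 ('v, 'k) mpol)" and c w
    proof -
      have "ksc c w = cpart (fsc c (const_lift w) :: nat \<Rightarrow>\<^sub>0 ('v, 'k) mpol)"
        by (rule poly_mapping_eqI) (simp add: lookup_ksc lookup_const_lift Const_def)
      hence "rm D (ksc c w) = cpart (fsc c (tm D (const_lift w)))"
        by (simp only: rm_cpart fsc_fmul tm_fmul)
      also have "\<dots> = ksc c (rm D (cpart (const_lift w :: nat \<Rightarrow>\<^sub>0 ('v, 'k) mpol)))"
        unfolding rm_cpart by (rule poly_mapping_eqI) (simp add: lookup_ksc)
      finally show ?thesis unfolding cpart_const_lift .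
    qed
    moreover have "rm D (v + w) = rm D v + rm D w" for D :: "nat \<Rightarrow> (nat \<Rightarrow>\<^sub>0 ('v, 'k) mpol)" and v w
      by (rule tensor_map_add) (simp_all add: residue_scale_def distrib_left)
    ultimately show ?thesis by (simp add: Vector_Spaces.linear_iff ksc.vector_space_axioms)
  qed
  ultimately show ?thesis
    unfolding tensor_boundaries_def by (intro module_hom.subspace_image) (simp_all add: module_hom_iff_linear)
qed

lemma cpart_part: "w \<in> G q j \<Longrightarrow> cpart w \<in> tensor_part F residue_gr q j"
proof -
  assume w: "w \<in> G q j"
  have "cpart w \<in> supported (basis F q)" using w unfolding FG_iff supported_iff by simp
  moreover have "Poly_Mapping.lookup (cpart w) b \<in> residue_gr (j - bdeg F q b)" for b
    using FG_lookup[OF w, of b] unfolding homogeneous_iff_lookup residue_gr_def by auto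
  ultimately show ?thesis unfolding tensor_part_def by blast
qed

lemma const_lift_part: "y \<in> tensor_part F residue_gr q j \<Longrightarrow> const_lift y \<in> G q j"
proof -
  assume y: "y \<in> tensor_part F residue_gr q j"
  show ?thesis
    unfolding FG_iff lookup_const_lift
  proof
    fix b
    show "if b \<in> basis F q then Const (Poly_Mapping.lookup y b) \<in> homogeneous (j - bdeg F q b)
      else Const (Poly_Mapping.lookup y b) = (0 :: ('v, 'k) mpol)"
    proof (cases "b \<in> basis F q")
      case True
      hence "Poly_Mapping.lookup y b \<in> residue_gr (j - bdeg F q b)" using y unfolding tensor_part_def by blast
      thus ?thesis using True homogeneous_Const[of "Poly_Mapping.lookup y b"] poly.zero_G
        by (cases "j - bdeg F q b = 0") (auto simp: residue_gr_def Const_def)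
    next
      case False
      hence "Poly_Mapping.lookup y b = 0" using y unfolding tensor_part_def supported_iff by blast
      thus ?thesis using False by (simp add: Const_def)
    qed
  qed
qed

lemma tor_V: "has_qdim ksc (tensor_cycles F residue_scale residue_gr q j) (tensor_boundaries F residue_scale residue_gr q j) h
    \<longleftrightarrow> has_qdim fsc (V q j) (W q j) h"
proof (rule has_qdim_image[OF linear_cpart boundaries_subspace _ V_subspace])
  fix w assume w: "w \<in> V q j"
  have wG: "w \<in> G q j" using w unfolding V_def by blast
  show "cpart w \<in> tensor_cycles F residue_scale residue_gr q j"
    using cpart_part[OF wG] w unfolding tensor_cycles_def V_def by (auto simp: rm_cpart split: nat.splits)
  show "cpart w \<in> tensor_boundaries F residue_scale residue_gr q j \<longleftrightarrow> w \<in> W q j"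
  proof
    assume "cpart w \<in> tensor_boundaries F residue_scale residue_gr q j"
    then obtain y where y: "y \<in> tensor_part F residue_gr (Suc q) j" "cpart w = rm (diff F q) y"
      unfolding tensor_boundaries_def by blast
    have "cpart w = cpart (T q (const_lift y))"
      using y(2) rm_cpart[of "diff F q" "const_lift y"] unfolding cpart_const_lift by simp
    hence "cpart (w - T q (const_lift y)) = 0" by (simp add: cpart_diff)
    thus "w \<in> W q j" unfolding W_def using wG const_lift_part[OF y(1)] by blast
  next
    assume "w \<in> W q j"
    then obtain u where u: "u \<in> G (Suc q) j" "cpart (w - T q u) = 0" unfolding W_def by blast
    hence "cpart w = rm (diff F q) (cpart u)" by (simp add: cpart_diff rm_cpart)
    thus "cpart w \<in> tensor_boundaries F residue_scale residue_gr q j"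
      unfolding tensor_boundaries_def using cpart_part[OF u(1)] by blast
  qed
next
  fix y assume y: "y \<in> tensor_cycles F residue_scale residue_gr q j"
  have yp: "y \<in> tensor_part F residue_gr q j" using y unfolding tensor_cycles_def by blast
  have "const_lift y \<in> V q j"
    unfolding V_def
  proof (intro CollectI conjI)
    show "const_lift y \<in> G q j" by (rule const_lift_part[OF yp])
    show "case q of 0 \<Rightarrow> True | Suc p \<Rightarrow> cpart (T p (const_lift y)) = 0"
      using y unfolding tensor_cycles_def
      by (auto simp: rm_cpart[symmetric] cpart_const_lift split: nat.splits)
  qed
  moreover have "y - cpart (const_lift y :: nat \<Rightarrow>\<^sub>0 ('v, 'k) mpol) \<in> tensor_boundaries F residue_scale residue_gr q j"
    unfolding cpart_const_lift using ksc.subspace_0[OF boundaries_subspace] by simp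
  ultimately show "\<exists>v\<in>V q j. y - cpart v \<in> tensor_boundaries F residue_scale residue_gr q j" by blast
qed

text \<open>Both sides are the degree \<open>j\<close> part of the module modulo the variables: on
  the Koszul side a class in degree 0 is taken modulo \<open>Ker 0\<close> and modulo the Koszul
  boundaries, which are the elements without constant part.\<close>

lemma Hk_V0: "Hk 0 0 j h \<longleftrightarrow> has_qdim fsc (V 0 j) (W 0 j) h"
  unfolding Hk_def
proof (rule has_qdim_image[OF linear_spike[OF kspace_fsc] Fg.subspace_bounds[OF Ker_stable] _ V_subspace])
  let ?n = "length vs" and ?z = "replicate (length vs) False"
  fix w assume "w \<in> V 0 j"
  hence w: "w \<in> G 0 j" unfolding V_def by blast
  have sp: "spike ?n w \<in> kchains (G 0) ?n 0 j" by (rule spike_chains) (rule Fg.zero_G w)+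
  show "spike ?n w \<in> koszul_cycles fX (G 0) (Ker 0) vs 0 j"
    unfolding koszul_cycles_def using sp Fg.koszul_chains_0[OF sp] Ker_stable[of 0]
    unfolding Fg.stable_def by (simp add: fsc.subspace_0)
  show "spike ?n w \<in> koszul_bounds fX (G 0) (Ker 0) vs 0 j \<longleftrightarrow> w \<in> W 0 j"
  proof
    assume "spike ?n w \<in> koszul_bounds fX (G 0) (Ker 0) vs 0 j"
    from Fg.koszul_boundsD[OF this] obtain e g where eg: "e \<in> kchains (G 0) ?n (Suc 0) j"
      "g \<in> kchains (G 0) ?n 0 j" "\<forall>s. g s \<in> Ker 0" "spike ?n w = koszul fX vs e + g" by (elim exE conjE)
    have "g ?z \<in> G 0 j" using Fg.chains_range[OF eg(2), of ?z] by simp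
    then obtain u where u: "u \<in> G 1 j" "T 0 u = g ?z" using Ker_lift[of "g ?z" 0 j] eg(3) by auto
    have "w = koszul fX vs e ?z + g ?z" using fun_cong[OF eg(4), of ?z] by (simp add: spike_def)
    hence "cpart (w - T 0 u) = 0" using u(2) cpart_koszul[OF vs(2)] by simp
    thus "w \<in> W 0 j" unfolding W_def using w u(1) by auto
  next
    assume "w \<in> W 0 j"
    then obtain u where u: "u \<in> G (Suc 0) j" "cpart (w - T 0 u) = 0" unfolding W_def by blast
    have "w - T 0 u \<in> G 0 j" using w T_G[OF u(1)] fsc.subspace_diff[OF Fg.G_subspace] by blast
    from free_boundary_0[OF vs this u(2)] obtain e where e: "e \<in> kchains (G 0) ?n 1 j"
      "koszul fX vs e = spike ?n (w - T 0 u)" by blast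
    have "T 0 u \<in> Ker 0" using u(1) unfolding Ker_def FG_def by blast
    moreover have sp: "spike ?n (T 0 u) \<in> kchains (G 0) ?n 0 j"
      by (rule spike_chains) (rule Fg.zero_G T_G[OF u(1)])+
    moreover have "0 \<in> Ker 0" using Ker_stable[of 0] unfolding Fg.stable_def by (simp add: fsc.subspace_0)
    ultimately have "koszul fX vs e + spike ?n (T 0 u) \<in> koszul_bounds fX (G 0) (Ker 0) vs 0 j"
      using e(1) sp
      by (intro Fg.koszul_boundsI) (auto simp: spike_def)
    moreover have "koszul fX vs e + spike ?n (T 0 u) = spike ?n w"
      unfolding e(2) by (rule ext) (simp add: spike_def)
    ultimately show "spike ?n w \<in> koszul_bounds fX (G 0) (Ker 0) vs 0 j" by simp
  qed
next
  let ?n = "length vs" and ?z = "replicate (length vs) False"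
  fix c assume "c \<in> koszul_cycles fX (G 0) (Ker 0) vs 0 j"
  hence c: "c \<in> kchains (G 0) ?n 0 j" unfolding koszul_cycles_def by blast
  have "c ?z \<in> V 0 j" unfolding V_def using Fg.chains_range[OF c, of ?z] by simp
  moreover have "c - spike ?n (c ?z) \<in> koszul_bounds fX (G 0) (Ker 0) vs 0 j"
    using chains_0_spike[OF c] Fg.ch.subspace_0[OF Fg.subspace_bounds[OF Ker_stable]] by simp
  ultimately show "\<exists>v\<in>V 0 j. c - spike ?n v \<in> koszul_bounds fX (G 0) (Ker 0) vs 0 j" by blast
qed

text \<open>By \<open>koszul_shift\<close>, the first Koszul homology of the quotient by
  \<open>Ker p\<close> consists of elements of \<open>Ker p\<close> that bound in the free module,
  i.e. the kernel of the map from \<open>Ker p\<close> to the free module after reduction modulo the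
  variables. The differential \<open>T p\<close> carries \<open>V (Suc p) j\<close> onto these
  elements.\<close>

lemma Hk_V_Suc: "Hk p 1 j h \<longleftrightarrow> has_qdim fsc (V (Suc p) j) (W (Suc p) j) h"
proof -
  let ?n = "length vs" and ?z = "replicate (length vs) False"
  let ?G' = "\<lambda>d. G p d \<inter> Ker p"
  let ?C = "koszul_cycles fX ?G' {0} vs 0 j \<inter> koszul fX vs ` kchains (G p) ?n (Suc 0) j"
  let ?B = "koszul_bounds fX ?G' {0} vs 0 j"
  interpret G': graded_ops "fsc :: 'k \<Rightarrow> (nat \<Rightarrow>\<^sub>0 ('v, 'k) mpol) \<Rightarrow> _" fX ?G'
    by (rule Fg.graded_ops_Int[OF Ker_stable])
  have "has_qdim (pw fsc) ?C ?B h \<longleftrightarrow> Hk p (Suc 0) j h"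
    unfolding Hk_def by (rule Fg.koszul_shift[OF Ker_stable]) (rule free_exact[OF vs(1)])
  moreover have "has_qdim (pw fsc) ?C ?B h \<longleftrightarrow> has_qdim fsc (V (Suc p) j) (W (Suc p) j) h"
  proof (rule has_qdim_image[where f = "\<lambda>w. spike ?n (T p w)"])
    have "spike ?n (T p (a + b)) = spike ?n (T p a) + spike ?n (T p b)" for a b
      by (rule ext) (simp add: spike_def tm_add)
    moreover have "spike ?n (T p (fsc c a)) = pw fsc c (spike ?n (T p a))" for c a
      by (rule ext) (auto simp add: spike_def fsc_fmul tm_fmul intro!: poly_mapping_eqI)
    ultimately show "Vector_Spaces.linear fsc (pw fsc) (\<lambda>w. spike ?n (T p w))"
      by (simp add: Vector_Spaces.linear_iff fsc.vector_space_axioms Fg.ch.vector_space_axioms)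
    show "Fg.ch.subspace ?B" by (rule G'.subspace_bounds[OF Fg.stable_0])
    show "fsc.subspace (V (Suc p) j)" by (rule V_subspace)
  next
    fix w assume wV: "w \<in> V (Suc p) j"
    hence w: "w \<in> G (Suc p) j" "cpart (T p w) = 0" unfolding V_def by auto
    have Tw: "T p w \<in> ?G' j" using T_G[OF w(1)] w(1) unfolding Ker_def FG_def by blast
    have sp: "spike ?n (T p w) \<in> kchains ?G' ?n 0 j" by (rule spike_chains) (rule G'.zero_G Tw)+
    show "spike ?n (T p w) \<in> ?C"
    proof
      show "spike ?n (T p w) \<in> koszul_cycles fX ?G' {0} vs 0 j"
        unfolding koszul_cycles_def using sp G'.koszul_chains_0[OF sp] by simp
      show "spike ?n (T p w) \<in> koszul fX vs ` kchains (G p) ?n (Suc 0) j"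
        using free_boundary_0[OF vs T_G[OF w(1)] w(2)] by force
    qed
    show "spike ?n (T p w) \<in> ?B \<longleftrightarrow> w \<in> W (Suc p) j"
    proof
      assume "spike ?n (T p w) \<in> ?B"
      then obtain e' where e': "e' \<in> kchains ?G' ?n (Suc 0) j" "spike ?n (T p w) = koszul fX vs e'"
        unfolding G'.koszul_bounds_0 by blast
      \<comment> \<open>A boundary inside \<open>Ker p\<close> lifts along \<open>T p\<close>. Its
        lift differs from \<open>w\<close> by an element of \<open>Ker (Suc p)\<close>, which is an
        image of \<open>T (Suc p)\<close>.\<close>
      have "\<exists>e\<in>kchains (G (Suc p)) ?n (Suc 0) j. \<forall>s. T p (e s) = e' s"
      proof (rule chain_lift)
        show "\<exists>a\<in>G (Suc p) (j - int (Suc 0)). T p a = e' s"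
          if "length s = ?n" "count_list s True = Suc 0" for s
          using Ker_lift chains_D1[OF e'(1) that] by blast
        show "T p 0 = e' s" if "length s \<noteq> ?n \<or> count_list s True \<noteq> Suc 0" for s
          using chains_D2[OF e'(1) that] by simp
      qed
      then obtain e where e: "e \<in> kchains (G (Suc p)) ?n (Suc 0) j" "\<And>s. T p (e s) = e' s" by blast
      let ?w0 = "koszul fX vs e ?z"
      have "T p ?w0 = koszul fX vs (\<lambda>s. T p (e s)) ?z"
        by (rule koszul_map[symmetric]) (simp_all add: tm_add tm_fX)
      also have "\<dots> = T p w" using fun_cong[OF e'(2), of ?z] by (simp add: e(2) spike_def)
      finally have "T p (w - ?w0) = 0" by (simp add: tm_diff)
      moreover have w0: "?w0 \<in> G (Suc p) j" using Fg.koszul_range[OF e(1), of ?z] by simp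
      have d: "w - ?w0 \<in> G (Suc p) j" by (rule fsc.subspace_diff[OF Fg.G_subspace w(1) w0])
      ultimately have "w - ?w0 \<in> Ker (Suc p)" unfolding Ker_Suc FG_def by blast
      from Ker_lift[OF d this] obtain u where u: "u \<in> G (Suc (Suc p)) j" "T (Suc p) u = w - ?w0" by blast
      have "w - T (Suc p) u = ?w0" using u(2) by simp
      hence "cpart (w - T (Suc p) u) = 0" using cpart_koszul[OF vs(2), of e ?z] by simp
      thus "w \<in> W (Suc p) j" unfolding W_def using w(1) u(1) by blast
    next
      assume "w \<in> W (Suc p) j"
      then obtain u where u: "u \<in> G (Suc (Suc p)) j" "cpart (w - T (Suc p) u) = 0" unfolding W_def by blast
      have Tu: "T (Suc p) u \<in> G (Suc p) j" by (rule T_G[OF u(1)])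
      have d: "w - T (Suc p) u \<in> G (Suc p) j" by (rule fsc.subspace_diff[OF Fg.G_subspace w(1) Tu])
      from free_boundary_0[OF vs d u(2)] obtain e where e: "e \<in> kchains (G (Suc p)) ?n 1 j"
        "koszul fX vs e = spike ?n (w - T (Suc p) u)" by blast
      have "T (Suc p) u \<in> Ker (Suc p)" using u(1) unfolding Ker_def FG_def by blast
      hence "T p (T (Suc p) u) = 0" unfolding Ker_Suc by blast
      hence Tw: "T p (w - T (Suc p) u) = T p w" by (simp add: tm_diff)
      have "koszul fX vs (\<lambda>s. T p (e s)) = (\<lambda>s. T p (koszul fX vs e s))"
        by (rule ext, rule koszul_map) (simp_all add: tm_add tm_fX)
      also have "\<dots> = spike ?n (T p w)" unfolding e(2) by (rule ext) (simp add: spike_def Tw)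
      finally have k: "spike ?n (T p w) = koszul fX vs (\<lambda>s. T p (e s))" by simp
      have "(\<lambda>s. T p (e s)) \<in> kchains ?G' ?n (Suc 0) j"
      proof (rule chains_I)
        fix s :: "bool list" assume "length s = ?n" "count_list s True = Suc 0"
        hence es: "e s \<in> G (Suc p) (j - int (Suc 0))" using chains_D1[OF e(1)] by simp
        show "T p (e s) \<in> G p (j - int (Suc 0)) \<inter> Ker p"
          using T_G[OF es] es unfolding Ker_def FG_def by blast
      next
        fix s assume "length s \<noteq> ?n \<or> count_list s True \<noteq> Suc 0"
        hence "e s = 0" using chains_D2[OF e(1), of s] by simp
        thus "T p (e s) = 0" by simp
      qed
      thus "spike ?n (T p w) \<in> ?B" unfolding k G'.koszul_bounds_0 by (rule imageI)
    qed
  next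
    fix y assume y: "y \<in> ?C"
    hence yc: "y \<in> kchains ?G' ?n 0 j" unfolding koszul_cycles_def by blast
    have yz: "y ?z \<in> G p j \<inter> Ker p" using G'.chains_range[OF yc, of ?z] by simp
    then obtain w where w: "w \<in> G (Suc p) j" "T p w = y ?z" using Ker_lift by blast
    obtain e where "y = koszul fX vs e" using y by blast
    hence "cpart (y ?z) = 0" using cpart_koszul[OF vs(2)] by simp
    hence "w \<in> V (Suc p) j" unfolding V_def using w by simp
    moreover have "y - spike ?n (T p w) = 0" using chains_0_spike[OF yc] w(2) by simp
    hence "y - spike ?n (T p w) \<in> ?B"
      using Fg.ch.subspace_0[OF G'.subspace_bounds[OF Fg.stable_0]] by simp
    ultimately show "\<exists>v\<in>V (Suc p) j. y - spike ?n (T p v) \<in> ?B" by blast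
  qed
  ultimately show ?thesis by simp
qed

theorem tor_koszul:
  "has_qdim ksc (tensor_cycles F residue_scale residue_gr q j) (tensor_boundaries F residue_scale residue_gr q j) h
    \<longleftrightarrow> Hk 0 q j h"
proof (cases q)
  case 0
  thus ?thesis using tor_V[of 0] Hk_V0 by simp
next
  case (Suc p)
  thus ?thesis using tor_V[of "Suc p"] Hk_V_Suc[of p] Hk_shifts[of p] by simp
qed

end

section \<open>The Betti numbers of \<open>R\<close> as Koszul homology\<close>

lemma squares_class_sum: "squares_class (\<Sum>a\<in>A. f a) = (\<Sum>a\<in>A. squares_class (f a))"
  by (induction A rule: infinite_finite_induct) (simp_all add: squares_class_add zero_squares_ring_def)

lemma squares_class_diff: "squares_class (p - q) = squares_class p - squares_class q"
  by (simp add: minus_squares_ring.abs_eq)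

lemma Const_simps: "Const (a + b) = Const a + Const b" "Const (a * b) = Const a * Const b" "Const 1 = 1"
  by (simp_all add: Const_def single_add mult_single)

lemma squares_class_psc: "squares_class (psc c p) = squares_scale (Const c) (squares_class p)"
  by (simp add: psc_def squares_scale_class)

lemma graded_ops_squares:
  "graded_ops (\<lambda>c. squares_scale (Const c) :: ('v::finite, 'k::field) squares_ring \<Rightarrow> _)
     (\<lambda>v. squares_scale (Var v)) squares_gr"
proof -
  interpret M: module "squares_scale :: ('v, 'k) mpol \<Rightarrow> ('v, 'k) squares_ring \<Rightarrow> _" by (rule module_squares)
  interpret kspace "\<lambda>c. squares_scale (Const c) :: ('v, 'k) squares_ring \<Rightarrow> _"
    by standard (simp_all add: M.scale_left_distrib M.scale_right_distrib Const_simps)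
  show ?thesis
  proof
    show "squares_scale (Var v) (a + b) = squares_scale (Var v) a + squares_scale (Var v) b"
      for v and a b :: "('v, 'k) squares_ring"
      by (rule M.scale_right_distrib)
    show "squares_scale (Var v) (squares_scale (Const c) a) = squares_scale (Const c) (squares_scale (Var v) a)"
      for v c and a :: "('v, 'k) squares_ring"
      by (simp add: mult.commute)
    show "squares_scale (Var u) (squares_scale (Var v) a) = squares_scale (Var v) (squares_scale (Var u) a)"
      for u v and a :: "('v, 'k) squares_ring"
      by (simp add: mult.commute)
    show "subspace (squares_gr d :: ('v, 'k) squares_ring set)" for d
    proof (rule subspaceI)
      show "0 \<in> (squares_gr d :: ('v, 'k) squares_ring set)"
        unfolding squares_gr_def zero_squares_ring_def by (rule imageI) (rule poly.zero_G)
    next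
      fix x y :: "('v, 'k) squares_ring" assume "x \<in> squares_gr d" "y \<in> squares_gr d"
      then obtain p q where "p \<in> homogeneous d" "q \<in> homogeneous d" "x = squares_class p" "y = squares_class q"
        unfolding squares_gr_def by blast
      thus "x + y \<in> squares_gr d"
        unfolding squares_gr_def
        by (intro rev_image_eqI[of "p + q"] psc.subspace_add[OF subspace_homogeneous]) (simp_all add: squares_class_add)
    next
      fix c and x :: "('v, 'k) squares_ring" assume "x \<in> squares_gr d"
      then obtain p where "p \<in> homogeneous d" "x = squares_class p" unfolding squares_gr_def by blast
      thus "squares_scale (Const c) x \<in> squares_gr d"
        unfolding squares_gr_def
        by (intro rev_image_eqI[of "psc c p"] psc.subspace_scale[OF subspace_homogeneous])
           (simp_all add: squares_class_psc)
    qed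
    show "squares_scale (Var v) a \<in> squares_gr (d + 1)" if a: "a \<in> squares_gr d"
      for v d and a :: "('v, 'k) squares_ring"
    proof -
      obtain p where p: "p \<in> homogeneous d" "a = squares_class p" using a unfolding squares_gr_def by blast
      have "Var v * p \<in> homogeneous (d + 1)" using poly.X_G[OF p(1)] .
      thus ?thesis unfolding squares_gr_def p(2) squares_scale_class by (rule imageI)
    qed
  qed
qed

lemma has_qdim_squares_ring:
  "has_qdim (pw (\<lambda>c. squares_scale (Const c)))
     (koszul_cycles (\<lambda>v. squares_scale (Var v)) (squares_gr :: _ \<Rightarrow> ('v::finite, 'k::field) squares_ring set) {0} vs i j)
     (koszul_bounds (\<lambda>v. squares_scale (Var v)) squares_gr {0} vs i j) h
   \<longleftrightarrow> kbetti vs (squares_ideal :: ('v, 'k) mpol set) i j h"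
  unfolding kbetti_def
proof (rule poly.koszul_quotient_map[OF graded_ops_squares hideal_stable[OF hideal_squares]])
  interpret R: graded_ops "\<lambda>c. squares_scale (Const c) :: ('v, 'k) squares_ring \<Rightarrow> _"
    "\<lambda>v. squares_scale (Var v)" squares_gr by (rule graded_ops_squares)
  show "Vector_Spaces.linear psc (\<lambda>c. squares_scale (Const c)) (squares_class :: ('v, 'k) mpol \<Rightarrow> _)"
    by (simp add: Vector_Spaces.linear_iff psc.vector_space_axioms R.vector_space_axioms squares_class_add squares_class_psc)
qed (auto simp: squares_scale_class squares_gr_def squares_class_eq_0)

text \<open>Here \<open>R\<close> has two presentations: as the quotient of the first free module of
  an arbitrary resolution, and as \<open>Q\<close> modulo \<open>squares_ideal\<close>. Both Koszul
  homologies are compared with that of the type \<open>squares_ring\<close>.\<close>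

lemma Hk_kbetti:
  fixes F :: "('v::finite, 'k::field, ('v, 'k) squares_ring) free_resolution"
  assumes F: "graded_free_resolution squares_scale squares_gr F" and vs: "distinct vs" "set vs = UNIV"
  shows "has_qdim ksc (tensor_cycles F residue_scale residue_gr i j) (tensor_boundaries F residue_scale residue_gr i j) h
    \<longleftrightarrow> kbetti vs (squares_ideal :: ('v, 'k) mpol set) i j h"
proof -
  interpret resolution F squares_scale squares_gr vs by unfold_locales fact+
  interpret R: graded_ops "\<lambda>c. squares_scale (Const c) :: ('v, 'k) squares_ring \<Rightarrow> _"
    "\<lambda>v. squares_scale (Var v)" squares_gr by (rule graded_ops_squares)
  let ?B = "basis F 0" and ?dg = "bdeg F 0"
  have "\<exists>p. aug F b = squares_class p \<and> (b \<in> ?B \<longrightarrow> p \<in> homogeneous (?dg b))" for b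
  proof (cases "b \<in> ?B")
    case True
    have "aug F b \<in> squares_gr (?dg b)" by (rule bspec[OF conjunct1[OF F_parts] True])
    thus ?thesis unfolding squares_gr_def by blast
  next
    case False
    have "\<exists>q. x = squares_class q" for x :: "('v, 'k) squares_ring"
      by (induct x rule: squares_ring.abs_induct) blast
    thus ?thesis using False by blast
  qed
  hence "\<forall>b. \<exists>p. aug F b = squares_class p \<and> (b \<in> ?B \<longrightarrow> p \<in> homogeneous (?dg b))" by blast
  from choice[OF this] obtain p where p: "\<forall>b. aug F b = squares_class (p b) \<and> (b \<in> ?B \<longrightarrow> p b \<in> homogeneous (?dg b))"
    by (rule exE)
  \<comment> \<open>Representatives of the values of \<open>aug F\<close> lift the augmentation to a
    map \<open>\<phi>\<close> into \<open>Q\<close>. Written as a matrix with target basis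
    \<open>{0}\<close>, it inherits compatibility with components from
    \<open>tm_gcomp\<close>.\<close>
  define D where "D b = (Poly_Mapping.single 0 (p b) :: nat \<Rightarrow>\<^sub>0 ('v, 'k) mpol)" for b
  define \<phi> where "\<phi> w = Poly_Mapping.lookup (tm D w) 0" for w
  have D: "D b \<in> supported {0}" for b unfolding D_def supported_iff by (auto simp: lookup_single when_def)
  have Dh: "Poly_Mapping.lookup (D b) c \<in> homogeneous (?dg b - 0)" if "b \<in> ?B" "c \<in> {0}" for b c
    using p that by (simp add: D_def lookup_single)
  have aug: "aug_map squares_scale (aug F) w = squares_class (\<phi> w)" for w
  proof -
    have "\<phi> w = (\<Sum>b\<in>Poly_Mapping.keys w. Poly_Mapping.lookup w b * p b)"
      unfolding \<phi>_def by (simp add: lookup_tm[OF finite_keys subset_refl] D_def mult.commute)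
    hence "squares_class (\<phi> w) = (\<Sum>b\<in>Poly_Mapping.keys w. squares_class (Poly_Mapping.lookup w b * p b))"
      by (simp only: squares_class_sum)
    also have "\<dots> = aug_map squares_scale (aug F) w"
      unfolding aug_map_def by (intro sum.cong refl) (simp add: p squares_scale_class)
    finally show ?thesis by simp
  qed
  have \<phi>_fmul: "\<phi> (fmul q w) = q * \<phi> w" for q w by (simp add: \<phi>_def tm_fmul)
  have \<phi>_add: "\<phi> (v + w) = \<phi> v + \<phi> w" for v w by (simp add: \<phi>_def tm_add lookup_add)
  have \<phi>_gcomp: "\<phi> (gcomp ?dg d w) = hcomp d (\<phi> w)" if "w \<in> supported ?B" for d w
  proof -
    have "tm D (gcomp ?dg d w) = gcomp (\<lambda>_. 0) d (tm D w)"
      by (rule tm_gcomp[where B' = ?B and B = "{0}"]) (rule D Dh that; assumption?)+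
    thus ?thesis by (simp add: \<phi>_def)
  qed
  have "has_qdim (pw (\<lambda>c. squares_scale (Const c)))
      (koszul_cycles (\<lambda>v. squares_scale (Var v)) squares_gr {0} vs i j)
      (koszul_bounds (\<lambda>v. squares_scale (Var v)) (squares_gr :: _ \<Rightarrow> ('v, 'k) squares_ring set) {0} vs i j) h
    \<longleftrightarrow> Hk 0 i j h"
    unfolding Hk_def
  proof (rule Fg.koszul_quotient_map[OF graded_ops_squares Ker_stable, where f = "\<lambda>w. squares_class (\<phi> w)"])
    show "Vector_Spaces.linear fsc (\<lambda>c. squares_scale (Const c)) (\<lambda>w. squares_class (\<phi> w))"
      by (simp add: Vector_Spaces.linear_iff fsc.vector_space_axioms R.vector_space_axioms squares_class_add
          fsc_fmul \<phi>_add \<phi>_fmul squares_scale_class)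
    show "squares_class (\<phi> (fX v a)) = squares_scale (Var v) (squares_class (\<phi> a))" for v a
      by (simp add: fX_def \<phi>_fmul squares_scale_class)
    have \<phi>_G: "\<phi> a \<in> homogeneous d" if a: "a \<in> G 0 d" for a d
    proof -
      have "a \<in> supported ?B" using a unfolding FG_def by blast
      from \<phi>_gcomp[OF this, of d] have "\<phi> a = hcomp d (\<phi> a)" unfolding gcomp_same[OF a] .
      thus ?thesis using hcomp_homogeneous by metis
    qed
    show "squares_class (\<phi> a) \<in> squares_gr d" if "a \<in> G 0 d" for a d
      unfolding squares_gr_def by (rule imageI) (rule \<phi>_G[OF that])
    show "\<exists>a\<in>G 0 d. squares_class (\<phi> a) = b" if b: "b \<in> squares_gr d" for d b
    proof -
      obtain q where q: "q \<in> homogeneous d" "b = squares_class q" using b unfolding squares_gr_def by blast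
      have "b \<in> aug_map squares_scale (aug F) ` supported ?B"
        using conjunct1[OF conjunct2[OF conjunct2[OF conjunct2[OF F_parts]]]] by simp
      then obtain w where w: "w \<in> supported ?B" "b = squares_class (\<phi> w)" unfolding aug by blast
      \<comment> \<open>The preimage \<open>w\<close> may have several components. Its component of
        degree \<open>d\<close> still maps to \<open>b\<close>, because the ideal is closed under
        components.\<close>
      have "squares_class (q - \<phi> w) = 0" using q(2) w(2) by (simp add: squares_class_diff)
      hence "q - \<phi> w \<in> squares_ideal" unfolding squares_class_eq_0 .
      hence "hcomp d (q - \<phi> w) \<in> squares_ideal" by (rule hidealD(4)[OF hideal_squares])
      hence "squares_class (hcomp d (q - \<phi> w)) = 0" unfolding squares_class_eq_0 .
      hence "squares_class (\<phi> (gcomp ?dg d w)) = b"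
        unfolding \<phi>_gcomp[OF w(1)] hcomp_minus hcomp_same[OF q(1)] squares_class_diff q(2) by simp
      thus ?thesis using gcomp_FG[OF w(1)] by blast
    qed
    show "squares_class (\<phi> a) = 0 \<longleftrightarrow> a \<in> Ker 0" if "a \<in> G 0 d" for d a
      using that unfolding Ker_0 aug FG_def by blast
  qed
  thus ?thesis unfolding tor_koszul has_qdim_squares_ring by blast
qed

text \<open>The comparison holds for every resolution, so the one selected in \<open>dim_Tor\<close>
  can stay unspecified.\<close>

theorem graded_betti_squares:
  assumes vs: "distinct vs" "set vs = UNIV"
    and h: "kbetti vs (squares_ideal :: ('v::finite, 'k::field) mpol set) i j h"
  shows "graded_betti (squares_scale :: ('v, 'k) mpol \<Rightarrow> ('v, 'k) squares_ring \<Rightarrow> _) squares_gr i j = h"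
proof -
  define F where "F = (SOME F. graded_free_resolution (squares_scale :: ('v, 'k) mpol \<Rightarrow> ('v, 'k) squares_ring \<Rightarrow> _) squares_gr F)"
  have F: "graded_free_resolution (squares_scale :: ('v, 'k) mpol \<Rightarrow> ('v, 'k) squares_ring \<Rightarrow> _) squares_gr F"
    unfolding F_def by (rule someI_ex[OF resolution_exists])
  interpret resolution F squares_scale squares_gr vs by unfold_locales fact+
  have s: "(\<lambda>c. Poly_Mapping.map ((residue_scale :: ('v, 'k) mpol \<Rightarrow> 'k \<Rightarrow> 'k) (Const c))) = ksc"
    by (intro ext arg_cong[where f = Poly_Mapping.map]) (simp add: fun_eq_iff residue_scale_def Const_def)
  have "quotient_dim ksc (tensor_cycles F residue_scale residue_gr i j) (tensor_boundaries F residue_scale residue_gr i j) = h"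
    by (rule ksc.quotient_dim_eq) (simp_all add: boundaries_subspace Hk_kbetti[OF F vs] h)
  thus ?thesis unfolding graded_betti_def dim_Tor_def Let_def F_def[symmetric] s .
qed

section \<open>The sequence \<open>\<rho>\<close>\<close>

text \<open>
  With \<open>n = 2 * r + 3\<close>, \<open>qc n\<close> and \<open>ec r\<close> are the coefficients of \<open>(1 - t\<^sup>2)\<^sup>n\<close> and \<open>P\<close>, \<open>gc n\<close> those of
  \<open>(1 - t) * (1 + t)\<^sup>n\<close>, and \<open>hc r\<close> those of \<open>P / (1 - t)\<^bsup>n-1\<^esup>\<close>, a truncation of \<open>gc n\<close>. Negative degrees are
  allowed in \<open>gc\<close> and \<open>hc\<close> so that reflecting the degree needs no side condition.
\<close>

definition qc :: "nat \<Rightarrow> nat \<Rightarrow> int" where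
  "qc n j = (if even j then (- 1) ^ (j div 2) * int (n choose (j div 2)) else 0)"

definition ec :: "nat \<Rightarrow> nat \<Rightarrow> int" where
  "ec r j = (\<Sum>i\<le>2 * r + 3. (- 1) ^ i * int (((2 * r + 3) choose i) * cn (2 * r + 3) (min (int j - int i) (int r + 1))))"

definition gc :: "nat \<Rightarrow> int \<Rightarrow> int" where
  "gc n d = int (cn n d) - int (cn n (d - 1))"

definition hc :: "nat \<Rightarrow> int \<Rightarrow> int" where
  "hc r d = (if d \<le> int r + 1 then gc (2 * r + 3) d else 0)"

section \<open>Generating functions\<close>

lemma one_minus_fps_X_power_nth: "((1 - fps_X) ^ m :: int fps) $ i = (- 1) ^ i * int (m choose i)"
proof (induction m arbitrary: i)
  case 0
  show ?case by (cases i) simp_all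
next
  case (Suc m)
  have "((1 - fps_X) ^ Suc m :: int fps) = (1 - fps_X) ^ m - fps_X * (1 - fps_X) ^ m"
    by (simp only: power_Suc left_diff_distrib mult_1_left)
  hence *: "((1 - fps_X) ^ Suc m :: int fps) $ i = (1 - fps_X) ^ m $ i - (fps_X * (1 - fps_X) ^ m) $ i"
    by (simp only: fps_sub_nth)
  show ?case unfolding * fps_X_mult_nth Suc by (cases i) (simp_all add: algebra_simps)
qed

lemma one_plus_fps_X_power_nth: "((1 + fps_X) ^ m :: int fps) $ i = int (m choose i)"
proof (induction m arbitrary: i)
  case 0
  show ?case by (cases i) simp_all
next
  case (Suc m)
  have "((1 + fps_X) ^ Suc m :: int fps) = (1 + fps_X) ^ m + fps_X * (1 + fps_X) ^ m"
    by (simp only: power_Suc distrib_right mult_1_left)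
  hence *: "((1 + fps_X) ^ Suc m :: int fps) $ i = (1 + fps_X) ^ m $ i + (fps_X * (1 + fps_X) ^ m) $ i"
    by (simp only: fps_add_nth)
  show ?case unfolding * fps_X_mult_nth Suc by (cases i) simp_all
qed

lemma one_minus_fps_X2_power_nth: "((1 - fps_X ^ 2) ^ m :: int fps) $ j = qc m j"
proof (induction m arbitrary: j)
  case 0
  show ?case by (cases j) (auto simp: qc_def elim!: evenE)
next
  case (Suc m)
  have "((1 - fps_X ^ 2) ^ Suc m :: int fps) = (1 - fps_X ^ 2) ^ m - fps_X ^ 2 * (1 - fps_X ^ 2) ^ m"
    by (simp only: power_Suc left_diff_distrib mult_1_left)
  hence *: "((1 - fps_X ^ 2) ^ Suc m :: int fps) $ j = qc m j - (if j < 2 then 0 else qc m (j - 2))"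
    by (simp only: fps_sub_nth fps_X_power_mult_nth Suc)
  consider "j = 0" | "j = 1" | i where "j = Suc (Suc i)" by (metis One_nat_def not0_implies_Suc)
  thus ?case unfolding * by cases (simp_all add: qc_def algebra_simps)
qed

text \<open>Since \<open>f\<close> is 0 at negative arguments, the sum can run to \<open>m\<close>
  for every \<open>j\<close>, as it does in the Euler characteristic of
  \<open>kbetti_euler\<close>.\<close>

lemma fps_convolution:
  fixes f :: "int \<Rightarrow> int"
  assumes f: "\<And>d. d < 0 \<Longrightarrow> f d = 0"
  shows "((1 - fps_X) ^ m * Abs_fps (\<lambda>d. f (int d))) $ j = (\<Sum>i\<le>m. (- 1) ^ i * int (m choose i) * f (int j - int i))"
proof -
  have "((1 - fps_X) ^ m * Abs_fps (\<lambda>d. f (int d))) $ j = (\<Sum>i\<le>j. (- 1) ^ i * int (m choose i) * f (int j - int i))"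
    by (auto simp: fps_mult_nth one_minus_fps_X_power_nth of_nat_diff atMost_atLeast0 intro!: sum.cong)
  also have "\<dots> = (\<Sum>i\<le>max j m. (- 1) ^ i * int (m choose i) * f (int j - int i))"
    by (intro sum.mono_neutral_left) (auto simp: f)
  also have "\<dots> = (\<Sum>i\<le>m. (- 1) ^ i * int (m choose i) * f (int j - int i))"
    by (intro sum.mono_neutral_right) auto
  finally show ?thesis .
qed

lemma cn_neg: "d < 0 \<Longrightarrow> cn n d = 0"
  by (simp add: cn_def)

lemma cn_sym: "cn n (int n - d) = cn n d"
  by (cases "0 \<le> d \<and> d \<le> int n") (auto simp: cn_def nat_diff_distrib binomial_symmetric[of "nat d" n])

lemma gc_antisym: "gc n (int n + 1 - d) = - gc n d"
  using cn_sym[of n "d - 1"] cn_sym[of n d] by (simp add: gc_def algebra_simps)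

text \<open>The sequence \<open>gc\<close> is antisymmetric about \<open>r + 2\<close>, where it
  vanishes, so it is its lower half minus the reflection of that half.\<close>

lemma gc_hc: "gc (2 * r + 3) d = hc r d - hc r (int (2 * r + 4) - d)"
proof -
  have a: "gc (2 * r + 3) (int (2 * r + 4) - d) = - gc (2 * r + 3) d"
  proof -
    have "int (2 * r + 4) - d = int (2 * r + 3) + 1 - d" by simp
    thus ?thesis by (simp only: gc_antisym)
  qed
  consider "d \<le> int r + 1" | "d = int r + 2" | "d \<ge> int r + 3" by linarith
  thus ?thesis
  proof cases
    case 2
    thus ?thesis using a by (simp add: hc_def)
  qed (use a in \<open>simp_all add: hc_def\<close>)
qed

lemma fps_gc: "Abs_fps (\<lambda>d. gc n (int d)) = (1 - fps_X) * (1 + fps_X) ^ n"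
proof (rule fps_ext)
  fix d
  show "Abs_fps (\<lambda>d. gc n (int d)) $ d = ((1 - fps_X) * (1 + fps_X) ^ n) $ d"
    by (cases d) (simp_all add: left_diff_distrib one_plus_fps_X_power_nth gc_def cn_def nat_diff_distrib)
qed

lemma power_odd_split: "(A :: 'a::monoid_mult) ^ (2 * r + 3) = A ^ (2 * r + 2) * A"
proof -
  have "2 * r + 3 = Suc (2 * r + 2)" by simp
  thus ?thesis by (simp only: power_Suc2)
qed

lemma qc_gc: "qc (2 * r + 3) j = (\<Sum>i\<le>2 * r + 2. (- 1) ^ i * int ((2 * r + 2) choose i) * gc (2 * r + 3) (int j - int i))"
proof -
  have "(1 - fps_X ^ 2 :: int fps) = (1 - fps_X) * (1 + fps_X)" by (simp add: algebra_simps power2_eq_square)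
  hence "(1 - fps_X ^ 2 :: int fps) ^ (2 * r + 3) = (1 - fps_X) ^ (2 * r + 2) * ((1 - fps_X) * (1 + fps_X) ^ (2 * r + 3))"
    by (simp only: power_mult_distrib power_odd_split[of "1 - fps_X :: int fps"] mult.assoc)
  also have "\<dots> = (1 - fps_X) ^ (2 * r + 2) * Abs_fps (\<lambda>d. gc (2 * r + 3) (int d))" unfolding fps_gc ..
  finally show ?thesis
    unfolding one_minus_fps_X2_power_nth[symmetric]
    by (simp only:) (rule fps_convolution, simp add: gc_def cn_neg)
qed

text \<open>The Hilbert series of \<open>T\<close>, by \<open>tdim_min\<close>.\<close>

definition hilb :: "nat \<Rightarrow> int fps" where
  "hilb r = Abs_fps (\<lambda>d. int (cn (2 * r + 3) (min (int d) (int r + 1))))"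

lemma ec_nth: "ec r j = ((1 - fps_X) ^ (2 * r + 3) * hilb r) $ j"
  unfolding hilb_def
  by (subst fps_convolution[of "\<lambda>d. int (cn (2 * r + 3) (min d (int r + 1)))"])
     (simp_all add: cn_neg ec_def mult.assoc)

text \<open>One factor \<open>1 - t\<close> turns the Hilbert function into its differences, which
  are 0 beyond degree \<open>r + 1\<close>, where that function is constant.\<close>

lemma hilb_hc: "(1 - fps_X) * hilb r = Abs_fps (\<lambda>d. hc r (int d))"
proof (rule fps_ext)
  fix d
  show "((1 - fps_X) * hilb r) $ d = Abs_fps (\<lambda>d. hc r (int d)) $ d"
  proof (cases d)
    case (Suc d')
    have "min (int d') (int r + 1) = int d'" "min (int d) (int r + 1) = int d" if "int d \<le> int r + 1" using that Suc by auto
    moreover have "min (int d') (int r + 1) = min (int d) (int r + 1)" if "\<not> int d \<le> int r + 1" using that Suc by auto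
    ultimately show ?thesis
      by (auto simp: left_diff_distrib hilb_def hc_def gc_def Suc)
  qed (simp add: left_diff_distrib hilb_def hc_def gc_def cn_neg)
qed

lemma ec_hc: "ec r j = (\<Sum>i\<le>2 * r + 2. (- 1) ^ i * int ((2 * r + 2) choose i) * hc r (int j - int i))"
proof -
  have "(1 - fps_X) ^ (2 * r + 3) * hilb r = (1 - fps_X) ^ (2 * r + 2) * ((1 - fps_X) * hilb r)"
    by (simp only: power_odd_split mult.assoc)
  thus ?thesis unfolding ec_nth hilb_hc
    by (simp only:) (rule fps_convolution, simp add: hc_def gc_def cn_neg)
qed

lemma ec_vanish: "j \<ge> 3 * r + 4 \<Longrightarrow> ec r j = 0"
  unfolding ec_hc by (intro sum.neutral) (auto simp: hc_def)

text \<open>The truncation \<open>hc\<close> agrees with \<open>gc\<close> up to degree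
  \<open>r + 2\<close>: it cuts off after \<open>r + 1\<close>, and the coefficient of
  \<open>gc\<close> at \<open>r + 2\<close> is 0 anyway.\<close>

lemma ec_low:
  assumes "j \<le> r + 2"
  shows "ec r j = qc (2 * r + 3) j"
proof -
  have "hc r (int j - int i) = gc (2 * r + 3) (int j - int i)" for i
  proof (cases "int j - int i \<le> int r + 1")
    case False
    hence "int j - int i = int r + 2" using assms by linarith
    thus ?thesis using gc_hc[of r "int r + 2"] by (simp add: hc_def)
  qed (simp add: hc_def)
  thus ?thesis unfolding ec_hc qc_gc by simp
qed

text \<open>Reflecting \<open>i\<close> in the row of length \<open>2 * r + 2\<close> and the
  argument of \<open>hc\<close> in \<open>2 * r + 4\<close> gives the reflection in
  \<open>4 * r + 6 = 2 * n\<close>; the difference is supplied by \<open>gc_hc\<close>.\<close>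

lemma ec_sym:
  assumes "j \<le> 4 * r + 6"
  shows "ec r j = qc (2 * r + 3) j + ec r (4 * r + 6 - j)"
proof -
  have "ec r (4 * r + 6 - j) = (\<Sum>i\<le>2 * r + 2. (- 1) ^ i * int ((2 * r + 2) choose i) * hc r (int (4 * r + 6 - j) - int i))"
    by (rule ec_hc)
  also have "\<dots> = (\<Sum>i\<le>2 * r + 2. (- 1) ^ i * int ((2 * r + 2) choose i) * hc r (int (2 * r + 4) - (int j - int i)))"
  proof (rule sum.reindex_bij_witness[of _ "\<lambda>i. 2 * r + 2 - i" "\<lambda>i. 2 * r + 2 - i"])
    fix i assume i: "i \<in> {..2 * r + 2}"
    have "(- 1) ^ (2 * r + 2 - i) = ((- 1) ^ i :: int)"
      using i by (cases "even i") auto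
    moreover have "(2 * r + 2) choose (2 * r + 2 - i) = ((2 * r + 2) choose i)"
      using i by (intro binomial_symmetric[symmetric]) simp
    moreover have "int (2 * r + 4) - (int j - int (2 * r + 2 - i)) = int (4 * r + 6 - j) - int i"
      using i assms by (simp add: of_nat_diff)
    ultimately show "(- 1) ^ (2 * r + 2 - i) * int ((2 * r + 2) choose (2 * r + 2 - i)) *
        hc r (int (2 * r + 4) - (int j - int (2 * r + 2 - i)))
      = (- 1) ^ i * int ((2 * r + 2) choose i) * hc r (int (4 * r + 6 - j) - int i)" by simp
  qed auto
  finally have "qc (2 * r + 3) j + ec r (4 * r + 6 - j) = (\<Sum>i\<le>2 * r + 2. (- 1) ^ i * int ((2 * r + 2) choose i) *
      (gc (2 * r + 3) (int j - int i) + hc r (int (2 * r + 4) - (int j - int i))))"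
    unfolding qc_gc distrib_left sum.distrib by simp
  also have "\<dots> = ec r j" unfolding ec_hc by (intro sum.cong refl) (simp add: gc_hc)
  finally show ?thesis by simp
qed

lemma choose_fps_inverse: "Abs_fps (\<lambda>k. int ((m + k) choose m)) * (1 - fps_X) ^ Suc m = 1"
proof (induction m)
  case 0
  show ?case by (rule fps_ext) (auto simp add: right_diff_distrib)
next
  case (Suc m)
  have "Abs_fps (\<lambda>k. int ((Suc m + k) choose Suc m)) * (1 - fps_X) = Abs_fps (\<lambda>k. int ((m + k) choose m))"
  proof (rule fps_ext)
    fix k
    show "(Abs_fps (\<lambda>k. int ((Suc m + k) choose Suc m)) * (1 - fps_X)) $ k = Abs_fps (\<lambda>k. int ((m + k) choose m)) $ k"
      by (cases k) (simp_all add: right_diff_distrib)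
  qed
  thus ?case using Suc by (simp only: power_Suc mult.assoc[symmetric])
qed

text \<open>The binomial coefficients are those of the inverse of \<open>(1 - t)^(n - 1)\<close>.
  Dividing \<open>P\<close> by that power leaves a polynomial of degree at most
  \<open>r + 1\<close>, so the coefficient at \<open>k + r + 1\<close> is 0.\<close>

lemma ec_recursion:
  assumes "1 \<le> k"
  shows "(\<Sum>j\<le>k + r + 1. ec r j * int ((2 * r + 1 + (k + r + 1 - j)) choose (2 * r + 1))) = 0"
proof -
  let ?B = "Abs_fps (\<lambda>k. int ((2 * r + 1 + k) choose (2 * r + 1)))"
  have m: "2 * r + 2 = Suc (2 * r + 1)" by simp
  have "((1 - fps_X) ^ (2 * r + 3) * hilb r) * ?B = (?B * (1 - fps_X) ^ Suc (2 * r + 1)) * ((1 - fps_X) * hilb r)"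
    unfolding power_odd_split m by (simp only: mult_ac)
  also have "\<dots> = Abs_fps (\<lambda>d. hc r (int d))" unfolding choose_fps_inverse hilb_hc by simp
  finally have "(((1 - fps_X) ^ (2 * r + 3) * hilb r) * ?B) $ (k + r + 1) = hc r (int (k + r + 1))" by simp
  also have "\<dots> = 0" using assms by (simp add: hc_def)
  finally show ?thesis by (simp only: fps_mult_nth[of _ ?B] ec_nth[symmetric] atMost_atLeast0 fps_nth_Abs_fps)
qed

text \<open>
  The strand of the Betti table of \<open>T\<close> with the signs of the Euler characteristic; the entries of
  \<open>qc\<close> below \<open>2 * r + 1\<close> are those of the diagonal \<open>j = 2i\<close>, which is not part of the strand.
\<close>

definition sc :: "nat \<Rightarrow> nat \<Rightarrow> int" where
  "sc r k = ec r (k + r + 1) - (if k + r + 1 \<le> 2 * r then qc (2 * r + 3) (k + r + 1) else 0)"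

lemma ell_eq: "ell (2 * r + 2) = int r"
  by (simp add: ell_def)

text \<open>\<open>ec_recursion\<close> separated into the diagonal entries \<open>qc\<close> of
  degree at most \<open>2 * r\<close> and the remaining strand, with
  \<open>3 * r + 2 + k - 2 * i\<close> as the upper entry belonging to degree
  \<open>2 * i\<close>.\<close>

lemma sc_recursion:
  assumes k: "1 \<le> k"
  shows "(\<Sum>i\<le>k. sc r i * int ((2 * r + 1 + (k - i)) choose (2 * r + 1)))
    + (\<Sum>i\<le>r. (- 1) ^ i * int ((2 * r + 3) choose i) * int ((3 * r + 2 + k - 2 * i) choose (2 * r + 1))) = 0"
proof -
  let ?b = "\<lambda>j. int ((2 * r + 1 + (k + r + 1 - j)) choose (2 * r + 1))"
  define q where "q j = (if j \<le> 2 * r then qc (2 * r + 3) j else 0)" for j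
  \<comment> \<open>Up to degree \<open>r\<close> the two sequences agree by \<open>ec_low\<close>,
    so the sum begins at the strand.\<close>
  have "(\<Sum>j\<le>k + r + 1. (ec r j - q j) * ?b j) = (\<Sum>j\<in>{r + 1..k + r + 1}. (ec r j - q j) * ?b j)"
    by (intro sum.mono_neutral_right) (auto simp: q_def ec_low)
  also have "\<dots> = (\<Sum>i\<le>k. sc r i * int ((2 * r + 1 + (k - i)) choose (2 * r + 1)))"
    by (rule sum.reindex_bij_witness[of _ "\<lambda>i. i + r + 1" "\<lambda>j. j - r - 1"]) (auto simp: sc_def q_def)
  finally have 1: "(\<Sum>i\<le>k. sc r i * int ((2 * r + 1 + (k - i)) choose (2 * r + 1)))
    = - (\<Sum>j\<le>k + r + 1. q j * ?b j)"
    using ec_recursion[OF k, of r] by (simp add: left_diff_distrib sum_subtractf)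
  have "(\<Sum>j\<le>k + r + 1. q j * ?b j) = (\<Sum>j\<in>{j. even j \<and> j \<le> 2 * r \<and> j \<le> k + r + 1}. q j * ?b j)"
    by (intro sum.mono_neutral_right) (auto simp: q_def qc_def)
  also have "\<dots> = (\<Sum>i\<in>{i. i \<le> r \<and> 2 * i \<le> k + r + 1}.
      (- 1) ^ i * int ((2 * r + 3) choose i) * int ((3 * r + 2 + k - 2 * i) choose (2 * r + 1)))"
  proof (rule sum.reindex_bij_witness[of _ "\<lambda>i. 2 * i" "\<lambda>j. j div 2"])
    fix j assume j: "j \<in> {j. even j \<and> j \<le> 2 * r \<and> j \<le> k + r + 1}"
    hence "2 * r + 1 + (k + r + 1 - j) = 3 * r + 2 + k - 2 * (j div 2)" by auto
    thus "(- 1) ^ (j div 2) * int ((2 * r + 3) choose (j div 2)) * int ((3 * r + 2 + k - 2 * (j div 2)) choose (2 * r + 1))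
      = q j * ?b j" using j by (simp add: q_def qc_def)
  qed auto
  also have "\<dots> = (\<Sum>i\<le>r. (- 1) ^ i * int ((2 * r + 3) choose i) * int ((3 * r + 2 + k - 2 * i) choose (2 * r + 1)))"
    \<comment> \<open>For \<open>2 * i > k + r + 1\<close> the upper entry is smaller than
      \<open>2 * r + 1\<close>, so the added terms are 0.\<close>
    by (rule sum.mono_neutral_left) (auto intro!: binomial_eq_0)
  finally show ?thesis using 1 by simp
qed

text \<open>In \<open>sc_recursion\<close> the term \<open>i = k\<close> has coefficient 1. Solving
  for it and inserting the signs gives the recursion that defines \<open>rho\<close>.\<close>

lemma rho_sc: "rho (2 * r + 2) k = (- 1) ^ k * sc r k"
proof (induction k rule: less_induct)
  case (less k)
  show ?case
  proof (cases "k = 0")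
    case True
    \<comment> \<open>For \<open>r = 0\<close> nothing is subtracted in degree 1, but the
      coefficient there is 0 because the degree is odd.\<close>
    have "sc r 0 = 0" by (cases "r = 0") (auto simp: sc_def ec_low qc_def)
    thus ?thesis using True by (simp add: rho.simps)
  next
    case False
    have set: "{i. int i \<le> int r} = {..r}" by auto
    have n: "2 * r + 2 + 1 = 2 * r + 3" "2 * r + 2 - 1 = 2 * r + 1" by simp_all
    have u: "nat (int (2 * r + 2) + int k + int r - 2 * int i) = 3 * r + 2 + k - 2 * i" for i by linarith
    have s: "(- 1) ^ (i + k + 1) * c * ((- 1) ^ i * x) = - ((- 1) ^ k * (x * c))" for i and c x :: int
    proof -
      have "(- 1) ^ (i + k + 1) * c * ((- 1) ^ i * x) = ((- 1) ^ (i + k + 1) * (- 1) ^ i) * (x * c)"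
        by (simp only: mult_ac)
      also have "(- 1) ^ (i + k + 1) * (- 1) ^ i = (- ((- 1) ^ k) :: int)"
        by (cases "even i"; cases "even k") simp_all
      finally show ?thesis by simp
    qed
    have "rho (2 * r + 2) k = (\<Sum>i<k. (- 1) ^ (i + k + 1) * int ((2 * r + 2 + k - i - 1) choose (2 * r + 1)) * rho (2 * r + 2) i)
        + (\<Sum>i\<le>r. (- 1) ^ (i + k + 1) * int ((3 * r + 2 + k - 2 * i) choose (2 * r + 1)) * int ((2 * r + 3) choose i))"
      using False by (subst rho.simps) (simp only: ell_eq set u n if_False)
    also have "(\<Sum>i<k. (- 1) ^ (i + k + 1) * int ((2 * r + 2 + k - i - 1) choose (2 * r + 1)) * rho (2 * r + 2) i)
      = (\<Sum>i<k. - ((- 1) ^ k * (sc r i * int ((2 * r + 1 + (k - i)) choose (2 * r + 1)))))"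
    proof (intro sum.cong refl)
      fix i assume "i \<in> {..<k}"
      hence i: "i < k" by simp
      hence "2 * r + 2 + k - i - 1 = 2 * r + 1 + (k - i)" by simp
      thus "(- 1) ^ (i + k + 1) * int ((2 * r + 2 + k - i - 1) choose (2 * r + 1)) * rho (2 * r + 2) i
        = - ((- 1) ^ k * (sc r i * int ((2 * r + 1 + (k - i)) choose (2 * r + 1))))"
        unfolding less.IH[OF i] s by simp
    qed
    also have "\<dots> = - ((- 1) ^ k * (\<Sum>i<k. sc r i * int ((2 * r + 1 + (k - i)) choose (2 * r + 1))))"
      by (simp only: sum_negf sum_distrib_left)
    also have "(\<Sum>i\<le>r. (- 1) ^ (i + k + 1) * int ((3 * r + 2 + k - 2 * i) choose (2 * r + 1)) * int ((2 * r + 3) choose i))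
      = - ((- 1) ^ k * (\<Sum>i\<le>r. (- 1) ^ i * int ((2 * r + 3) choose i) * int ((3 * r + 2 + k - 2 * i) choose (2 * r + 1))))"
      unfolding sum_distrib_left sum_negf[symmetric] by (intro sum.cong refl) (simp add: power_add mult_ac)
    finally have "rho (2 * r + 2) k = (- 1) ^ k * (- (\<Sum>i<k. sc r i * int ((2 * r + 1 + (k - i)) choose (2 * r + 1)))
        - (\<Sum>i\<le>r. (- 1) ^ i * int ((2 * r + 3) choose i) * int ((3 * r + 2 + k - 2 * i) choose (2 * r + 1))))"
      by (simp only: right_diff_distrib mult_minus_right)
    moreover have "(\<Sum>i\<le>k. sc r i * int ((2 * r + 1 + (k - i)) choose (2 * r + 1)))
      = (\<Sum>i<k. sc r i * int ((2 * r + 1 + (k - i)) choose (2 * r + 1))) + sc r k"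
      by (simp flip: lessThan_Suc_atMost)
    ultimately show ?thesis using sc_recursion[of k r] False by simp
  qed
qed

section \<open>Vanishing and symmetry of \<open>rho\<close>\<close>

lemma rho_eqI:
  assumes "(- 1) ^ k * x = sc r k"
  shows "x = rho (2 * r + 2) k"
  unfolding rho_sc assms[symmetric] by (simp add: mult.assoc[symmetric] power_mult_distrib[symmetric])

lemma rho_vanish: "2 * r + 3 \<le> k \<Longrightarrow> rho (2 * r + 2) k = 0"
  unfolding rho_sc by (simp add: sc_def ec_vanish)

lemma rho_0: "rho m 0 = 0"
  by (simp add: rho.simps)

text \<open>For \<open>r >= 2\<close> the degree \<open>r + 2\<close> is at most
  \<open>2 * r\<close> and within the range of \<open>ec_low\<close>, so the two terms of
  \<open>sc\<close> cancel.\<close>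

lemma rho_1: "2 \<le> r \<Longrightarrow> rho (2 * r + 2) 1 = 0"
  unfolding rho_sc by (simp add: sc_def ec_low)

text \<open>The defect \<open>qc\<close> in \<open>ec_sym\<close> is compensated by the subtraction
  in \<open>sc\<close>, which applies on one side of the middle, or it vanishes in odd degree.
  Neither happens in the degrees \<open>2 * r + 2\<close> and \<open>2 * r + 4\<close>, the excluded
  cases; \<open>k = r + 2\<close> is fixed by the reflection.\<close>

lemma rho_sym:
  assumes k: "k \<le> 2 * r + 4" "k \<noteq> r + 1" "k \<noteq> r + 3"
  shows "rho (2 * r + 2) (2 * r + 4 - k) = rho (2 * r + 2) k"
proof -
  have j: "4 * r + 6 - (k + r + 1) = 2 * r + 4 - k + r + 1" "4 * r + 6 - (2 * r + 4 - k + r + 1) = k + r + 1"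
    using k(1) by simp_all
  have e: "ec r (k + r + 1) = qc (2 * r + 3) (k + r + 1) + ec r (2 * r + 4 - k + r + 1)"
    using ec_sym[of "k + r + 1" r] k(1) unfolding j by simp
  have e': "ec r (2 * r + 4 - k + r + 1) = qc (2 * r + 3) (2 * r + 4 - k + r + 1) + ec r (k + r + 1)"
    using ec_sym[of "2 * r + 4 - k + r + 1" r] k(1) unfolding j by simp
  have s: "(- 1) ^ (2 * r + 4 - k) = ((- 1) ^ k :: int)" using k(1) by (cases "even k") auto
  consider "k \<le> r - 1" "r \<noteq> 0" | "k = r" | "k = r + 2" | "k = r + 4" | "k \<ge> r + 5" using k by linarith
  hence "sc r (2 * r + 4 - k) = sc r k"
  proof cases
    case 1
    hence "k + r + 1 \<le> 2 * r" "\<not> 2 * r + 4 - k + r + 1 \<le> 2 * r" by linarith+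
    thus ?thesis unfolding sc_def using e by simp
  next
    case 2
    have "qc (2 * r + 3) (k + r + 1) = 0" using 2 by (simp add: qc_def)
    thus ?thesis using e 2 by (simp add: sc_def)
  next
    case 3
    thus ?thesis by simp
  next
    case 4
    have "qc (2 * r + 3) (k + r + 1) = 0" using 4 by (simp add: qc_def)
    thus ?thesis using e 4 by (simp add: sc_def)
  next
    case 5
    hence "2 * r + 4 - k + r + 1 \<le> 2 * r" "\<not> k + r + 1 \<le> 2 * r" using k(1) by linarith+
    thus ?thesis unfolding sc_def using e' by simp
  qed
  thus ?thesis unfolding rho_sc s by simp
qed

text \<open>In degree \<open>2 * r + 2\<close> the subtraction in \<open>sc\<close> has already
  stopped, so the defect of the symmetry remains.\<close>

lemma rho_middle: "rho (2 * r + 2) (r + 1) = rho (2 * r + 2) (r + 3) + int ((2 * r + 3) choose (r + 1))"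
proof -
  have "ec r (r + 1 + r + 1) = qc (2 * r + 3) (r + 1 + r + 1) + ec r (r + 3 + r + 1)"
    using ec_sym[of "r + 1 + r + 1" r] by (simp add: algebra_simps)
  moreover have "qc (2 * r + 3) (r + 1 + r + 1) = (- 1) ^ (r + 1) * int ((2 * r + 3) choose (r + 1))"
  proof -
    have h: "r + 1 + r + 1 = 2 * (r + 1)" by simp
    show ?thesis unfolding h qc_def by simp
  qed
  ultimately have "sc r (r + 1) = (- 1) ^ (r + 1) * int ((2 * r + 3) choose (r + 1)) + sc r (r + 3)" by (simp add: sc_def)
  moreover have "(- 1) ^ (r + 3) = ((- 1) ^ (r + 1) :: int)" by (simp add: power_add)
  moreover have "(- 1) ^ (r + 1) * ((- 1) ^ (r + 1) * x) = (x :: int)" for x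
    by (simp add: mult.assoc[symmetric] power_mult_distrib[symmetric])
  ultimately show ?thesis unfolding rho_sc by (simp only: distrib_left)
qed

section \<open>The Betti table of \<open>R\<close>\<close>

lemma of_nat_fact_nonzero:
  assumes "CHAR('k) > n \<or> CHAR('k::field) = 0" "k \<le> n"
  shows "of_nat (fact k) \<noteq> (0 :: 'k)"
proof -
  have "of_nat j \<noteq> (0 :: 'k)" if "1 \<le> j" "j \<le> n" for j
    using assms(1) that by (auto simp: of_nat_eq_0_iff_char_dvd dest: dvd_imp_le)
  hence "(\<Prod>j\<in>{1..k}. of_nat j) \<noteq> (0 :: 'k)" using assms(2) by (subst prod_zero_iff) auto
  thus ?thesis by (simp add: fact_prod)
qed

lemma graded_betti_squares_ring:
  assumes card: "CARD('v::finite) = 2 * r + 3" and char: "CHAR('k::field) > 2 * r + 3 \<or> CHAR('k) = 0"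
  shows "int (graded_betti (squares_scale :: ('v, 'k) mpol \<Rightarrow> ('v, 'k) squares_ring \<Rightarrow> _) squares_gr i j) =
    (if j \<le> int (i + r) then (if j = 2 * int i then int ((2 * r + 4) choose i) else 0)
     else if j = int (i + r + 1) then rho (2 * r + 2) i + (if i = r + 1 then int ((2 * r + 3) choose r) else 0)
     else if j = int (i + r + 2) \<and> 1 \<le> i then rho (2 * r + 2) (i - 1) else 0)"
proof -
  interpret squares_setup r "undefined :: 'v" "undefined :: 'k itself"
    using card of_nat_fact_nonzero[OF char] by unfold_locales
  obtain vs :: "'v list" where vs: "distinct vs" "set vs = UNIV"
    using finite_distinct_list[of "UNIV :: 'v set"] by auto
  obtain a where a: "\<And>i j. kbetti vs (squares_ideal :: ('v, 'k) mpol set) i j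
       (if j \<le> int (i + r) then (if j = 2 * int i then (2 * r + 4) choose i else 0)
        else if j = int (i + r + 1) then a i + (if i = r + 1 then (2 * r + 3) choose r else 0)
        else if j = int (i + r + 2) \<and> 1 \<le> i then a (i - 1) else 0)"
    and a': "\<And>k. (- 1) ^ k * int (a k) = (\<Sum>i\<le>2 * r + 3. (- 1) ^ i * int (((2 * r + 3) choose i) *
        cn (2 * r + 3) (min (int (k + r + 1) - int i) (int r + 1))))
       - (if even (k + r + 1) \<and> k + r + 1 \<le> 2 * r then (- 1) ^ ((k + r + 1) div 2) * int ((2 * r + 3) choose ((k + r + 1) div 2)) else 0)"
  proof (rule kbetti_squares[OF vs], goal_cases)
    case (1 a)
    show ?case by (rule 1(1)) (rule 1(2) 1(3))+
  qed
  have "int (a k) = rho (2 * r + 2) k" for k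
    by (rule rho_eqI) (auto simp: a' sc_def ec_def qc_def)
  thus ?thesis unfolding graded_betti_squares[OF vs a] by simp
qed

theorem theorem4p11:
  fixes n l :: nat
    and \<beta> :: "nat \<Rightarrow> int \<Rightarrow> int"
    and \<rho> :: "nat \<Rightarrow> int"
  defines "\<beta> \<equiv> \<lambda>i j. int (graded_betti
             (squares_scale :: ('v::finite, 'k::field) mpol \<Rightarrow> ('v, 'k) squares_ring \<Rightarrow> _) squares_gr i j)"
    and "\<rho> \<equiv> rho (n - 1)"
  assumes "n = CARD('v)" and "n \<ge> 3" and "odd n" and "l = (n - 3) div 2"
    and "CHAR('k) > n \<or> CHAR('k) = 0"
  shows "(\<forall>i j. \<beta> i j =
            (if j = 2 * int i \<and> i \<le> l then int ((n + 1) choose i)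
             else if j = 2 * int i \<and> 2 * i = i + (l + 1) then \<rho> (l + 1) + int (n choose l)
             else if j = int (i + (l + 1)) \<and> j \<noteq> 2 * int i \<and> i \<le> n - 1 then \<rho> i
             else if j = int (i + (l + 2)) \<and> 1 \<le> i \<and> i \<le> n then \<rho> (i - 1)
             else 0)) \<and>
         (n \<ge> 7 \<longrightarrow>
            \<beta> (l + 1) (int (2 * l + 2)) = \<rho> (l + 1) + int (n choose l) \<and>
            (\<forall>i. 2 \<le> i \<and> i \<le> l + 3 \<and> i \<noteq> l + 1 \<longrightarrow> \<beta> i (int (i + l + 1)) = \<rho> i) \<and>
            (\<forall>i. l + 4 \<le> i \<and> i \<le> n - 1 \<longrightarrow> \<beta> i (int (i + l + 1)) = \<rho> (n + 1 - i)) \<and>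
            (\<forall>i. 3 \<le> i \<and> i \<le> l + 4 \<longrightarrow> \<beta> i (int (i + l + 2)) = \<rho> (i - 1)) \<and>
            (\<forall>i. l + 5 \<le> i \<and> i \<le> n \<longrightarrow> \<beta> i (int (i + l + 2)) = \<rho> (n + 2 - i)) \<and>
            (\<forall>i. \<beta> i (int (i + l + 1)) \<noteq> 0 \<longrightarrow>
                 i = l + 1 \<or> (2 \<le> i \<and> i \<le> l + 3 \<and> i \<noteq> l + 1) \<or> (l + 4 \<le> i \<and> i \<le> n - 1)) \<and>
            (\<forall>i. \<beta> i (int (i + l + 2)) \<noteq> 0 \<longrightarrow>
                 (3 \<le> i \<and> i \<le> l + 4) \<or> (l + 5 \<le> i \<and> i \<le> n))) \<and>
         \<rho> (l + 1) + int (n choose l) = \<rho> (l + 3) + int ((n + 1) choose (l + 1))"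
proof -
  have n: "n = 2 * l + 3" and l: "l = (n - 3) div 2"
    using assms(4,5,6) by (auto elim!: oddE)
  have n1: "n - 1 = 2 * l + 2" using n by simp
  have \<beta>: "\<beta> i j =
    (if j \<le> int (i + l) then (if j = 2 * int i then int ((2 * l + 4) choose i) else 0)
     else if j = int (i + l + 1) then \<rho> i + (if i = l + 1 then int ((2 * l + 3) choose l) else 0)
     else if j = int (i + l + 2) \<and> 1 \<le> i then \<rho> (i - 1) else 0)" for i j
    unfolding \<beta>_def \<rho>_def n1
    by (rule graded_betti_squares_ring) (use assms(3,7) n in auto)
  \<comment> \<open>Accounts for the zero entries beyond \<open>i = n - 1\<close> on the first
    strand and beyond \<open>i = n\<close> on the second.\<close>
  have vanish: "\<rho> i = 0" if "i \<ge> n" for i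
    using rho_vanish[of l i] that unfolding \<rho>_def n1 by (simp add: n)
  have zero: "\<rho> 0 = 0" by (simp add: \<rho>_def rho_0)
  have one: "\<rho> 1 = 0" if "n \<ge> 7" using rho_1[of l] that unfolding \<rho>_def n1 by (simp add: n)
  have sym: "\<rho> (n + 1 - i) = \<rho> i" if "i \<le> n + 1" "i \<noteq> l + 1" "i \<noteq> l + 3" for i
  proof -
    have e: "n + 1 = 2 * l + 4" using n by simp
    show ?thesis unfolding \<rho>_def n1 e by (rule rho_sym[OF that[unfolded e]])
  qed
  have middle: "\<rho> (l + 1) = \<rho> (l + 3) + int (n choose (l + 1))"
    using rho_middle[of l] unfolding \<rho>_def n1 by (simp add: n)
  have strand1: "\<beta> i (int (i + l + 1)) = (if i = l + 1 then \<rho> i + int (n choose l) else \<rho> i)" for i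
    unfolding \<beta> by (simp add: n)
  have strand2: "\<beta> i (int (i + l + 2)) = (if 1 \<le> i then \<rho> (i - 1) else 0)" for i
    unfolding \<beta> by simp
  have cases: "\<beta> i j =
            (if j = 2 * int i \<and> i \<le> l then int ((n + 1) choose i)
             else if j = 2 * int i \<and> 2 * i = i + (l + 1) then \<rho> (l + 1) + int (n choose l)
             else if j = int (i + (l + 1)) \<and> j \<noteq> 2 * int i \<and> i \<le> n - 1 then \<rho> i
             else if j = int (i + (l + 2)) \<and> 1 \<le> i \<and> i \<le> n then \<rho> (i - 1)
             else 0)" for i j
  proof -
    consider "j \<le> int (i + l)" | "j = int (i + l + 1)" | "j = int (i + l + 2)" | "j > int (i + l + 2)" by linarith
    thus ?thesis
    proof cases
      case 1
      have e: "n + 1 = 2 * l + 4" using n by simp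
      show ?thesis unfolding \<beta> e using 1 by auto
    next
      case 2
      show ?thesis unfolding 2 strand1 using vanish[of i] by auto
    next
      case 3
      show ?thesis unfolding 3 strand2 using vanish[of "i - 1"] by auto
    next
      case 4
      thus ?thesis unfolding \<beta> by auto
    qed
  qed
  have nonzero: "i \<ge> 2 \<and> i \<le> n - 1" if "n \<ge> 7" "\<rho> i \<noteq> 0" for i
  proof -
    have "i \<noteq> 0" "i \<noteq> 1" "\<not> i \<ge> n" using zero one[OF that(1)] vanish[of i] that(2) by metis+
    thus ?thesis by linarith
  qed
  have "\<beta> (l + 1) (int (2 * l + 2)) = \<rho> (l + 1) + int (n choose l)"
    using strand1[of "l + 1"] by (simp add: algebra_simps)
  moreover have "\<beta> i (int (i + l + 1)) = \<rho> i" if "i \<noteq> l + 1" for i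
    using strand1[of i] that by simp
  moreover have "\<beta> i (int (i + l + 1)) = \<rho> (n + 1 - i)" if "l + 4 \<le> i" "i \<le> n - 1" for i
    using strand1[of i] sym[of i] that by simp
  moreover have "\<beta> i (int (i + l + 2)) = \<rho> (i - 1)" if "3 \<le> i" for i
    using strand2[of i] that by simp
  moreover have "\<beta> i (int (i + l + 2)) = \<rho> (n + 2 - i)" if "l + 5 \<le> i" "i \<le> n" for i
  proof -
    have "n + 1 - (i - 1) = n + 2 - i" using that by simp
    thus ?thesis using strand2[of i] sym[of "i - 1"] that by simp
  qed
  moreover have "i = l + 1 \<or> (2 \<le> i \<and> i \<le> l + 3 \<and> i \<noteq> l + 1) \<or> (l + 4 \<le> i \<and> i \<le> n - 1)"
    if "n \<ge> 7" "\<beta> i (int (i + l + 1)) \<noteq> 0" for i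
    using that(2) nonzero[OF that(1), of i] unfolding strand1 by (cases "i = l + 1") auto
  moreover have "(3 \<le> i \<and> i \<le> l + 4) \<or> (l + 5 \<le> i \<and> i \<le> n)"
    if "n \<ge> 7" "\<beta> i (int (i + l + 2)) \<noteq> 0" for i
    using that(2) nonzero[OF that(1), of "i - 1"] unfolding strand2 by (cases "1 \<le> i") auto
  \<comment> \<open>Adding \<open>n choose l\<close> to both sides of \<open>middle\<close> and
    applying Pascal's rule.\<close>
  moreover have "\<rho> (l + 1) + int (n choose l) = \<rho> (l + 3) + int ((n + 1) choose (l + 1))"
    using middle by simp
  ultimately show ?thesis using cases by (intro conjI impI allI) blast+
qed

end
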